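(* Let $G_1,G_2$ be compact Lie groups with Lie algebras $\mathfrak g_1,\mathfrak g_2$, let $G=G_1\times G_2$, $X_1\in\mathfrak g_1$, $X_2\in\mathfrak g_2$, let $a\in C^\infty(G_1)$ be real-valued, $q\in C^\infty(G)$, $a_0:=\int_{G_1}a(x_1)\,dx_1$ and $q_0:=\int_Gq(x)\,dx$. Consider $$L_{aq}=X_1+a(x_1)X_2+q(x_1,x_2),\qquad L_{a_0q_0}=X_1+a_0X_2+q_0.$$ Assume that there exist a real-valued $A\in C^\infty(G_1)$ with $X_1A=a-a_0$ and a function $Q\in C^\infty(G)$ with $(X_1+a(x_1)X_2)Q=q-q_0$. Then: - $L_{aq}$ is globally hypoelliptic if and only if $L_{a_0q_0}$ is globally hypoelliptic; - $L_{aq}$ is globally hypoelliptic modulo $\ker L_{aq}$ if and only if $L_{a_0q_0}$ is globally hypoelliptic modulo $\ker L_{a_0q_0}$; - $L_{aq}$ is globally solvable if and only if $L_{a_0q_0}$ is globally solvable.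
   Context: For a compact Lie group $H$: $C^\infty(H)$ denotes complex-valued smooth functions, $\mathcal D'(H)$ the space of distributions (continuous linear functionals on the Fréchet space $C^\infty(H)$), $dx$ the normalized Haar measure, and $\widehat H$ the set of equivalence classes of continuous irreducible unitary representations; $\xi$ denotes a matrix-valued representative $\xi:H\to\mathbb C^{d_\xi\times d_\xi}$ of $[\xi]$, $d_\xi=\dim\xi$. An element $X$ of the Lie algebra acts as the left-invariant vector field $Xf(x)=\frac{d}{dt}f(x\exp(tX))|_{t=0}$; on $G=G_1\times G_2$, $X_1$ acts in $x_1$ and $X_2$ in $x_2$. The symbol of $X$ at $\xi$ is $\sigma_X(\xi)=\xi(x)^*(X\xi)(x)$, independent of $x$. For each $[\xi]\in\widehat{G_1}$, $[\eta]\in\widehat{G_2}$ one fixes representatives such that $\sigma_{X_1}(\xi)_{mn}=i\lambda_m(\xi)\delta_{mn}$ and $\sigma_{X_2}(\eta)_{rs}=i\mu_r(\eta)\delta_{rs}$, with $\lambda_m(\xi),\mu_r(\eta)\in\mathbb R$; this is always possible. For $u\in\mathcal D'(G)$, $\widehat{\widehat u}(\xi,\eta)_{mn_{rs}}=\langle u,\overline{\xi_{nm}}\times\overline{\eta_{sr}}\rangle$, and $\widehat u(\cdot,\eta)_{rs}\in\mathcal D'(G_1)$ is the distribution $\psi\mapsto\langle u,\psi\times\overline{\eta_{sr}}\rangle$, where $(f\times g)(x_1,x_2)=f(x_1)g(x_2)$ and functions are identified with distributions via normalized Haar measure. The operator $L_{aq}$ extends to $\mathcal D'(G)$ by $\langle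 L_{aq}u,\varphi\rangle=-\langle u,(X_1+aX_2)\varphi\rangle+\langle u,q\varphi\rangle$, and similarly for $L_{a_0q_0}$. Define on $\mathcal D'(G)$ $$\Psi_au=\sum_{[\eta]\in\widehat{G_2}}d_\eta\sum_{r,s=1}^{d_\eta}e^{i\mu_r(\eta)A(x_1)}\,\widehat u(x_1,\eta)_{rs}\,\eta_{sr}(x_2),$$ which is a bijection of $\mathcal D'(G)$. Let $\mathcal K_{a_0q_0}=\{w\in\mathcal D'(G):\ \widehat{\widehat w}(\xi,\eta)_{mn_{rs}}=0\ \text{whenever}\ \lambda_m(\xi)+a_0\mu_r(\eta)-iq_0=0,\ 1\le m,n\le d_\xi,\ 1\le r,s\le d_\eta\}$. $L_{a_0q_0}$ is globally solvable if $L_{a_0q_0}(\mathcal D'(G))=\mathcal K_{a_0q_0}$. $L_{aq}$ is globally solvable if $L_{aq}(\mathcal D'(G))=\mathcal J_{aq}$, where $\mathcal J_{aq}=\{v\in\mathcal D'(G):\ \Psi_a(e^Qv)\in\mathcal K_{a_0q_0}\}$. An operator $P:\mathcal D'(G)\to\mathcal D'(G)$ is globally hypoelliptic if $u\in\mathcal D'(G)$ and $Pu\in C^\infty(G)$ imply $u\in C^\infty(G)$. It is globally hypoelliptic modulo $\ker P$ if whenever $u\in\mathcal D'(G)$ and $Pu\in C^\infty(G)$, there exists $v\in C^\infty(G)$ such that $u-v\in\ker P$. *)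

theory Defs
  imports
    "HOL-Probability.Probability"
    "HOL-Algebra.Group"
    "Jordan_Normal_Form.Schur_Decomposition"
begin

subsection \<open>Smooth maps and manifolds\<close>

text \<open>
  The model spaces are real normed vector spaces which are assumed finite-dimensional where it
  matters (the class of Euclidean spaces would exclude dimension 0, that is, finite groups).
  On an open set \<open>S\<close>, \<open>Ck_on k S f\<close> says that \<open>f\<close> is \<open>k\<close> times continuously differentiable.
\<close>

primrec Ck_on ::
  "nat \<Rightarrow> 'e::real_normed_vector set \<Rightarrow> ('e \<Rightarrow> 'f::real_normed_vector) \<Rightarrow> bool"
where
  "Ck_on 0 S f \<longleftrightarrow> continuous_on S f"
| "Ck_on (Suc k) S f \<longleftrightarrow>
     (\<forall>x\<in>S. f differentiable (at x)) \<and>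
     (\<forall>v. Ck_on k S (\<lambda>x. frechet_derivative f (at x) v))"

definition smooth_on ::
  "'e::real_normed_vector set \<Rightarrow> ('e \<Rightarrow> 'f::real_normed_vector) \<Rightarrow> bool"
where
  "smooth_on S f \<longleftrightarrow> (\<forall>k. Ck_on k S f)"

text \<open>A chart is a pair of its domain and a map whose values off the domain are irrelevant.\<close>

type_synonym ('a, 'e) chart = "'a set \<times> ('a \<Rightarrow> 'e)"

definition smooth_atlas ::
  "('a::topological_space, 'e::real_normed_vector) chart set \<Rightarrow> bool"
where
  "smooth_atlas \<A> \<longleftrightarrow>
     (\<Union>(U, \<phi>)\<in>\<A>. U) = UNIV \<and>
     (\<forall>(U, \<phi>)\<in>\<A>. open U \<and> open (\<phi> ` U) \<and> homeomorphism U (\<phi> ` U) \<phi> (inv_into U \<phi>)) \<and>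
     (\<forall>(U, \<phi>)\<in>\<A>. \<forall>(V, \<psi>)\<in>\<A>. smooth_on (\<phi> ` (U \<inter> V)) (\<psi> \<circ> inv_into U \<phi>))"

definition smooth_map ::
  "('a::topological_space, 'e::real_normed_vector) chart set \<Rightarrow>
   ('b::topological_space, 'f::real_normed_vector) chart set \<Rightarrow> ('a \<Rightarrow> 'b) \<Rightarrow> bool"
where
  "smooth_map \<A> \<B> f \<longleftrightarrow>
     continuous_on UNIV f \<and>
     (\<forall>(U, \<phi>)\<in>\<A>. \<forall>(V, \<psi>)\<in>\<B>. smooth_on (\<phi> ` (U \<inter> f -` V)) (\<psi> \<circ> f \<circ> inv_into U \<phi>))"

abbreviation std_atlas :: "('e, 'e) chart set" where
  "std_atlas \<equiv> {(UNIV, id)}"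

definition prod_atlas ::
  "('a, 'e) chart set \<Rightarrow> ('b, 'f) chart set \<Rightarrow> ('a \<times> 'b, 'e \<times> 'f) chart set"
where
  "prod_atlas \<A> \<B> = {(U \<times> V, map_prod \<phi> \<psi>) |U \<phi> V \<psi>. (U, \<phi>) \<in> \<A> \<and> (V, \<psi>) \<in> \<B>}"


subsection \<open>Compact Lie groups\<close>

record ('a, 'e) lie_group = "'a monoid" +
  atlas :: "('a, 'e) chart set"

text \<open>
  The underlying set is the whole type, which carries the topology; the sort constraint makes it
  Hausdorff and second countable.
\<close>

definition compact_lie_group ::
  "('a::{t2_space, second_countable_topology}, 'e::real_normed_vector) lie_group \<Rightarrow> bool"
where
  "compact_lie_group H \<longleftrightarrow>
     group H \<and> carrier H = UNIV \<and> compact (UNIV :: 'a set) \<and>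
     (\<exists>B :: 'e set. finite B \<and> span B = UNIV) \<and>
     smooth_atlas (atlas H) \<and>
     smooth_map (prod_atlas (atlas H) (atlas H)) (atlas H) (\<lambda>(x, y). x \<otimes>\<^bsub>H\<^esub> y) \<and>
     smooth_map (atlas H) (atlas H) (\<lambda>x. inv\<^bsub>H\<^esub> x)"

definition lie_prod ::
  "('a, 'e) lie_group \<Rightarrow> ('b, 'f) lie_group \<Rightarrow> ('a \<times> 'b, 'e \<times> 'f) lie_group"
where
  "lie_prod G\<^sub>1 G\<^sub>2 =
     \<lparr>carrier = carrier (G\<^sub>1 \<times>\<times> G\<^sub>2), mult = mult (G\<^sub>1 \<times>\<times> G\<^sub>2), one = one (G\<^sub>1 \<times>\<times> G\<^sub>2),
      atlas = prod_atlas (atlas G\<^sub>1) (atlas G\<^sub>2)\<rparr>"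

text \<open>
  The Lie algebra is taken in the form \<open>Hom(\<real>, H)\<close> (as in Hofmann and Morris, The Structure of
  Compact Groups): an element \<open>X\<close> is a smooth one-parameter subgroup, and \<open>exp(tX)\<close> is \<open>X t\<close>.
\<close>

definition lie_algebra ::
  "('a::topological_space, 'e::real_normed_vector) lie_group \<Rightarrow> (real \<Rightarrow> 'a) set"
where
  "lie_algebra H =
     {X. smooth_map std_atlas (atlas H) X \<and> (\<forall>s t. X (s + t) = X s \<otimes>\<^bsub>H\<^esub> X t)}"

definition vfield ::
  "('a, 'e) lie_group \<Rightarrow> (real \<Rightarrow> 'a) \<Rightarrow> ('a \<Rightarrow> 'f::real_normed_vector) \<Rightarrow> 'a \<Rightarrow> 'f"
where
  "vfield H X f x = vector_derivative (\<lambda>t. f (x \<otimes>\<^bsub>H\<^esub> X t)) (at 0)"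

text \<open>Left invariance suffices in the next definition, since the group is compact.\<close>

definition normalized_haar ::
  "('a::topological_space, 'e) lie_group \<Rightarrow> 'a measure \<Rightarrow> bool"
where
  "normalized_haar H M \<longleftrightarrow>
     sets M = sets borel \<and> prob_space M \<and> (\<forall>g. distr M borel (\<lambda>x. g \<otimes>\<^bsub>H\<^esub> x) = M)"


subsection \<open>Smooth functions and distributions\<close>

definition C_inf ::
  "('a::topological_space, 'e::real_normed_vector) lie_group \<Rightarrow> ('a \<Rightarrow> complex) set"
where
  "C_inf H = {f. smooth_map (atlas H) std_atlas f}"

primrec iter_deriv ::
  "'e::real_normed_vector list \<Rightarrow> ('e \<Rightarrow> 'f::real_normed_vector) \<Rightarrow> 'e \<Rightarrow> 'f"
where
  "iter_deriv [] f = f"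
| "iter_deriv (v # vs) f = (\<lambda>x. frechet_derivative (iter_deriv vs f) (at x) v)"

text \<open>
  The usual Frechet topology of \<open>C_inf H\<close>: uniform convergence of all derivatives on compact
  subsets of charts. The sets below are the balls of the defining seminorms.
\<close>

definition C_inf_ball ::
  "('a::topological_space, 'e::real_normed_vector) lie_group \<Rightarrow> ('a, 'e) chart \<Rightarrow> 'e set \<Rightarrow>
   'e list \<Rightarrow> real \<Rightarrow> ('a \<Rightarrow> complex) \<Rightarrow> ('a \<Rightarrow> complex) set"
where
  "C_inf_ball H c K vs \<epsilon> f =
     {g \<in> C_inf H. \<forall>y\<in>K.
        norm (iter_deriv vs ((\<lambda>x. g x - f x) \<circ> inv_into (fst c) (snd c)) y) < \<epsilon>}"

definition C_inf_topology ::
  "('a::topological_space, 'e::real_normed_vector) lie_group \<Rightarrow> ('a \<Rightarrow> complex) topology"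
where
  "C_inf_topology H =
     topology_generated_by
       {C_inf_ball H c K vs \<epsilon> f |c K vs \<epsilon> f.
          c \<in> atlas H \<and> compact K \<and> K \<subseteq> snd c ` fst c \<and> \<epsilon> > 0 \<and> f \<in> C_inf H}"

text \<open>
  Functionals on \<open>C_inf H\<close> are represented extensionally, so that equality of distributions is
  equality of functionals.
\<close>

definition distributions ::
  "('a::topological_space, 'e::real_normed_vector) lie_group \<Rightarrow>
   (('a \<Rightarrow> complex) \<Rightarrow> complex) set"
where
  "distributions H =
     {u \<in> extensional (C_inf H).
        (\<forall>f\<in>C_inf H. \<forall>g\<in>C_inf H. u (\<lambda>x. f x + g x) = u f + u g) \<and>
        (\<forall>f\<in>C_inf H. \<forall>c. u (\<lambda>x. c * f x) = c * u f) \<and>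
        continuous_map (C_inf_topology H) euclidean u}"

definition dist_of ::
  "('a::topological_space, 'e::real_normed_vector) lie_group \<Rightarrow> 'a measure \<Rightarrow>
   ('a \<Rightarrow> complex) \<Rightarrow> (('a \<Rightarrow> complex) \<Rightarrow> complex)"
where
  "dist_of H M f = (\<lambda>\<phi>\<in>C_inf H. \<integral>x. f x * \<phi> x \<partial>M)"

definition smooth_distributions ::
  "('a::topological_space, 'e::real_normed_vector) lie_group \<Rightarrow> 'a measure \<Rightarrow>
   (('a \<Rightarrow> complex) \<Rightarrow> complex) set"
where
  "smooth_distributions H M = dist_of H M ` C_inf H"

definition dist_diff ::
  "('a::topological_space, 'e::real_normed_vector) lie_group \<Rightarrow>
   (('a \<Rightarrow> complex) \<Rightarrow> complex) \<Rightarrow> (('a \<Rightarrow> complex) \<Rightarrow> complex) \<Rightarrow>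
   (('a \<Rightarrow> complex) \<Rightarrow> complex)"
where
  "dist_diff H u v = (\<lambda>\<phi>\<in>C_inf H. u \<phi> - v \<phi>)"

definition dist_times ::
  "('a::topological_space, 'e::real_normed_vector) lie_group \<Rightarrow> ('a \<Rightarrow> complex) \<Rightarrow>
   (('a \<Rightarrow> complex) \<Rightarrow> complex) \<Rightarrow> (('a \<Rightarrow> complex) \<Rightarrow> complex)"
where
  "dist_times H g u = (\<lambda>\<phi>\<in>C_inf H. u (\<lambda>x. g x * \<phi> x))"

definition dist_kernel ::
  "('a::topological_space, 'e::real_normed_vector) lie_group \<Rightarrow>
   ((('a \<Rightarrow> complex) \<Rightarrow> complex) \<Rightarrow> (('a \<Rightarrow> complex) \<Rightarrow> complex)) \<Rightarrow>
   (('a \<Rightarrow> complex) \<Rightarrow> complex) set"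
where
  "dist_kernel H P = {u \<in> distributions H. P u = (\<lambda>\<phi>\<in>C_inf H. 0)}"

definition globally_hypoelliptic ::
  "('a::topological_space, 'e::real_normed_vector) lie_group \<Rightarrow> 'a measure \<Rightarrow>
   ((('a \<Rightarrow> complex) \<Rightarrow> complex) \<Rightarrow> (('a \<Rightarrow> complex) \<Rightarrow> complex)) \<Rightarrow> bool"
where
  "globally_hypoelliptic H M P \<longleftrightarrow>
     (\<forall>u\<in>distributions H.
        P u \<in> smooth_distributions H M \<longrightarrow> u \<in> smooth_distributions H M)"

definition globally_hypoelliptic_mod_kernel ::
  "('a::topological_space, 'e::real_normed_vector) lie_group \<Rightarrow> 'a measure \<Rightarrow>
   ((('a \<Rightarrow> complex) \<Rightarrow> complex) \<Rightarrow> (('a \<Rightarrow> complex) \<Rightarrow> complex)) \<Rightarrow> bool"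
where
  "globally_hypoelliptic_mod_kernel H M P \<longleftrightarrow>
     (\<forall>u\<in>distributions H.
        P u \<in> smooth_distributions H M \<longrightarrow>
        (\<exists>v\<in>smooth_distributions H M. dist_diff H u v \<in> dist_kernel H P))"


subsection \<open>The unitary dual\<close>

definition unitary_rep ::
  "('a::topological_space, 'e) lie_group \<Rightarrow> nat \<Rightarrow> ('a \<Rightarrow> complex mat) \<Rightarrow> bool"
where
  "unitary_rep H d \<xi> \<longleftrightarrow>
     (\<forall>x. \<xi> x \<in> carrier_mat d d \<and> mat_adjoint (\<xi> x) * \<xi> x = 1\<^sub>m d) \<and>
     (\<forall>x y. \<xi> (x \<otimes>\<^bsub>H\<^esub> y) = \<xi> x * \<xi> y) \<and>
     (\<forall>i<d. \<forall>j<d. continuous_on UNIV (\<lambda>x. \<xi> x $$ (i, j)))"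

definition invariant_subspace ::
  "nat \<Rightarrow> ('a \<Rightarrow> complex mat) \<Rightarrow> complex Matrix.vec set \<Rightarrow> bool"
where
  "invariant_subspace d \<xi> W \<longleftrightarrow>
     W \<subseteq> carrier_vec d \<and> 0\<^sub>v d \<in> W \<and>
     (\<forall>v\<in>W. \<forall>w\<in>W. v + w \<in> W) \<and> (\<forall>c. \<forall>v\<in>W. c \<cdot>\<^sub>v v \<in> W) \<and>
     (\<forall>x. \<forall>v\<in>W. \<xi> x *\<^sub>v v \<in> W)"

definition rep_dim :: "('a, 'e) lie_group \<Rightarrow> ('a \<Rightarrow> complex mat) \<Rightarrow> nat" where
  "rep_dim H \<xi> = dim_row (\<xi> \<one>\<^bsub>H\<^esub>)"

text \<open>
  Every irreducible unitary representation of a compact group is finite-dimensional, so the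
  matrix-valued ones represent all classes.
\<close>

definition irreducible_rep ::
  "('a::topological_space, 'e) lie_group \<Rightarrow> ('a \<Rightarrow> complex mat) \<Rightarrow> bool"
where
  "irreducible_rep H \<xi> \<longleftrightarrow>
     (let d = rep_dim H \<xi> in
        d > 0 \<and> unitary_rep H d \<xi> \<and>
        (\<forall>W. invariant_subspace d \<xi> W \<longrightarrow> W = {0\<^sub>v d} \<or> W = carrier_vec d))"

definition equivalent_reps ::
  "('a, 'e) lie_group \<Rightarrow> ('a \<Rightarrow> complex mat) \<Rightarrow> ('a \<Rightarrow> complex mat) \<Rightarrow> bool"
where
  "equivalent_reps H \<xi> \<eta> \<longleftrightarrow>
     rep_dim H \<xi> = rep_dim H \<eta> \<and>
     (\<exists>T\<in>carrier_mat (rep_dim H \<xi>) (rep_dim H \<xi>).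
        invertible_mat T \<and> (\<forall>x. T * \<xi> x = \<eta> x * T))"

definition dual_representatives ::
  "('a::topological_space, 'e) lie_group \<Rightarrow> ('a \<Rightarrow> complex mat) set \<Rightarrow> bool"
where
  "dual_representatives H R \<longleftrightarrow>
     (\<forall>\<xi>\<in>R. irreducible_rep H \<xi>) \<and>
     (\<forall>\<zeta>. irreducible_rep H \<zeta> \<longrightarrow> (\<exists>!\<xi>. \<xi> \<in> R \<and> equivalent_reps H \<zeta> \<xi>))"

definition symbol ::
  "('a, 'e) lie_group \<Rightarrow> (real \<Rightarrow> 'a) \<Rightarrow> ('a \<Rightarrow> complex mat) \<Rightarrow> 'a \<Rightarrow> complex mat"
where
  "symbol H X \<xi> x =
     mat_adjoint (\<xi> x) *
     Matrix.mat (rep_dim H \<xi>) (rep_dim H \<xi>) (\<lambda>(m, n). vfield H X (\<lambda>y. \<xi> y $$ (m, n)) x)"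

definition diagonal_symbol ::
  "('a, 'e) lie_group \<Rightarrow> (real \<Rightarrow> 'a) \<Rightarrow> ('a \<Rightarrow> complex mat) set \<Rightarrow>
   (('a \<Rightarrow> complex mat) \<Rightarrow> nat \<Rightarrow> real) \<Rightarrow> bool"
where
  "diagonal_symbol H X R lam \<longleftrightarrow>
     (\<forall>\<xi>\<in>R. \<forall>x. symbol H X \<xi> x =
        mat_diag (rep_dim H \<xi>) (\<lambda>m. \<i> * complex_of_real (lam \<xi> m)))"


subsection \<open>Operators and Fourier coefficients on a product\<close>

definition fun_tensor ::
  "('a \<Rightarrow> complex) \<Rightarrow> ('b \<Rightarrow> complex) \<Rightarrow> 'a \<times> 'b \<Rightarrow> complex"
where
  "fun_tensor f g = (\<lambda>(x\<^sub>1, x\<^sub>2). f x\<^sub>1 * g x\<^sub>2)"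

definition principal_part ::
  "('a, 'e) lie_group \<Rightarrow> ('b, 'f) lie_group \<Rightarrow> (real \<Rightarrow> 'a) \<Rightarrow> (real \<Rightarrow> 'b) \<Rightarrow>
   ('a \<Rightarrow> real) \<Rightarrow> ('a \<times> 'b \<Rightarrow> complex) \<Rightarrow> 'a \<times> 'b \<Rightarrow> complex"
where
  "principal_part G\<^sub>1 G\<^sub>2 X\<^sub>1 X\<^sub>2 a \<phi> = (\<lambda>(x\<^sub>1, x\<^sub>2).
     vfield G\<^sub>1 X\<^sub>1 (\<lambda>y. \<phi> (y, x\<^sub>2)) x\<^sub>1 +
     complex_of_real (a x\<^sub>1) * vfield G\<^sub>2 X\<^sub>2 (\<lambda>y. \<phi> (x\<^sub>1, y)) x\<^sub>2)"

definition L_op ::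
  "('a::topological_space, 'e::real_normed_vector) lie_group \<Rightarrow>
   ('b::topological_space, 'f::real_normed_vector) lie_group \<Rightarrow>
   (real \<Rightarrow> 'a) \<Rightarrow> (real \<Rightarrow> 'b) \<Rightarrow> ('a \<Rightarrow> real) \<Rightarrow> ('a \<times> 'b \<Rightarrow> complex) \<Rightarrow>
   (('a \<times> 'b \<Rightarrow> complex) \<Rightarrow> complex) \<Rightarrow> (('a \<times> 'b \<Rightarrow> complex) \<Rightarrow> complex)"
where
  "L_op G\<^sub>1 G\<^sub>2 X\<^sub>1 X\<^sub>2 a q u =
     (\<lambda>\<phi>\<in>C_inf (lie_prod G\<^sub>1 G\<^sub>2).
        - u (principal_part G\<^sub>1 G\<^sub>2 X\<^sub>1 X\<^sub>2 a \<phi>) + u (\<lambda>x. q x * \<phi> x))"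

text \<open>Matrix indices start at 0 here and below.\<close>

definition fourier_coeff ::
  "(('a \<times> 'b \<Rightarrow> complex) \<Rightarrow> complex) \<Rightarrow> ('a \<Rightarrow> complex mat) \<Rightarrow> ('b \<Rightarrow> complex mat) \<Rightarrow>
   nat \<Rightarrow> nat \<Rightarrow> nat \<Rightarrow> nat \<Rightarrow> complex"
where
  "fourier_coeff u \<xi> \<eta> m n r s =
     u (fun_tensor (\<lambda>x. cnj (\<xi> x $$ (n, m))) (\<lambda>y. cnj (\<eta> y $$ (s, r))))"

definition partial_fourier_coeff ::
  "('a::topological_space, 'e::real_normed_vector) lie_group \<Rightarrow>
   (('a \<times> 'b \<Rightarrow> complex) \<Rightarrow> complex) \<Rightarrow> ('b \<Rightarrow> complex mat) \<Rightarrow> nat \<Rightarrow> nat \<Rightarrow>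
   (('a \<Rightarrow> complex) \<Rightarrow> complex)"
where
  "partial_fourier_coeff G\<^sub>1 u \<eta> r s =
     (\<lambda>\<psi>\<in>C_inf G\<^sub>1. u (fun_tensor \<psi> (\<lambda>y. cnj (\<eta> y $$ (s, r)))))"

text \<open>The product \<open>v(x\<^sub>1) g(x\<^sub>2)\<close> of a distribution \<open>v\<close> and a function \<open>g\<close>.\<close>

definition dist_tensor ::
  "('a::topological_space, 'e::real_normed_vector) lie_group \<Rightarrow>
   ('b::topological_space, 'f::real_normed_vector) lie_group \<Rightarrow> 'b measure \<Rightarrow>
   (('a \<Rightarrow> complex) \<Rightarrow> complex) \<Rightarrow> ('b \<Rightarrow> complex) \<Rightarrow>
   (('a \<times> 'b \<Rightarrow> complex) \<Rightarrow> complex)"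
where
  "dist_tensor G\<^sub>1 G\<^sub>2 M\<^sub>2 v g =
     (\<lambda>\<phi>\<in>C_inf (lie_prod G\<^sub>1 G\<^sub>2). v (\<lambda>x\<^sub>1. \<integral>x\<^sub>2. g x\<^sub>2 * \<phi> (x\<^sub>1, x\<^sub>2) \<partial>M\<^sub>2))"

text \<open>
  The series defining the operator below is summed, unconditionally, in the weak topology of
  distributions, i.e. after pairing with each test function.
\<close>

definition Psi_op ::
  "('a::topological_space, 'e::real_normed_vector) lie_group \<Rightarrow>
   ('b::topological_space, 'f::real_normed_vector) lie_group \<Rightarrow> 'b measure \<Rightarrow>
   ('b \<Rightarrow> complex mat) set \<Rightarrow> (('b \<Rightarrow> complex mat) \<Rightarrow> nat \<Rightarrow> real) \<Rightarrow> ('a \<Rightarrow> real) \<Rightarrow>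
   (('a \<times> 'b \<Rightarrow> complex) \<Rightarrow> complex) \<Rightarrow> (('a \<times> 'b \<Rightarrow> complex) \<Rightarrow> complex)"
where
  "Psi_op G\<^sub>1 G\<^sub>2 M\<^sub>2 R\<^sub>2 mu A u =
     (\<lambda>\<phi>\<in>C_inf (lie_prod G\<^sub>1 G\<^sub>2).
        \<Sum>\<^sub>\<infinity>\<eta>\<in>R\<^sub>2. of_nat (rep_dim G\<^sub>2 \<eta>) *
          (\<Sum>r<rep_dim G\<^sub>2 \<eta>. \<Sum>s<rep_dim G\<^sub>2 \<eta>.
             dist_tensor G\<^sub>1 G\<^sub>2 M\<^sub>2
               (dist_times G\<^sub>1 (\<lambda>x\<^sub>1. exp (\<i> * complex_of_real (mu \<eta> r * A x\<^sub>1)))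
                  (partial_fourier_coeff G\<^sub>1 u \<eta> r s))
               (\<lambda>x\<^sub>2. \<eta> x\<^sub>2 $$ (s, r)) \<phi>))"

definition K_space ::
  "('a::topological_space, 'e::real_normed_vector) lie_group \<Rightarrow>
   ('b::topological_space, 'f::real_normed_vector) lie_group \<Rightarrow>
   ('a \<Rightarrow> complex mat) set \<Rightarrow> ('b \<Rightarrow> complex mat) set \<Rightarrow>
   (('a \<Rightarrow> complex mat) \<Rightarrow> nat \<Rightarrow> real) \<Rightarrow> (('b \<Rightarrow> complex mat) \<Rightarrow> nat \<Rightarrow> real) \<Rightarrow>
   real \<Rightarrow> complex \<Rightarrow> (('a \<times> 'b \<Rightarrow> complex) \<Rightarrow> complex) set"
where
  "K_space G\<^sub>1 G\<^sub>2 R\<^sub>1 R\<^sub>2 lam mu a\<^sub>0 q\<^sub>0 =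
     {w \<in> distributions (lie_prod G\<^sub>1 G\<^sub>2).
        \<forall>\<xi>\<in>R\<^sub>1. \<forall>\<eta>\<in>R\<^sub>2.
        \<forall>m<rep_dim G\<^sub>1 \<xi>. \<forall>n<rep_dim G\<^sub>1 \<xi>. \<forall>r<rep_dim G\<^sub>2 \<eta>. \<forall>s<rep_dim G\<^sub>2 \<eta>.
          complex_of_real (lam \<xi> m) + complex_of_real (a\<^sub>0 * mu \<eta> r) - \<i> * q\<^sub>0 = 0 \<longrightarrow>
          fourier_coeff w \<xi> \<eta> m n r s = 0}"

definition J_space ::
  "('a::topological_space, 'e::real_normed_vector) lie_group \<Rightarrow>
   ('b::topological_space, 'f::real_normed_vector) lie_group \<Rightarrow> 'b measure \<Rightarrow>
   ('a \<Rightarrow> complex mat) set \<Rightarrow> ('b \<Rightarrow> complex mat) set \<Rightarrow>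
   (('a \<Rightarrow> complex mat) \<Rightarrow> nat \<Rightarrow> real) \<Rightarrow> (('b \<Rightarrow> complex mat) \<Rightarrow> nat \<Rightarrow> real) \<Rightarrow>
   ('a \<Rightarrow> real) \<Rightarrow> ('a \<times> 'b \<Rightarrow> complex) \<Rightarrow> real \<Rightarrow> complex \<Rightarrow>
   (('a \<times> 'b \<Rightarrow> complex) \<Rightarrow> complex) set"
where
  "J_space G\<^sub>1 G\<^sub>2 M\<^sub>2 R\<^sub>1 R\<^sub>2 lam mu A Q a\<^sub>0 q\<^sub>0 =
     {v \<in> distributions (lie_prod G\<^sub>1 G\<^sub>2).
        Psi_op G\<^sub>1 G\<^sub>2 M\<^sub>2 R\<^sub>2 mu A (dist_times (lie_prod G\<^sub>1 G\<^sub>2) (\<lambda>x. exp (Q x)) v)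
          \<in> K_space G\<^sub>1 G\<^sub>2 R\<^sub>1 R\<^sub>2 lam mu a\<^sub>0 q\<^sub>0}"

text \<open>
  Solvability has a separate definition for the constant-coefficient operator and for the
  variable-coefficient one; the latter is relative to the chosen \<open>A\<close> and \<open>Q\<close>.
\<close>

definition globally_solvable_const ::
  "('a::topological_space, 'e::real_normed_vector) lie_group \<Rightarrow>
   ('b::topological_space, 'f::real_normed_vector) lie_group \<Rightarrow>
   (real \<Rightarrow> 'a) \<Rightarrow> (real \<Rightarrow> 'b) \<Rightarrow>
   ('a \<Rightarrow> complex mat) set \<Rightarrow> ('b \<Rightarrow> complex mat) set \<Rightarrow>
   (('a \<Rightarrow> complex mat) \<Rightarrow> nat \<Rightarrow> real) \<Rightarrow> (('b \<Rightarrow> complex mat) \<Rightarrow> nat \<Rightarrow> real) \<Rightarrow>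
   real \<Rightarrow> complex \<Rightarrow> bool"
where
  "globally_solvable_const G\<^sub>1 G\<^sub>2 X\<^sub>1 X\<^sub>2 R\<^sub>1 R\<^sub>2 lam mu a\<^sub>0 q\<^sub>0 \<longleftrightarrow>
     L_op G\<^sub>1 G\<^sub>2 X\<^sub>1 X\<^sub>2 (\<lambda>_. a\<^sub>0) (\<lambda>_. q\<^sub>0) ` distributions (lie_prod G\<^sub>1 G\<^sub>2)
       = K_space G\<^sub>1 G\<^sub>2 R\<^sub>1 R\<^sub>2 lam mu a\<^sub>0 q\<^sub>0"

definition globally_solvable_var ::
  "('a::topological_space, 'e::real_normed_vector) lie_group \<Rightarrow>
   ('b::topological_space, 'f::real_normed_vector) lie_group \<Rightarrow> 'b measure \<Rightarrow>
   (real \<Rightarrow> 'a) \<Rightarrow> (real \<Rightarrow> 'b) \<Rightarrow>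
   ('a \<Rightarrow> complex mat) set \<Rightarrow> ('b \<Rightarrow> complex mat) set \<Rightarrow>
   (('a \<Rightarrow> complex mat) \<Rightarrow> nat \<Rightarrow> real) \<Rightarrow> (('b \<Rightarrow> complex mat) \<Rightarrow> nat \<Rightarrow> real) \<Rightarrow>
   ('a \<Rightarrow> real) \<Rightarrow> ('a \<times> 'b \<Rightarrow> complex) \<Rightarrow> ('a \<Rightarrow> real) \<Rightarrow> ('a \<times> 'b \<Rightarrow> complex) \<Rightarrow>
   real \<Rightarrow> complex \<Rightarrow> bool"
where
  "globally_solvable_var G\<^sub>1 G\<^sub>2 M\<^sub>2 X\<^sub>1 X\<^sub>2 R\<^sub>1 R\<^sub>2 lam mu a q A Q a\<^sub>0 q\<^sub>0 \<longleftrightarrow>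
     L_op G\<^sub>1 G\<^sub>2 X\<^sub>1 X\<^sub>2 a q ` distributions (lie_prod G\<^sub>1 G\<^sub>2)
       = J_space G\<^sub>1 G\<^sub>2 M\<^sub>2 R\<^sub>1 R\<^sub>2 lam mu A Q a\<^sub>0 q\<^sub>0"

end

theory Submission
  imports Defs "Jordan_Normal_Form.Spectral_Radius"
begin

text \<open>
  The flow of \<open>X\<^sub>2\<close> defines a shear \<open>F(x\<^sub>1, x\<^sub>2) = (x\<^sub>1, x\<^sub>2 exp(-A(x\<^sub>1) X\<^sub>2))\<close> of the product. Put
  \<open>\<langle>\<Theta>u, \<phi>\<rangle> = \<langle>u, e\<^sup>Q (\<phi> \<circ> F)\<rangle>\<close>. The chain rule and the equations for \<open>A\<close> and \<open>Q\<close> show that \<open>\<Theta>\<close>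
  intertwines \<open>L\<^sub>a\<^sub>q\<close> with the constant-coefficient operator, and \<open>F\<close> preserves Haar measure, so \<open>\<Theta>\<close>
  is a bijection both of the distributions and of the smooth ones. Hypoellipticity, with or without
  the kernel, is therefore the same for the two operators.

  For solvability, \<open>\<Psi>\<^sub>a(e\<^sup>Q v)\<close> has to be compared with \<open>\<Theta>v\<close>. Along the flow the matrix coefficient
  \<open>\<eta>\<^sub>s\<^sub>r\<close> is multiplied by an exponential, so \<open>\<Psi>\<^sub>a u\<close> is the pullback by \<open>F\<close> of the Fourier series of
  \<open>u\<close> in the second variable, and by Schur orthogonality its double Fourier coefficients are those
  of the pullback of \<open>u\<close> itself; the completeness half of the Peter-Weyl theorem is not involved. The
  Fourier series converges weakly to a distribution because its partial sums are bounded, uniformly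
  over all finite sets of representations, by finitely many seminorms of the test function: Bessel's
  inequality bounds the partial sum kernels as bilinear forms on the square-integrable functions, and
  the fundamental theorem of calculus on a box reduces the evaluation at the identity to such forms
  applied to derivatives of translates.
\<close>

section \<open>Finite-dimensional calculus\<close>

text \<open>Only solvability forces a convergence proof: \<open>J_space\<close> asks that
  \<open>Psi_op\<close> of a distribution lie in \<open>K_space\<close>, hence be a distribution,
  and an infinite sum that fails to converge has the value 0 by convention. The obstacle is that
  Bessel controls square norms, for which evaluation at a point is not continuous. Averaging removes
  the point: the kernel of a partial sum depends only on x^{-1}y, so the value at the identity for a
  test function \<Theta> is the integral over x and y of \<Theta>(x^{-1}y) times the kernel. This
  would be a bounded bilinear form if \<Theta>(x^{-1}y) were a product of a function of x and one of
  y. In a chart, x enters through finitely many coordinates; integrating along each of them from a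
  face of a cube leaves x only in the upper limit, that is, in a cut-off factor bounded by 1. Each
  coordinate costs one derivative and a factor depending on the cube alone. The weight and the shear
  act on test functions, so the sign of -A is that of the transposed problem; on densities one
  composes with the inverse shear.\<close>

definition fin_dim :: "'e::real_normed_vector itself \<Rightarrow> bool" where
  "fin_dim _ \<longleftrightarrow> (\<exists>B::'e set. finite B \<and> span B = UNIV)"

section \<open>Coordinates with respect to a basis\<close>

lemma fin_dim_basis:
  assumes "fin_dim TYPE('e::real_normed_vector)"
  obtains B :: "'e::real_normed_vector set" where "finite B" "independent B" "span B = UNIV"
proof -
  obtain B0 :: "'e set" where B0: "finite B0" "span B0 = UNIV"
    using assms by (auto simp: fin_dim_def)
  obtain B where B: "B \<subseteq> B0" "independent B" "B0 \<subseteq> span B"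
    using real_vector.maximal_independent_subset by blast
  have "span B = UNIV"
    using B(3) B0(2) real_vector.span_minimal[OF B(3)] by (simp add: real_vector.subspace_span top.extremum_unique)
  with B B0 that show thesis by (meson finite_subset)
qed

lemma fin_dim_real: "fin_dim TYPE(real)"
proof -
  have "x *\<^sub>R 1 \<in> span {1::real}" for x
    by (intro real_vector.span_scale real_vector.span_base) simp
  hence "x \<in> span {1::real}" for x by simp
  thus ?thesis unfolding fin_dim_def by (intro exI[of _ "{1}"]) auto
qed

lemma fin_dim_prod:
  assumes "fin_dim TYPE('e::real_normed_vector)" "fin_dim TYPE('f::real_normed_vector)"
  shows "fin_dim TYPE('e \<times> 'f)"
proof -
  obtain B :: "'e set" and C :: "'f set" where BC: "finite B" "span B = UNIV" "finite C" "span C = UNIV"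
    using assms by (auto simp: fin_dim_def)
  let ?D = "(\<lambda>b. (b, 0)) ` B \<union> (\<lambda>c. (0, c)) ` C"
  have 1: "(x, 0) \<in> span ?D" for x
  proof -
    have "linear (\<lambda>b::'e. (b, 0::'f))" by (auto intro!: linearI)
    hence "span ((\<lambda>b. (b, 0::'f)) ` B) = (\<lambda>b. (b, 0)) ` span B"
      by (rule linear_span_image)
    hence "(x, 0) \<in> span ((\<lambda>b. (b, 0::'f)) ` B)" using BC by auto
    thus ?thesis by (meson Un_upper1 real_vector.span_mono subsetD)
  qed
  have 2: "(0, x) \<in> span ?D" for x
  proof -
    have "linear (\<lambda>b::'f. (0::'e, b))" by (auto intro!: linearI)
    hence "span ((\<lambda>b. (0::'e, b)) ` C) = (\<lambda>b. (0, b)) ` span C"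
      by (rule linear_span_image)
    hence "(0, x) \<in> span ((\<lambda>b. (0::'e, b)) ` C)" using BC by auto
    thus ?thesis by (meson Un_upper2 real_vector.span_mono subsetD)
  qed
  have "z \<in> span ?D" for z
    using real_vector.span_add[OF 1[of "fst z"] 2[of "snd z"]] by (cases z) simp
  hence "span ?D = UNIV" by blast
  moreover have "finite ?D" using BC by auto
  ultimately show ?thesis unfolding fin_dim_def by blast
qed

text \<open>This is the equivalence of norms in finite dimension, proved without assuming that the
  space is complete. In the induction the new vector \<open>a\<close> has positive distance
  \<open>d\<close> from the span of \<open>B\<close>: by the estimate for \<open>B\<close>, vectors
  of the span converging to \<open>a\<close> have Cauchy coefficients, so their limit stays in the
  span.\<close>

lemma coeff_norm_bound:
  fixes B :: "'e::real_normed_vector set"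
  assumes "finite B" "independent B"
  shows "\<exists>C>0. \<forall>c. (\<Sum>b\<in>B. \<bar>c b\<bar>) \<le> C * norm (\<Sum>b\<in>B. c b *\<^sub>R b)"
  using assms
proof (induction B rule: finite_induct)
  case empty thus ?case by (auto intro: exI[of _ 1])
next
  case (insert a B)
  have ind: "independent B" and a: "a \<notin> span B"
    using insert by (auto simp: real_vector.independent_insert)
  obtain C where C: "C > 0" "\<And>c. (\<Sum>b\<in>B. \<bar>c b\<bar>) \<le> C * norm (\<Sum>b\<in>B. c b *\<^sub>R b)"
    using insert.IH[OF ind] by blast
  have "\<exists>d>0. \<forall>c. d \<le> norm (a - (\<Sum>b\<in>B. c b *\<^sub>R b))"
  proof (rule ccontr)
    assume "\<not> ?thesis"
    hence "\<forall>n::nat. \<exists>c. norm (a - (\<Sum>b\<in>B. c b *\<^sub>R b)) < 1 / real (Suc n)"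
      by (metis not_le of_nat_0_less_iff zero_less_Suc zero_less_divide_1_iff)
    then obtain c where c: "\<And>n. norm (a - (\<Sum>b\<in>B. c n b *\<^sub>R b)) < 1 / real (Suc n)" by metis
    define x where "x n = (\<Sum>b\<in>B. c n b *\<^sub>R b)" for n
    have "(\<lambda>n. a - x n) \<longlonglongrightarrow> 0"
      using LIMSEQ_norm_0[of "\<lambda>n. a - x n"] c unfolding x_def by simp
    hence "(\<lambda>n. a - (a - x n)) \<longlonglongrightarrow> a - 0" by (intro tendsto_diff tendsto_const)
    hence xa: "x \<longlonglongrightarrow> a" by simp
    have Cau: "Cauchy (\<lambda>n. c n b)" if b: "b \<in> B" for b
    proof (rule metric_CauchyI)
      fix e :: real assume "e > 0"
      have "Cauchy x" using xa by (rule LIMSEQ_imp_Cauchy)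
      then obtain N where N: "\<And>m n. m \<ge> N \<Longrightarrow> n \<ge> N \<Longrightarrow> dist (x m) (x n) < e / C"
        using \<open>e > 0\<close> C(1) by (meson metric_CauchyD zero_less_divide_iff)
      have "dist (c m b) (c n b) < e" if "m \<ge> N" "n \<ge> N" for m n
      proof -
        have "\<bar>c m b - c n b\<bar> \<le> (\<Sum>b\<in>B. \<bar>c m b - c n b\<bar>)"
          using b insert.hyps by (intro member_le_sum) auto
        also have "\<dots> \<le> C * norm (\<Sum>b\<in>B. (c m b - c n b) *\<^sub>R b)" by (rule C(2))
        also have "(\<Sum>b\<in>B. (c m b - c n b) *\<^sub>R b) = x m - x n"
          by (simp add: x_def scaleR_left_diff_distrib sum_subtractf)
        also have "C * norm (x m - x n) < e"
          using N[OF that] C(1) by (simp add: dist_norm pos_less_divide_eq mult.commute)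
        finally show ?thesis by (simp add: dist_real_def)
      qed
      thus "\<exists>M. \<forall>m\<ge>M. \<forall>n\<ge>M. dist (c m b) (c n b) < e" by blast
    qed
    hence "\<forall>b\<in>B. \<exists>l. (\<lambda>n. c n b) \<longlonglongrightarrow> l"
      using Cauchy_convergent_iff convergent_def by blast
    then obtain l where l: "\<And>b. b \<in> B \<Longrightarrow> (\<lambda>n. c n b) \<longlonglongrightarrow> l b" by metis
    have "x \<longlonglongrightarrow> (\<Sum>b\<in>B. l b *\<^sub>R b)"
      unfolding x_def by (intro tendsto_intros l)
    hence "a = (\<Sum>b\<in>B. l b *\<^sub>R b)" using xa LIMSEQ_unique by blast
    hence "a \<in> span B" by (simp add: real_vector.span_base real_vector.span_scale real_vector.span_sum)
    with a show False by blast
  qed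
  then obtain d where d: "d > 0" "\<And>c. d \<le> norm (a - (\<Sum>b\<in>B. c b *\<^sub>R b))" by blast
  \<comment> \<open>\<open>1 / d\<close> bounds the coefficient of \<open>a\<close>; the factor
    \<open>1 + norm a / d\<close> bounds the part \<open>s\<close> in the span of \<open>B\<close>
    by the norm of the whole vector.\<close>
  define C' where "C' = 1 / d + C * (1 + norm a / d)"
  have "(\<Sum>b\<in>insert a B. \<bar>c b\<bar>) \<le> C' * norm (\<Sum>b\<in>insert a B. c b *\<^sub>R b)" for c
  proof -
    define s where "s = (\<Sum>b\<in>B. c b *\<^sub>R b)"
    define t where "t = c a *\<^sub>R a + s"
    have ca: "\<bar>c a\<bar> \<le> norm t / d"
    proof (cases "c a = 0")
      case True thus ?thesis using d(1) by simp
    next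
      case False
      have "d \<le> norm (a - (\<Sum>b\<in>B. (- c b / c a) *\<^sub>R b))" by (rule d(2))
      also have "a - (\<Sum>b\<in>B. (- c b / c a) *\<^sub>R b) = (1 / c a) *\<^sub>R t"
        using False by (simp add: t_def s_def scaleR_right_distrib scaleR_sum_right sum_negf divide_inverse mult.commute)
      finally have "d \<le> norm t / \<bar>c a\<bar>" by (simp add: divide_inverse mult.commute)
      thus ?thesis using False d(1) by (simp add: field_simps)
    qed
    have "norm s \<le> norm t + \<bar>c a\<bar> * norm a"
      unfolding t_def by (metis add_diff_cancel_left' norm_scaleR norm_triangle_ineq4 add.commute)
    also have "\<dots> \<le> norm t + (norm t / d) * norm a"
      using mult_right_mono[OF ca, of "norm a"] by simp
    finally have s: "norm s \<le> norm t * (1 + norm a / d)" by (simp add: field_simps)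
    have "(\<Sum>b\<in>insert a B. \<bar>c b\<bar>) = \<bar>c a\<bar> + (\<Sum>b\<in>B. \<bar>c b\<bar>)" using insert by simp
    also have "\<dots> \<le> norm t / d + C * norm s" using ca C(2)[of c] by (simp add: s_def)
    also have "\<dots> \<le> norm t / d + C * (norm t * (1 + norm a / d))"
      using s C(1) by simp
    also have "\<dots> = C' * norm t" by (simp add: C'_def field_simps)
    finally show ?thesis using insert by (simp add: t_def s_def)
  qed
  moreover have "C' > 0" using C(1) d(1) by (auto simp: C'_def intro!: add_pos_nonneg)
  ultimately show ?case by blast
qed

text \<open>Continuity of the coordinates is what lets derivatives in variable directions be
  expanded in the fixed directions of a basis.\<close>

lemma bounded_linear_representation:
  fixes B :: "'e::real_normed_vector set"
  assumes B: "finite B" "independent B" "span B = UNIV" and b: "b \<in> B"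
  shows "bounded_linear (\<lambda>v. representation B v b)"
proof -
  obtain C where C: "C > 0" "\<And>c. (\<Sum>b\<in>B. \<bar>c b\<bar>) \<le> C * norm (\<Sum>b\<in>B. c b *\<^sub>R b)"
    using coeff_norm_bound[OF B(1,2)] by blast
  show ?thesis
  proof (rule bounded_linear_intro[where K = C])
    fix x y :: 'e and r :: real
    show "representation B (x + y) b = representation B x b + representation B y b"
      by (simp add: real_vector.representation_add B)
    show "representation B (r *\<^sub>R x) b = r *\<^sub>R representation B x b"
      by (simp add: real_vector.representation_scale B)
    have "\<bar>representation B x b\<bar> \<le> (\<Sum>b\<in>B. \<bar>representation B x b\<bar>)"
      using b B by (intro member_le_sum) auto
    also have "\<dots> \<le> C * norm (\<Sum>b\<in>B. representation B x b *\<^sub>R b)" by (rule C(2))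
    also have "(\<Sum>b\<in>B. representation B x b *\<^sub>R b) = x"
      by (rule real_vector.sum_representation_eq) (use B in auto)
    finally show "norm (representation B x b) \<le> norm x * C" by (simp add: mult.commute)
  qed
qed

lemma basis_expansion:
  fixes B :: "'e::real_normed_vector set"
  assumes B: "finite B" "independent B" "span B = UNIV"
  shows "(\<Sum>b\<in>B. representation B v b *\<^sub>R b) = v"
  by (rule real_vector.sum_representation_eq) (use B in auto)

section \<open>Rules for C^k maps\<close>

lemma frechet_derivative_cong_open:
  assumes "open S" "x \<in> S" "\<And>y. y \<in> S \<Longrightarrow> f y = g y"
  shows "frechet_derivative f (at x) = frechet_derivative g (at x)"
    and "f differentiable (at x) \<longleftrightarrow> g differentiable (at x)"
proof -
  have *: "(f has_derivative D) (at x) \<longleftrightarrow> (g has_derivative D) (at x)" for D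
    using assms has_derivative_transform_within_open by metis
  show "frechet_derivative f (at x) = frechet_derivative g (at x)"
    unfolding frechet_derivative_def by (simp add: *)
  show "f differentiable (at x) \<longleftrightarrow> g differentiable (at x)"
    unfolding differentiable_def by (simp add: *)
qed

lemma Ck_on_cong:
  assumes "open S" "\<And>y. y \<in> S \<Longrightarrow> f y = g y"
  shows "Ck_on k S f \<longleftrightarrow> Ck_on k S g"
  using assms(2)
proof (induction k arbitrary: f g)
  case 0 thus ?case using continuous_on_cong by auto
next
  case (Suc k)
  have "Ck_on k S (\<lambda>x. frechet_derivative f (at x) v) \<longleftrightarrow> Ck_on k S (\<lambda>x. frechet_derivative g (at x) v)" for v
    by (rule Suc.IH) (metis frechet_derivative_cong_open(1) assms(1) Suc.prems)
  moreover have "f differentiable (at x) \<longleftrightarrow> g differentiable (at x)" if "x \<in> S" for x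
    by (rule frechet_derivative_cong_open(2)[OF assms(1) that]) (use Suc.prems in auto)
  ultimately show ?case by auto
qed

lemma Ck_on_subset: "Ck_on k S f \<Longrightarrow> T \<subseteq> S \<Longrightarrow> Ck_on k T f"
  by (induction k arbitrary: f) (auto intro: continuous_on_subset)

lemma Ck_on_mono_Suc: "Ck_on (Suc k) S f \<Longrightarrow> Ck_on k S f"
proof (induction k arbitrary: f)
  case 0
  thus ?case by (auto intro!: continuous_at_imp_continuous_on differentiable_imp_continuous_within)
next
  case (Suc k) thus ?case by (metis Ck_on.simps(2))
qed

lemma Ck_on_local:
  assumes "\<And>x. x \<in> S \<Longrightarrow> \<exists>T. open T \<and> x \<in> T \<and> Ck_on k T f"
  shows "Ck_on k S f"
  using assms
proof (induction k arbitrary: f)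
  case 0
  show ?case unfolding Ck_on.simps
  proof (rule continuous_at_imp_continuous_on, rule)
    fix x assume "x \<in> S"
    then obtain T where "open T" "x \<in> T" "Ck_on 0 T f" using 0 by blast
    thus "isCont f x" by (simp add: continuous_on_eq_continuous_at)
  qed
next
  case (Suc k)
  have "Ck_on k S (\<lambda>x. frechet_derivative f (at x) v)" for v
    by (rule Suc.IH) (use Suc.prems in \<open>auto; blast\<close>)
  moreover have "f differentiable (at x)" if "x \<in> S" for x
    using Suc.prems[OF that] by auto
  ultimately show ?case by auto
qed

lemma Ck_on_const: "Ck_on k S (\<lambda>_. c)"
  by (induction k arbitrary: c) auto

lemma frechet_derivative_eqI:
  "(f has_derivative D) (at x) \<Longrightarrow> frechet_derivative f (at x) v = D v"
  using frechet_derivative_at by metis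

lemma has_frechet_derivative: "f differentiable (at x) \<Longrightarrow> (f has_derivative frechet_derivative f (at x)) (at x)"
  using frechet_derivative_works by blast

text \<open>\<open>Ck_on\<close> speaks of \<open>frechet_derivative\<close>, a chosen function;
  this rule accepts any explicit formula for the derivative on an open set, so that the closure
  properties below become inductions over the sum, product and chain rules.\<close>

lemma Ck_on_SucI:
  assumes S: "open S" and der: "\<And>x. x \<in> S \<Longrightarrow> (f has_derivative f' x) (at x)"
    and Ck: "\<And>v. Ck_on k S (\<lambda>x. f' x v)"
  shows "Ck_on (Suc k) S f"
  unfolding Ck_on.simps
proof (intro conjI allI ballI)
  show "f differentiable (at x)" if "x \<in> S" for x using der[OF that] by (auto simp: differentiable_def)
  fix v
  have "Ck_on k S (\<lambda>x. frechet_derivative f (at x) v) \<longleftrightarrow> Ck_on k S (\<lambda>x. f' x v)"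
    by (rule Ck_on_cong[OF S frechet_derivative_eqI[OF der]])
  with Ck show "Ck_on k S (\<lambda>x. frechet_derivative f (at x) v)" by simp
qed

lemma Ck_on_SucD:
  assumes "Ck_on (Suc k) S f"
  shows "x \<in> S \<Longrightarrow> (f has_derivative frechet_derivative f (at x)) (at x)"
    and "Ck_on k S (\<lambda>x. frechet_derivative f (at x) v)" and "Ck_on k S f"
  using assms Ck_on_mono_Suc[OF assms] has_frechet_derivative by auto

lemma Ck_on_add:
  assumes "open S" "Ck_on k S f" "Ck_on k S g"
  shows "Ck_on k S (\<lambda>x. f x + g x)"
  using assms(2,3)
proof (induction k arbitrary: f g)
  case 0 thus ?case by (auto intro: continuous_on_add)
next
  case (Suc k)
  show ?case
    by (rule Ck_on_SucI[OF assms(1) has_derivative_add[OF Ck_on_SucD(1)[OF Suc.prems(1)] Ck_on_SucD(1)[OF Suc.prems(2)]]])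
      (auto intro!: Suc.IH Ck_on_SucD(2) Suc.prems)
qed

lemma Ck_on_sum:
  assumes "open S" "\<And>i. i \<in> I \<Longrightarrow> Ck_on k S (f i)"
  shows "Ck_on k S (\<lambda>x. \<Sum>i\<in>I. f i x)"
  using assms(2)
  by (induction I rule: infinite_finite_induct) (auto intro!: Ck_on_add Ck_on_const assms(1))

lemma Ck_on_bounded_linear:
  assumes L: "bounded_linear L" and S: "open S" and f: "Ck_on k S f"
  shows "Ck_on k S (\<lambda>x. L (f x))"
  using f
proof (induction k arbitrary: f)
  case 0 thus ?case using bounded_linear.continuous_on[OF L] by auto
next
  case (Suc k)
  show ?case
    by (rule Ck_on_SucI[OF S bounded_linear.has_derivative[OF L Ck_on_SucD(1)[OF Suc.prems]]])
      (auto intro!: Suc.IH Ck_on_SucD(2) Suc.prems)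
qed

lemma Ck_on_bounded_bilinear:
  assumes P: "bounded_bilinear P" and S: "open S" and f: "Ck_on k S f" and g: "Ck_on k S g"
  shows "Ck_on k S (\<lambda>x. P (f x) (g x))"
  using f g
proof (induction k arbitrary: f g)
  case 0 thus ?case using bounded_bilinear.continuous_on[OF P] by auto
next
  case (Suc k)
  show ?case
  proof (rule Ck_on_SucI[OF S])
    fix x assume "x \<in> S"
    show "((\<lambda>x. P (f x) (g x)) has_derivative
     (\<lambda>v. P (f x) (frechet_derivative g (at x) v) + P (frechet_derivative f (at x) v) (g x))) (at x)"
      using Ck_on_SucD(1)[OF Suc.prems(1) \<open>x \<in> S\<close>] Ck_on_SucD(1)[OF Suc.prems(2) \<open>x \<in> S\<close>]
      by (rule bounded_bilinear.FDERIV[OF P])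
  next
    fix v
    show "Ck_on k S (\<lambda>x. P (f x) (frechet_derivative g (at x) v) + P (frechet_derivative f (at x) v) (g x))"
      by (intro Ck_on_add S Suc.IH Ck_on_SucD(2)[OF Suc.prems(1)] Ck_on_SucD(2)[OF Suc.prems(2)]
          Ck_on_SucD(3)[OF Suc.prems(1)] Ck_on_SucD(3)[OF Suc.prems(2)])
  qed
qed

lemma Ck_on_bounded_linear_fun: "bounded_linear L \<Longrightarrow> Ck_on k S L"
proof (cases k)
  case 0
  assume "bounded_linear L" thus ?thesis using 0 by (simp add: linear_continuous_on)
next
  case (Suc j)
  assume L: "bounded_linear L"
  have "frechet_derivative L (at x) v = L v" for x v
    using frechet_derivative_eqI bounded_linear_imp_has_derivative[OF L] by metis
  thus ?thesis using Suc L by (simp add: Ck_on_const bounded_linear_imp_differentiable)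
qed

lemma frechet_derivative_basis:
  fixes B :: "'e::real_normed_vector set"
  assumes B: "finite B" "independent B" "span B = UNIV" and f: "f differentiable (at x)"
  shows "frechet_derivative f (at x) v = (\<Sum>b\<in>B. representation B v b *\<^sub>R frechet_derivative f (at x) b)"
proof -
  interpret linear "frechet_derivative f (at x)" by (rule linear_frechet_derivative[OF f])
  have "frechet_derivative f (at x) v = frechet_derivative f (at x) (\<Sum>b\<in>B. representation B v b *\<^sub>R b)"
    using basis_expansion[OF B] by simp
  thus ?thesis by (simp add: sum scale)
qed

text \<open>The derivative of \<open>g\<close> at \<open>f x\<close> is taken in the direction
  \<open>frechet_derivative f (at x) v\<close>, which varies with \<open>x\<close>, while the
  induction hypothesis knows only fixed directions. Expanding the direction in a basis of the middle
  space leaves derivatives of \<open>g\<close> in basis directions, with coefficients that are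
  coordinates of the derivative of \<open>f\<close>.\<close>

lemma Ck_on_compose:
  fixes f :: "'d::real_normed_vector \<Rightarrow> 'e::real_normed_vector"
  assumes fd: "fin_dim TYPE('e)" and S: "open S" and T: "open T" and fST: "f ` S \<subseteq> T"
    and f: "Ck_on k S f" and g: "Ck_on k T g"
  shows "Ck_on k S (\<lambda>x. g (f x))"
proof -
  obtain B :: "'e set" where B: "finite B" "independent B" "span B = UNIV"
    using fin_dim_basis[OF fd] by blast
  show ?thesis using f g
  proof (induction k arbitrary: g)
    case 0 thus ?case using continuous_on_compose2 fST by auto
  next
    case (Suc k)
    show ?case
    proof (rule Ck_on_SucI[OF S])
      fix x assume x: "x \<in> S"
      have fx: "f differentiable (at x)" and gx: "g differentiable (at (f x))"
        using Suc.prems x fST by auto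
      have "((\<lambda>x. g (f x)) has_derivative (\<lambda>v. frechet_derivative g (at (f x)) (frechet_derivative f (at x) v))) (at x)"
        by (rule has_derivative_compose[OF has_frechet_derivative[OF fx] has_frechet_derivative[OF gx]])
      thus "((\<lambda>x. g (f x)) has_derivative
       (\<lambda>v. \<Sum>b\<in>B. representation B (frechet_derivative f (at x) v) b *\<^sub>R frechet_derivative g (at (f x)) b)) (at x)"
        by (simp only: frechet_derivative_basis[OF B gx, symmetric])
    next
      fix v
      show "Ck_on k S (\<lambda>x. \<Sum>b\<in>B. representation B (frechet_derivative f (at x) v) b *\<^sub>R frechet_derivative g (at (f x)) b)"
        by (intro Ck_on_sum S Ck_on_bounded_bilinear[OF bounded_bilinear_scaleR]
            Ck_on_bounded_linear[OF bounded_linear_representation[OF B]] Suc.IH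
            Ck_on_SucD(2)[OF Suc.prems(1)] Ck_on_SucD(2)[OF Suc.prems(2)] Ck_on_SucD(3)[OF Suc.prems(1)])
    qed
  qed
qed

section \<open>Iterated directional derivatives\<close>

lemma iter_deriv_append: "iter_deriv (us @ vs) f = iter_deriv us (iter_deriv vs f)"
  by (induction us) auto

lemma Ck_on_iter_deriv: "Ck_on (k + length vs) S f \<Longrightarrow> Ck_on k S (iter_deriv vs f)"
proof (induction vs arbitrary: f rule: rev_induct)
  case (snoc v vs)
  thus ?case by (simp add: iter_deriv_append)
qed auto

lemma smooth_on_iter_deriv: "smooth_on S f \<Longrightarrow> smooth_on S (iter_deriv vs f)"
  unfolding smooth_on_def using Ck_on_iter_deriv by blast

lemma smooth_on_differentiable: "smooth_on S f \<Longrightarrow> x \<in> S \<Longrightarrow> f differentiable (at x)"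
  unfolding smooth_on_def using Ck_on.simps(2) by blast

lemma smooth_on_continuous_on: "smooth_on S f \<Longrightarrow> continuous_on S f"
  unfolding smooth_on_def using Ck_on.simps(1) by blast

lemma iter_deriv_imp_Ck_on:
  assumes "\<And>vs x. x \<in> S \<Longrightarrow> iter_deriv vs f differentiable (at x)"
  shows "Ck_on k S f"
  using assms
proof (induction k arbitrary: f)
  case 0
  have "isCont f x" if "x \<in> S" for x
    using 0[OF that, of "[]"] by (simp add: differentiable_imp_continuous_within)
  thus ?case by (simp add: continuous_at_imp_continuous_on)
next
  case (Suc k)
  have "iter_deriv vs (\<lambda>x. frechet_derivative f (at x) v) = iter_deriv (vs @ [v]) f" for vs v
    by (simp add: iter_deriv_append)
  hence "Ck_on k S (\<lambda>x. frechet_derivative f (at x) v)" for v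
    by (intro Suc.IH) (use Suc.prems in auto)
  thus ?case using Suc.prems[of _ "[]"] by auto
qed

lemma smooth_on_iff:
  "smooth_on S f \<longleftrightarrow> (\<forall>vs. \<forall>x\<in>S. iter_deriv vs f differentiable (at x))"
  using iter_deriv_imp_Ck_on smooth_on_def smooth_on_iter_deriv smooth_on_differentiable by metis

lemma iter_deriv_cong:
  assumes "open S" "\<And>y. y \<in> S \<Longrightarrow> f y = g y" "x \<in> S"
  shows "iter_deriv vs f x = iter_deriv vs g x"
  using assms(3)
proof (induction vs arbitrary: x)
  case Nil thus ?case using assms by simp
next
  case (Cons v vs)
  show ?case using frechet_derivative_cong_open(1)[OF assms(1) Cons.prems Cons.IH] by simp
qed

lemma smooth_on_cong:
  assumes "open S" "\<And>y. y \<in> S \<Longrightarrow> f y = g y"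
  shows "smooth_on S f \<longleftrightarrow> smooth_on S g"
  unfolding smooth_on_def by (simp add: Ck_on_cong[OF assms])

lemma smooth_on_subset: "smooth_on S f \<Longrightarrow> T \<subseteq> S \<Longrightarrow> smooth_on T f"
  unfolding smooth_on_def using Ck_on_subset by blast

lemma smooth_on_local:
  "(\<And>x. x \<in> S \<Longrightarrow> \<exists>T. open T \<and> x \<in> T \<and> smooth_on T f) \<Longrightarrow> smooth_on S f"
  unfolding smooth_on_def by (metis Ck_on_local)

lemma smooth_on_const [simp]: "smooth_on S (\<lambda>_. c)"
  by (simp add: smooth_on_def Ck_on_const)

lemma smooth_on_add: "open S \<Longrightarrow> smooth_on S f \<Longrightarrow> smooth_on S g \<Longrightarrow> smooth_on S (\<lambda>x. f x + g x)"
  by (simp add: smooth_on_def Ck_on_add)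

lemma smooth_on_sum: "open S \<Longrightarrow> (\<And>i. i \<in> I \<Longrightarrow> smooth_on S (f i)) \<Longrightarrow> smooth_on S (\<lambda>x. \<Sum>i\<in>I. f i x)"
  by (simp add: smooth_on_def Ck_on_sum)

lemma smooth_on_bounded_linear:
  "bounded_linear L \<Longrightarrow> open S \<Longrightarrow> smooth_on S f \<Longrightarrow> smooth_on S (\<lambda>x. L (f x))"
  by (simp add: smooth_on_def Ck_on_bounded_linear)

lemma smooth_on_bounded_linear_fun: "bounded_linear L \<Longrightarrow> smooth_on S L"
  by (simp add: smooth_on_def Ck_on_bounded_linear_fun)

lemma smooth_on_bounded_bilinear:
  "bounded_bilinear P \<Longrightarrow> open S \<Longrightarrow> smooth_on S f \<Longrightarrow> smooth_on S g \<Longrightarrow> smooth_on S (\<lambda>x. P (f x) (g x))"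
  by (simp add: smooth_on_def Ck_on_bounded_bilinear)

lemmas smooth_on_mult = smooth_on_bounded_bilinear[OF bounded_bilinear_mult]
lemma smooth_on_compose:
  fixes f :: "'d::real_normed_vector \<Rightarrow> 'e::real_normed_vector"
  assumes "fin_dim TYPE('e)" "open S" "open T" "f ` S \<subseteq> T" "smooth_on S f" "smooth_on T g"
  shows "smooth_on S (\<lambda>x. g (f x))"
  using assms Ck_on_compose unfolding smooth_on_def by blast

lemma smooth_on_Pair:
  assumes "open S" "smooth_on S f" "smooth_on S g"
  shows "smooth_on S (\<lambda>x. (f x, g x))"
proof -
  have "bounded_linear (\<lambda>a::'b. (a, 0::'c))" "bounded_linear (\<lambda>a::'c. (0::'b, a))"
    by (simp_all add: bounded_linear_Pair bounded_linear_ident bounded_linear_zero)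
  hence "smooth_on S (\<lambda>x. (f x, 0) + (0, g x))"
    using assms by (intro smooth_on_add) (auto intro: smooth_on_bounded_linear)
  thus ?thesis by simp
qed

lemma smooth_on_fst: "open S \<Longrightarrow> smooth_on S f \<Longrightarrow> smooth_on S (\<lambda>x. fst (f x))"
  and smooth_on_snd: "open S \<Longrightarrow> smooth_on S f \<Longrightarrow> smooth_on S (\<lambda>x. snd (f x))"
  by (auto intro: smooth_on_bounded_linear bounded_linear_fst bounded_linear_snd)

lemma smooth_on_id: "smooth_on S (\<lambda>x. x)"
  by (rule smooth_on_bounded_linear_fun[OF bounded_linear_ident])

lemma smooth_on_frechet_derivative:
  "smooth_on S f \<Longrightarrow> smooth_on S (\<lambda>x. frechet_derivative f (at x) v)"
  using smooth_on_iter_deriv[of S f "[v]"] by simp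

lemma open_vimage_affine:
  fixes L :: "'d::real_normed_vector \<Rightarrow> 'e::real_normed_vector"
  assumes "bounded_linear L" "open W"
  shows "open {x. L x + p \<in> W}"
proof -
  have "continuous_on UNIV (\<lambda>x. L x + p)"
    by (intro continuous_intros linear_continuous_on assms)
  from open_vimage[OF assms(2) this] show ?thesis by (simp add: vimage_def)
qed

text \<open>For an affine inner map the directions change by the constant linear map
  \<open>L\<close>, so no lower-order terms appear. The two slice lemmas below use it to compare
  derivatives in one variable with joint derivatives.\<close>

lemma iter_deriv_affine:
  assumes L: "bounded_linear L" and W: "open W" and f: "smooth_on W f" and x: "L x + p \<in> W"
  shows "iter_deriv vs (\<lambda>x. f (L x + p)) x = iter_deriv (map L vs) f (L x + p)"
    and "iter_deriv vs (\<lambda>x. f (L x + p)) differentiable (at x)"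
proof -
  have der: "((\<lambda>x. iter_deriv us f (L x + p)) has_derivative
      (\<lambda>v. frechet_derivative (iter_deriv us f) (at (L x + p)) (L v))) (at x)"
    if "L x + p \<in> W" for us x
  proof (rule has_derivative_compose[of "\<lambda>x. L x + p" L])
    show "((\<lambda>x. L x + p) has_derivative L) (at x)"
      using has_derivative_add[OF bounded_linear_imp_has_derivative[OF L] has_derivative_const[of p]] by simp
    show "(iter_deriv us f has_derivative frechet_derivative (iter_deriv us f) (at (L x + p))) (at (L x + p))"
      using f that by (simp add: smooth_on_iff has_frechet_derivative)
  qed
  have eq: "iter_deriv vs (\<lambda>x. f (L x + p)) x = iter_deriv (map L vs) f (L x + p)" if "L x + p \<in> W" for x vs
    using that
  proof (induction vs arbitrary: x)
    case (Cons v vs)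
    have "frechet_derivative (iter_deriv vs (\<lambda>x. f (L x + p))) (at x) =
        frechet_derivative (\<lambda>x. iter_deriv (map L vs) f (L x + p)) (at x)"
      by (rule frechet_derivative_cong_open(1)[OF open_vimage_affine[OF L W, of p]]) (use Cons in auto)
    thus ?case using frechet_derivative_eqI[OF der[OF Cons.prems]] by simp
  qed simp
  show "iter_deriv vs (\<lambda>x. f (L x + p)) x = iter_deriv (map L vs) f (L x + p)" by (rule eq[OF x])
  have "iter_deriv vs (\<lambda>x. f (L x + p)) differentiable (at x) \<longleftrightarrow>
       (\<lambda>x. iter_deriv (map L vs) f (L x + p)) differentiable (at x)"
    by (rule frechet_derivative_cong_open(2)[OF open_vimage_affine[OF L W, of p]]) (use x eq in auto)
  thus "iter_deriv vs (\<lambda>x. f (L x + p)) differentiable (at x)"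
    using der[OF x] by (auto simp: differentiable_def)
qed

lemma iter_deriv_slice1:
  assumes W: "open W" and f: "smooth_on W f" and x: "(x, y) \<in> W"
  shows "iter_deriv vs (\<lambda>x. f (x, y)) x = iter_deriv (map (\<lambda>v. (v, 0)) vs) f (x, y)"
    and "iter_deriv vs (\<lambda>x. f (x, y)) differentiable (at x)"
proof -
  have L: "bounded_linear (\<lambda>v. (v, 0))" by (simp add: bounded_linear_Pair bounded_linear_ident bounded_linear_zero)
  show "iter_deriv vs (\<lambda>x. f (x, y)) x = iter_deriv (map (\<lambda>v. (v, 0)) vs) f (x, y)"
   and "iter_deriv vs (\<lambda>x. f (x, y)) differentiable (at x)"
    using iter_deriv_affine[OF L W f, of x "(0, y)" vs] x by auto
qed

lemma iter_deriv_slice2: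
  assumes W: "open W" and f: "smooth_on W f" and x: "(x, y) \<in> W"
  shows "iter_deriv vs (\<lambda>y. f (x, y)) y = iter_deriv (map (\<lambda>v. (0, v)) vs) f (x, y)"
    and "iter_deriv vs (\<lambda>y. f (x, y)) differentiable (at y)"
proof -
  have L: "bounded_linear (\<lambda>v. (0, v))" by (simp add: bounded_linear_Pair bounded_linear_ident bounded_linear_zero)
  show "iter_deriv vs (\<lambda>y. f (x, y)) y = iter_deriv (map (\<lambda>v. (0, v)) vs) f (x, y)"
   and "iter_deriv vs (\<lambda>y. f (x, y)) differentiable (at y)"
    using iter_deriv_affine[OF L W f, of y "(x, 0)" vs] x by auto
qed

text \<open>An inexplicit Faa di Bruno formula. What matters is the order of quantifiers: the
  coefficients and directions in \<open>J\<close> are chosen before \<open>g\<close>, so that on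
  compact sets they give estimates uniform in \<open>g\<close>.\<close>

lemma iter_deriv_pullback:
  fixes f :: "'d::real_normed_vector \<Rightarrow> 'e::real_normed_vector" and c :: "'d \<Rightarrow> complex"
  assumes fd: "fin_dim TYPE('e)" and S: "open S" and T: "open T" and fST: "f ` S \<subseteq> T"
    and f: "smooth_on S f" and c: "smooth_on S c"
  shows "\<exists>J::(('d \<Rightarrow> complex) \<times> 'e list) list. (\<forall>(a, ws)\<in>set J. smooth_on S a) \<and>
     (\<forall>g. smooth_on T g \<longrightarrow> (\<forall>x\<in>S. iter_deriv vs (\<lambda>x. c x * g (f x)) x =
         (\<Sum>(a, ws)\<leftarrow>J. a x * iter_deriv ws g (f x))))"
proof (induction vs)
  case Nil
  show ?case by (rule exI[of _ "[(c, [])]"]) (use c in auto)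
next
  case (Cons v vs)
  then obtain J :: "(('d \<Rightarrow> complex) \<times> 'e list) list" where J: "\<And>a ws. (a, ws) \<in> set J \<Longrightarrow> smooth_on S a"
    and Jg: "\<And>g x. smooth_on T g \<Longrightarrow> x \<in> S \<Longrightarrow> iter_deriv vs (\<lambda>x. c x * g (f x)) x =
         (\<Sum>(a, ws)\<leftarrow>J. a x * iter_deriv ws g (f x))" by blast
  obtain B :: "'e set" where B: "finite B" "independent B" "span B = UNIV"
    using fin_dim_basis[OF fd] by blast
  obtain bl where bl: "set bl = B" "distinct bl" using finite_distinct_list[OF B(1)] by blast
  define co where "co x b = complex_of_real (representation B (frechet_derivative f (at x) v) b)" for x b
  \<comment> \<open>One further differentiation of a summand: the product rule differentiates the
    coefficient, and the chain rule contributes one new summand for each basis direction, weighted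
    by the coordinate \<open>co\<close>.\<close>
  define step where "step = (\<lambda>(a, ws). (\<lambda>x. frechet_derivative a (at x) v, ws) #
      map (\<lambda>b. (\<lambda>x. a x * co x b, b # ws)) bl)"
  have co: "smooth_on S (\<lambda>x. co x b)" if "b \<in> B" for b
  proof -
    have rep: "smooth_on S (\<lambda>x. representation B (frechet_derivative f (at x) v) b)"
      by (rule smooth_on_bounded_linear[OF bounded_linear_representation[OF B that] S smooth_on_frechet_derivative[OF f]])
    show ?thesis unfolding co_def by (rule smooth_on_bounded_linear[OF bounded_linear_of_real S rep])
  qed
  have der1: "((\<lambda>x. a x * iter_deriv ws g (f x)) has_derivative
       (\<lambda>u. a x * (frechet_derivative (iter_deriv ws g) (at (f x)) (frechet_derivative f (at x) u))
           + frechet_derivative a (at x) u * iter_deriv ws g (f x))) (at x)"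
    if "(a, ws) \<in> set J" "smooth_on T g" "x \<in> S" for a ws g x
  proof (rule has_derivative_mult)
    show "(a has_derivative frechet_derivative a (at x)) (at x)"
      by (rule has_frechet_derivative[OF smooth_on_differentiable[OF J[OF that(1)] that(3)]])
    show "((\<lambda>x. iter_deriv ws g (f x)) has_derivative
       (\<lambda>u. frechet_derivative (iter_deriv ws g) (at (f x)) (frechet_derivative f (at x) u))) (at x)"
    proof (rule has_derivative_compose[of f, OF has_frechet_derivative has_frechet_derivative])
      show "f differentiable (at x)" using f that(3) by (rule smooth_on_differentiable)
      show "iter_deriv ws g differentiable (at (f x))"
        using that fST by (auto simp: smooth_on_iff)
    qed
  qed
  have val: "a x * (frechet_derivative (iter_deriv ws g) (at (f x)) (frechet_derivative f (at x) v))
           + frechet_derivative a (at x) v * iter_deriv ws g (f x) =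
         (\<Sum>(a, ws)\<leftarrow>step (a, ws). a x * iter_deriv ws g (f x))"
    if "smooth_on T g" "x \<in> S" for a ws g x
  proof -
    have "iter_deriv ws g differentiable (at (f x))"
      using that fST by (auto simp: smooth_on_iff)
    from frechet_derivative_basis[OF B this, of "frechet_derivative f (at x) v"]
    have "frechet_derivative (iter_deriv ws g) (at (f x)) (frechet_derivative f (at x) v) =
       (\<Sum>b\<leftarrow>bl. co x b * iter_deriv (b # ws) g (f x))"
      by (simp add: bl co_def scaleR_conv_of_real flip: sum.distinct_set_conv_list)
    thus ?thesis
      by (simp add: step_def o_def sum_list_const_mult[symmetric] mult.assoc)
  qed
  have "((\<lambda>x. \<Sum>(a, ws)\<leftarrow>K. a x * iter_deriv ws g (f x)) has_derivative
       (\<lambda>u. \<Sum>(a, ws)\<leftarrow>K. a x * (frechet_derivative (iter_deriv ws g) (at (f x)) (frechet_derivative f (at x) u))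
           + frechet_derivative a (at x) u * iter_deriv ws g (f x))) (at x)"
    if "set K \<subseteq> set J" "smooth_on T g" "x \<in> S" for K g x
    using that
  proof (induction K)
    case (Cons p K)
    obtain a ws where p: "p = (a, ws)" by (cases p)
    have "(a, ws) \<in> set J" using Cons.prems p by auto
    from has_derivative_add[OF der1[OF this Cons.prems(2,3)] Cons.IH] Cons.prems
    show ?case by (simp add: p)
  qed simp
  note derJ = this[OF order.refl]
  have stepval: "(\<Sum>(a, ws)\<leftarrow>K. a x * (frechet_derivative (iter_deriv ws g) (at (f x)) (frechet_derivative f (at x) v))
           + frechet_derivative a (at x) v * iter_deriv ws g (f x)) =
        (\<Sum>(a, ws)\<leftarrow>concat (map step K). a x * iter_deriv ws g (f x))"
    if "smooth_on T g" "x \<in> S" for K g x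
  proof (induction K)
    case (Cons p K)
    obtain a ws where p: "p = (a, ws)" by (cases p)
    show ?case unfolding p list.map concat.simps map_append sum_list_append sum_list.Cons prod.case
      by (simp only: Cons.IH[symmetric]) (simp only: val[OF that])
  qed simp
  show ?case
  proof (intro exI[of _ "concat (map step J)"] conjI allI impI ballI)
    fix p assume "p \<in> set (concat (map step J))"
    then obtain a ws where a: "(a, ws) \<in> set J" "p \<in> set (step (a, ws))" by auto
    have "smooth_on S (\<lambda>x. a x * co x b)" if "b \<in> B" for b
      by (rule smooth_on_mult[OF S J[OF a(1)] co[OF that]])
    thus "case p of (a, ws) \<Rightarrow> smooth_on S a"
      using a smooth_on_frechet_derivative[OF J[OF a(1)]] by (auto simp: step_def bl)
  next
    fix g :: "'e \<Rightarrow> complex" and x assume g: "smooth_on T g" and x: "x \<in> S"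
    have "frechet_derivative (iter_deriv vs (\<lambda>x. c x * g (f x))) (at x) =
      frechet_derivative (\<lambda>x. \<Sum>(a, ws)\<leftarrow>J. a x * iter_deriv ws g (f x)) (at x)"
      by (rule frechet_derivative_cong_open(1)[OF S x Jg[OF g]])
    hence "iter_deriv (v # vs) (\<lambda>x. c x * g (f x)) x =
      frechet_derivative (\<lambda>x. \<Sum>(a, ws)\<leftarrow>J. a x * iter_deriv ws g (f x)) (at x) v" by simp
    also have "\<dots> = (\<Sum>(a, ws)\<leftarrow>concat (map step J). a x * iter_deriv ws g (f x))"
      by (simp only: frechet_derivative_eqI[OF derJ[OF g x]] stepval[OF g x])
    finally show "iter_deriv (v # vs) (\<lambda>x. c x * g (f x)) x =
      (\<Sum>(a, ws)\<leftarrow>concat (map step J). a x * iter_deriv ws g (f x))" .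
  qed
qed

section \<open>Differentiation under the integral sign\<close>

lemma integrable_continuous_compact:
  fixes h :: "'b::topological_space \<Rightarrow> 'c::{banach, second_countable_topology}"
  assumes "compact (UNIV :: 'b set)" "finite_measure N" "sets N = sets borel" "continuous_on UNIV h"
  shows "integrable N h"
proof -
  have "bounded (range h)" using compact_imp_bounded[OF compact_continuous_image[OF assms(4,1)]] .
  then obtain C where "\<And>x. norm (h x) \<le> C" by (auto simp: bounded_iff)
  moreover have "h \<in> borel_measurable N"
    using borel_measurable_continuous_onI[OF assms(4)] measurable_cong_sets[OF assms(3) refl] by blast
  ultimately show ?thesis by (intro finite_measure.integrable_const_bound[OF assms(2), of _ C]) auto
qed

text \<open>The parameter \<open>y\<close> runs through a space without differentiable structure.
  Joint continuity of every \<open>x\<close>-derivative, combined later with compactness of that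
  space, takes the place of a domination hypothesis.\<close>

definition param_smooth :: "'e::real_normed_vector set \<Rightarrow> ('e \<Rightarrow> 'b::topological_space \<Rightarrow> complex) \<Rightarrow> bool" where
  "param_smooth S f \<longleftrightarrow> (\<forall>vs. (\<forall>y. \<forall>x\<in>S. iter_deriv vs (\<lambda>x. f x y) differentiable (at x)) \<and>
      continuous_on (S \<times> UNIV) (\<lambda>(x, y). iter_deriv vs (\<lambda>x. f x y) x))"

text \<open>Because the parameter space is compact, the derivatives at nearby points differ little,
  uniformly in \<open>y\<close>. The mean value estimate then bounds the remainder of the integrand
  uniformly in \<open>y\<close>, and integration against a finite measure preserves the
  bound.\<close>

lemma has_derivative_integral_param:
  fixes f :: "'e::real_normed_vector \<Rightarrow> 'b::topological_space \<Rightarrow> complex"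
  assumes fd: "fin_dim TYPE('e)" and S: "open S" and cpt: "compact (UNIV :: 'b set)"
    and N: "finite_measure N" "sets N = sets borel"
    and diff: "\<And>x y. x \<in> S \<Longrightarrow> (\<lambda>x. f x y) differentiable (at x)"
    and cont0: "continuous_on (S \<times> UNIV) (\<lambda>(x, y). f x y)"
    and cont: "\<And>v. continuous_on (S \<times> UNIV) (\<lambda>(x, y). frechet_derivative (\<lambda>x. f x y) (at x) v)"
    and x: "x \<in> S"
  shows "((\<lambda>x. \<integral>y. f x y \<partial>N) has_derivative (\<lambda>v. \<integral>y. frechet_derivative (\<lambda>x. f x y) (at x) v \<partial>N)) (at x)"
proof -
  interpret finite_measure N by fact
  obtain B :: "'e set" where B: "finite B" "independent B" "span B = UNIV"
    using fin_dim_basis[OF fd] by blast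
  obtain C where C: "C > 0" "\<And>c. (\<Sum>b\<in>B. \<bar>c b\<bar>) \<le> C * norm (\<Sum>b\<in>B. c b *\<^sub>R b)"
    using coeff_norm_bound[OF B(1,2)] by blast
  have Pair: "continuous_on UNIV (Pair x :: 'b \<Rightarrow> _)" for x :: 'e
    using continuous_on_Pair[OF continuous_on_const continuous_on_id] by (simp add: fun_eq_iff)
  have slice: "continuous_on UNIV (\<lambda>y. h x y)"
    if "continuous_on (S \<times> UNIV) (\<lambda>(x, y). h x y)" "x \<in> S" for h :: "'e \<Rightarrow> 'b \<Rightarrow> complex" and x
    using continuous_on_compose2[OF that(1) Pair, of x] that(2) by auto
  have int0: "integrable N (\<lambda>y. f x y)" if "x \<in> S" for x
    by (rule integrable_continuous_compact[OF cpt N slice[OF cont0 that]])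
  have int1: "integrable N (\<lambda>y. frechet_derivative (\<lambda>x. f x y) (at x) v)" if "x \<in> S" for x v
    by (rule integrable_continuous_compact[OF cpt N slice[OF cont that]])
  have exp: "frechet_derivative (\<lambda>x. f x y) (at x) v =
     (\<Sum>b\<in>B. representation B v b *\<^sub>R frechet_derivative (\<lambda>x. f x y) (at x) b)" if "x \<in> S" for x y v
    by (rule frechet_derivative_basis[OF B diff[OF that]])
  show ?thesis unfolding has_derivative_at_alt
  proof (intro conjI allI impI)
    have "(\<lambda>v. \<integral>y. frechet_derivative (\<lambda>x. f x y) (at x) v \<partial>N) =
       (\<lambda>v. \<Sum>b\<in>B. representation B v b *\<^sub>R (\<integral>y. frechet_derivative (\<lambda>x. f x y) (at x) b \<partial>N))"
      by (rule ext, subst exp[OF x]) (simp add: int1[OF x])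
    moreover have "bounded_linear (\<lambda>v. \<Sum>b\<in>B. representation B v b *\<^sub>R (\<integral>y. frechet_derivative (\<lambda>x. f x y) (at x) b \<partial>N))"
      by (rule bounded_linear_sum, rule bounded_linear_compose[OF bounded_linear_scaleR_left], rule bounded_linear_representation[OF B])
    ultimately show "bounded_linear (\<lambda>v. \<integral>y. frechet_derivative (\<lambda>x. f x y) (at x) v \<partial>N)"
      by (simp only:)
  next
    fix e :: real assume e: "0 < e"
    define m where "m = measure N (space N)"
    \<comment> \<open>Chosen so that \<open>e' * C * m \<le> e\<close>: the constant
      \<open>C\<close> turns a bound on basis directions into one on the operator norm, and
      \<open>m\<close> is the total mass. Adding 1 keeps the denominator positive for the zero
      measure.\<close>
    define e' where "e' = e / (C * (m + 1))"
    have m: "m \<ge> 0" by (simp add: m_def)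
    have e': "e' > 0" using e C(1) m by (simp add: e'_def)
    \<comment> \<open>Tube lemma: continuity on a product with a compact factor gives one
      neighbourhood of \<open>x\<close> that serves all \<open>y\<close>.\<close>
    have nbhd: "\<exists>X. open X \<and> x \<in> X \<and> (\<forall>z\<in>X \<inter> S. \<forall>y. norm (frechet_derivative (\<lambda>x. f x y) (at z) b - frechet_derivative (\<lambda>x. f x y) (at x) b) \<le> e')" for b
    proof -
      obtain X where "x \<in> X" "open X" "\<forall>z\<in>X \<inter> S. \<forall>y\<in>UNIV. dist ((\<lambda>(x, y). frechet_derivative (\<lambda>x. f x y) (at x) b) (z, y))
            ((\<lambda>(x, y). frechet_derivative (\<lambda>x. f x y) (at x) b) (x, y)) \<le> e'"
        by (rule continuous_on_prod_compactE[OF cont[of b] cpt x e'])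
      thus ?thesis by (intro exI[of _ X]) (simp add: dist_norm)
    qed
    then obtain X where X: "\<And>b. open (X b)" "\<And>b. x \<in> X b"
      "\<And>b z y. z \<in> X b \<Longrightarrow> z \<in> S \<Longrightarrow> norm (frechet_derivative (\<lambda>x. f x y) (at z) b - frechet_derivative (\<lambda>x. f x y) (at x) b) \<le> e'"
    proof -
      assume *: "\<And>X. (\<And>b. open (X b)) \<Longrightarrow> (\<And>b. x \<in> X b) \<Longrightarrow> (\<And>b z y. z \<in> X b \<Longrightarrow> z \<in> S \<Longrightarrow>
        norm (frechet_derivative (\<lambda>x. f x y) (at z) b - frechet_derivative (\<lambda>x. f x y) (at x) b) \<le> e') \<Longrightarrow> thesis"
      from nbhd have "\<forall>b. \<exists>X. open X \<and> x \<in> X \<and> (\<forall>z\<in>X \<inter> S. \<forall>y. norm (frechet_derivative (\<lambda>x. f x y) (at z) b - frechet_derivative (\<lambda>x. f x y) (at x) b) \<le> e')" by blast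
      from choice[OF this] show thesis using * by blast
    qed
    have "open (S \<inter> (\<Inter>b\<in>B. X b))" using S X(1) B(1) by (intro open_Int open_INT) auto
    moreover have "x \<in> S \<inter> (\<Inter>b\<in>B. X b)" using x X(2) by auto
    ultimately obtain d where d: "d > 0" "ball x d \<subseteq> S \<inter> (\<Inter>b\<in>B. X b)"
      using open_contains_ball by metis
    have "norm ((\<integral>y. f z y \<partial>N) - (\<integral>y. f x y \<partial>N) - (\<integral>y. frechet_derivative (\<lambda>x. f x y) (at x) (z - x) \<partial>N)) \<le> e * norm (z - x)"
      if z: "norm (z - x) < d" for z
    proof -
      have zS: "z \<in> S" using d z by (auto simp: subset_iff dist_norm norm_minus_commute)
      have *: "norm (f z y - f x y - frechet_derivative (\<lambda>x. f x y) (at x) (z - x)) \<le> norm (z - x) * (e' * C)" for y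
      proof (rule differentiable_bound_linearization[where S = "ball x d"])
        show "x \<in> ball x d" using d by simp
        show "((\<lambda>x. f x y) has_derivative frechet_derivative (\<lambda>x. f x y) (at w)) (at w within ball x d)" if "w \<in> ball x d" for w
        proof (rule has_derivative_at_withinI, rule has_frechet_derivative, rule diff)
          show "w \<in> S" using d that by auto
        qed
        show "x + t *\<^sub>R (z - x) \<in> ball x d" if "t \<in> {0..1}" for t
        proof -
          have "norm (t *\<^sub>R (z - x)) \<le> 1 * norm (z - x)" using that by (simp add: mult_left_le_one_le)
          thus ?thesis using z by (simp add: dist_norm)
        qed
        show "onorm (frechet_derivative (\<lambda>x. f x y) (at w) - frechet_derivative (\<lambda>x. f x y) (at x)) \<le> e' * C" if w: "w \<in> ball x d" for w
          unfolding fun_diff_def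
        proof (rule onorm_bound)
          show "0 \<le> e' * C" using e' C(1) by simp
          fix v
          have wS: "w \<in> S" using w d by auto
          have "frechet_derivative (\<lambda>x. f x y) (at w) v - frechet_derivative (\<lambda>x. f x y) (at x) v =
            (\<Sum>b\<in>B. representation B v b *\<^sub>R (frechet_derivative (\<lambda>x. f x y) (at w) b - frechet_derivative (\<lambda>x. f x y) (at x) b))"
            by (subst exp[OF wS], subst exp[OF x]) (simp add: sum_subtractf scaleR_diff_right)
          also have "norm \<dots> \<le> (\<Sum>b\<in>B. \<bar>representation B v b\<bar> * e')"
            using w d wS by (intro sum_norm_le) (auto intro!: mult_left_mono X(3))
          also have "\<dots> = e' * (\<Sum>b\<in>B. \<bar>representation B v b\<bar>)" by (simp add: sum_distrib_left mult.commute)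
          also have "\<dots> \<le> e' * (C * norm (\<Sum>b\<in>B. representation B v b *\<^sub>R b))"
            using e' C(2) by (intro mult_left_mono) auto
          finally show "norm (frechet_derivative (\<lambda>x. f x y) (at w) v - frechet_derivative (\<lambda>x. f x y) (at x) v) \<le> e' * C * norm v"
            by (simp add: basis_expansion[OF B])
        qed
      qed
      have "(\<integral>y. f z y \<partial>N) - (\<integral>y. f x y \<partial>N) - (\<integral>y. frechet_derivative (\<lambda>x. f x y) (at x) (z - x) \<partial>N) =
        (\<integral>y. f z y - f x y - frechet_derivative (\<lambda>x. f x y) (at x) (z - x) \<partial>N)"
        using int0[OF zS] int0[OF x] int1[OF x] by simp
      also have "norm \<dots> \<le> (\<integral>y. norm (f z y - f x y - frechet_derivative (\<lambda>x. f x y) (at x) (z - x)) \<partial>N)"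
        by (rule integral_norm_bound)
      also have "\<dots> \<le> (\<integral>y. norm (z - x) * (e' * C) \<partial>N)"
        using int0[OF zS] int0[OF x] int1[OF x] * by (intro integral_mono) auto
      also have "\<dots> = norm (z - x) * (e' * C * m)" by (simp add: m_def)
      also have "\<dots> \<le> norm (z - x) * e"
      proof (rule mult_left_mono)
        have "e' * C * m \<le> e' * C * (m + 1)" using e' C(1) by simp
        also have "\<dots> = e" using C(1) m by (simp add: e'_def)
        finally show "e' * C * m \<le> e" .
      qed simp
      finally show ?thesis by (simp add: mult.commute)
    qed
    thus "\<exists>d>0. \<forall>z. norm (z - x) < d \<longrightarrow> norm ((\<integral>y. f z y \<partial>N) - (\<integral>y. f x y \<partial>N) - (\<integral>y. frechet_derivative (\<lambda>x. f x y) (at x) (z - x) \<partial>N)) \<le> e * norm (z - x)"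
      using d(1) by blast
  qed
qed

lemma integral_param_smooth:
  fixes f :: "'e::real_normed_vector \<Rightarrow> 'b::topological_space \<Rightarrow> complex"
  assumes fd: "fin_dim TYPE('e)" and S: "open S" and cpt: "compact (UNIV :: 'b set)"
    and N: "finite_measure N" "sets N = sets borel" and f: "param_smooth S f"
  shows "smooth_on S (\<lambda>x. \<integral>y. f x y \<partial>N)"
    and "x \<in> S \<Longrightarrow> iter_deriv vs (\<lambda>x. \<integral>y. f x y \<partial>N) x = (\<integral>y. iter_deriv vs (\<lambda>x. f x y) x \<partial>N)"
proof -
  have der: "((\<lambda>x. \<integral>y. iter_deriv vs (\<lambda>x. f x y) x \<partial>N) has_derivative (\<lambda>v. \<integral>y. iter_deriv (v # vs) (\<lambda>x. f x y) x \<partial>N)) (at x)"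
    if "x \<in> S" for x vs
  proof -
    have "continuous_on (S \<times> UNIV) (\<lambda>(x, y). iter_deriv (v # vs) (\<lambda>x. f x y) x)" for v
      using f unfolding param_smooth_def by blast
    hence "continuous_on (S \<times> UNIV) (\<lambda>(x, y). frechet_derivative (iter_deriv vs (\<lambda>x. f x y)) (at x) v)" for v
      by simp
    thus ?thesis unfolding iter_deriv.simps
      using f that unfolding param_smooth_def by (intro has_derivative_integral_param[OF fd S cpt N]) auto
  qed
  have eq: "iter_deriv vs (\<lambda>x. \<integral>y. f x y \<partial>N) x = (\<integral>y. iter_deriv vs (\<lambda>x. f x y) x \<partial>N)" if "x \<in> S" for vs x
    using that
  proof (induction vs arbitrary: x)
    case (Cons v vs)
    have "frechet_derivative (iter_deriv vs (\<lambda>x. \<integral>y. f x y \<partial>N)) (at x) =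
       frechet_derivative (\<lambda>x. \<integral>y. iter_deriv vs (\<lambda>x. f x y) x \<partial>N) (at x)"
      by (rule frechet_derivative_cong_open(1)[OF S Cons.prems Cons.IH])
    thus ?case using frechet_derivative_eqI[OF der[OF Cons.prems]] by simp
  qed simp
  thus "x \<in> S \<Longrightarrow> iter_deriv vs (\<lambda>x. \<integral>y. f x y \<partial>N) x = (\<integral>y. iter_deriv vs (\<lambda>x. f x y) x \<partial>N)" .
  show "smooth_on S (\<lambda>x. \<integral>y. f x y \<partial>N)" unfolding smooth_on_iff
  proof (intro allI ballI)
    fix vs x assume "x \<in> S"
    have "iter_deriv vs (\<lambda>x. \<integral>y. f x y \<partial>N) differentiable (at x) \<longleftrightarrow>
       (\<lambda>x. \<integral>y. iter_deriv vs (\<lambda>x. f x y) x \<partial>N) differentiable (at x)"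
      by (rule frechet_derivative_cong_open(2)[OF S \<open>x \<in> S\<close> eq])
    thus "iter_deriv vs (\<lambda>x. \<integral>y. f x y \<partial>N) differentiable (at x)"
      using der[OF \<open>x \<in> S\<close>] by (auto simp: differentiable_def)
  qed
qed

section \<open>Manifolds\<close>

definition manifold :: "('a::topological_space, 'e::real_normed_vector) chart set \<Rightarrow> bool" where
  "manifold \<A> \<longleftrightarrow> smooth_atlas \<A> \<and> fin_dim TYPE('e)"

lemma manifold_fin_dim: "manifold (\<A> :: ('a::topological_space, 'e::real_normed_vector) chart set) \<Longrightarrow> fin_dim TYPE('e)"
  by (simp add: manifold_def)

lemma chartD:
  assumes "manifold \<A>" "(U, \<phi>) \<in> \<A>"
  shows "open U" "open (\<phi> ` U)" "inj_on \<phi> U" "continuous_on U \<phi>" "continuous_on (\<phi> ` U) (inv_into U \<phi>)"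
    "\<And>x. x \<in> U \<Longrightarrow> inv_into U \<phi> (\<phi> x) = x"
    "\<And>y. y \<in> \<phi> ` U \<Longrightarrow> inv_into U \<phi> y \<in> U"
    "\<And>y. y \<in> \<phi> ` U \<Longrightarrow> \<phi> (inv_into U \<phi> y) = y"
proof -
  have *: "open U \<and> open (\<phi> ` U) \<and> homeomorphism U (\<phi> ` U) \<phi> (inv_into U \<phi>)"
    using assms unfolding manifold_def smooth_atlas_def by blast
  thus "open U" "open (\<phi> ` U)" "inj_on \<phi> U" "continuous_on U \<phi>" "continuous_on (\<phi> ` U) (inv_into U \<phi>)"
    "\<And>x. x \<in> U \<Longrightarrow> inv_into U \<phi> (\<phi> x) = x"
    "\<And>y. y \<in> \<phi> ` U \<Longrightarrow> inv_into U \<phi> y \<in> U"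
    "\<And>y. y \<in> \<phi> ` U \<Longrightarrow> \<phi> (inv_into U \<phi> y) = y"
    by (auto simp: homeomorphism_def inv_into_into f_inv_into_f intro: inj_on_inverseI)
qed

lemma chart_transition:
  "manifold \<A> \<Longrightarrow> (U, \<phi>) \<in> \<A> \<Longrightarrow> (V, \<psi>) \<in> \<A> \<Longrightarrow> smooth_on (\<phi> ` (U \<inter> V)) (\<psi> \<circ> inv_into U \<phi>)"
  unfolding manifold_def smooth_atlas_def by blast

lemma chart_ex:
  assumes "manifold \<A>"
  obtains U \<phi> where "(U, \<phi>) \<in> \<A>" "x \<in> U"
proof -
  have "x \<in> (\<Union>(U, \<phi>)\<in>\<A>. U)" using assms unfolding manifold_def smooth_atlas_def by simp
  thus thesis using that by auto
qed

lemma continuous_on_charts: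
  assumes A: "manifold \<A>" and f: "\<And>U \<phi>. (U, \<phi>) \<in> \<A> \<Longrightarrow> continuous_on U f"
  shows "continuous_on UNIV f"
proof -
  have "continuous_on (\<Union>c\<in>\<A>. fst c) f"
    by (rule continuous_on_open_UN) (use f chartD(1)[OF A] in auto)
  moreover have "x \<in> (\<Union>c\<in>\<A>. fst c)" for x
  proof -
    obtain U \<phi> where "(U, \<phi>) \<in> \<A>" "x \<in> U" using chart_ex[OF A] by blast
    thus ?thesis by (intro UN_I[of "(U, \<phi>)"]) auto
  qed
  hence "(\<Union>c\<in>\<A>. fst c) = UNIV" by blast
  ultimately show ?thesis by simp
qed

text \<open>Smoothness of a map from a piece of a normed space into a manifold. Group operations and
  flows are handled through such local parametrisations, so that no charts on the source have to be
  carried along; \<open>smooth_map_iff\<close> translates back.\<close>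

definition msmooth :: "'d::real_normed_vector set \<Rightarrow> ('a::topological_space, 'e::real_normed_vector) chart set \<Rightarrow> ('d \<Rightarrow> 'a) \<Rightarrow> bool" where
  "msmooth S \<A> F \<longleftrightarrow> continuous_on S F \<and> (\<forall>(U, \<phi>)\<in>\<A>. smooth_on (S \<inter> F -` U) (\<lambda>x. \<phi> (F x)))"

lemma msmoothI:
  assumes "continuous_on S F" "\<And>U \<phi>. (U, \<phi>) \<in> \<A> \<Longrightarrow> smooth_on (S \<inter> F -` U) (\<lambda>x. \<phi> (F x))"
  shows "msmooth S \<A> F"
  unfolding msmooth_def using assms by blast

lemma msmooth_continuous: "msmooth S \<A> F \<Longrightarrow> continuous_on S F"
  by (simp add: msmooth_def)

lemma msmoothD: "msmooth S \<A> F \<Longrightarrow> (U, \<phi>) \<in> \<A> \<Longrightarrow> smooth_on (S \<inter> F -` U) (\<lambda>x. \<phi> (F x))"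
  unfolding msmooth_def by blast

lemma msmooth_cong:
  assumes "open S" "manifold \<A>" "\<And>x. x \<in> S \<Longrightarrow> F x = F' x" "msmooth S \<A> F"
  shows "msmooth S \<A> F'"
proof (rule msmoothI)
  show "continuous_on S F'"
    by (rule iffD1[OF continuous_on_cong[OF refl assms(3)] msmooth_continuous[OF assms(4)]])
  fix U \<phi> assume U: "(U, \<phi>) \<in> \<A>"
  have eq: "S \<inter> F' -` U = S \<inter> F -` U" using assms(3) by auto
  have "open (S \<inter> F -` U)"
    using continuous_open_preimage[OF msmooth_continuous[OF assms(4)] assms(1)] chartD(1)[OF assms(2) U] by blast
  from smooth_on_cong[OF this, of "\<lambda>x. \<phi> (F x)" "\<lambda>x. \<phi> (F' x)"]
  show "smooth_on (S \<inter> F' -` U) (\<lambda>x. \<phi> (F' x))"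
    using msmoothD[OF assms(4) U] assms(3) by (auto simp: eq)
qed

lemma msmooth_chart_inv:
  assumes "manifold \<A>" "(U, \<phi>) \<in> \<A>"
  shows "msmooth (\<phi> ` U) \<A> (inv_into U \<phi>)"
proof (rule msmoothI, rule chartD(5)[OF assms])
  fix V \<psi> assume V: "(V, \<psi>) \<in> \<A>"
  have "\<phi> ` U \<inter> inv_into U \<phi> -` V = \<phi> ` (U \<inter> V)"
    using chartD(6)[OF assms] by force
  thus "smooth_on (\<phi> ` U \<inter> inv_into U \<phi> -` V) (\<lambda>x. \<psi> (inv_into U \<phi> x))"
    using chart_transition[OF assms V] by (simp add: o_def)
qed

lemma smooth_map_iff:
  assumes "manifold \<A>"
  shows "smooth_map \<A> \<B> f \<longleftrightarrow> continuous_on UNIV f \<and> (\<forall>(U, \<phi>)\<in>\<A>. msmooth (\<phi> ` U) \<B> (\<lambda>x. f (inv_into U \<phi> x)))"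
proof -
  have eq: "\<phi> ` (U \<inter> f -` V) = \<phi> ` U \<inter> (\<lambda>x. f (inv_into U \<phi> x)) -` V" if "(U, \<phi>) \<in> \<A>" for U \<phi> V
    using chartD(6)[OF assms that] by force
  have ct: "continuous_on (\<phi> ` U) (\<lambda>x. f (inv_into U \<phi> x))" if "continuous_on UNIV f" "(U, \<phi>) \<in> \<A>" for U \<phi>
    using continuous_on_compose2[OF that(1) chartD(5)[OF assms that(2)]] by auto
  show ?thesis
    unfolding smooth_map_def msmooth_def using eq ct by (auto simp: o_def split_beta)
qed

text \<open>The chart \<open>\<phi>\<close> is only one of those against which smoothness is tested;
  the others are reached through the transition maps.\<close>

lemma smooth_on_imp_msmooth:
  assumes A: "manifold \<A>" and S: "open S" and UV: "(U, \<phi>) \<in> \<A>"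
    and F: "smooth_on S f" "\<And>x. x \<in> S \<Longrightarrow> f x \<in> \<phi> ` U"
  shows "msmooth S \<A> (\<lambda>x. inv_into U \<phi> (f x))"
proof (rule msmoothI)
  show "continuous_on S (\<lambda>x. inv_into U \<phi> (f x))"
    by (rule continuous_on_compose2[OF chartD(5)[OF A UV] smooth_on_continuous_on[OF F(1)]]) (use F(2) in auto)
  fix V \<psi> assume V: "(V, \<psi>) \<in> \<A>"
  have op: "open (\<phi> ` (U \<inter> V))"
  proof -
    have "\<phi> ` (U \<inter> V) = \<phi> ` U \<inter> inv_into U \<phi> -` V" using chartD(6)[OF A UV] by force
    thus ?thesis using continuous_open_preimage[OF chartD(5,2)[OF A UV] chartD(1)[OF A V]] by simp
  qed
  have eq: "S \<inter> (\<lambda>x. inv_into U \<phi> (f x)) -` V = S \<inter> f -` (\<phi> ` (U \<inter> V))"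
    using F(2) chartD(6)[OF A UV] by force
  have op2: "open (S \<inter> f -` (\<phi> ` (U \<inter> V)))"
    by (rule continuous_open_preimage[OF smooth_on_continuous_on[OF F(1)] S op])
  show "smooth_on (S \<inter> (\<lambda>x. inv_into U \<phi> (f x)) -` V) (\<lambda>x. \<psi> (inv_into U \<phi> (f x)))"
    unfolding eq
    using smooth_on_compose[OF manifold_fin_dim[OF A] op2 op _ smooth_on_subset[OF F(1)] chart_transition[OF A UV V]]
    by (auto simp: o_def)
qed

lemma msmooth_local:
  assumes S: "open S" and T: "\<And>x. x \<in> S \<Longrightarrow> \<exists>T. open T \<and> x \<in> T \<and> T \<subseteq> S \<and> msmooth T \<A> F" and A: "manifold \<A>"
  shows "msmooth S \<A> F"
proof (rule msmoothI)
  show "continuous_on S F"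
  proof (rule continuous_at_imp_continuous_on, rule ballI)
    fix x assume "x \<in> S"
    with T obtain T where T: "open T" "x \<in> T" "msmooth T \<A> F" by blast
    show "isCont F x" using msmooth_continuous[OF T(3)] T by (simp add: continuous_on_eq_continuous_at)
  qed
  fix U \<phi> assume U: "(U, \<phi>) \<in> \<A>"
  show "smooth_on (S \<inter> F -` U) (\<lambda>x. \<phi> (F x))"
  proof (rule smooth_on_local)
    fix x assume x: "x \<in> S \<inter> F -` U"
    with T obtain T where T: "open T" "x \<in> T" "msmooth T \<A> F" by blast
    have "open (T \<inter> F -` U)"
      by (rule continuous_open_preimage[OF msmooth_continuous[OF T(3)] T(1) chartD(1)[OF A U]])
    thus "\<exists>T. open T \<and> x \<in> T \<and> smooth_on T (\<lambda>x. \<phi> (F x))"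
      using T x msmoothD[OF T(3) U] by blast
  qed
qed

lemma msmooth_normed:
  assumes "open S" shows "msmooth S std_atlas F \<longleftrightarrow> smooth_on S F"
  unfolding msmooth_def by (auto dest: smooth_on_continuous_on)

lemma manifold_std: "fin_dim TYPE('e::real_normed_vector) \<Longrightarrow> manifold (std_atlas :: ('e, 'e) chart set)"
  unfolding manifold_def smooth_atlas_def
  by (auto simp: homeomorphism_def inv_id o_def smooth_on_id id_def)

text \<open>Near a point the inner map is written as \<open>inv_into U \<phi> (\<phi> (F x))\<close>
  with a chart around its value, which splits every chart expression of the composite into two maps
  between normed spaces.\<close>

lemma msmooth_compose:
  assumes A: "manifold \<A>" and B: "manifold \<B>" and f: "smooth_map \<A> \<B> f" and S: "open S" and F: "msmooth S \<A> F"
  shows "msmooth S \<B> (\<lambda>x. f (F x))"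
proof (rule msmooth_local[OF S _ B])
  fix x assume x: "x \<in> S"
  obtain U \<phi> where U: "(U, \<phi>) \<in> \<A>" "F x \<in> U" using chart_ex[OF A] by blast
  define T where "T = S \<inter> F -` U"
  have T: "open T" unfolding T_def
    by (rule continuous_open_preimage[OF msmooth_continuous[OF F] S chartD(1)[OF A U(1)]])
  have xT: "x \<in> T" using x U by (simp add: T_def)
  have phF: "smooth_on T (\<lambda>x. \<phi> (F x))" using msmoothD[OF F U(1)] by (simp add: T_def)
  have fi: "msmooth (\<phi> ` U) \<B> (\<lambda>x. f (inv_into U \<phi> x))"
    using f U(1) smooth_map_iff[OF A] by blast
  have "msmooth T \<B> (\<lambda>x. f (inv_into U \<phi> (\<phi> (F x))))"
  proof (rule msmoothI)
    show ct: "continuous_on T (\<lambda>x. f (inv_into U \<phi> (\<phi> (F x))))"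
      by (rule continuous_on_compose2[OF msmooth_continuous[OF fi] smooth_on_continuous_on[OF phF]])
        (auto simp: T_def)
    fix V \<psi> assume V: "(V, \<psi>) \<in> \<B>"
    show "smooth_on (T \<inter> (\<lambda>x. f (inv_into U \<phi> (\<phi> (F x)))) -` V) (\<lambda>x. \<psi> (f (inv_into U \<phi> (\<phi> (F x)))))"
    proof (rule smooth_on_compose[OF manifold_fin_dim[OF A], where f = "\<lambda>x. \<phi> (F x)"])
      show "open (T \<inter> (\<lambda>x. f (inv_into U \<phi> (\<phi> (F x)))) -` V)"
        by (rule continuous_open_preimage[OF ct T chartD(1)[OF B V]])
      show "open (\<phi> ` U \<inter> (\<lambda>x. f (inv_into U \<phi> x)) -` V)"
        by (rule continuous_open_preimage[OF msmooth_continuous[OF fi] chartD(2)[OF A U(1)] chartD(1)[OF B V]])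
      show "smooth_on (T \<inter> (\<lambda>x. f (inv_into U \<phi> (\<phi> (F x)))) -` V) (\<lambda>x. \<phi> (F x))"
        by (rule smooth_on_subset[OF phF]) auto
      show "smooth_on (\<phi> ` U \<inter> (\<lambda>x. f (inv_into U \<phi> x)) -` V) (\<lambda>y. \<psi> (f (inv_into U \<phi> y)))"
        by (rule msmoothD[OF fi V])
    qed (auto simp: T_def)
  qed
  hence "msmooth T \<B> (\<lambda>x. f (F x))"
    by (rule msmooth_cong[OF T B, rotated]) (simp add: T_def chartD(6)[OF A U(1)])
  thus "\<exists>T. open T \<and> x \<in> T \<and> T \<subseteq> S \<and> msmooth T \<B> (\<lambda>x. f (F x))"
    using T xT by (auto simp: T_def)
qed

lemma msmooth_comp_smooth:
  fixes g :: "'c::real_normed_vector \<Rightarrow> 'd::real_normed_vector"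
  assumes fd: "fin_dim TYPE('d)" and A: "manifold \<A>" and S: "open S" and T: "open T" and gT: "g ` T \<subseteq> S"
    and g: "smooth_on T g" and F: "msmooth S \<A> F"
  shows "msmooth T \<A> (\<lambda>x. F (g x))"
proof (rule msmoothI)
  show ct: "continuous_on T (\<lambda>x. F (g x))"
    by (rule continuous_on_compose2[OF msmooth_continuous[OF F] smooth_on_continuous_on[OF g] gT])
  fix V \<psi> assume V: "(V, \<psi>) \<in> \<A>"
  show "smooth_on (T \<inter> (\<lambda>x. F (g x)) -` V) (\<lambda>x. \<psi> (F (g x)))"
  proof (rule smooth_on_compose[OF fd, where f = g])
    show "open (T \<inter> (\<lambda>x. F (g x)) -` V)"
      by (rule continuous_open_preimage[OF ct T chartD(1)[OF A V]])
    show "open (S \<inter> F -` V)"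
      by (rule continuous_open_preimage[OF msmooth_continuous[OF F] S chartD(1)[OF A V]])
    show "smooth_on (T \<inter> (\<lambda>x. F (g x)) -` V) g" by (rule smooth_on_subset[OF g]) auto
    show "smooth_on (S \<inter> F -` V) (\<lambda>y. \<psi> (F y))" by (rule msmoothD[OF F V])
  qed (use gT in auto)
qed

section \<open>Products of manifolds\<close>

lemma inv_into_map_prod:
  assumes "inj_on \<phi> U" "inj_on \<psi> V" "x \<in> \<phi> ` U" "y \<in> \<psi> ` V"
  shows "inv_into (U \<times> V) (map_prod \<phi> \<psi>) (x, y) = (inv_into U \<phi> x, inv_into V \<psi> y)"
proof -
  have "inj_on (map_prod \<phi> \<psi>) (U \<times> V)" using assms by (simp add: map_prod_inj_on)
  moreover have "(x, y) = map_prod \<phi> \<psi> (inv_into U \<phi> x, inv_into V \<psi> y)"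
    using assms by (simp add: f_inv_into_f)
  moreover have "(inv_into U \<phi> x, inv_into V \<psi> y) \<in> U \<times> V" using assms by (simp add: inv_into_into)
  ultimately show ?thesis by (metis inv_into_f_f)
qed

lemma prod_atlasE:
  assumes "c \<in> prod_atlas \<A> \<B>"
  obtains U \<phi> V \<psi> where "c = (U \<times> V, map_prod \<phi> \<psi>)" "(U, \<phi>) \<in> \<A>" "(V, \<psi>) \<in> \<B>"
  using assms unfolding prod_atlas_def by blast

lemma map_prod_image: "map_prod \<phi> \<psi> ` (U \<times> V) = \<phi> ` U \<times> \<psi> ` V"
  by (auto simp: image_iff)

lemma msmooth_fst_snd:
  assumes A: "manifold \<A>" and B: "manifold \<B>" and S: "open S" and F: "msmooth S (prod_atlas \<A> \<B>) F"
  shows "msmooth S \<A> (\<lambda>x. fst (F x))" "msmooth S \<B> (\<lambda>x. snd (F x))"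
proof -
  have ct: "continuous_on S (\<lambda>x. fst (F x))" "continuous_on S (\<lambda>x. snd (F x))"
    using msmooth_continuous[OF F] by (auto intro: continuous_on_fst continuous_on_snd)
  have op: "open (S \<inter> F -` (U \<times> V))" if "(U, \<phi>) \<in> \<A>" "(V, \<psi>) \<in> \<B>" for U V \<phi> \<psi>
    by (rule continuous_open_preimage[OF msmooth_continuous[OF F] S])
      (intro open_Times chartD(1)[OF A that(1)] chartD(1)[OF B that(2)])
  have sm: "smooth_on (S \<inter> F -` (U \<times> V)) (\<lambda>x. map_prod \<phi> \<psi> (F x))"
    if "(U, \<phi>) \<in> \<A>" "(V, \<psi>) \<in> \<B>" for U V \<phi> \<psi>
    by (rule msmoothD[OF F]) (use that in \<open>auto simp: prod_atlas_def\<close>)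
  show "msmooth S \<A> (\<lambda>x. fst (F x))" unfolding msmooth_def
  proof (intro conjI ct, clarify, rule smooth_on_local)
    fix U \<phi> x assume U: "(U, \<phi>) \<in> \<A>" and x: "x \<in> S \<inter> (\<lambda>x. fst (F x)) -` U"
    obtain V \<psi> where V: "(V, \<psi>) \<in> \<B>" "snd (F x) \<in> V" using chart_ex[OF B] by blast
    have "smooth_on (S \<inter> F -` (U \<times> V)) (\<lambda>x. fst (map_prod \<phi> \<psi> (F x)))"
      by (rule smooth_on_fst[OF op[OF U V(1)] sm[OF U V(1)]])
    moreover have "x \<in> S \<inter> F -` (U \<times> V)" using x V by (auto simp: mem_Times_iff)
    ultimately show "\<exists>T. open T \<and> x \<in> T \<and> smooth_on T (\<lambda>x. \<phi> (fst (F x)))"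
      using op[OF U V(1)] by auto
  qed
  show "msmooth S \<B> (\<lambda>x. snd (F x))" unfolding msmooth_def
  proof (intro conjI ct, clarify, rule smooth_on_local)
    fix V \<psi> x assume V: "(V, \<psi>) \<in> \<B>" and x: "x \<in> S \<inter> (\<lambda>x. snd (F x)) -` V"
    obtain U \<phi> where U: "(U, \<phi>) \<in> \<A>" "fst (F x) \<in> U" using chart_ex[OF A] by blast
    have "smooth_on (S \<inter> F -` (U \<times> V)) (\<lambda>x. snd (map_prod \<phi> \<psi> (F x)))"
      by (rule smooth_on_snd[OF op[OF U(1) V] sm[OF U(1) V]])
    moreover have "x \<in> S \<inter> F -` (U \<times> V)" using x U by (auto simp: mem_Times_iff)
    ultimately show "\<exists>T. open T \<and> x \<in> T \<and> smooth_on T (\<lambda>x. \<psi> (snd (F x)))"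
      using op[OF U(1) V] by auto
  qed
qed

lemma msmooth_Pair:
  assumes A: "manifold \<A>" and B: "manifold \<B>" and S: "open S" and F: "msmooth S \<A> F" and F': "msmooth S \<B> F'"
  shows "msmooth S (prod_atlas \<A> \<B>) (\<lambda>x. (F x, F' x))"
  unfolding msmooth_def
proof (intro conjI ballI)
  show "continuous_on S (\<lambda>x. (F x, F' x))"
    by (intro continuous_on_Pair msmooth_continuous[OF F] msmooth_continuous[OF F'])
  fix c assume "c \<in> prod_atlas \<A> \<B>"
  then obtain U \<phi> V \<psi> where c: "c = (U \<times> V, map_prod \<phi> \<psi>)" and U: "(U, \<phi>) \<in> \<A>" and V: "(V, \<psi>) \<in> \<B>"
    by (rule prod_atlasE)
  have eq: "S \<inter> (\<lambda>x. (F x, F' x)) -` (U \<times> V) = (S \<inter> F -` U) \<inter> (S \<inter> F' -` V)" by auto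
  have op: "open ((S \<inter> F -` U) \<inter> (S \<inter> F' -` V))"
    using continuous_open_preimage[OF msmooth_continuous[OF F] S chartD(1)[OF A U]]
      continuous_open_preimage[OF msmooth_continuous[OF F'] S chartD(1)[OF B V]] by (rule open_Int)
  have "smooth_on ((S \<inter> F -` U) \<inter> (S \<inter> F' -` V)) (\<lambda>x. (\<phi> (F x), \<psi> (F' x)))"
    by (rule smooth_on_Pair[OF op smooth_on_subset[OF msmoothD[OF F U]] smooth_on_subset[OF msmoothD[OF F' V]]]) auto
  thus "case c of (U, \<phi>) \<Rightarrow> smooth_on (S \<inter> (\<lambda>x. (F x, F' x)) -` U) (\<lambda>x. \<phi> (F x, F' x))"
    by (simp add: c eq)
qed

lemma msmooth_prod_chart_inv:
  assumes A: "manifold \<A>" and B: "manifold \<B>" and U: "(U, \<phi>) \<in> \<A>" and V: "(V, \<psi>) \<in> \<B>"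
  shows "msmooth (\<phi> ` U \<times> \<psi> ` V) (prod_atlas \<A> \<B>) (\<lambda>z. (inv_into U \<phi> (fst z), inv_into V \<psi> (snd z)))"
proof -
  have op: "open (\<phi> ` U \<times> \<psi> ` V)" by (intro open_Times chartD(2)[OF A U] chartD(2)[OF B V])
  show ?thesis
    by (rule msmooth_Pair[OF A B op]; rule smooth_on_imp_msmooth[OF A op U] smooth_on_imp_msmooth[OF B op V])
      (auto intro: smooth_on_fst[OF op] smooth_on_snd[OF op] smooth_on_id)
qed

lemma manifold_prod:
  assumes A: "manifold \<A>" and B: "manifold \<B>"
  shows "manifold (prod_atlas \<A> \<B>)"
  unfolding manifold_def smooth_atlas_def
proof (intro conjI)
  show "fin_dim TYPE('b \<times> 'd)"
    by (rule fin_dim_prod[OF manifold_fin_dim[OF A] manifold_fin_dim[OF B]])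
  show "(\<Union>(U, \<phi>)\<in>prod_atlas \<A> \<B>. U) = UNIV"
  proof (rule UNIV_eq_I[symmetric])
    fix z :: "'a \<times> 'c"
    obtain U \<phi> where U: "(U, \<phi>) \<in> \<A>" "fst z \<in> U" using chart_ex[OF A] by blast
    obtain V \<psi> where V: "(V, \<psi>) \<in> \<B>" "snd z \<in> V" using chart_ex[OF B] by blast
    show "z \<in> (\<Union>(U, \<phi>)\<in>prod_atlas \<A> \<B>. U)"
      by (rule UN_I[of "(U \<times> V, map_prod \<phi> \<psi>)"]) (use U V in \<open>auto simp: prod_atlas_def mem_Times_iff\<close>)
  qed
  have inv: "inv_into (U \<times> V) (map_prod \<phi> \<psi>) z = (inv_into U \<phi> (fst z), inv_into V \<psi> (snd z))"
    if "(U, \<phi>) \<in> \<A>" "(V, \<psi>) \<in> \<B>" "z \<in> \<phi> ` U \<times> \<psi> ` V" for U \<phi> V \<psi> z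
    using inv_into_map_prod[OF chartD(3)[OF A that(1)] chartD(3)[OF B that(2)], of "fst z" "snd z"] that(3)
    by (auto simp: mem_Times_iff)
  show "\<forall>(U, \<phi>)\<in>prod_atlas \<A> \<B>. open U \<and> open (\<phi> ` U) \<and> homeomorphism U (\<phi> ` U) \<phi> (inv_into U \<phi>)"
  proof
    fix c assume "c \<in> prod_atlas \<A> \<B>"
    then obtain U \<phi> V \<psi> where c: "c = (U \<times> V, map_prod \<phi> \<psi>)" and U: "(U, \<phi>) \<in> \<A>" and V: "(V, \<psi>) \<in> \<B>"
      by (rule prod_atlasE)
    have "homeomorphism (U \<times> V) (\<phi> ` U \<times> \<psi> ` V) (map_prod \<phi> \<psi>) (inv_into (U \<times> V) (map_prod \<phi> \<psi>))"
      unfolding homeomorphism_def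
    proof (intro conjI ballI)
      show "continuous_on (U \<times> V) (map_prod \<phi> \<psi>)"
        unfolding map_prod_def split_beta
        by (intro continuous_on_Pair continuous_on_compose2[OF chartD(4)[OF A U] continuous_on_fst[OF continuous_on_id]]
            continuous_on_compose2[OF chartD(4)[OF B V] continuous_on_snd[OF continuous_on_id]]) auto
      have ct: "continuous_on (\<phi> ` U \<times> \<psi> ` V) (\<lambda>z. (inv_into U \<phi> (fst z), inv_into V \<psi> (snd z)))"
        by (intro continuous_on_Pair continuous_on_compose2[OF chartD(5)[OF A U] continuous_on_fst[OF continuous_on_id]]
            continuous_on_compose2[OF chartD(5)[OF B V] continuous_on_snd[OF continuous_on_id]]) auto
      have "continuous_on (\<phi> ` U \<times> \<psi> ` V) (inv_into (U \<times> V) (map_prod \<phi> \<psi>)) \<longleftrightarrow>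
         continuous_on (\<phi> ` U \<times> \<psi> ` V) (\<lambda>z. (inv_into U \<phi> (fst z), inv_into V \<psi> (snd z)))"
        by (intro continuous_on_cong refl inv[OF U V])
      with ct show "continuous_on (\<phi> ` U \<times> \<psi> ` V) (inv_into (U \<times> V) (map_prod \<phi> \<psi>))" by simp
      show "map_prod \<phi> \<psi> ` (U \<times> V) = \<phi> ` U \<times> \<psi> ` V" by (rule map_prod_image)
      have inj: "inj_on (map_prod \<phi> \<psi>) (U \<times> V)"
        by (rule map_prod_inj_on[OF chartD(3)[OF A U] chartD(3)[OF B V]])
      show "inv_into (U \<times> V) (map_prod \<phi> \<psi>) ` (\<phi> ` U \<times> \<psi> ` V) = U \<times> V"
        unfolding map_prod_image[symmetric] using inv_into_image_cancel[OF inj order.refl] by simp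
      show "inv_into (U \<times> V) (map_prod \<phi> \<psi>) (map_prod \<phi> \<psi> x) = x" if "x \<in> U \<times> V" for x
        by (rule inv_into_f_f[OF inj that])
      show "map_prod \<phi> \<psi> (inv_into (U \<times> V) (map_prod \<phi> \<psi>) y) = y" if "y \<in> \<phi> ` U \<times> \<psi> ` V" for y
        by (rule f_inv_into_f) (use that map_prod_image in blast)
    qed
    thus "case c of (U, \<phi>) \<Rightarrow> open U \<and> open (\<phi> ` U) \<and> homeomorphism U (\<phi> ` U) \<phi> (inv_into U \<phi>)"
      using chartD(1,2)[OF A U] chartD(1,2)[OF B V] by (simp add: c map_prod_image open_Times)
  qed
  show "\<forall>(U, \<phi>)\<in>prod_atlas \<A> \<B>. \<forall>(V, \<psi>)\<in>prod_atlas \<A> \<B>. smooth_on (\<phi> ` (U \<inter> V)) (\<psi> \<circ> inv_into U \<phi>)"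
  proof -
    have "smooth_on (map_prod \<phi> \<psi> ` (U \<times> V \<inter> W)) (\<kappa> \<circ> inv_into (U \<times> V) (map_prod \<phi> \<psi>))"
      if U: "(U, \<phi>) \<in> \<A>" and V: "(V, \<psi>) \<in> \<B>" and d': "(W, \<kappa>) \<in> prod_atlas \<A> \<B>" for U \<phi> V \<psi> W \<kappa>
    proof -
    let ?F = "\<lambda>z. (inv_into U \<phi> (fst z), inv_into V \<psi> (snd z))"
    have sub: "map_prod \<phi> \<psi> ` (U \<times> V \<inter> W) = (\<phi> ` U \<times> \<psi> ` V) \<inter> ?F -` W"
      using chartD(6)[OF A U] chartD(6)[OF B V] by (force simp: image_iff)
    have F: "msmooth (\<phi> ` U \<times> \<psi> ` V) (prod_atlas \<A> \<B>) ?F"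
      by (rule msmooth_prod_chart_inv[OF A B U V])
    have opW: "open W" 
      using d' unfolding prod_atlas_def by (auto intro!: open_Times chartD(1)[OF A] chartD(1)[OF B])
    have op: "open ((\<phi> ` U \<times> \<psi> ` V) \<inter> ?F -` W)"
      by (rule continuous_open_preimage[OF msmooth_continuous[OF F] _ opW])
        (intro open_Times chartD(2)[OF A U] chartD(2)[OF B V])
    have "smooth_on ((\<phi> ` U \<times> \<psi> ` V) \<inter> ?F -` W) (\<lambda>z. \<kappa> (?F z))"
      by (rule msmoothD[OF F]) (rule d')
    hence "smooth_on ((\<phi> ` U \<times> \<psi> ` V) \<inter> ?F -` W) (\<kappa> \<circ> inv_into (U \<times> V) (map_prod \<phi> \<psi>))"
      by (subst smooth_on_cong[OF op, of _ "\<lambda>z. \<kappa> (?F z)"]) (simp_all add: inv[OF U V])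
    thus ?thesis by (simp only: sub)
    qed
    note * = this
    show ?thesis
    proof (intro ballI)
      fix c assume "c \<in> prod_atlas \<A> \<B>"
      then obtain U \<phi> V \<psi> where c: "c = (U \<times> V, map_prod \<phi> \<psi>)" and U: "(U, \<phi>) \<in> \<A>" and V: "(V, \<psi>) \<in> \<B>"
        by (rule prod_atlasE)
      show "case c of (U, \<phi>) \<Rightarrow> \<forall>(V, \<psi>)\<in>prod_atlas \<A> \<B>. smooth_on (\<phi> ` (U \<inter> V)) (\<psi> \<circ> inv_into U \<phi>)"
        unfolding c prod.case using *[OF U V] by blast
    qed
  qed
qed

lemma continuous_on_chartsI:
  assumes A: "manifold \<A>" and f: "\<And>U \<phi>. (U, \<phi>) \<in> \<A> \<Longrightarrow> continuous_on (\<phi> ` U) (\<lambda>x. f (inv_into U \<phi> x))"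
  shows "continuous_on UNIV f"
proof (rule continuous_on_charts[OF A])
  fix U \<phi> assume U: "(U, \<phi>) \<in> \<A>"
  have "continuous_on U (\<lambda>x. f (inv_into U \<phi> (\<phi> x)))"
    by (rule continuous_on_compose2[OF f[OF U] chartD(4)[OF A U]]) auto
  thus "continuous_on U f" by (subst (asm) continuous_on_cong[OF refl, of _ _ f]) (simp_all add: chartD(6)[OF A U])
qed

lemma smooth_mapI_prod:
  assumes A: "manifold \<A>" and B: "manifold \<B>" and C: "manifold \<C>"
    and f: "\<And>U \<phi> V \<psi>. (U, \<phi>) \<in> \<A> \<Longrightarrow> (V, \<psi>) \<in> \<B> \<Longrightarrow>
      msmooth (\<phi> ` U \<times> \<psi> ` V) \<C> (\<lambda>z. f (inv_into U \<phi> (fst z), inv_into V \<psi> (snd z)))"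
  shows "smooth_map (prod_atlas \<A> \<B>) \<C> f"
proof -
  have *: "msmooth (\<kappa> ` W) \<C> (\<lambda>z. f (inv_into W \<kappa> z))" if "(W, \<kappa>) \<in> prod_atlas \<A> \<B>" for W \<kappa>
  proof -
    obtain U \<phi> V \<psi> where c: "(W, \<kappa>) = (U \<times> V, map_prod \<phi> \<psi>)" and U: "(U, \<phi>) \<in> \<A>" and V: "(V, \<psi>) \<in> \<B>"
      using \<open>(W, \<kappa>) \<in> _\<close> by (rule prod_atlasE)
    have op: "open (\<phi> ` U \<times> \<psi> ` V)" by (intro open_Times chartD(2)[OF A U] chartD(2)[OF B V])
    have "msmooth (\<phi> ` U \<times> \<psi> ` V) \<C> (\<lambda>z. f (inv_into (U \<times> V) (map_prod \<phi> \<psi>) z))"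
      by (rule msmooth_cong[OF op C _ f[OF U V]])
        (use inv_into_map_prod[OF chartD(3)[OF A U] chartD(3)[OF B V]] in force)
    thus ?thesis using c by (simp add: map_prod_image)
  qed
  note AB = manifold_prod[OF A B]
  have "continuous_on UNIV f" by (rule continuous_on_chartsI[OF AB msmooth_continuous[OF *]])
  thus ?thesis using smooth_map_iff[OF AB] * by blast
qed

lemma msmooth_const: "msmooth S \<A> (\<lambda>_. p)"
  by (auto simp: msmooth_def)

section \<open>Smooth functions\<close>

text \<open>Continuity, a separate clause of \<open>smooth_map\<close>, follows from the chart
  expressions because charts are homeomorphisms with open domains.\<close>

lemma C_inf_iff:
  assumes "manifold (atlas H)"
  shows "f \<in> C_inf H \<longleftrightarrow> (\<forall>(U, \<phi>)\<in>atlas H. smooth_on (\<phi> ` U) (\<lambda>x. f (inv_into U \<phi> x)))" (is "_ \<longleftrightarrow> ?R")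
proof -
  have eq: "msmooth (\<phi> ` U) std_atlas (\<lambda>x. f (inv_into U \<phi> x)) \<longleftrightarrow> smooth_on (\<phi> ` U) (\<lambda>x. f (inv_into U \<phi> x))"
    if "(U, \<phi>) \<in> atlas H" for U \<phi>
    by (rule msmooth_normed[OF chartD(2)[OF assms that]])
  show ?thesis unfolding C_inf_def mem_Collect_eq smooth_map_iff[OF assms]
  proof (intro iffI conjI)
    assume "?R"
    hence R: "smooth_on (\<phi> ` U) (\<lambda>x. f (inv_into U \<phi> x))" if "(U, \<phi>) \<in> atlas H" for U \<phi>
      using that by blast
    show "continuous_on UNIV f"
      by (rule continuous_on_chartsI[OF assms smooth_on_continuous_on[OF R]])
    show "\<forall>(U, \<phi>)\<in>atlas H. msmooth (\<phi> ` U) std_atlas (\<lambda>x. f (inv_into U \<phi> x))"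
      by (clarify, rule iffD2[OF eq R])
  next
    assume "continuous_on UNIV f \<and> (\<forall>(U, \<phi>)\<in>atlas H. msmooth (\<phi> ` U) std_atlas (\<lambda>x. f (inv_into U \<phi> x)))"
    hence "msmooth (\<phi> ` U) std_atlas (\<lambda>x. f (inv_into U \<phi> x))" if "(U, \<phi>) \<in> atlas H" for U \<phi>
      using that by blast
    from iffD1[OF eq this] show ?R by blast
  qed
qed

lemma C_inf_continuous: "f \<in> C_inf H \<Longrightarrow> continuous_on UNIV f"
  by (simp add: C_inf_def smooth_map_def)

lemma fin_dim_complex: "fin_dim TYPE(complex)"
proof -
  have "x \<in> span {1, \<i>}" for x
  proof -
    have "1 \<in> span {1, \<i>}" "\<i> \<in> span {1, \<i>}"
      by (rule real_vector.span_base, simp)+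
    from real_vector.span_add[OF real_vector.span_scale[OF this(1), of "Re x"] real_vector.span_scale[OF this(2), of "Im x"]]
    have "Re x *\<^sub>R 1 + Im x *\<^sub>R \<i> \<in> span {1, \<i>}" .
    moreover have "Re x *\<^sub>R 1 + Im x *\<^sub>R \<i> = x" by (simp add: complex_eq_iff)
    ultimately show ?thesis by simp
  qed
  hence "span {1, \<i>} = UNIV" by blast
  thus ?thesis unfolding fin_dim_def by (intro exI[of _ "{1, \<i>}"]) simp
qed

lemma C_inf_compose:
  assumes "manifold (atlas H)" "f \<in> C_inf H" "open S" "msmooth S (atlas H) F"
  shows "smooth_on S (\<lambda>x. f (F x))"
  using msmooth_compose[OF assms(1) manifold_std[OF fin_dim_complex] _ assms(3,4), of f] assms(2)
  unfolding C_inf_def using msmooth_normed[OF assms(3)] by auto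

lemma C_inf_smooth_map:
  assumes G: "manifold (atlas G)" and H: "manifold (atlas H)" and f: "f \<in> C_inf H" and F: "smooth_map (atlas G) (atlas H) F"
  shows "(\<lambda>x. f (F x)) \<in> C_inf G"
  unfolding C_inf_iff[OF G]
proof (clarify)
  fix U \<phi> assume U: "(U, \<phi>) \<in> atlas G"
  show "smooth_on (\<phi> ` U) (\<lambda>x. f (F (inv_into U \<phi> x)))"
    by (rule C_inf_compose[OF H f chartD(2)[OF G U]]) (use F U smooth_map_iff[OF G, of "atlas H" F] in auto)
qed

lemma C_inf_const: "manifold (atlas H) \<Longrightarrow> (\<lambda>_. c) \<in> C_inf H"
  by (auto simp: C_inf_iff)

lemma C_inf_add: "manifold (atlas H) \<Longrightarrow> f \<in> C_inf H \<Longrightarrow> g \<in> C_inf H \<Longrightarrow> (\<lambda>x. f x + g x) \<in> C_inf H"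
  unfolding C_inf_iff by (auto intro!: smooth_on_add chartD(2))

lemma C_inf_mult: "manifold (atlas H) \<Longrightarrow> f \<in> C_inf H \<Longrightarrow> g \<in> C_inf H \<Longrightarrow> (\<lambda>x. f x * g x) \<in> C_inf H"
  unfolding C_inf_iff by (auto intro!: smooth_on_mult chartD(2))

lemma C_inf_cmult: "manifold (atlas H) \<Longrightarrow> f \<in> C_inf H \<Longrightarrow> (\<lambda>x. c * f x) \<in> C_inf H"
  by (intro C_inf_mult C_inf_const)

lemma C_inf_diff:
  assumes "manifold (atlas H)" "f \<in> C_inf H" "g \<in> C_inf H"
  shows "(\<lambda>x. f x - g x) \<in> C_inf H"
  using C_inf_add[OF assms(1,2) C_inf_cmult[OF assms(1,3), of "-1"]] by simp

lemma C_inf_sum: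
  "manifold (atlas H) \<Longrightarrow> (\<And>i. i \<in> I \<Longrightarrow> f i \<in> C_inf H) \<Longrightarrow> (\<lambda>x. \<Sum>i\<in>I. f i x) \<in> C_inf H"
  by (induction I rule: infinite_finite_induct) (auto intro!: C_inf_const C_inf_add)

lemma C_inf_cnj: "manifold (atlas H) \<Longrightarrow> f \<in> C_inf H \<Longrightarrow> (\<lambda>x. cnj (f x)) \<in> C_inf H"
  unfolding C_inf_iff by (auto intro!: smooth_on_bounded_linear[OF bounded_linear_cnj] chartD(2))

text \<open>The exponential reproduces itself under differentiation, so the induction closes with
  the product rule.\<close>

lemma Ck_on_exp:
  fixes f :: "'e::real_normed_vector \<Rightarrow> complex"
  assumes S: "open S" and f: "Ck_on k S f"
  shows "Ck_on k S (\<lambda>x. exp (f x))"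
  using f
proof (induction k)
  case 0 thus ?case by (auto intro: continuous_on_exp)
next
  case (Suc k)
  show ?case
  proof (rule Ck_on_SucI[OF S])
    fix x assume "x \<in> S"
    have "((exp :: complex \<Rightarrow> complex) has_derivative (*) (exp (f x))) (at (f x))"
      using DERIV_exp has_field_derivative_def by blast
    from has_derivative_compose[OF Ck_on_SucD(1)[OF Suc.prems \<open>x \<in> S\<close>] this]
    show "((\<lambda>x. exp (f x)) has_derivative (\<lambda>v. exp (f x) * frechet_derivative f (at x) v)) (at x)" .
  next
    fix v show "Ck_on k S (\<lambda>x. exp (f x) * frechet_derivative f (at x) v)"
      by (intro Ck_on_bounded_bilinear[OF bounded_bilinear_mult S] Suc.IH[OF Ck_on_SucD(3)[OF Suc.prems]] Ck_on_SucD(2)[OF Suc.prems])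
  qed
qed

lemma C_inf_exp: "manifold (atlas H) \<Longrightarrow> f \<in> C_inf H \<Longrightarrow> (\<lambda>x. exp (f x)) \<in> C_inf H"
  unfolding C_inf_iff smooth_on_def by (auto intro!: Ck_on_exp chartD(2))

section \<open>Seminorms and distributions\<close>

lemma iter_deriv_add:
  assumes S: "open S" and f: "smooth_on S f" and g: "smooth_on S g" and x: "x \<in> S"
  shows "iter_deriv vs (\<lambda>x. f x + g x) x = iter_deriv vs f x + iter_deriv vs g x"
  using x
proof (induction vs arbitrary: x)
  case (Cons v vs)
  have "frechet_derivative (iter_deriv vs (\<lambda>x. f x + g x)) (at x) =
     frechet_derivative (\<lambda>x. iter_deriv vs f x + iter_deriv vs g x) (at x)"
    by (rule frechet_derivative_cong_open(1)[OF S Cons.prems Cons.IH])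
  moreover have "iter_deriv vs f differentiable (at x)" "iter_deriv vs g differentiable (at x)"
    using f g Cons.prems by (auto simp: smooth_on_iff)
  from frechet_derivative_eqI[OF has_derivative_add[OF this[THEN has_frechet_derivative]]]
  have "frechet_derivative (\<lambda>x. iter_deriv vs f x + iter_deriv vs g x) (at x) v =
     frechet_derivative (iter_deriv vs f) (at x) v + frechet_derivative (iter_deriv vs g) (at x) v" .
  ultimately show ?case by simp
qed simp

lemma iter_deriv_zero: "iter_deriv vs (\<lambda>_. 0) = (\<lambda>_. 0)"
  by (induction vs) auto

lemma iter_deriv_bounded_linear:
  assumes L: "bounded_linear L" and S: "open S" and f: "smooth_on S f" and x: "x \<in> S"
  shows "iter_deriv vs (\<lambda>x. L (f x)) x = L (iter_deriv vs f x)"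
  using x
proof (induction vs arbitrary: x)
  case (Cons v vs)
  have "frechet_derivative (iter_deriv vs (\<lambda>x. L (f x))) (at x) =
     frechet_derivative (\<lambda>x. L (iter_deriv vs f x)) (at x)"
    by (rule frechet_derivative_cong_open(1)[OF S Cons.prems Cons.IH])
  moreover have "iter_deriv vs f differentiable (at x)"
    using f Cons.prems by (auto simp: smooth_on_iff)
  from frechet_derivative_eqI[OF bounded_linear.has_derivative[OF L this[THEN has_frechet_derivative]]]
  have "frechet_derivative (\<lambda>x. L (iter_deriv vs f x)) (at x) v = L (frechet_derivative (iter_deriv vs f) (at x) v)" .
  ultimately show ?case by simp
qed simp

lemma iter_deriv_cmult:
  fixes f :: "'e::real_normed_vector \<Rightarrow> complex"
  assumes "open S" "smooth_on S f" "x \<in> S"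
  shows "iter_deriv vs (\<lambda>x. c * f x) x = c * iter_deriv vs f x"
  by (rule iter_deriv_bounded_linear[OF bounded_linear_mult_right assms])

section \<open>Bounds by finite families of seminorms\<close>

type_synonym ('a, 'e) seminorm_index = "('a, 'e) chart \<times> 'e set \<times> 'e list"

definition admissible :: "('a::topological_space, 'e::real_normed_vector) chart set \<Rightarrow> ('a, 'e) seminorm_index set \<Rightarrow> bool" where
  "admissible \<A> I \<longleftrightarrow> finite I \<and> (\<forall>(c, K, vs)\<in>I. c \<in> \<A> \<and> compact K \<and> K \<subseteq> snd c ` fst c)"

text \<open>A common bound instead of suprema over the sets \<open>K\<close>, so that no value has
  to be assigned to the supremum of an empty or unbounded set.\<close>

definition seminorms_le :: "('a, 'e::real_normed_vector) seminorm_index set \<Rightarrow> real \<Rightarrow> ('a \<Rightarrow> complex) \<Rightarrow> bool" where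
  "seminorms_le I B f \<longleftrightarrow> (\<forall>(c, K, vs)\<in>I. \<forall>y\<in>K. norm (iter_deriv vs (f \<circ> inv_into (fst c) (snd c)) y) \<le> B)"

lemma admissible_Un: "admissible \<A> I \<Longrightarrow> admissible \<A> J \<Longrightarrow> admissible \<A> (I \<union> J)"
  unfolding admissible_def by blast

lemma admissible_UN: "finite X \<Longrightarrow> (\<And>x. x \<in> X \<Longrightarrow> admissible \<A> (I x)) \<Longrightarrow> admissible \<A> (\<Union>x\<in>X. I x)"
  unfolding admissible_def by blast

lemma admissible_empty: "admissible \<A> {}"
  by (simp add: admissible_def)

lemma seminorms_le_mono: "seminorms_le I B f \<Longrightarrow> J \<subseteq> I \<Longrightarrow> B \<le> C \<Longrightarrow> seminorms_le J C f"
  unfolding seminorms_le_def by fastforce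

lemma seminorms_leD:
  "seminorms_le I B f \<Longrightarrow> ((U, \<phi>), K, vs) \<in> I \<Longrightarrow> y \<in> K \<Longrightarrow> norm (iter_deriv vs (\<lambda>x. f (inv_into U \<phi> x)) y) \<le> B"
  unfolding seminorms_le_def by (auto simp: o_def)

lemma C_inf_chart:
  "manifold (atlas H) \<Longrightarrow> f \<in> C_inf H \<Longrightarrow> (U, \<phi>) \<in> atlas H \<Longrightarrow> smooth_on (\<phi> ` U) (\<lambda>x. f (inv_into U \<phi> x))"
  using C_inf_iff by blast

lemma seminorms_le_iff:
  "seminorms_le I B f \<longleftrightarrow> (\<forall>U \<phi> K vs y. ((U, \<phi>), K, vs) \<in> I \<longrightarrow> y \<in> K \<longrightarrow> norm (iter_deriv vs (\<lambda>x. f (inv_into U \<phi> x)) y) \<le> B)"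
  unfolding seminorms_le_def by (force simp: o_def)

lemma admissibleD:
  assumes "admissible \<A> I" "((U, \<phi>), K, vs) \<in> I"
  shows "(U, \<phi>) \<in> \<A>" "compact K" "K \<subseteq> \<phi> ` U" "y \<in> K \<Longrightarrow> y \<in> \<phi> ` U"
  using assms unfolding admissible_def by fastforce+

lemma seminorms_le_cmult:
  assumes H: "manifold (atlas H)" and I: "admissible (atlas H) I" and f: "f \<in> C_inf H" and le: "seminorms_le I B f"
  shows "seminorms_le I (norm c * B) (\<lambda>x. c * f x)"
  unfolding seminorms_le_iff
proof (intro allI impI)
  fix U \<phi> K vs y assume i: "((U, \<phi>), K, vs) \<in> I" and y: "y \<in> K"
  note U = admissibleD[OF I i]
  have "iter_deriv vs (\<lambda>x. c * f (inv_into U \<phi> x)) y = c * iter_deriv vs (\<lambda>x. f (inv_into U \<phi> x)) y"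
    by (rule iter_deriv_cmult[OF chartD(2)[OF H U(1)] C_inf_chart[OF H f U(1)] U(4)[OF y]])
  thus "norm (iter_deriv vs (\<lambda>x. c * f (inv_into U \<phi> x)) y) \<le> norm c * B"
    using seminorms_leD[OF le i y] by (simp add: norm_mult mult_left_mono)
qed

lemma openin_C_inf_ball:
  assumes "c \<in> atlas H" "compact K" "K \<subseteq> snd c ` fst c" "\<epsilon> > 0" "f \<in> C_inf H"
  shows "openin (C_inf_topology H) (C_inf_ball H c K vs \<epsilon> f)"
  unfolding C_inf_topology_def openin_topology_generated_by_iff
  by (rule generate_topology_on.Basis, rule CollectI, intro exI conjI, rule refl) (rule assms)+

lemma topspace_C_inf_topology:
  assumes H: "manifold (atlas H)"
  shows "topspace (C_inf_topology H) = C_inf H"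
proof
  obtain U \<phi> where U: "(U, \<phi>) \<in> atlas H" using chart_ex[OF H] by blast
  show "C_inf H \<subseteq> topspace (C_inf_topology H)"
  proof
    fix f assume f: "f \<in> C_inf H"
    \<comment> \<open>Over the empty compact set the condition of the ball is vacuous, so this basic
      open set is all of \<open>C_inf H\<close>.\<close>
    have "openin (C_inf_topology H) (C_inf_ball H (U, \<phi>) {} [] 1 f)"
      by (rule openin_C_inf_ball[OF U]) (simp_all add: f)
    moreover have "f \<in> C_inf_ball H (U, \<phi>) {} [] 1 f" using f by (simp add: C_inf_ball_def)
    ultimately show "f \<in> topspace (C_inf_topology H)" using openin_subset by blast
  qed
  show "topspace (C_inf_topology H) \<subseteq> C_inf H"
    unfolding C_inf_topology_def topology_generated_by_topspace by (auto simp: C_inf_ball_def)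
qed

text \<open>A basic ball need not be centred at \<open>g\<close>. On the compact set
  \<open>K\<close> the norm in its condition has a bound \<open>m < \<epsilon>\<close>, which leaves
  the margin \<open>\<epsilon> - m\<close> for a neighbourhood around \<open>g\<close>; half of it
  is used.\<close>

lemma openin_C_inf_topology_nbhd:
  assumes H: "manifold (atlas H)" and O: "openin (C_inf_topology H) W" and g: "g \<in> W"
  shows "\<exists>I \<epsilon>. admissible (atlas H) I \<and> \<epsilon> > 0 \<and> (\<forall>h\<in>C_inf H. seminorms_le I \<epsilon> (\<lambda>x. h x - g x) \<longrightarrow> h \<in> W)"
proof -
  have "generate_topology_on {C_inf_ball H c K vs \<epsilon> f |c K vs \<epsilon> f.
          c \<in> atlas H \<and> compact K \<and> K \<subseteq> snd c ` fst c \<and> \<epsilon> > 0 \<and> f \<in> C_inf H} W"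
    using O unfolding C_inf_topology_def by (simp add: openin_topology_generated_by_iff)
  thus ?thesis using g
  proof (induction rule: generate_topology_on.induct)
    case Empty thus ?case by simp
  next
    case (Int a b)
    obtain I \<epsilon> where I: "admissible (atlas H) I" "\<epsilon> > 0" "\<And>h. h \<in> C_inf H \<Longrightarrow> seminorms_le I \<epsilon> (\<lambda>x. h x - g x) \<Longrightarrow> h \<in> a"
      using Int by blast
    obtain J \<delta> where J: "admissible (atlas H) J" "\<delta> > 0" "\<And>h. h \<in> C_inf H \<Longrightarrow> seminorms_le J \<delta> (\<lambda>x. h x - g x) \<Longrightarrow> h \<in> b"
      using Int by blast
    show ?case
    proof (intro exI[of _ "I \<union> J"] exI[of _ "min \<epsilon> \<delta>"] conjI ballI impI)
      fix h assume h: "h \<in> C_inf H" "seminorms_le (I \<union> J) (min \<epsilon> \<delta>) (\<lambda>x. h x - g x)"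
      from h(2) have "seminorms_le I \<epsilon> (\<lambda>x. h x - g x)" "seminorms_le J \<delta> (\<lambda>x. h x - g x)"
        by (auto elim: seminorms_le_mono)
      thus "h \<in> a \<inter> b" using I(3) J(3) h(1) by blast
    qed (use I J admissible_Un in auto)
  next
    case (UN K)
    then obtain k where k: "k \<in> K" "g \<in> k" by blast
    from UN.IH[OF this] obtain I \<epsilon> where "admissible (atlas H) I" "\<epsilon> > 0"
      "\<And>h. h \<in> C_inf H \<Longrightarrow> seminorms_le I \<epsilon> (\<lambda>x. h x - g x) \<Longrightarrow> h \<in> k" by blast
    thus ?case using k(1) by (intro exI[of _ I] exI[of _ \<epsilon>]) blast
  next
    case (Basis s)
    then obtain U \<phi> K vs \<epsilon> f where s: "s = C_inf_ball H (U, \<phi>) K vs \<epsilon> f" and U: "(U, \<phi>) \<in> atlas H"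
      and K: "compact K" "K \<subseteq> \<phi> ` U" and \<epsilon>: "\<epsilon> > 0" and f: "f \<in> C_inf H" by auto
    have g: "g \<in> C_inf H" "\<And>y. y \<in> K \<Longrightarrow> norm (iter_deriv vs (\<lambda>x. g (inv_into U \<phi> x) - f (inv_into U \<phi> x)) y) < \<epsilon>"
      using Basis.prems by (auto simp: s C_inf_ball_def o_def)
    note op = chartD(2)[OF H U]
    have sm: "smooth_on (\<phi> ` U) (\<lambda>x. p (inv_into U \<phi> x) - r (inv_into U \<phi> x))" if "p \<in> C_inf H" "r \<in> C_inf H" for p r
      by (rule C_inf_chart[OF H C_inf_diff[OF H that] U])
    have "\<exists>m<\<epsilon>. \<forall>y\<in>K. norm (iter_deriv vs (\<lambda>x. g (inv_into U \<phi> x) - f (inv_into U \<phi> x)) y) \<le> m"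
    proof (cases "K = {}")
      case True thus ?thesis using \<epsilon> by auto
    next
      case False
      have "continuous_on K (\<lambda>y. norm (iter_deriv vs (\<lambda>x. g (inv_into U \<phi> x) - f (inv_into U \<phi> x)) y))"
        by (intro continuous_on_norm continuous_on_subset[OF smooth_on_continuous_on[OF smooth_on_iter_deriv[OF sm]] K(2)] g f)
      from continuous_attains_sup[OF K(1) False this] g(2) show ?thesis by auto
    qed
    then obtain m where m: "m < \<epsilon>" "\<And>y. y \<in> K \<Longrightarrow> norm (iter_deriv vs (\<lambda>x. g (inv_into U \<phi> x) - f (inv_into U \<phi> x)) y) \<le> m" by blast
    show ?case
    proof (intro exI[of _ "{((U, \<phi>), K, vs)}"] exI[of _ "(\<epsilon> - m) / 2"] conjI ballI impI)
      show "admissible (atlas H) {((U, \<phi>), K, vs)}" using U K by (simp add: admissible_def)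
      show "(\<epsilon> - m) / 2 > 0" using m by simp
      fix h assume h: "h \<in> C_inf H" "seminorms_le {((U, \<phi>), K, vs)} ((\<epsilon> - m) / 2) (\<lambda>x. h x - g x)"
      have "norm (iter_deriv vs (\<lambda>x. h (inv_into U \<phi> x) - f (inv_into U \<phi> x)) y) < \<epsilon>" if y: "y \<in> K" for y
      proof -
        have yU: "y \<in> \<phi> ` U" using y K by blast
        have "iter_deriv vs (\<lambda>x. (h (inv_into U \<phi> x) - g (inv_into U \<phi> x)) + (g (inv_into U \<phi> x) - f (inv_into U \<phi> x))) y
           = iter_deriv vs (\<lambda>x. h (inv_into U \<phi> x) - g (inv_into U \<phi> x)) y + iter_deriv vs (\<lambda>x. g (inv_into U \<phi> x) - f (inv_into U \<phi> x)) y"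
          by (rule iter_deriv_add[OF op sm[OF h(1) g(1)] sm[OF g(1) f] yU])
        hence "norm (iter_deriv vs (\<lambda>x. h (inv_into U \<phi> x) - f (inv_into U \<phi> x)) y) \<le> (\<epsilon> - m) / 2 + m"
          using norm_triangle_mono[OF seminorms_leD[OF h(2) _ y] m(2)[OF y]] by simp
        thus ?thesis using m(1) by (simp add: field_simps)
      qed
      thus "h \<in> s" using h(1) by (simp add: s C_inf_ball_def o_def)
    qed
  qed
qed

text \<open>For a linear functional, continuity amounts to continuity at zero, that is, to a bound
  by finitely many seminorms; the topology enters later arguments only through this estimate.
  Working with a positive bound \<open>B\<close> permits the rescaling by
  \<open>\<epsilon> / B\<close>.\<close>

lemma distributions_iff:
  assumes H: "manifold (atlas H)"
  shows "u \<in> distributions H \<longleftrightarrow> u \<in> extensional (C_inf H) \<and>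
     (\<forall>f\<in>C_inf H. \<forall>g\<in>C_inf H. u (\<lambda>x. f x + g x) = u f + u g) \<and>
     (\<forall>f\<in>C_inf H. \<forall>c. u (\<lambda>x. c * f x) = c * u f) \<and>
     (\<exists>I C. admissible (atlas H) I \<and> C \<ge> 0 \<and> (\<forall>f\<in>C_inf H. \<forall>B>0. seminorms_le I B f \<longrightarrow> norm (u f) \<le> C * B))"
proof -
  have "continuous_map (C_inf_topology H) euclidean u \<longleftrightarrow>
    (\<exists>I C. admissible (atlas H) I \<and> C \<ge> 0 \<and> (\<forall>f\<in>C_inf H. \<forall>B>0. seminorms_le I B f \<longrightarrow> norm (u f) \<le> C * B))"
    if add: "\<And>f g. f \<in> C_inf H \<Longrightarrow> g \<in> C_inf H \<Longrightarrow> u (\<lambda>x. f x + g x) = u f + u g"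
    and cmult: "\<And>f c. f \<in> C_inf H \<Longrightarrow> u (\<lambda>x. c * f x) = c * u f"
  proof
    assume cont: "continuous_map (C_inf_topology H) euclidean u"
    have "openin (C_inf_topology H) {f \<in> topspace (C_inf_topology H). u f \<in> ball 0 1}"
      using cont by (rule openin_continuous_map_preimage) simp
    moreover have "u (\<lambda>_. 0) = 0" using cmult[OF C_inf_const[OF H], of 0] by simp
    hence "(\<lambda>_. 0) \<in> {f \<in> topspace (C_inf_topology H). u f \<in> ball 0 1}"
      by (simp add: topspace_C_inf_topology[OF H] C_inf_const[OF H])
    ultimately obtain I \<epsilon> where I: "admissible (atlas H) I" "\<epsilon> > 0"
      "\<And>h. h \<in> C_inf H \<Longrightarrow> seminorms_le I \<epsilon> (\<lambda>x. h x - 0) \<Longrightarrow> norm (u h) < 1"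
      using openin_C_inf_topology_nbhd[OF H] by force
    have "norm (u f) \<le> 1 / \<epsilon> * B" if f: "f \<in> C_inf H" "B > 0" "seminorms_le I B f" for f B
    proof -
      have "seminorms_le I (norm (complex_of_real (\<epsilon> / B)) * B) (\<lambda>x. complex_of_real (\<epsilon> / B) * f x)"
        by (rule seminorms_le_cmult[OF H I(1) f(1,3)])
      hence "norm (u (\<lambda>x. complex_of_real (\<epsilon> / B) * f x)) < 1"
        using f(2) I(2) by (intro I(3) C_inf_cmult[OF H f(1)]) (simp add: norm_divide)
      hence "\<epsilon> / B * norm (u f) < 1" using f(2) I(2) cmult[OF f(1), of "complex_of_real (\<epsilon> / B)"]
        by (simp add: norm_mult norm_divide)
      thus ?thesis using f(2) I(2) by (simp add: field_simps)
    qed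
    thus "\<exists>I C. admissible (atlas H) I \<and> C \<ge> 0 \<and> (\<forall>f\<in>C_inf H. \<forall>B>0. seminorms_le I B f \<longrightarrow> norm (u f) \<le> C * B)"
      using I by (intro exI[of _ I] exI[of _ "1 / \<epsilon>"]) auto
  next
    assume "\<exists>I C. admissible (atlas H) I \<and> C \<ge> 0 \<and> (\<forall>f\<in>C_inf H. \<forall>B>0. seminorms_le I B f \<longrightarrow> norm (u f) \<le> C * B)"
    then obtain I C where I: "admissible (atlas H) I" and C: "C \<ge> 0"
      and le: "\<And>f B. f \<in> C_inf H \<Longrightarrow> B > 0 \<Longrightarrow> seminorms_le I B f \<Longrightarrow> norm (u f) \<le> C * B" by blast
    show "continuous_map (C_inf_topology H) euclidean u"
      unfolding continuous_map_def
    proof (intro conjI allI impI)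
      fix V :: "complex set" assume "openin euclidean V"
      hence V: "open V" by simp
      let ?W = "{f \<in> topspace (C_inf_topology H). u f \<in> V}"
      show "openin (C_inf_topology H) ?W"
      proof (subst openin_subopen, intro ballI)
        fix f assume "f \<in> ?W"
        hence f: "f \<in> C_inf H" "u f \<in> V" by (auto simp: topspace_C_inf_topology[OF H])
        obtain \<delta> where \<delta>: "\<delta> > 0" "ball (u f) \<delta> \<subseteq> V" using V f(2) open_contains_ball by blast
        define B where "B = \<delta> / (2 * (C + 1))"
        have B: "B > 0" using \<delta> C by (simp add: B_def)
        have CB: "C * B < \<delta>"
        proof -
          have "C * B \<le> (C + 1) * B" using B by simp
          also have "\<dots> = \<delta> / 2" using C by (simp add: B_def field_simps)
          finally show ?thesis using \<delta> by simp
        qed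
        \<comment> \<open>The whole space is added so that the family is nonempty and its
          intersection consists of smooth functions even when \<open>I\<close> is empty.\<close>
        let ?X = "{C_inf_ball H c K vs B f |c K vs. (c, K, vs) \<in> I} \<union> {C_inf H}"
        have "?X = (\<lambda>(c, K, vs). C_inf_ball H c K vs B f) ` I \<union> {C_inf H}" by (auto simp: image_iff)
        hence fin: "finite ?X" using I by (simp add: admissible_def)
        have "openin (C_inf_topology H) (C_inf_ball H c K vs B f)" if "(c, K, vs) \<in> I" for c K vs
        proof -
          have "c \<in> atlas H \<and> compact K \<and> K \<subseteq> snd c ` fst c" using I that unfolding admissible_def by blast
          thus ?thesis using openin_C_inf_ball B f(1) by blast
        qed
        moreover have "openin (C_inf_topology H) (C_inf H)"
          using openin_topspace[of "C_inf_topology H"] by (simp add: topspace_C_inf_topology[OF H])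
        ultimately have "openin (C_inf_topology H) (\<Inter>?X)"
          using fin by (intro openin_Inter) auto
        moreover have "f \<in> C_inf_ball H c K vs B f" for c K vs
          using f(1) B by (simp add: C_inf_ball_def o_def iter_deriv_zero)
        hence "f \<in> \<Inter>?X" using f(1) by blast
        moreover have "\<Inter>?X \<subseteq> ?W"
        proof
          fix h assume h: "h \<in> \<Inter>?X"
          have hC: "h \<in> C_inf H" using h by blast
          have "norm (iter_deriv vs (\<lambda>x. h (inv_into U \<phi> x) - f (inv_into U \<phi> x)) y) \<le> B"
            if "((U, \<phi>), K, vs) \<in> I" "y \<in> K" for U \<phi> K vs y
          proof -
            have "h \<in> C_inf_ball H (U, \<phi>) K vs B f" using h that by blast
            thus ?thesis using that(2) by (auto simp: C_inf_ball_def o_def less_imp_le)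
          qed
          hence "seminorms_le I B (\<lambda>x. h x - f x)" unfolding seminorms_le_iff by blast
          from le[OF C_inf_diff[OF H hC f(1)] B this] CB have *: "norm (u (\<lambda>x. h x - f x)) < \<delta>" by simp
          have "u h = u (\<lambda>x. (h x - f x) + f x)" by simp
          also have "\<dots> = u (\<lambda>x. h x - f x) + u f" by (rule add[OF C_inf_diff[OF H hC f(1)] f(1)])
          finally have "u h \<in> ball (u f) \<delta>" using * by (simp add: dist_norm norm_minus_commute)
          thus "h \<in> ?W" using \<delta>(2) hC by (auto simp: topspace_C_inf_topology[OF H])
        qed
        ultimately show "\<exists>T. openin (C_inf_topology H) T \<and> f \<in> T \<and> T \<subseteq> ?W" by blast
      qed
    qed simp
  qed
  thus ?thesis unfolding distributions_def by blast
qed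

lemma distributionD:
  assumes "u \<in> distributions H"
  shows "u \<in> extensional (C_inf H)"
    and "f \<in> C_inf H \<Longrightarrow> g \<in> C_inf H \<Longrightarrow> u (\<lambda>x. f x + g x) = u f + u g"
    and "f \<in> C_inf H \<Longrightarrow> u (\<lambda>x. c * f x) = c * u f"
  using assms unfolding distributions_def by blast+

text \<open>Since \<open>K\<close> is mapped into one chart, the coefficients of
  \<open>iter_deriv_pullback\<close> are continuous on \<open>K\<close> and hence bounded there, and
  derivatives of \<open>f\<close> are evaluated only on the compact set \<open>KF\<close>.\<close>

lemma pullback_bound_local:
  fixes F :: "'d::real_normed_vector \<Rightarrow> 'a::topological_space" and H :: "('a, 'e::real_normed_vector) lie_group"
  assumes H: "manifold (atlas H)" and S: "open S" and c: "smooth_on S c" and F: "msmooth S (atlas H) F"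
    and K: "compact K" "K \<subseteq> S" and U: "(U, \<phi>) \<in> atlas H" and KU: "F ` K \<subseteq> U"
  shows "\<exists>I C. admissible (atlas H) I \<and> C \<ge> 0 \<and> (\<forall>f\<in>C_inf H. \<forall>B>0. seminorms_le I B f \<longrightarrow>
     (\<forall>y\<in>K. norm (iter_deriv vs (\<lambda>x. c x * f (F x)) y) \<le> C * B))"
proof -
  define S' where "S' = S \<inter> F -` U"
  have S': "open S'" unfolding S'_def
    by (rule continuous_open_preimage[OF msmooth_continuous[OF F] S chartD(1)[OF H U]])
  have sub: "S' \<subseteq> S" and KS': "K \<subseteq> S'" using K KU by (auto simp: S'_def)
  have phF: "smooth_on S' (\<lambda>x. \<phi> (F x))" using msmoothD[OF F U] by (simp add: S'_def)
  obtain J :: "(('d \<Rightarrow> complex) \<times> 'e list) list" where J: "\<And>a ws. (a, ws) \<in> set J \<Longrightarrow> smooth_on S' a"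
    and Jg: "\<And>g x. smooth_on (\<phi> ` U) g \<Longrightarrow> x \<in> S' \<Longrightarrow> iter_deriv vs (\<lambda>x. c x * g (\<phi> (F x))) x =
         (\<Sum>(a, ws)\<leftarrow>J. a x * iter_deriv ws g (\<phi> (F x)))"
  proof -
    have "(\<lambda>x. \<phi> (F x)) ` S' \<subseteq> \<phi> ` U" by (auto simp: S'_def)
    from iter_deriv_pullback[OF manifold_fin_dim[OF H] S' chartD(2)[OF H U] this phF smooth_on_subset[OF c sub], of vs] that
    show thesis by blast
  qed
  have "\<exists>M\<ge>0. \<forall>x\<in>K. norm (a x) \<le> M" if "(a, ws) \<in> set J" for a ws
  proof -
    have "continuous_on K a" using smooth_on_continuous_on[OF J[OF that]] KS' continuous_on_subset by blast
    hence "bounded (a ` K)" using compact_continuous_image[OF _ K(1)] compact_imp_bounded by blast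
    then obtain M where "\<And>x. x \<in> K \<Longrightarrow> norm (a x) \<le> M" by (auto simp: bounded_iff)
    thus ?thesis by (intro exI[of _ "max M 0"]) force
  qed
  hence "\<exists>M. 0 \<le> M \<and> (\<forall>x\<in>K. norm (fst p x) \<le> M)" if "p \<in> set J" for p
    using that by (cases p) fastforce
  hence "\<forall>p\<in>set J. \<exists>M. 0 \<le> M \<and> (\<forall>x\<in>K. norm (fst p x) \<le> M)" by blast
  from bchoice[OF this] obtain M where M: "\<And>p. p \<in> set J \<Longrightarrow> M p \<ge> (0::real)"
    "\<And>p x. p \<in> set J \<Longrightarrow> x \<in> K \<Longrightarrow> norm (fst p x) \<le> M p" by blast
  define KF where "KF = (\<lambda>x. \<phi> (F x)) ` K"
  define I where "I = (\<lambda>p. ((U, \<phi>), KF, snd p)) ` set J"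
  have cKF: "compact KF" unfolding KF_def
    by (rule compact_continuous_image[OF continuous_on_subset[OF smooth_on_continuous_on[OF phF] KS'] K(1)])
  have KFU: "KF \<subseteq> \<phi> ` U" using KU by (auto simp: KF_def)
  show ?thesis
  proof (intro exI[of _ I] exI[of _ "\<Sum>p\<leftarrow>J. M p"] conjI ballI allI impI)
    show "admissible (atlas H) I" unfolding admissible_def I_def using U cKF KFU by auto
    show "0 \<le> (\<Sum>p\<leftarrow>J. M p)" by (rule sum_list_nonneg) (use M(1) in auto)
    fix f B y assume f: "f \<in> C_inf H" and B: "(0::real) < B" and le: "seminorms_le I B f" and y: "y \<in> K"
    have yS: "y \<in> S'" using y KS' by blast
    have "iter_deriv vs (\<lambda>x. c x * f (F x)) y = iter_deriv vs (\<lambda>x. c x * f (inv_into U \<phi> (\<phi> (F x)))) y"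
      by (rule iter_deriv_cong[OF S' _ yS]) (simp add: S'_def chartD(6)[OF H U])
    also have "\<dots> = (\<Sum>(a, ws)\<leftarrow>J. a y * iter_deriv ws (\<lambda>x. f (inv_into U \<phi> x)) (\<phi> (F y)))"
      by (rule Jg[OF C_inf_chart[OF H f U] yS])
    also have "norm \<dots> \<le> (\<Sum>p\<leftarrow>J. M p * B)"
    proof -
      have "norm (\<Sum>(a, ws)\<leftarrow>L. a y * iter_deriv ws (\<lambda>x. f (inv_into U \<phi> x)) (\<phi> (F y))) \<le> (\<Sum>p\<leftarrow>L. M p * B)"
        if "set L \<subseteq> set J" for L
        using that
      proof (induction L)
        case (Cons p L)
        obtain a ws where p: "p = (a, ws)" by (cases p)
        have "norm (a y) \<le> M p" using M(2)[of p y] Cons.prems p y by simp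
        moreover have "norm (iter_deriv ws (\<lambda>x. f (inv_into U \<phi> x)) (\<phi> (F y))) \<le> B"
        proof (rule seminorms_leD[OF le])
          show "((U, \<phi>), KF, ws) \<in> I" unfolding I_def
            by (rule image_eqI[of _ _ p]) (use Cons.prems p in auto)
        qed (use y in \<open>auto simp: KF_def\<close>)
        ultimately have "norm (a y * iter_deriv ws (\<lambda>x. f (inv_into U \<phi> x)) (\<phi> (F y))) \<le> M p * B"
          unfolding norm_mult by (intro mult_mono) (use M(1)[of p] Cons.prems in auto)
        from norm_triangle_mono[OF this Cons.IH] Cons.prems show ?case by (simp add: p)
      qed simp
      thus ?thesis by blast
    qed
    also have "\<dots> = (\<Sum>p\<leftarrow>J. M p) * B" by (simp add: sum_list_mult_const)
    finally show "norm (iter_deriv vs (\<lambda>x. c x * f (F x)) y) \<le> (\<Sum>p\<leftarrow>J. M p) * B" .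
  qed
qed

text \<open>A compact set is covered by finitely many balls whose images each stay within one chart;
  the seminorm families are united and the constants added.\<close>

lemma pullback_bound:
  fixes F :: "'d::real_normed_vector \<Rightarrow> 'a::topological_space" and H :: "('a, 'e::real_normed_vector) lie_group"
  assumes H: "manifold (atlas H)" and S: "open S" and c: "smooth_on S c" and F: "msmooth S (atlas H) F"
    and K: "compact K" "K \<subseteq> S"
  shows "\<exists>I C. admissible (atlas H) I \<and> C \<ge> 0 \<and> (\<forall>f\<in>C_inf H. \<forall>B>0. seminorms_le I B f \<longrightarrow>
     (\<forall>y\<in>K. norm (iter_deriv vs (\<lambda>x. c x * f (F x)) y) \<le> C * B))"
proof -
  define P where "P K' I C \<longleftrightarrow> admissible (atlas H) I \<and> C \<ge> 0 \<and> (\<forall>f\<in>C_inf H. \<forall>B>0. seminorms_le I B f \<longrightarrow>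
     (\<forall>y\<in>K'. norm (iter_deriv vs (\<lambda>x. c x * f (F x)) y) \<le> C * B))" for K' I C
  have "\<exists>r>0. \<exists>I C. P (K \<inter> cball y r) I C" if y: "y \<in> K" for y
  proof -
    obtain U \<phi> where U: "(U, \<phi>) \<in> atlas H" "F y \<in> U" using chart_ex[OF H] by blast
    have "open (S \<inter> F -` U)"
      by (rule continuous_open_preimage[OF msmooth_continuous[OF F] S chartD(1)[OF H U(1)]])
    moreover have "y \<in> S \<inter> F -` U" using y K U by auto
    ultimately obtain r where r: "r > 0" "cball y r \<subseteq> S \<inter> F -` U" using open_contains_cball by blast
    have "compact (K \<inter> cball y r)" by (rule compact_Int_closed[OF K(1) closed_cball])
    from pullback_bound_local[OF H S c F this _ U(1), of vs] r K(2) have "\<exists>I C. P (K \<inter> cball y r) I C"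
      unfolding P_def by blast
    thus ?thesis using r by blast
  qed
  then obtain r I C where r: "\<And>y. y \<in> K \<Longrightarrow> r y > 0" and P: "\<And>y. y \<in> K \<Longrightarrow> P (K \<inter> cball y (r y)) (I y) (C y)"
    by metis
  have "K \<subseteq> (\<Union>y\<in>K. ball y (r y))" using r by force
  then obtain X where X: "X \<subseteq> K" "finite X" "K \<subseteq> (\<Union>y\<in>X. ball y (r y))"
    using compactE_image[OF K(1), of K "\<lambda>y. ball y (r y)"] by auto
  have "P K (\<Union>y\<in>X. I y) (\<Sum>y\<in>X. C y)" unfolding P_def
  proof (intro conjI ballI allI impI)
    show "admissible (atlas H) (\<Union>y\<in>X. I y)" using X P by (intro admissible_UN) (auto simp: P_def)
    show "0 \<le> (\<Sum>y\<in>X. C y)" using X P by (intro sum_nonneg) (auto simp: P_def)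
    fix f B z assume f: "f \<in> C_inf H" and B: "(0::real) < B" and le: "seminorms_le (\<Union>y\<in>X. I y) B f" and z: "z \<in> K"
    then obtain y where y: "y \<in> X" "z \<in> ball y (r y)" using X by blast
    have "seminorms_le (I y) B f" using seminorms_le_mono[OF le _ order.refl] y by blast
    hence "norm (iter_deriv vs (\<lambda>x. c x * f (F x)) z) \<le> C y * B"
      using P[of y] X y z f B unfolding P_def by auto
    also have "\<dots> \<le> (\<Sum>y\<in>X. C y) * B"
      using X y B P by (intro mult_right_mono member_le_sum) (auto simp: P_def)
    finally show "norm (iter_deriv vs (\<lambda>x. c x * f (F x)) z) \<le> (\<Sum>y\<in>X. C y) * B" .
  qed
  thus ?thesis unfolding P_def by blast
qed

text \<open>The transpose of the weighted pullback that sends \<open>f\<close> to \<open>c\<close>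
  times the composition of \<open>f\<close> with \<open>F\<close>. Accordingly \<open>F\<close>
  points from the space carrying \<open>u\<close> to the space carrying the result.\<close>

definition transfer_dist :: "('a::topological_space, 'e::real_normed_vector) lie_group \<Rightarrow> ('b \<Rightarrow> complex) \<Rightarrow> ('b \<Rightarrow> 'a) \<Rightarrow>
   (('b \<Rightarrow> complex) \<Rightarrow> complex) \<Rightarrow> (('a \<Rightarrow> complex) \<Rightarrow> complex)" where
  "transfer_dist H c F u = (\<lambda>f\<in>C_inf H. u (\<lambda>x. c x * f (F x)))"

lemma seminorms_weighted_pullback:
  assumes G: "manifold (atlas G)" and H: "manifold (atlas H)"
    and c: "c \<in> C_inf G" and F: "smooth_map (atlas G) (atlas H) F" and I: "admissible (atlas G) I"
  shows "\<exists>J C. admissible (atlas H) J \<and> C > 0 \<and> (\<forall>f\<in>C_inf H. \<forall>B>0. seminorms_le J B f \<longrightarrow>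
     seminorms_le I (C * B) (\<lambda>x. c x * f (F x)))"
proof -
  have "\<exists>J C. admissible (atlas H) J \<and> C \<ge> 0 \<and> (\<forall>f\<in>C_inf H. \<forall>B>0. seminorms_le J B f \<longrightarrow>
     (\<forall>y\<in>K. norm (iter_deriv vs (\<lambda>x. c (inv_into U \<phi> x) * f (F (inv_into U \<phi> x))) y) \<le> C * B))"
    if "((U, \<phi>), K, vs) \<in> I" for U \<phi> K vs
  proof -
    note U = admissibleD[OF I that]
    have "msmooth (\<phi> ` U) (atlas H) (\<lambda>x. F (inv_into U \<phi> x))"
      using F U(1) smooth_map_iff[OF G] by blast
    from pullback_bound[OF H chartD(2)[OF G U(1)] C_inf_chart[OF G c U(1)] this U(2,3)] show ?thesis .
  qed
  hence "\<forall>i\<in>I. \<exists>J C. admissible (atlas H) J \<and> C \<ge> 0 \<and> (\<forall>f\<in>C_inf H. \<forall>B>0. seminorms_le J B f \<longrightarrow>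
     (\<forall>y\<in>fst (snd i). norm (iter_deriv (snd (snd i)) (\<lambda>x. c (inv_into (fst (fst i)) (snd (fst i)) x) * f (F (inv_into (fst (fst i)) (snd (fst i)) x))) y) \<le> C * B))"
    by auto
  from bchoice[OF this] obtain J where "\<forall>i\<in>I. \<exists>C. admissible (atlas H) (J i) \<and> C \<ge> 0 \<and> (\<forall>f\<in>C_inf H. \<forall>B>0. seminorms_le (J i) B f \<longrightarrow>
     (\<forall>y\<in>fst (snd i). norm (iter_deriv (snd (snd i)) (\<lambda>x. c (inv_into (fst (fst i)) (snd (fst i)) x) * f (F (inv_into (fst (fst i)) (snd (fst i)) x))) y) \<le> C * B))"
    by blast
  from bchoice[OF this] obtain C where JC: "\<And>i. i \<in> I \<Longrightarrow> admissible (atlas H) (J i) \<and> C i \<ge> 0 \<and> (\<forall>f\<in>C_inf H. \<forall>B>0. seminorms_le (J i) B f \<longrightarrow>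
     (\<forall>y\<in>fst (snd i). norm (iter_deriv (snd (snd i)) (\<lambda>x. c (inv_into (fst (fst i)) (snd (fst i)) x) * f (F (inv_into (fst (fst i)) (snd (fst i)) x))) y) \<le> C i * B))"
    by blast
  have fin: "finite I" using I by (simp add: admissible_def)
  \<comment> \<open>Adding 1 makes the constant positive, so that the resulting bound can be fed
    into an estimate stated for positive bounds.\<close>
  show ?thesis
  proof (intro exI[of _ "\<Union>i\<in>I. J i"] exI[of _ "(\<Sum>i\<in>I. C i) + 1"] conjI ballI allI impI)
    show "admissible (atlas H) (\<Union>i\<in>I. J i)" using JC by (intro admissible_UN fin) auto
    show "0 < (\<Sum>i\<in>I. C i) + 1" using JC by (intro add_nonneg_pos sum_nonneg) auto
    fix f B assume f: "f \<in> C_inf H" and B: "(0::real) < B" and le: "seminorms_le (\<Union>i\<in>I. J i) B f"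
    show "seminorms_le I (((\<Sum>i\<in>I. C i) + 1) * B) (\<lambda>x. c x * f (F x))"
      unfolding seminorms_le_iff
    proof (intro allI impI)
      fix U \<phi> K vs y assume i: "((U, \<phi>), K, vs) \<in> I" and y: "y \<in> K"
      have "seminorms_le (J ((U, \<phi>), K, vs)) B f" using seminorms_le_mono[OF le _ order.refl] i by blast
      hence "norm (iter_deriv vs (\<lambda>x. c (inv_into U \<phi> x) * f (F (inv_into U \<phi> x))) y) \<le> C ((U, \<phi>), K, vs) * B"
        using JC[OF i] f B y by auto
      also have "\<dots> \<le> ((\<Sum>i\<in>I. C i) + 1) * B"
      proof (rule mult_right_mono)
        have "C ((U, \<phi>), K, vs) \<le> (\<Sum>i\<in>I. C i)" using JC i by (intro member_le_sum fin) auto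
        thus "C ((U, \<phi>), K, vs) \<le> (\<Sum>i\<in>I. C i) + 1" by simp
      qed (use B in simp)
      finally show "norm (iter_deriv vs (\<lambda>x. c (inv_into U \<phi> x) * f (F (inv_into U \<phi> x))) y) \<le> ((\<Sum>i\<in>I. C i) + 1) * B" .
    qed
  qed
qed

lemma transfer_dist:
  assumes G: "manifold (atlas G)" and H: "manifold (atlas H)"
    and c: "c \<in> C_inf G" and F: "smooth_map (atlas G) (atlas H) F" and u: "u \<in> distributions G"
  shows "transfer_dist H c F u \<in> distributions H"
proof -
  have cf: "(\<lambda>x. c x * f (F x)) \<in> C_inf G" if "f \<in> C_inf H" for f
    by (rule C_inf_mult[OF G c C_inf_smooth_map[OF G H that F]])
  note u' = u[unfolded distributions_iff[OF G]]
  obtain I C where I: "admissible (atlas G) I" and C: "C \<ge> 0"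
    and le: "\<And>f B. f \<in> C_inf G \<Longrightarrow> B > 0 \<Longrightarrow> seminorms_le I B f \<Longrightarrow> norm (u f) \<le> C * B" using u' by blast
  obtain J D where J: "admissible (atlas H) J" and D: "D > 0"
    and leJ: "\<And>f B. f \<in> C_inf H \<Longrightarrow> B > 0 \<Longrightarrow> seminorms_le J B f \<Longrightarrow> seminorms_le I (D * B) (\<lambda>x. c x * f (F x))"
    using seminorms_weighted_pullback[OF G H c F I] by blast
  show ?thesis unfolding distributions_iff[OF H]
  proof (intro conjI ballI allI exI[of _ J] exI[of _ "C * D"] impI)
    show "transfer_dist H c F u \<in> extensional (C_inf H)" by (simp add: transfer_dist_def)
    show "admissible (atlas H) J" by fact
    show "0 \<le> C * D" using C D by simp
    fix f assume f: "f \<in> C_inf H"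
    show "transfer_dist H c F u (\<lambda>x. f x + g x) = transfer_dist H c F u f + transfer_dist H c F u g" if g: "g \<in> C_inf H" for g
    proof -
      have "u (\<lambda>x. c x * f (F x) + c x * g (F x)) = u (\<lambda>x. c x * f (F x)) + u (\<lambda>x. c x * g (F x))"
        by (rule distributionD(2)[OF u cf[OF f] cf[OF g]])
      thus ?thesis using f g C_inf_add[OF H f g] by (simp add: transfer_dist_def distrib_left)
    qed
    show "transfer_dist H c F u (\<lambda>x. k * f x) = k * transfer_dist H c F u f" for k
    proof -
      have "u (\<lambda>x. k * (c x * f (F x))) = k * u (\<lambda>x. c x * f (F x))"
        by (rule distributionD(3)[OF u cf[OF f]])
      thus ?thesis using f C_inf_cmult[OF H f] by (simp add: transfer_dist_def mult.left_commute)
    qed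
    fix B :: real assume B: "0 < B" "seminorms_le J B f"
    have "norm (u (\<lambda>x. c x * f (F x))) \<le> C * (D * B)"
      using D B by (intro le cf f leJ) auto
    thus "norm (transfer_dist H c F u f) \<le> C * D * B" using f by (simp add: transfer_dist_def mult.assoc)
  qed
qed

section \<open>Haar measure\<close>

text \<open>Uniqueness of Haar measure is a matter of the topological group alone. Keeping it apart
  from the Lie structure lets it be applied to the product group through
  \<open>compact_topological_group_prod\<close>.\<close>

locale compact_topological_group =
  fixes H :: "('a::{t2_space, second_countable_topology}, 'e::real_normed_vector) lie_group" (structure)
  assumes grp: "group H" and UNIV_carrier: "carrier H = UNIV" and compact_UNIV: "compact (UNIV :: 'a set)"
    and cont_mult: "continuous_on UNIV (\<lambda>(x, y). x \<otimes> y)" and cont_inv: "continuous_on UNIV (\<lambda>x. inv x)"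
begin

sublocale group H by (rule grp)

lemma continuous_on_mult_grp [continuous_intros]:
  "continuous_on S f \<Longrightarrow> continuous_on S g \<Longrightarrow> continuous_on S (\<lambda>x. f x \<otimes> g x)"
  using continuous_on_compose2[OF cont_mult continuous_on_Pair[of S f g]] by simp

lemma continuous_on_inv_grp [continuous_intros]: "continuous_on S f \<Longrightarrow> continuous_on S (\<lambda>x. inv (f x))"
  using continuous_on_compose2[OF cont_inv] by blast

lemma grp_simps [simp]: "x \<in> carrier H" by (simp add: UNIV_carrier)

lemma measurable_mult_grp: "(\<lambda>(x, y). x \<otimes> y) \<in> borel_measurable (borel \<Otimes>\<^sub>M borel)"
  unfolding borel_prod by (rule borel_measurable_continuous_onI[OF cont_mult])

lemma measurable_lmult: "(\<lambda>x. g \<otimes> x) \<in> borel_measurable borel"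
  by (intro borel_measurable_continuous_onI continuous_intros continuous_on_id continuous_on_const)

lemma measurable_rmult: "(\<lambda>x. x \<otimes> g) \<in> borel_measurable borel"
  by (intro borel_measurable_continuous_onI continuous_intros continuous_on_id continuous_on_const)

lemma measurable_inv_grp: "(\<lambda>x. inv x) \<in> borel_measurable borel"
  by (intro borel_measurable_continuous_onI continuous_intros continuous_on_id)

text \<open>Averaging the left translates of a set against the image of the second measure under
  inversion turns the first measure into the latter.\<close>

lemma haar_eq_inverse:
  assumes M: "normalized_haar H M" and N: "normalized_haar H N"
  shows "M = distr N borel (\<lambda>x. inv x)"
proof (rule measure_eqI)
  define N' where "N' = distr N borel (\<lambda>x. inv x)"
  have sM [measurable_cong]: "sets M = sets borel" and sN [measurable_cong]: "sets N = sets borel"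
    using M N by (auto simp: normalized_haar_def)
  have sN' [measurable_cong]: "sets N' = sets borel" by (simp add: N'_def)
  have mi: "(\<lambda>x. inv x) \<in> N \<rightarrow>\<^sub>M borel"
    using measurable_inv_grp sN by (simp cong: measurable_cong_sets)
  interpret M: prob_space M using M by (simp add: normalized_haar_def)
  interpret N: prob_space N using N by (simp add: normalized_haar_def)
  interpret N': prob_space N' unfolding N'_def by (rule N.prob_space_distr[OF mi])
  interpret P: pair_sigma_finite N' M ..
  show "sets M = sets (distr N borel (\<lambda>x. inv x))" by (simp add: sM)
  fix A assume "A \<in> sets M"
  hence A [measurable]: "A \<in> sets borel" by (simp add: sM)
  define f where "f = (indicator A :: 'a \<Rightarrow> ennreal)"
  have f: "f \<in> borel_measurable borel" unfolding f_def by simp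
  have L: "(\<integral>\<^sup>+y. f (x \<otimes> y) \<partial>K) = (\<integral>\<^sup>+y. f y \<partial>K)"
    if K: "normalized_haar H K" for K x
  proof -
    have sK: "sets K = sets borel" and dK: "distr K borel (\<lambda>y. x \<otimes> y) = K" using K by (auto simp: normalized_haar_def)
    have "(\<integral>\<^sup>+y. f y \<partial>K) = (\<integral>\<^sup>+y. f y \<partial>distr K borel (\<lambda>y. x \<otimes> y))" by (simp add: dK)
    also have "\<dots> = (\<integral>\<^sup>+y. f (x \<otimes> y) \<partial>K)"
      by (rule nn_integral_distr) (use measurable_lmult sK f in \<open>auto cong: measurable_cong_sets\<close>)
    finally show ?thesis by simp
  qed
  have R: "(\<integral>\<^sup>+x. f (x \<otimes> y) \<partial>N') = (\<integral>\<^sup>+x. f x \<partial>N')" for y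
  proof -
    have fr: "(\<lambda>x. f (x \<otimes> z)) \<in> borel_measurable borel" for z
      by (rule measurable_compose[OF measurable_rmult f])
    have fi: "(\<lambda>x. f (inv x \<otimes> z)) \<in> borel_measurable borel" for z
      by (rule measurable_compose[OF measurable_inv_grp fr])
    have "(\<integral>\<^sup>+x. f (x \<otimes> y) \<partial>N') = (\<integral>\<^sup>+x. f (inv x \<otimes> y) \<partial>N)"
      unfolding N'_def by (rule nn_integral_distr[OF mi]) (use fr in simp)
    also have "\<dots> = (\<integral>\<^sup>+x. f (inv x \<otimes> y) \<partial>distr N borel (\<lambda>x. y \<otimes> x))"
      using N by (simp add: normalized_haar_def)
    also have "\<dots> = (\<integral>\<^sup>+x. f (inv (y \<otimes> x) \<otimes> y) \<partial>N)"
      by (rule nn_integral_distr) (use measurable_lmult sN fi in \<open>auto cong: measurable_cong_sets\<close>)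
    also have "\<dots> = (\<integral>\<^sup>+x. f (inv x) \<partial>N)"
      by (simp add: inv_mult_group m_assoc)
    also have "\<dots> = (\<integral>\<^sup>+x. f x \<partial>N')"
      unfolding N'_def by (rule nn_integral_distr[OF mi, symmetric]) (use f in simp)
    finally show ?thesis .
  qed
  have meas: "(\<lambda>(x, y). f (x \<otimes> y)) \<in> borel_measurable (N' \<Otimes>\<^sub>M M)"
  proof -
    have "(\<lambda>p. f (case p of (x, y) \<Rightarrow> x \<otimes> y)) \<in> borel_measurable (borel \<Otimes>\<^sub>M borel)"
      by (rule measurable_compose[OF measurable_mult_grp f])
    moreover have "sets (N' \<Otimes>\<^sub>M M) = sets (borel \<Otimes>\<^sub>M borel)"
      by (rule sets_pair_measure_cong[OF sN' sM])
    ultimately show ?thesis by (simp add: split_beta cong: measurable_cong_sets)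
  qed
  have "emeasure M A = (\<integral>\<^sup>+y. f y \<partial>M)" by (simp add: f_def sM)
  also have "\<dots> = (\<integral>\<^sup>+x. (\<integral>\<^sup>+y. f (x \<otimes> y) \<partial>M) \<partial>N')" by (simp add: L[OF M] N'.emeasure_space_1)
  also have "\<dots> = (\<integral>\<^sup>+y. (\<integral>\<^sup>+x. f (x \<otimes> y) \<partial>N') \<partial>M)"
    using P.Fubini[OF meas] by simp
  also have "\<dots> = (\<integral>\<^sup>+x. f x \<partial>N')" by (simp add: R M.emeasure_space_1)
  also have "\<dots> = emeasure N' A" by (simp add: f_def sN')
  finally show "emeasure M A = emeasure (distr N borel (\<lambda>x. inv x)) A" by (simp add: N'_def)
qed

text \<open>Both measures are the image of \<open>N\<close> under inversion. This later identifies
  the given Haar measure of the product group with the product of the two Haar measures.\<close>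

lemma haar_unique:
  assumes "normalized_haar H M" "normalized_haar H N"
  shows "M = N"
  using haar_eq_inverse[OF assms] haar_eq_inverse[OF assms(2,2)] by simp

text \<open>The measure is invariant under inversion, and inversion exchanges left and right
  translations.\<close>

lemma haar_right_invariant:
  assumes M: "normalized_haar H M"
  shows "distr M borel (\<lambda>x. x \<otimes> g) = M"
proof -
  have sM: "sets M = sets borel" using M by (simp add: normalized_haar_def)
  note cs = measurable_cong_sets[OF sM refl]
  have "distr M borel (\<lambda>x. x \<otimes> g) = distr (distr M borel (\<lambda>x. inv x)) borel (\<lambda>x. x \<otimes> g)"
    using haar_eq_inverse[OF M M] by simp
  also have "\<dots> = distr M borel (\<lambda>x. inv x \<otimes> g)"
    by (subst distr_distr) (use measurable_inv_grp measurable_rmult in \<open>simp_all add: o_def cs\<close>)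
  also have "\<dots> = distr M borel (\<lambda>x. inv (inv g \<otimes> x))" by (simp add: inv_mult_group)
  also have "\<dots> = distr (distr M borel (\<lambda>x. inv g \<otimes> x)) borel (\<lambda>x. inv x)"
    by (subst distr_distr) (use measurable_inv_grp measurable_lmult in \<open>simp_all add: o_def cs\<close>)
  also have "\<dots> = distr M borel (\<lambda>x. inv x)" using M by (simp add: normalized_haar_def)
  also have "\<dots> = M" using haar_eq_inverse[OF M M] by simp
  finally show ?thesis .
qed

lemma haar_integral_left:
  fixes f :: "'a \<Rightarrow> 'c::{banach, second_countable_topology}"
  assumes M: "normalized_haar H M" and f: "f \<in> borel_measurable borel"
  shows "(\<integral>x. f (g \<otimes> x) \<partial>M) = (\<integral>x. f x \<partial>M)"
proof -
  have sM: "sets M = sets borel" and d: "distr M borel (\<lambda>x. g \<otimes> x) = M" using M by (auto simp: normalized_haar_def)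
  have "(\<integral>x. f x \<partial>distr M borel (\<lambda>x. g \<otimes> x)) = (\<integral>x. f (g \<otimes> x) \<partial>M)"
    by (rule integral_distr) (use measurable_lmult f in \<open>simp_all add: measurable_cong_sets[OF sM refl]\<close>)
  thus ?thesis by (simp add: d)
qed

lemma haar_integral_right:
  fixes f :: "'a \<Rightarrow> 'c::{banach, second_countable_topology}"
  assumes M: "normalized_haar H M" and f: "f \<in> borel_measurable borel"
  shows "(\<integral>x. f (x \<otimes> g) \<partial>M) = (\<integral>x. f x \<partial>M)"
proof -
  have sM: "sets M = sets borel" using M by (auto simp: normalized_haar_def)
  have "(\<integral>x. f x \<partial>distr M borel (\<lambda>x. x \<otimes> g)) = (\<integral>x. f (x \<otimes> g) \<partial>M)"
    by (rule integral_distr) (use measurable_rmult f in \<open>simp_all add: measurable_cong_sets[OF sM refl]\<close>)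
  thus ?thesis by (simp add: haar_right_invariant[OF M])
qed

end

lemma compact_lie_group_topological:
  fixes H :: "('a::{t2_space, second_countable_topology}, 'e::real_normed_vector) lie_group"
  assumes "compact_lie_group H"
  shows "compact_topological_group H"
proof (rule compact_topological_group.intro)
  show "group H" "carrier H = UNIV" "compact (UNIV :: 'a set)" using assms by (auto simp: compact_lie_group_def)
  show "continuous_on UNIV (\<lambda>(x, y). x \<otimes>\<^bsub>H\<^esub> y)" "continuous_on UNIV (\<lambda>x. inv\<^bsub>H\<^esub> x)"
    using assms by (auto simp: compact_lie_group_def smooth_map_def)
qed

section \<open>Haar measure on the product group\<close>

lemma lie_prod_simps [simp]:
  "carrier (lie_prod G\<^sub>1 G\<^sub>2) = carrier G\<^sub>1 \<times> carrier G\<^sub>2"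
  "x \<otimes>\<^bsub>lie_prod G\<^sub>1 G\<^sub>2\<^esub> y = (fst x \<otimes>\<^bsub>G\<^sub>1\<^esub> fst y, snd x \<otimes>\<^bsub>G\<^sub>2\<^esub> snd y)"
  "\<one>\<^bsub>lie_prod G\<^sub>1 G\<^sub>2\<^esub> = (\<one>\<^bsub>G\<^sub>1\<^esub>, \<one>\<^bsub>G\<^sub>2\<^esub>)"
  "atlas (lie_prod G\<^sub>1 G\<^sub>2) = prod_atlas (atlas G\<^sub>1) (atlas G\<^sub>2)"
  by (simp_all add: lie_prod_def DirProd_def split_beta)

lemma compact_topological_group_prod:
  fixes G\<^sub>1 :: "('a::{t2_space, second_countable_topology}, 'e::real_normed_vector) lie_group"
    and G\<^sub>2 :: "('b::{t2_space, second_countable_topology}, 'f::real_normed_vector) lie_group"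
  assumes "compact_topological_group G\<^sub>1" "compact_topological_group G\<^sub>2"
  shows "compact_topological_group (lie_prod G\<^sub>1 G\<^sub>2)"
proof -
  interpret G1: compact_topological_group G\<^sub>1 by fact
  interpret G2: compact_topological_group G\<^sub>2 by fact
  have inv: "group (lie_prod G\<^sub>1 G\<^sub>2)"
  proof (rule groupI)
    show "\<exists>y\<in>carrier (lie_prod G\<^sub>1 G\<^sub>2). y \<otimes>\<^bsub>lie_prod G\<^sub>1 G\<^sub>2\<^esub> x = \<one>\<^bsub>lie_prod G\<^sub>1 G\<^sub>2\<^esub>" for x
      by (rule bexI[of _ "(inv\<^bsub>G\<^sub>1\<^esub> fst x, inv\<^bsub>G\<^sub>2\<^esub> snd x)"]) (auto simp: G1.UNIV_carrier G2.UNIV_carrier)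
  qed (auto simp: G1.UNIV_carrier G2.UNIV_carrier G1.m_assoc G2.m_assoc)
  interpret group "lie_prod G\<^sub>1 G\<^sub>2" by fact
  have inv_eq: "inv\<^bsub>lie_prod G\<^sub>1 G\<^sub>2\<^esub> x = (inv\<^bsub>G\<^sub>1\<^esub> fst x, inv\<^bsub>G\<^sub>2\<^esub> snd x)" for x
    by (rule inv_equality) (auto simp: G1.UNIV_carrier G2.UNIV_carrier)
  show ?thesis
  proof
    show "carrier (lie_prod G\<^sub>1 G\<^sub>2) = UNIV" by (simp add: G1.UNIV_carrier G2.UNIV_carrier)
    show "compact (UNIV :: ('a \<times> 'b) set)"
      using compact_Times[OF G1.compact_UNIV G2.compact_UNIV] by simp
    show "continuous_on UNIV (\<lambda>(x, y). x \<otimes>\<^bsub>lie_prod G\<^sub>1 G\<^sub>2\<^esub> y)"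
      by (auto simp: split_beta intro!: continuous_intros)
    show "continuous_on UNIV (\<lambda>x. inv\<^bsub>lie_prod G\<^sub>1 G\<^sub>2\<^esub> x)"
      unfolding inv_eq by (auto intro!: continuous_intros)
  qed
qed

lemma normalized_haar_prod:
  fixes G\<^sub>1 :: "('a::{t2_space, second_countable_topology}, 'e::real_normed_vector) lie_group"
    and G\<^sub>2 :: "('b::{t2_space, second_countable_topology}, 'f::real_normed_vector) lie_group"
  assumes G: "compact_topological_group G\<^sub>1" "compact_topological_group G\<^sub>2"
    and M: "normalized_haar G\<^sub>1 M\<^sub>1" "normalized_haar G\<^sub>2 M\<^sub>2"
  shows "normalized_haar (lie_prod G\<^sub>1 G\<^sub>2) (M\<^sub>1 \<Otimes>\<^sub>M M\<^sub>2)"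
  unfolding normalized_haar_def
proof (intro conjI allI)
  interpret G1: compact_topological_group G\<^sub>1 by fact
  interpret G2: compact_topological_group G\<^sub>2 by fact
  have s: "sets M\<^sub>1 = sets borel" "sets M\<^sub>2 = sets borel" using M by (auto simp: normalized_haar_def)
  interpret M1: prob_space M\<^sub>1 using M by (simp add: normalized_haar_def)
  interpret M2: prob_space M\<^sub>2 using M by (simp add: normalized_haar_def)
  interpret P: pair_prob_space M\<^sub>1 M\<^sub>2 ..
  show sP: "sets (M\<^sub>1 \<Otimes>\<^sub>M M\<^sub>2) = sets borel"
    unfolding borel_prod[symmetric] by (rule sets_pair_measure_cong[OF s])
  show "prob_space (M\<^sub>1 \<Otimes>\<^sub>M M\<^sub>2)" by (rule P.prob_space_axioms)
  fix g :: "'a \<times> 'b"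
  let ?f1 = "\<lambda>x. fst g \<otimes>\<^bsub>G\<^sub>1\<^esub> x" and ?f2 = "\<lambda>x. snd g \<otimes>\<^bsub>G\<^sub>2\<^esub> x"
  have d: "distr M\<^sub>1 borel ?f1 = M\<^sub>1" "distr M\<^sub>2 borel ?f2 = M\<^sub>2" using M by (auto simp: normalized_haar_def)
  have "distr M\<^sub>1 borel ?f1 \<Otimes>\<^sub>M distr M\<^sub>2 borel ?f2 = distr (M\<^sub>1 \<Otimes>\<^sub>M M\<^sub>2) (borel \<Otimes>\<^sub>M borel) (\<lambda>(x, y). (?f1 x, ?f2 y))"
    by (rule pair_measure_distr)
      (use G1.measurable_lmult G2.measurable_lmult s d M2.sigma_finite_measure_axioms in \<open>auto simp: measurable_cong_sets[OF s(1) refl] measurable_cong_sets[OF s(2) refl]\<close>)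
  from this[symmetric] show "distr (M\<^sub>1 \<Otimes>\<^sub>M M\<^sub>2) borel (\<lambda>x. g \<otimes>\<^bsub>lie_prod G\<^sub>1 G\<^sub>2\<^esub> x) = M\<^sub>1 \<Otimes>\<^sub>M M\<^sub>2"
    by (simp add: d borel_prod case_prod_unfold)
qed

section \<open>Bump functions\<close>

text \<open>The standard flat function exp(-1/t), extended by zero, with a polynomial factor in 1/t;
  letting the polynomial vary makes the family closed under differentiation.\<close>

definition flat_fun :: "real poly \<Rightarrow> real \<Rightarrow> real" where
  "flat_fun p t = (if t > 0 then poly p (1 / t) * exp (- (1 / t)) else 0)"

lemma poly_exp_tendsto_0: "((\<lambda>s. poly p s * exp (- s)) \<longlongrightarrow> (0::real)) at_top"
proof -
  have "((\<lambda>s. \<Sum>i\<le>degree p. coeff p i * (s ^ i / exp s)) \<longlongrightarrow> (\<Sum>i\<le>degree p. coeff p i * 0)) at_top"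
    by (intro tendsto_intros tendsto_power_div_exp_0)
  moreover have "(\<Sum>i\<le>degree p. coeff p i * (s ^ i / exp s)) = poly p s * exp (- s)" for s
    by (simp add: poly_altdef exp_minus sum_distrib_right divide_inverse mult.assoc)
  ultimately show ?thesis by simp
qed

lemma flat_fun_tendsto_0: "(flat_fun p \<longlongrightarrow> 0) (at 0)"
proof (rule filterlim_split_at)
  have "eventually (\<lambda>t. 0 = flat_fun p t) (at_left 0)"
    by (auto simp: eventually_at_filter flat_fun_def)
  thus "(flat_fun p \<longlongrightarrow> 0) (at_left 0)" by (rule Lim_transform_eventually[OF tendsto_const])
  have "((\<lambda>t. poly p (inverse t) * exp (- inverse t)) \<longlongrightarrow> 0) (at_right 0)"
    by (rule filterlim_compose[OF poly_exp_tendsto_0 filterlim_inverse_at_top_right])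
  moreover have "eventually (\<lambda>t. poly p (inverse t) * exp (- inverse t) = flat_fun p t) (at_right 0)"
    by (auto simp: eventually_at_filter flat_fun_def inverse_eq_divide)
  ultimately show "(flat_fun p \<longlongrightarrow> 0) (at_right 0)" by (rule Lim_transform_eventually)
qed

text \<open>With s = 1/t one has ds/dt = -s^2, so p(s) exp(-s) has derivative s^2 (p(s) - p'(s))
  exp(-s). At zero the difference quotient is the flat function of the polynomial s p(s), which
  tends to 0.\<close>

lemma flat_fun_deriv:
  "(flat_fun p has_real_derivative flat_fun ([:0, 0, 1:] * (p - pderiv p)) t) (at t)"
proof -
  consider "t < 0" | "t = 0" | "t > 0" by linarith
  thus ?thesis
  proof cases
    case 1
    have "((\<lambda>_. 0) has_real_derivative 0) (at t)" by simp
    moreover have "eventually (\<lambda>s. 0 = flat_fun p s) (nhds t)"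
      by (rule eventually_nhds_in_open[of "{..<0}", THEN eventually_mono]) (use 1 in \<open>auto simp: flat_fun_def\<close>)
    ultimately have "(flat_fun p has_real_derivative 0) (at t)"
      using DERIV_cong_ev[of t t "\<lambda>_. 0" "flat_fun p" 0 0] by auto
    thus ?thesis using 1 by (simp add: flat_fun_def)
  next
    case 2
    have "((\<lambda>h. flat_fun ([:0, 1:] * p) h) \<longlongrightarrow> 0) (at 0)" by (rule flat_fun_tendsto_0)
    moreover have "eventually (\<lambda>h. flat_fun ([:0, 1:] * p) h = (flat_fun p (0 + h) - flat_fun p 0) / h) (at 0)"
      by (auto simp: eventually_at_filter flat_fun_def)
    ultimately have "((\<lambda>h. (flat_fun p (0 + h) - flat_fun p 0) / h) \<longlongrightarrow> 0) (at 0)"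
      by (rule Lim_transform_eventually)
    thus ?thesis using 2 by (simp add: DERIV_def flat_fun_def)
  next
    case 3
    have inv: "((\<lambda>t. 1 / t) has_real_derivative - (1 / t^2)) (at t)"
      using 3 by (auto intro!: derivative_eq_intros simp: power2_eq_square)
    have e: "((\<lambda>t. exp (- (1 / t))) has_real_derivative exp (- (1 / t)) * (1 / t^2)) (at t)"
      using DERIV_fun_exp[OF DERIV_minus[OF inv]] by simp
    have pd: "((\<lambda>t. poly p (1 / t)) has_real_derivative poly (pderiv p) (1 / t) * (- (1 / t^2))) (at t)"
      by (rule DERIV_chain2[OF poly_DERIV inv])
    have D: "((\<lambda>t. poly p (1 / t) * exp (- (1 / t))) has_real_derivative
        flat_fun ([:0, 0, 1:] * (p - pderiv p)) t) (at t)"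
      using DERIV_mult[OF pd e] 3 by (simp add: flat_fun_def algebra_simps power2_eq_square)
    have ev: "eventually (\<lambda>s. poly p (1 / s) * exp (- (1 / s)) = flat_fun p s) (nhds t)"
      by (rule eventually_nhds_in_open[of "{0<..}", THEN eventually_mono]) (use 3 in \<open>auto simp: flat_fun_def\<close>)
    show ?thesis by (rule iffD1[OF DERIV_cong_ev[OF refl ev refl] D])
  qed
qed

lemma smooth_on_flat_fun: "smooth_on S (flat_fun p)"
proof -
  have "Ck_on k UNIV (flat_fun p)" for k
  proof (induction k arbitrary: p)
    case 0
    have "continuous_on UNIV (flat_fun p)"
      using DERIV_isCont[OF flat_fun_deriv] by (simp add: continuous_at_imp_continuous_on)
    thus ?case by simp
  next
    case (Suc k)
    show ?case
    proof (rule Ck_on_SucI[OF open_UNIV])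
      fix x show "(flat_fun p has_derivative (*) (flat_fun ([:0, 0, 1:] * (p - pderiv p)) x)) (at x)"
        using flat_fun_deriv[of p x] unfolding has_field_derivative_def .
      show "Ck_on k UNIV (\<lambda>x. flat_fun ([:0, 0, 1:] * (p - pderiv p)) x * v)" for v
        by (rule Ck_on_bounded_bilinear[OF bounded_bilinear_mult open_UNIV Suc.IH Ck_on_const])
    qed
  qed
  thus ?thesis using smooth_on_subset[of UNIV "flat_fun p" S] by (simp add: smooth_on_def)
qed

text \<open>A coordinate cube is a sum of finitely many segments, so its compactness follows by
  induction and rests on no Heine-Borel property of the normed space.\<close>

lemma compact_coefficient_cube:
  fixes B :: "'e::real_normed_vector set"
  assumes "finite B"
  shows "compact {\<Sum>b\<in>B. c b *\<^sub>R b |c. \<forall>b\<in>B. \<bar>c b\<bar> \<le> r}"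
  using assms
proof (induction B rule: finite_induct)
  case empty thus ?case by simp
next
  case (insert a B)
  have "compact ((\<lambda>t. t *\<^sub>R a) ` {-r..r})"
    by (intro compact_continuous_image continuous_intros compact_Icc)
  from compact_sums[OF this insert.IH]
  have "compact {x + y |x y. x \<in> (\<lambda>t. t *\<^sub>R a) ` {-r..r} \<and> y \<in> {\<Sum>b\<in>B. c b *\<^sub>R b |c. \<forall>b\<in>B. \<bar>c b\<bar> \<le> r}}" .
  also have "{x + y |x y. x \<in> (\<lambda>t. t *\<^sub>R a) ` {-r..r} \<and> y \<in> {\<Sum>b\<in>B. c b *\<^sub>R b |c. \<forall>b\<in>B. \<bar>c b\<bar> \<le> r}}
     = {\<Sum>b\<in>insert a B. c b *\<^sub>R b |c. \<forall>b\<in>insert a B. \<bar>c b\<bar> \<le> r}" (is "?L = ?R")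
  proof
    show "?L \<subseteq> ?R"
    proof clarify
      fix t c assume t: "t \<in> {-r..r}" and c: "\<forall>b\<in>B. \<bar>c b\<bar> \<le> r"
      have "(\<Sum>b\<in>insert a B. (c(a := t)) b *\<^sub>R b) = t *\<^sub>R a + (\<Sum>b\<in>B. c b *\<^sub>R b)"
        using insert.hyps by (simp, intro sum.cong) auto
      moreover have "\<forall>b\<in>insert a B. \<bar>(c(a := t)) b\<bar> \<le> r" using t c by auto
      ultimately show "\<exists>ca. t *\<^sub>R a + (\<Sum>b\<in>B. c b *\<^sub>R b) = (\<Sum>b\<in>insert a B. ca b *\<^sub>R b) \<and> (\<forall>b\<in>insert a B. \<bar>ca b\<bar> \<le> r)"
        by metis
    qed
    show "?R \<subseteq> ?L"
    proof clarify
      fix c assume c: "\<forall>b\<in>insert a B. \<bar>c b\<bar> \<le> r"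
      hence "c a *\<^sub>R a \<in> (\<lambda>t. t *\<^sub>R a) ` {-r..r}" by (auto simp: abs_le_iff)
      moreover have "(\<Sum>b\<in>insert a B. c b *\<^sub>R b) = c a *\<^sub>R a + (\<Sum>b\<in>B. c b *\<^sub>R b)" using insert.hyps by simp
      ultimately show "\<exists>x y. (\<Sum>b\<in>insert a B. c b *\<^sub>R b) = x + y \<and> x \<in> (\<lambda>t. t *\<^sub>R a) ` {-r..r} \<and> y \<in> {\<Sum>b\<in>B. c b *\<^sub>R b |c. \<forall>b\<in>B. \<bar>c b\<bar> \<le> r}"
        using c by blast
    qed
  qed
  finally show ?case .
qed

lemma compact_cube:
  fixes B :: "'e::real_normed_vector set"
  assumes B: "finite B" "independent B" "span B = UNIV"
  shows "compact {v. \<forall>b\<in>B. \<bar>representation B (v - p) b\<bar> \<le> r}"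
proof -
  have "{v. \<forall>b\<in>B. \<bar>representation B (v - p) b\<bar> \<le> r} = (+) p ` {\<Sum>b\<in>B. c b *\<^sub>R b |c. \<forall>b\<in>B. \<bar>c b\<bar> \<le> r}" (is "?L = ?R")
  proof
    show "?L \<subseteq> ?R"
    proof clarify
      fix v assume v: "\<forall>b\<in>B. \<bar>representation B (v - p) b\<bar> \<le> r"
      show "v \<in> ?R"
      proof (rule image_eqI[of _ _ "\<Sum>b\<in>B. representation B (v - p) b *\<^sub>R b"])
        show "v = p + (\<Sum>b\<in>B. representation B (v - p) b *\<^sub>R b)" by (simp add: basis_expansion[OF B])
        show "(\<Sum>b\<in>B. representation B (v - p) b *\<^sub>R b) \<in> {\<Sum>b\<in>B. c b *\<^sub>R b |c. \<forall>b\<in>B. \<bar>c b\<bar> \<le> r}"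
          using v by blast
      qed
    qed
    show "?R \<subseteq> ?L"
    proof clarify
      fix c b assume c: "\<forall>b\<in>B. \<bar>c b\<bar> \<le> r" and b: "b \<in> B"
      have "representation B (\<Sum>b\<in>B. c b *\<^sub>R b) b = (\<Sum>b'\<in>B. c b' * representation B b' b)"
        using B by (simp add: real_vector.representation_sum real_vector.representation_scale)
      also have "\<dots> = (\<Sum>b'\<in>B. if b' = b then c b' else 0)"
        by (intro sum.cong refl) (auto simp: real_vector.representation_basis[OF B(2)])
      also have "\<dots> = c b" using b B(1) by simp
      finally show "\<bar>representation B (p + (\<Sum>b\<in>B. c b *\<^sub>R b) - p) b\<bar> \<le> r" using c b by simp
    qed
  qed
  thus ?thesis using compact_translation[OF compact_coefficient_cube[OF B(1)]] by simp
qed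

text \<open>Coordinate cubes serve as basic neighbourhoods: they are compact, and they are also the
  boxes along which one later integrates one coordinate at a time.\<close>

lemma cube_subset_open:
  fixes B :: "'e::real_normed_vector set"
  assumes B: "finite B" "independent B" "span B = UNIV" and W: "open W" "p \<in> W"
  obtains r where "r > 0" "{v. \<forall>b\<in>B. \<bar>representation B (v - p) b\<bar> \<le> r} \<subseteq> W"
proof -
  obtain e where e: "e > 0" "ball p e \<subseteq> W" using W open_contains_ball by blast
  \<comment> \<open>A vector with coordinates at most \<open>r\<close> has norm at most
    \<open>r * m\<close>, which is half of \<open>e\<close>. The summand 1 keeps \<open>m\<close>
    positive in dimension 0.\<close>
  define m where "m = (\<Sum>b\<in>B. norm b) + 1"
  have m: "m > 0" unfolding m_def by (intro add_nonneg_pos sum_nonneg) auto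
  define r where "r = e / (2 * m)"
  have r: "r > 0" using e m by (simp add: r_def)
  have "{v. \<forall>b\<in>B. \<bar>representation B (v - p) b\<bar> \<le> r} \<subseteq> W"
  proof clarify
    fix v assume v: "\<forall>b\<in>B. \<bar>representation B (v - p) b\<bar> \<le> r"
    have "norm (v - p) = norm (\<Sum>b\<in>B. representation B (v - p) b *\<^sub>R b)" by (simp add: basis_expansion[OF B])
    also have "\<dots> \<le> (\<Sum>b\<in>B. r * norm b)" using v by (intro sum_norm_le) (auto intro!: mult_right_mono)
    also have "\<dots> \<le> r * m" using r by (simp add: sum_distrib_left[symmetric] m_def)
    also have "\<dots> < e" using e m by (simp add: r_def)
    finally show "v \<in> W" using e by (auto simp: dist_norm norm_minus_commute)
  qed
  with r that show thesis by blast
qed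

text \<open>The bump lives in a cube inside one chart and is zero elsewhere. The set
  \<open>K\<close> corresponding to the cube is compact, hence closed in a Hausdorff space, so every
  point has a neighbourhood either inside the chart domain or off \<open>K\<close>, and in both
  cases the function is smooth on it.\<close>

lemma manifold_bump:
  fixes H :: "('a::t2_space, 'e::real_normed_vector) lie_group"
  assumes H: "manifold (atlas H)" and W: "open W" "x\<^sub>0 \<in> W"
  obtains f where "(\<lambda>x. complex_of_real (f x)) \<in> C_inf H" "\<And>x. f x \<ge> 0" "f x\<^sub>0 > 0" "\<And>x. x \<notin> W \<Longrightarrow> f x = 0"
proof -
  obtain U \<phi> where U: "(U, \<phi>) \<in> atlas H" "x\<^sub>0 \<in> U" using chart_ex[OF H] by blast
  note ch = chartD[OF H U(1)]
  obtain B :: "'e set" where B: "finite B" "independent B" "span B = UNIV"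
    using fin_dim_basis[OF manifold_fin_dim[OF H]] by blast
  have op: "open (\<phi> ` U \<inter> inv_into U \<phi> -` W)" by (rule continuous_open_preimage[OF ch(5,2) W(1)])
  have "\<phi> x\<^sub>0 \<in> \<phi> ` U \<inter> inv_into U \<phi> -` W" using U W ch(6) by auto
  from cube_subset_open[OF B op this] obtain r where r: "r > 0"
    "{v. \<forall>b\<in>B. \<bar>representation B (v - \<phi> x\<^sub>0) b\<bar> \<le> r} \<subseteq> \<phi> ` U \<inter> inv_into U \<phi> -` W" by blast
  define Q where "Q = {v. \<forall>b\<in>B. \<bar>representation B (v - \<phi> x\<^sub>0) b\<bar> \<le> r}"
  have Q: "compact Q" "Q \<subseteq> \<phi> ` U" "Q \<subseteq> inv_into U \<phi> -` W"
    using r compact_cube[OF B] by (auto simp: Q_def)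
  define K where "K = inv_into U \<phi> ` Q"
  have K: "closed K" "K \<subseteq> U" "K \<subseteq> W"
  proof -
    have "compact K" unfolding K_def
      by (rule compact_continuous_image[OF continuous_on_subset[OF ch(5) Q(2)] Q(1)])
    thus "closed K" by (rule compact_imp_closed)
    show "K \<subseteq> U" "K \<subseteq> W" using Q ch(7) by (auto simp: K_def)
  qed
  \<comment> \<open>Positive only inside the coordinate ball of radius \<open>r\<close>, which lies
    in the cube \<open>Q\<close>; composing with a flat function cuts off smoothly at its
    boundary.\<close>
  define N where "N v = r\<^sup>2 - (\<Sum>b\<in>B. (representation B (v - \<phi> x\<^sub>0) b) * (representation B (v - \<phi> x\<^sub>0) b))" for v
  define f where "f x = (if x \<in> U then flat_fun 1 (N (\<phi> x)) else 0)" for x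
  have N: "smooth_on UNIV N"
  proof -
    have 1: "smooth_on UNIV (\<lambda>v. representation B (v + - \<phi> x\<^sub>0) b)" if "b \<in> B" for b
      by (rule smooth_on_bounded_linear[OF bounded_linear_representation[OF B that] open_UNIV
            smooth_on_add[OF open_UNIV smooth_on_id smooth_on_const]])
    have "smooth_on UNIV (\<lambda>v. \<Sum>b\<in>B. (representation B (v + - \<phi> x\<^sub>0) b) * (representation B (v + - \<phi> x\<^sub>0) b))"
      by (rule smooth_on_sum[OF open_UNIV], rule smooth_on_mult[OF open_UNIV]; rule 1)
    from smooth_on_add[OF open_UNIV smooth_on_const smooth_on_mult[OF open_UNIV smooth_on_const this], of "r\<^sup>2" "-1"]
    show ?thesis by (simp add: N_def[abs_def])
  qed
  have fK: "f x = 0" if "x \<notin> K" for x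
  proof (cases "x \<in> U")
    case True
    have "\<phi> x \<notin> Q"
    proof
      assume "\<phi> x \<in> Q"
      hence "inv_into U \<phi> (\<phi> x) \<in> K" unfolding K_def by (rule imageI)
      thus False using that True ch(6) by simp
    qed
    then obtain b where b: "b \<in> B" "\<bar>representation B (\<phi> x - \<phi> x\<^sub>0) b\<bar> > r" by (auto simp: Q_def not_le)
    have "r\<^sup>2 \<le> (representation B (\<phi> x - \<phi> x\<^sub>0) b)\<^sup>2" using b r(1) by (simp add: abs_le_square_iff[symmetric])
    also have "\<dots> \<le> (\<Sum>b\<in>B. (representation B (\<phi> x - \<phi> x\<^sub>0) b)\<^sup>2)" using b B(1) by (intro member_le_sum) auto
    finally have "N (\<phi> x) \<le> 0" by (simp add: N_def power2_eq_square)
    thus ?thesis by (simp add: f_def flat_fun_def)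
  qed (simp add: f_def)
  have "(\<lambda>x. complex_of_real (f x)) \<in> C_inf H" unfolding C_inf_iff[OF H]
  proof (clarify)
    fix V \<psi> assume V: "(V, \<psi>) \<in> atlas H"
    note cV = chartD[OF H V]
    show "smooth_on (\<psi> ` V) (\<lambda>x. complex_of_real (f (inv_into V \<psi> x)))"
    proof (rule smooth_on_local)
      fix y assume y: "y \<in> \<psi> ` V"
      show "\<exists>T. open T \<and> y \<in> T \<and> smooth_on T (\<lambda>x. complex_of_real (f (inv_into V \<psi> x)))"
      proof (cases "inv_into V \<psi> y \<in> U")
        case True
        define T where "T = \<psi> ` V \<inter> inv_into V \<psi> -` U"
        have T: "open T" "y \<in> T" unfolding T_def
          using continuous_open_preimage[OF cV(5,2) ch(1)] True y by auto
        have "smooth_on T (\<lambda>x. \<phi> (inv_into V \<psi> x))"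
          using msmoothD[OF msmooth_chart_inv[OF H V] U(1)] by (simp add: T_def)
        from smooth_on_compose[OF manifold_fin_dim[OF H] T(1) open_UNIV _ this N]
        have "smooth_on T (\<lambda>x. N (\<phi> (inv_into V \<psi> x)))" by simp
        from smooth_on_compose[OF fin_dim_real T(1) open_UNIV _ this smooth_on_flat_fun]
        have "smooth_on T (\<lambda>x. flat_fun 1 (N (\<phi> (inv_into V \<psi> x))))" by simp
        from smooth_on_bounded_linear[OF bounded_linear_of_real T(1) this]
        have "smooth_on T (\<lambda>x. complex_of_real (flat_fun 1 (N (\<phi> (inv_into V \<psi> x)))))" .
        hence "smooth_on T (\<lambda>x. complex_of_real (f (inv_into V \<psi> x)))"
          by (subst (asm) smooth_on_cong[OF T(1), of _ "\<lambda>x. complex_of_real (f (inv_into V \<psi> x))"])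
             (auto simp: f_def T_def)
        with T show ?thesis by blast
      next
        case False
        define T where "T = \<psi> ` V \<inter> inv_into V \<psi> -` (- K)"
        have T: "open T" "y \<in> T" unfolding T_def
          using continuous_open_preimage[OF cV(5,2), of "- K"] K False y by auto
        have "smooth_on T (\<lambda>x. complex_of_real (f (inv_into V \<psi> x)))"
          by (subst smooth_on_cong[OF T(1), of _ "\<lambda>x. 0"]) (auto simp: fK T_def)
        with T show ?thesis by blast
      qed
    qed
  qed
  moreover have "f x \<ge> 0" for x by (simp add: f_def flat_fun_def)
  moreover have "f x\<^sub>0 > 0"
    using U(2) r(1) B by (simp add: f_def N_def flat_fun_def real_vector.representation_zero)
  moreover have "f x = 0" if "x \<notin> W" for x using fK K that by blast
  ultimately show thesis using that by blast
qed

section \<open>Smoothness of representations\<close>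

text \<open>In a chart for the parameter, derivatives in \<open>s\<close> are joint derivatives in
  directions of the form (v, 0), and therefore continuous in both variables.\<close>

lemma param_smooth_C_inf:
  fixes G :: "('g::topological_space, 'h::real_normed_vector) lie_group"
    and \<B> :: "('b::topological_space, 'c::real_normed_vector) chart set"
  assumes G: "manifold (atlas G)" and B: "manifold \<B>" and S: "open S" and f: "f \<in> C_inf G"
    and \<Omega>: "\<And>V \<psi>. (V, \<psi>) \<in> \<B> \<Longrightarrow> msmooth (S \<times> \<psi> ` V) (atlas G) (\<lambda>z. \<Omega> (fst z) (inv_into V \<psi> (snd z)))"
  shows "param_smooth S (\<lambda>s y. f (\<Omega> s y))"
proof -
  have sm: "smooth_on (S \<times> \<psi> ` V) (\<lambda>z. f (\<Omega> (fst z) (inv_into V \<psi> (snd z))))" if "(V, \<psi>) \<in> \<B>" for V \<psi>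
    by (rule C_inf_compose[OF G f _ \<Omega>[OF that]]) (intro open_Times S chartD(2)[OF B that])
  have ev: "iter_deriv vs (\<lambda>s. f (\<Omega> s y)) s =
       iter_deriv (map (\<lambda>v. (v, 0)) vs) (\<lambda>z. f (\<Omega> (fst z) (inv_into V \<psi> (snd z)))) (s, \<psi> y)"
    and df: "iter_deriv vs (\<lambda>s. f (\<Omega> s y)) differentiable (at s)"
    if V: "(V, \<psi>) \<in> \<B>" "y \<in> V" and s: "s \<in> S" for V \<psi> y s vs
  proof -
    have op: "open (S \<times> \<psi> ` V)" by (intro open_Times S chartD(2)[OF B V(1)])
    have z: "(s, \<psi> y) \<in> S \<times> \<psi> ` V" using s V by simp
    show "iter_deriv vs (\<lambda>s. f (\<Omega> s y)) s =
       iter_deriv (map (\<lambda>v. (v, 0)) vs) (\<lambda>z. f (\<Omega> (fst z) (inv_into V \<psi> (snd z)))) (s, \<psi> y)"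
     and "iter_deriv vs (\<lambda>s. f (\<Omega> s y)) differentiable (at s)"
      using iter_deriv_slice1[OF op sm[OF V(1)] z, of vs] by (simp_all add: chartD(6)[OF B V])
  qed
  show ?thesis unfolding param_smooth_def
  proof (intro allI conjI ballI)
    fix vs y s assume s: "s \<in> S"
    obtain V \<psi> where V: "(V, \<psi>) \<in> \<B>" "y \<in> V" using chart_ex[OF B] by blast
    show "iter_deriv vs (\<lambda>s. f (\<Omega> s y)) differentiable (at s)" by (rule df[OF V s])
  next
    fix vs
    have "continuous_on (\<Union>c\<in>\<B>. S \<times> fst c) (\<lambda>(s, y). iter_deriv vs (\<lambda>s. f (\<Omega> s y)) s)"
    proof (rule continuous_on_open_UN)
      fix c assume c: "c \<in> \<B>"
      obtain V \<psi> where V: "c = (V, \<psi>)" by (cases c)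
      with c have V': "(V, \<psi>) \<in> \<B>" by simp
      show "open (S \<times> fst c)" using V S chartD(1)[OF B V'] by (auto intro: open_Times)
      have ct: "continuous_on (S \<times> V) (\<lambda>p. (fst p, \<psi> (snd p)))"
        by (intro continuous_on_Pair continuous_on_fst continuous_on_id
            continuous_on_compose2[OF chartD(4)[OF B V'] continuous_on_snd[OF continuous_on_id]]) auto
      have "continuous_on (S \<times> V) (\<lambda>p. iter_deriv (map (\<lambda>v. (v, 0)) vs) (\<lambda>z. f (\<Omega> (fst z) (inv_into V \<psi> (snd z)))) (fst p, \<psi> (snd p)))"
        by (rule continuous_on_compose2[OF smooth_on_continuous_on[OF smooth_on_iter_deriv[OF sm[OF V']]] ct]) auto
      moreover have "continuous_on (S \<times> V) (\<lambda>(s, y). iter_deriv vs (\<lambda>s. f (\<Omega> s y)) s) \<longleftrightarrow>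
         continuous_on (S \<times> V) (\<lambda>p. iter_deriv (map (\<lambda>v. (v, 0)) vs) (\<lambda>z. f (\<Omega> (fst z) (inv_into V \<psi> (snd z)))) (fst p, \<psi> (snd p)))"
        by (rule continuous_on_cong[OF refl]) (auto simp: ev[OF V'])
      ultimately show "continuous_on (S \<times> fst c) (\<lambda>(s, y). iter_deriv vs (\<lambda>s. f (\<Omega> s y)) s)"
        by (simp add: V)
    qed
    moreover have "S \<times> UNIV \<subseteq> (\<Union>c\<in>\<B>. S \<times> fst c)"
    proof clarify
      fix s y assume s: "s \<in> S"
      obtain V \<psi> where V: "(V, \<psi>) \<in> \<B>" "y \<in> V" using chart_ex[OF B] by blast
      show "(s, y) \<in> (\<Union>c\<in>\<B>. S \<times> fst c)" by (rule UN_I[OF V(1)]) (use s V in simp)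
    qed
    ultimately show "continuous_on (S \<times> UNIV) (\<lambda>(s, y). iter_deriv vs (\<lambda>s. f (\<Omega> s y)) s)"
      by (rule continuous_on_subset)
  qed
qed

lemma param_smooth_cmult:
  assumes S: "open S" and k: "continuous_on UNIV k" and f: "param_smooth S f"
  shows "param_smooth S (\<lambda>s y. k y * f s y)"
    and "s \<in> S \<Longrightarrow> iter_deriv vs (\<lambda>s. k y * f s y) s = k y * iter_deriv vs (\<lambda>s. f s y) s"
proof -
  have sm: "smooth_on S (\<lambda>s. f s y)" for y using f by (auto simp: param_smooth_def smooth_on_iff)
  have eq: "iter_deriv vs (\<lambda>s. k y * f s y) s = k y * iter_deriv vs (\<lambda>s. f s y) s" if "s \<in> S" for vs y s
    by (rule iter_deriv_cmult[OF S sm that])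
  thus "s \<in> S \<Longrightarrow> iter_deriv vs (\<lambda>s. k y * f s y) s = k y * iter_deriv vs (\<lambda>s. f s y) s" .
  have "smooth_on S (\<lambda>s. k y * f s y)" for y by (rule smooth_on_mult[OF S smooth_on_const sm])
  moreover have "continuous_on (S \<times> UNIV) (\<lambda>(s, y). iter_deriv vs (\<lambda>s. k y * f s y) s)" for vs
  proof -
    have "continuous_on (S \<times> UNIV) (\<lambda>(s, y). k y * iter_deriv vs (\<lambda>s. f s y) s)"
      using f unfolding param_smooth_def split_beta
      by (intro continuous_on_mult continuous_on_compose2[OF k continuous_on_snd[OF continuous_on_id]]) auto
    moreover have "continuous_on (S \<times> UNIV) (\<lambda>(s, y). iter_deriv vs (\<lambda>s. k y * f s y) s) \<longleftrightarrow>
       continuous_on (S \<times> UNIV) (\<lambda>(s, y). k y * iter_deriv vs (\<lambda>s. f s y) s)"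
      by (rule continuous_on_cong[OF refl]) (auto simp: eq)
    ultimately show ?thesis by simp
  qed
  ultimately show "param_smooth S (\<lambda>s y. k y * f s y)"
    unfolding param_smooth_def smooth_on_iff by blast
qed

lemma index_mult_mat_sum:
  assumes "A \<in> carrier_mat n m" "B \<in> carrier_mat m k" "i < n" "j < k"
  shows "(A * B) $$ (i, j) = (\<Sum>l<m. A $$ (i, l) * B $$ (l, j))"
  using assms by (simp add: scalar_prod_def atLeast0LessThan)

lemma index_mat_adjoint:
  fixes A :: "complex mat"
  assumes "A \<in> carrier_mat n m" "i < m" "j < n"
  shows "mat_adjoint A $$ (i, j) = cnj (A $$ (j, i))"
  using assms by (simp add: mat_adjoint_def mat_of_rows_def)

lemma mat_adjoint_carrier: "A \<in> carrier_mat n m \<Longrightarrow> mat_adjoint A \<in> carrier_mat m n"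
  unfolding mat_adjoint_def by (intro carrier_matI) auto

section \<open>Compact Lie groups with normalized Haar measure\<close>

locale compact_lie = compact_topological_group H for H :: "('a::{t2_space, second_countable_topology}, 'e::real_normed_vector) lie_group" (structure) +
  fixes M :: "'a measure"
  assumes lie: "compact_lie_group H" and haar: "normalized_haar H M"
begin

lemma mfd: "manifold (atlas H)"
  using lie unfolding compact_lie_group_def manifold_def fin_dim_def by blast

lemma msmooth_mult:
  assumes "open S" "msmooth S (atlas H) F" "msmooth S (atlas H) F'"
  shows "msmooth S (atlas H) (\<lambda>x. F x \<otimes> F' x)"
proof -
  have "smooth_map (prod_atlas (atlas H) (atlas H)) (atlas H) (\<lambda>(x, y). x \<otimes> y)"
    using lie by (simp add: compact_lie_group_def)
  from msmooth_compose[OF manifold_prod[OF mfd mfd] mfd this assms(1) msmooth_Pair[OF mfd mfd assms]]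
  show ?thesis by simp
qed

lemma msmooth_inv:
  assumes "open S" "msmooth S (atlas H) F"
  shows "msmooth S (atlas H) (\<lambda>x. inv (F x))"
proof -
  have "smooth_map (atlas H) (atlas H) (\<lambda>x. inv x)" using lie by (simp add: compact_lie_group_def)
  from msmooth_compose[OF mfd mfd this assms] show ?thesis .
qed

sublocale M: prob_space M using haar by (simp add: normalized_haar_def)

lemma sets_M: "sets M = sets borel" using haar by (simp add: normalized_haar_def)

lemma finite_M: "finite_measure M" by (rule M.finite_measure_axioms)

lemma space_M: "space M = UNIV" using sets_eq_imp_space_eq[OF sets_M] by simp

lemma integrable_cont:
  fixes f :: "'a \<Rightarrow> 'c::{banach, second_countable_topology}"
  shows "continuous_on UNIV f \<Longrightarrow> integrable M f"
  by (rule integrable_continuous_compact[OF compact_UNIV finite_M sets_M])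

lemma integral_left:
  fixes f :: "'a \<Rightarrow> 'c::{banach, second_countable_topology}"
  shows "continuous_on UNIV f \<Longrightarrow> (\<integral>x. f (g \<otimes> x) \<partial>M) = (\<integral>x. f x \<partial>M)"
  by (rule haar_integral_left[OF haar borel_measurable_continuous_onI])

lemma integral_right:
  fixes f :: "'a \<Rightarrow> 'c::{banach, second_countable_topology}"
  shows "continuous_on UNIV f \<Longrightarrow> (\<integral>x. f (x \<otimes> g) \<partial>M) = (\<integral>x. f x \<partial>M)"
  by (rule haar_integral_right[OF haar borel_measurable_continuous_onI])

text \<open>If \<open>W\<close> had measure zero, so would all its translates; but finitely many of
  them cover the compact group, which has measure 1.\<close>

lemma measure_open_pos:
  assumes W: "open W" "W \<noteq> {}"
  shows "measure M W > 0"
proof (rule ccontr)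
  assume "\<not> ?thesis"
  hence 0: "measure M W = 0" using measure_nonneg[of M W] by linarith
  obtain w where w: "w \<in> W" using W by blast
  define T where "T g = (\<lambda>x. g \<otimes> x) -` W" for g
  have T: "open (T g)" for g unfolding T_def
    by (rule open_vimage[OF W(1)]) (intro continuous_intros continuous_on_const continuous_on_id)
  have mT: "measure M (T g) = 0" for g
  proof -
    have "distr M borel (\<lambda>x. g \<otimes> x) = M" using haar by (simp add: normalized_haar_def)
    hence "measure M W = measure (distr M borel (\<lambda>x. g \<otimes> x)) W" by simp
    also have "\<dots> = measure M (T g)" unfolding T_def
      by (subst measure_distr) (use measurable_lmult W in \<open>auto simp: measurable_cong_sets[OF sets_M refl] space_M\<close>)
    finally show ?thesis using 0 by simp
  qed
  have "x \<in> T (w \<otimes> inv x)" for x using w by (simp add: T_def m_assoc)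
  hence "UNIV \<subseteq> (\<Union>g\<in>UNIV. T g)" by blast
  then obtain X where X: "finite X" "UNIV \<subseteq> (\<Union>g\<in>X. T g)"
    using compactE_image[OF compact_UNIV, of UNIV T] T by metis
  have "1 = measure M UNIV" using M.prob_space by (simp add: space_M)
  also have "\<dots> = measure M (\<Union>g\<in>X. T g)" using X by (simp add: top.extremum_unique)
  also have "\<dots> \<le> (\<Sum>g\<in>X. measure M (T g))"
    using X T by (intro M.finite_measure_subadditive_finite) (auto simp: sets_M)
  also have "\<dots> = 0" by (simp add: mT)
  finally show False by simp
qed

lemma integral_pos:
  fixes f :: "'a \<Rightarrow> real"
  assumes f: "continuous_on UNIV f" "\<And>x. f x \<ge> 0" "f x\<^sub>0 > 0"
  shows "(\<integral>x. f x \<partial>M) > 0"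
proof -
  define c where "c = f x\<^sub>0 / 2"
  define W where "W = f -` {c<..}"
  have W: "open W" unfolding W_def by (rule open_vimage[OF open_greaterThan f(1)])
  have "x\<^sub>0 \<in> W" using f(3) by (simp add: W_def c_def)
  hence "0 < measure M W" using measure_open_pos[OF W] by blast
  hence "0 < c * measure M W" using f(3) by (simp add: c_def)
  also have "c * measure M W = (\<integral>x. c * indicator W x \<partial>M)"
    using W by (simp add: sets_M space_M)
  also have "\<dots> \<le> (\<integral>x. f x \<partial>M)"
  proof (rule integral_mono)
    show "integrable M (\<lambda>x. c * indicator W x)" using W by (simp add: sets_M M.emeasure_finite less_top[symmetric])
    show "c * indicator W x \<le> f x" for x using f(2)[of x] by (auto simp: W_def indicator_def less_imp_le)
  qed (rule integrable_cont[OF f(1)])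
  finally show ?thesis .
qed

lemma repD:
  assumes "irreducible_rep H \<xi>"
  defines "d \<equiv> rep_dim H \<xi>"
  shows "d > 0" "\<xi> x \<in> carrier_mat d d" "mat_adjoint (\<xi> x) * \<xi> x = 1\<^sub>m d" "\<xi> (x \<otimes> y) = \<xi> x * \<xi> y"
    "i < d \<Longrightarrow> j < d \<Longrightarrow> continuous_on UNIV (\<lambda>x. \<xi> x $$ (i, j))"
    "invariant_subspace d \<xi> W \<Longrightarrow> W = {0\<^sub>v d} \<or> W = carrier_vec d"
  using assms unfolding irreducible_rep_def unitary_rep_def Let_def by auto

lemma rep_one: "irreducible_rep H \<xi> \<Longrightarrow> \<xi> \<one> = 1\<^sub>m (rep_dim H \<xi>)"
proof -
  assume irr: "irreducible_rep H \<xi>"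
  note r = repD[OF irr]
  have "\<xi> \<one> = 1\<^sub>m (rep_dim H \<xi>) * \<xi> \<one>" using r(2)[of \<one>] by simp
  also have "\<dots> = mat_adjoint (\<xi> \<one>) * (\<xi> \<one> * \<xi> \<one>)"
    using assoc_mult_mat[OF mat_adjoint_carrier[OF r(2)] r(2) r(2), of \<one> \<one> \<one>] r(3)[of \<one>] by simp
  also have "\<xi> \<one> * \<xi> \<one> = \<xi> \<one>" using r(4)[of \<one> \<one>] by simp
  also have "mat_adjoint (\<xi> \<one>) * \<xi> \<one> = 1\<^sub>m (rep_dim H \<xi>)" by (rule r(3))
  finally show ?thesis .
qed

lemma rep_inv: "irreducible_rep H \<xi> \<Longrightarrow> \<xi> (inv x) = mat_adjoint (\<xi> x)"
proof -
  assume irr: "irreducible_rep H \<xi>"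
  note r = repD[OF irr]
  have "\<xi> (inv x) = (mat_adjoint (\<xi> x) * \<xi> x) * \<xi> (inv x)" using r(2)[of "inv x"] r(3)[of x] by simp
  also have "\<dots> = mat_adjoint (\<xi> x) * (\<xi> x * \<xi> (inv x))"
    by (rule assoc_mult_mat[OF mat_adjoint_carrier[OF r(2)] r(2) r(2)])
  also have "\<xi> x * \<xi> (inv x) = 1\<^sub>m (rep_dim H \<xi>)" using r(4)[of x "inv x"] rep_one[OF irr] by simp
  finally show ?thesis using mat_adjoint_carrier[OF r(2)[of x]] by simp
qed

lemma rep_mult_index:
  assumes irr: "irreducible_rep H \<xi>" and "i < rep_dim H \<xi>" "j < rep_dim H \<xi>"
  shows "\<xi> (x \<otimes> y) $$ (i, j) = (\<Sum>k<rep_dim H \<xi>. \<xi> x $$ (i, k) * \<xi> y $$ (k, j))"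
  using index_mult_mat_sum[OF repD(2)[OF irr] repD(2)[OF irr] assms(2,3)] repD(4)[OF irr] by simp

lemma rep_inv_index:
  assumes irr: "irreducible_rep H \<xi>" and "i < rep_dim H \<xi>" "j < rep_dim H \<xi>"
  shows "\<xi> (inv x) $$ (i, j) = cnj (\<xi> x $$ (j, i))"
  using index_mat_adjoint[OF repD(2)[OF irr] assms(2,3)] rep_inv[OF irr] by simp

lemma rep_unitary_index:
  assumes irr: "irreducible_rep H \<xi>" and i: "i < rep_dim H \<xi>" "j < rep_dim H \<xi>"
  shows "(\<Sum>k<rep_dim H \<xi>. cnj (\<xi> x $$ (k, i)) * \<xi> x $$ (k, j)) = (if i = j then 1 else 0)"
proof -
  have "(\<Sum>k<rep_dim H \<xi>. \<xi> (inv x) $$ (i, k) * \<xi> x $$ (k, j)) = \<xi> (inv x \<otimes> x) $$ (i, j)"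
    by (rule rep_mult_index[OF assms, symmetric])
  also have "\<dots> = (if i = j then 1 else 0)" using rep_one[OF irr] i by simp
  finally show ?thesis using i by (simp add: rep_inv_index[OF irr])
qed

lemma C_inf_translate:
  assumes "f \<in> C_inf H"
  shows "(\<lambda>x. f (x \<otimes> g)) \<in> C_inf H"
  unfolding C_inf_iff[OF mfd]
proof clarify
  fix U \<phi> assume U: "(U, \<phi>) \<in> atlas H"
  show "smooth_on (\<phi> ` U) (\<lambda>x. f (inv_into U \<phi> x \<otimes> g))"
    by (intro C_inf_compose[OF mfd assms chartD(2)[OF mfd U]] msmooth_mult chartD(2)[OF mfd U]
        msmooth_chart_inv[OF mfd U] msmooth_const)
qed

text \<open>Convolving a representation with a smooth bump at the identity gives a nonzero vector with
  smooth orbit; the vectors with smooth orbit form an invariant subspace.\<close>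

lemma rep_smooth:
  assumes irr: "irreducible_rep H \<xi>" and i: "i < rep_dim H \<xi>" and j: "j < rep_dim H \<xi>"
  shows "(\<lambda>x. \<xi> x $$ (i, j)) \<in> C_inf H"
proof -
  define d where "d = rep_dim H \<xi>"
  note r = repD[OF irr, folded d_def]
  note ri = rep_mult_index[OF irr, folded d_def]
  define W where "W = {v \<in> carrier_vec d. \<forall>i<d. (\<lambda>x. \<Sum>k<d. \<xi> x $$ (i, k) * v $ k) \<in> C_inf H}"
  have inv: "invariant_subspace d \<xi> W"
    unfolding invariant_subspace_def
  proof (intro conjI ballI allI)
    show "W \<subseteq> carrier_vec d" by (auto simp: W_def)
    show "0\<^sub>v d \<in> W" by (auto simp: W_def C_inf_const[OF mfd])
    show "v + w \<in> W" if "v \<in> W" "w \<in> W" for v w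
    proof -
      have "(\<lambda>x. \<Sum>k<d. \<xi> x $$ (i, k) * (v + w) $ k) = (\<lambda>x. (\<Sum>k<d. \<xi> x $$ (i, k) * v $ k) + (\<Sum>k<d. \<xi> x $$ (i, k) * w $ k))" for i
        using that by (auto simp: W_def distrib_left sum.distrib)
      thus ?thesis using that C_inf_add[OF mfd] by (auto simp: W_def)
    qed
    show "c \<cdot>\<^sub>v v \<in> W" if "v \<in> W" for c v
    proof -
      have "(\<lambda>x. \<Sum>k<d. \<xi> x $$ (i, k) * (c \<cdot>\<^sub>v v) $ k) = (\<lambda>x. c * (\<Sum>k<d. \<xi> x $$ (i, k) * v $ k))" for i
        using that by (auto simp: W_def sum_distrib_left mult.left_commute)
      thus ?thesis using that C_inf_cmult[OF mfd] by (auto simp: W_def)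
    qed
    show "\<xi> z *\<^sub>v v \<in> W" if v: "v \<in> W" for z v
    proof -
      have vc: "v \<in> carrier_vec d" and vs: "\<And>i. i < d \<Longrightarrow> (\<lambda>x. \<Sum>k<d. \<xi> x $$ (i, k) * v $ k) \<in> C_inf H"
        using v by (auto simp: W_def)
      have "(\<lambda>x. \<Sum>k<d. \<xi> x $$ (i, k) * (\<xi> z *\<^sub>v v) $ k) = (\<lambda>x. \<Sum>k<d. \<xi> (x \<otimes> z) $$ (i, k) * v $ k)" if "i < d" for i
      proof
        fix x
        have "(\<Sum>k<d. \<xi> x $$ (i, k) * (\<xi> z *\<^sub>v v) $ k) = (\<Sum>k<d. \<xi> x $$ (i, k) * (\<Sum>l<d. \<xi> z $$ (k, l) * v $ l))"
          using r(2)[of z] vc by (intro sum.cong refl) (simp add: scalar_prod_def atLeast0LessThan)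
        also have "\<dots> = (\<Sum>l<d. (\<Sum>k<d. \<xi> x $$ (i, k) * \<xi> z $$ (k, l)) * v $ l)"
          by (simp add: sum_distrib_left sum_distrib_right mult.assoc) (rule sum.swap)
        also have "\<dots> = (\<Sum>l<d. \<xi> (x \<otimes> z) $$ (i, l) * v $ l)" using that by (simp add: ri)
        finally show "(\<Sum>k<d. \<xi> x $$ (i, k) * (\<xi> z *\<^sub>v v) $ k) = (\<Sum>l<d. \<xi> (x \<otimes> z) $$ (i, l) * v $ l)" .
      qed
      moreover have "\<xi> z *\<^sub>v v \<in> carrier_vec d" using r(2)[of z] vc by simp
      ultimately show ?thesis using C_inf_translate[OF vs] by (simp add: W_def)
    qed
  qed
  have "isCont (\<lambda>x. \<xi> x $$ (0, 0)) \<one>" using r(5)[OF r(1) r(1)] by (simp add: continuous_on_eq_continuous_at)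
  \<comment> \<open>At the identity this entry is 1. On \<open>V\<close> its real part stays
    positive, which makes component 0 of the averaged vector nonzero.\<close>
  define V where "V = {x. Re (\<xi> x $$ (0, 0)) > 1 / 2}"
  have V: "open V"
  proof -
    have "continuous_on UNIV (\<lambda>x. Re (\<xi> x $$ (0, 0)))" by (intro continuous_intros r(5)[OF r(1) r(1)])
    from open_vimage[OF open_greaterThan this, of "1 / 2"] show ?thesis by (simp add: V_def vimage_def)
  qed
  have "\<one> \<in> V" using rep_one[OF irr] r(1) by (simp add: V_def d_def)
  from manifold_bump[OF mfd V this] obtain f where f: "(\<lambda>x. complex_of_real (f x)) \<in> C_inf H"
    "\<And>x. f x \<ge> 0" "f \<one> > 0" "\<And>x. x \<notin> V \<Longrightarrow> f x = 0" by blast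
  have fc: "continuous_on UNIV f"
    using continuous_on_Re[OF C_inf_continuous[OF f(1)]] by simp
  \<comment> \<open>Column 0 of the representation averaged against the bump. Applying
    \<open>\<xi> x\<close> and substituting by left invariance moves the dependence on
    \<open>x\<close> from \<open>\<xi>\<close>, so far merely continuous, to the smooth factor
    \<open>f (inv x \<otimes> y)\<close>.\<close>
  define av where "av = vec d (\<lambda>k. \<integral>y. \<xi> y $$ (k, 0) * complex_of_real (f y) \<partial>M)"
  have intg: "integrable M (\<lambda>y. \<xi> y $$ (k, 0) * complex_of_real (f y))" if "k < d" for k
    by (intro integrable_cont continuous_intros r(5) that r(1) fc)
  have "av \<in> W" unfolding W_def
  proof (intro CollectI conjI allI impI)
    show "av \<in> carrier_vec d" by (simp add: av_def)
    fix i assume i: "i < d"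
    have "(\<Sum>k<d. \<xi> x $$ (i, k) * av $ k) = (\<integral>y. \<xi> y $$ (i, 0) * complex_of_real (f (inv x \<otimes> y)) \<partial>M)" for x
    proof -
      have "(\<Sum>k<d. \<xi> x $$ (i, k) * av $ k) = (\<integral>y. (\<Sum>k<d. \<xi> x $$ (i, k) * (\<xi> y $$ (k, 0) * complex_of_real (f y))) \<partial>M)"
        using intg by (simp add: av_def)
      also have "\<dots> = (\<integral>y. \<xi> (x \<otimes> y) $$ (i, 0) * complex_of_real (f (inv x \<otimes> (x \<otimes> y))) \<partial>M)"
        using i r(1) by (simp add: ri sum_distrib_right mult.assoc m_assoc[symmetric])
      also have "\<dots> = (\<integral>y. \<xi> y $$ (i, 0) * complex_of_real (f (inv x \<otimes> y)) \<partial>M)"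
        by (rule integral_left[where f = "\<lambda>y. \<xi> y $$ (i, 0) * complex_of_real (f (inv x \<otimes> y))"])
          (intro continuous_intros r(5)[OF i r(1)] continuous_on_compose2[OF fc] continuous_on_const continuous_on_id subset_UNIV)
      finally show ?thesis .
    qed
    moreover have "(\<lambda>x. \<integral>y. \<xi> y $$ (i, 0) * complex_of_real (f (inv x \<otimes> y)) \<partial>M) \<in> C_inf H"
      unfolding C_inf_iff[OF mfd]
    proof clarify
      fix U \<phi> assume U: "(U, \<phi>) \<in> atlas H"
      note op = chartD(2)[OF mfd U]
      have "param_smooth (\<phi> ` U) (\<lambda>s y. complex_of_real (f (inv (inv_into U \<phi> s) \<otimes> y)))"
      proof (rule param_smooth_C_inf[OF mfd mfd op f(1), where \<Omega> = "\<lambda>s y. inv (inv_into U \<phi> s) \<otimes> y"])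
        fix V \<psi> assume V: "(V, \<psi>) \<in> atlas H"
        have op2: "open (\<phi> ` U \<times> \<psi> ` V)" by (intro open_Times op chartD(2)[OF mfd V])
        show "msmooth (\<phi> ` U \<times> \<psi> ` V) (atlas H) (\<lambda>z. inv (inv_into U \<phi> (fst z)) \<otimes> inv_into V \<psi> (snd z))"
          by (intro msmooth_mult[OF op2] msmooth_inv[OF op2] smooth_on_imp_msmooth[OF mfd op2 U] smooth_on_imp_msmooth[OF mfd op2 V]
              smooth_on_fst[OF op2] smooth_on_snd[OF op2] smooth_on_id) auto
      qed
      from param_smooth_cmult(1)[OF op r(5)[OF i r(1)] this]
      have "param_smooth (\<phi> ` U) (\<lambda>s y. \<xi> y $$ (i, 0) * complex_of_real (f (inv (inv_into U \<phi> s) \<otimes> y)))" .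
      from integral_param_smooth(1)[OF manifold_fin_dim[OF mfd] op compact_UNIV finite_M sets_M this]
      show "smooth_on (\<phi> ` U) (\<lambda>x. \<integral>y. \<xi> y $$ (i, 0) * complex_of_real (f (inv (inv_into U \<phi> x) \<otimes> y)) \<partial>M)" .
    qed
    ultimately show "(\<lambda>x. \<Sum>k<d. \<xi> x $$ (i, k) * av $ k) \<in> C_inf H" by simp
  qed
  moreover have "av \<noteq> 0\<^sub>v d"
  proof
    assume "av = 0\<^sub>v d"
    hence "av $ 0 = 0" using r(1) by simp
    hence "Re (\<integral>y. \<xi> y $$ (0, 0) * complex_of_real (f y) \<partial>M) = 0" using r(1) by (simp add: av_def)
    hence "(\<integral>y. Re (\<xi> y $$ (0, 0)) * f y \<partial>M) = 0"
      using intg[OF r(1)] by (simp add: integral_Re[symmetric] del: integral_Re)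
    moreover have "(\<integral>y. Re (\<xi> y $$ (0, 0)) * f y \<partial>M) > 0"
    proof (rule integral_pos[of _ \<one>])
      show "continuous_on UNIV (\<lambda>y. Re (\<xi> y $$ (0, 0)) * f y)" by (intro continuous_intros r(5)[OF r(1) r(1)] fc)
      show "Re (\<xi> y $$ (0, 0)) * f y \<ge> 0" for y
        using f(2)[of y] f(4)[of y] by (cases "y \<in> V") (auto simp: V_def)
      show "Re (\<xi> \<one> $$ (0, 0)) * f \<one> > 0" using rep_one[OF irr] r(1) f(3) by (simp add: d_def)
    qed
    ultimately show False by simp
  qed
  ultimately have "W = carrier_vec d" using r(6)[OF inv] by blast
  hence "unit_vec d j \<in> W" by simp
  hence "(\<lambda>x. \<Sum>k<d. \<xi> x $$ (i, k) * unit_vec d j $ k) \<in> C_inf H" using i by (simp add: W_def d_def)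
  moreover have "(\<Sum>k<d. \<xi> x $$ (i, k) * unit_vec d j $ k) = \<xi> x $$ (i, j)" for x
  proof -
    have "(\<Sum>k<d. \<xi> x $$ (i, k) * unit_vec d j $ k) = (\<Sum>k<d. if k = j then \<xi> x $$ (i, k) else 0)"
      by (intro sum.cong refl) (use j in \<open>auto simp: unit_vec_def d_def\<close>)
    thus ?thesis using j by (simp add: d_def)
  qed
  ultimately show ?thesis by simp
qed

end

section \<open>Schur orthogonality\<close>

context compact_lie
begin

text \<open>A complex matrix of positive size has an eigenvalue, and its eigenspace is invariant
  because \<open>A\<close> commutes with the representation; irreducibility makes it the whole
  space.\<close>

lemma schur_scalar:
  assumes irr: "irreducible_rep H \<xi>" and A: "A \<in> carrier_mat (rep_dim H \<xi>) (rep_dim H \<xi>)"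
    and comm: "\<And>x. A * \<xi> x = \<xi> x * A"
  shows "\<exists>c. A = c \<cdot>\<^sub>m 1\<^sub>m (rep_dim H \<xi>)"
proof -
  define d where "d = rep_dim H \<xi>"
  note r = repD[OF irr, folded d_def]
  have A: "A \<in> carrier_mat d d" using A by (simp add: d_def)
  obtain c where "eigenvalue A c" using spectrum_non_empty[OF A r(1)] by (auto simp: spectrum_def)
  then obtain v where v: "v \<in> carrier_vec d" "v \<noteq> 0\<^sub>v d" "A *\<^sub>v v = c \<cdot>\<^sub>v v"
    using A by (auto simp: eigenvalue_def eigenvector_def)
  define W where "W = {v \<in> carrier_vec d. A *\<^sub>v v = c \<cdot>\<^sub>v v}"
  have "invariant_subspace d \<xi> W"
    unfolding invariant_subspace_def
  proof (intro conjI ballI allI)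
    show "W \<subseteq> carrier_vec d" by (auto simp: W_def)
    show "0\<^sub>v d \<in> W" using A by (auto simp: W_def)
    show "v + w \<in> W" if "v \<in> W" "w \<in> W" for v w
      using that A by (auto simp: W_def mult_add_distrib_mat_vec[of A d d] smult_add_distrib_vec[of _ d])
    show "k \<cdot>\<^sub>v v \<in> W" if "v \<in> W" for k v
      using that A by (auto simp: W_def mult_mat_vec[of A d d] smult_smult_assoc mult.commute)
    show "\<xi> z *\<^sub>v v \<in> W" if v: "v \<in> W" for z v
    proof -
      have vc: "v \<in> carrier_vec d" and ve: "A *\<^sub>v v = c \<cdot>\<^sub>v v" using v by (auto simp: W_def)
      have "A *\<^sub>v (\<xi> z *\<^sub>v v) = (A * \<xi> z) *\<^sub>v v" by (rule assoc_mult_mat_vec[symmetric, OF A r(2) vc])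
      also have "\<dots> = \<xi> z *\<^sub>v (A *\<^sub>v v)" unfolding comm by (rule assoc_mult_mat_vec[OF r(2) A vc])
      also have "\<dots> = c \<cdot>\<^sub>v (\<xi> z *\<^sub>v v)" unfolding ve by (rule mult_mat_vec[OF r(2) vc])
      finally show ?thesis using r(2)[of z] vc by (simp add: W_def)
    qed
  qed
  from r(6)[OF this] have "W = carrier_vec d" using v by (auto simp: W_def)
  hence e: "A *\<^sub>v v = c \<cdot>\<^sub>v v" if "v \<in> carrier_vec d" for v using that by (auto simp: W_def)
  have "A = c \<cdot>\<^sub>m 1\<^sub>m d"
  proof (rule eq_matI)
    fix i j assume "i < dim_row (c \<cdot>\<^sub>m 1\<^sub>m d)" "j < dim_col (c \<cdot>\<^sub>m 1\<^sub>m d)"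
    hence ij: "i < d" "j < d" by auto
    have "A $$ (i, j) = (A *\<^sub>v unit_vec d j) $ i" using A ij by simp
    also have "A *\<^sub>v unit_vec d j = c \<cdot>\<^sub>v unit_vec d j" by (rule e) simp
    finally show "A $$ (i, j) = (c \<cdot>\<^sub>m 1\<^sub>m d) $$ (i, j)" using ij by simp
  qed (use A in auto)
  thus ?thesis by (auto simp: d_def)
qed

text \<open>With \<open>S\<close> the adjoint of the intertwiner \<open>T\<close>, both
  \<open>S * T\<close> and \<open>T * S\<close> commute with the representations and are scalar.
  Their traces are the same sum of squared moduli of entries, and the triple product
  \<open>T * S * T\<close> shows that the two scalars agree. Being nonzero, they force equal
  dimensions, and \<open>S\<close> divided by the scalar inverts \<open>T\<close>.\<close>

lemma schur_equivalent:
  assumes irr: "irreducible_rep H \<xi>" "irreducible_rep H \<eta>"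
    and T: "T \<in> carrier_mat (rep_dim H \<xi>) (rep_dim H \<eta>)"
    and inter: "\<And>x. \<xi> x * T = T * \<eta> x"
    and ik: "i < rep_dim H \<xi>" "k < rep_dim H \<eta>" "T $$ (i, k) \<noteq> 0"
  shows "equivalent_reps H \<eta> \<xi>"
proof -
  define d where "d = rep_dim H \<xi>"
  define d' where "d' = rep_dim H \<eta>"
  note r = repD[OF irr(1), folded d_def] and r' = repD[OF irr(2), folded d'_def]
  have T: "T \<in> carrier_mat d d'" using T by (simp add: d_def d'_def)
  define S where "S = mat_adjoint T"
  have S: "S \<in> carrier_mat d' d" unfolding S_def by (rule mat_adjoint_carrier[OF T])
  have Si: "S $$ (i, j) = cnj (T $$ (j, i))" if "i < d'" "j < d" for i j
    unfolding S_def by (rule index_mat_adjoint[OF T that])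
  have inter': "S * \<xi> x = \<eta> x * S" for x
  proof (rule eq_matI)
    fix i j assume "i < dim_row (\<eta> x * S)" "j < dim_col (\<eta> x * S)"
    hence ij: "i < d'" "j < d" using r'(2)[of x] S by auto
    have "(\<Sum>k<d. \<xi> (inv x) $$ (j, k) * T $$ (k, i)) = (\<Sum>k<d'. T $$ (j, k) * \<eta> (inv x) $$ (k, i))"
      using index_mult_mat_sum[OF r(2) T ij(2,1), of "inv x"] index_mult_mat_sum[OF T r'(2) ij(2,1), of "inv x"] inter[of "inv x"] by simp
    hence "cnj (\<Sum>k<d. \<xi> (inv x) $$ (j, k) * T $$ (k, i)) = cnj (\<Sum>k<d'. T $$ (j, k) * \<eta> (inv x) $$ (k, i))" by simp
    hence "(\<Sum>k<d. cnj (T $$ (k, i)) * \<xi> x $$ (k, j)) = (\<Sum>k<d'. \<eta> x $$ (i, k) * cnj (T $$ (j, k)))"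
      using ij by (simp add: rep_inv_index[OF irr(1), folded d_def] rep_inv_index[OF irr(2), folded d'_def] mult.commute)
    thus "(S * \<xi> x) $$ (i, j) = (\<eta> x * S) $$ (i, j)"
      using index_mult_mat_sum[OF S r(2) ij, of x] index_mult_mat_sum[OF r'(2) S ij, of x] ij by (simp add: Si)
  qed (use r(2)[of x] r'(2)[of x] S in auto)
  have ST: "S * T \<in> carrier_mat d' d'" and TS: "T * S \<in> carrier_mat d d" using S T by auto
  have "(S * T) * \<eta> x = \<eta> x * (S * T)" for x
  proof -
    have "(S * T) * \<eta> x = S * (\<xi> x * T)" using assoc_mult_mat[OF S T r'(2)] inter by simp
    also have "\<dots> = (\<eta> x * S) * T" using assoc_mult_mat[OF S r(2) T, symmetric] inter' by simp
    finally show ?thesis using assoc_mult_mat[OF r'(2) S T] by simp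
  qed
  from schur_scalar[OF irr(2) _ this] ST obtain c where c: "S * T = c \<cdot>\<^sub>m 1\<^sub>m d'" by (auto simp: d'_def)
  have "(T * S) * \<xi> x = \<xi> x * (T * S)" for x
  proof -
    have "(T * S) * \<xi> x = T * (\<eta> x * S)" using assoc_mult_mat[OF T S r(2)] inter' by simp
    also have "\<dots> = (\<xi> x * T) * S" using assoc_mult_mat[OF T r'(2) S, symmetric] inter by simp
    finally show ?thesis using assoc_mult_mat[OF r(2) T S] by simp
  qed
  from schur_scalar[OF irr(1) _ this] TS obtain c' where c': "T * S = c' \<cdot>\<^sub>m 1\<^sub>m d" by (auto simp: d_def)
  have cS: "c = (\<Sum>i<d. complex_of_real ((cmod (T $$ (i, k)))\<^sup>2))" if "k < d'" for k
  proof -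
    have "c = (S * T) $$ (k, k)" using that by (simp add: c)
    also have "\<dots> = (\<Sum>i<d. S $$ (k, i) * T $$ (i, k))" by (rule index_mult_mat_sum[OF S T that that])
    finally show ?thesis using that by (simp add: Si complex_norm_square mult.commute del: of_real_power)
  qed
  have c'S: "c' = (\<Sum>k<d'. complex_of_real ((cmod (T $$ (i, k)))\<^sup>2))" if "i < d" for i
  proof -
    have "c' = (T * S) $$ (i, i)" using that by (simp add: c')
    also have "\<dots> = (\<Sum>k<d'. T $$ (i, k) * S $$ (k, i))" by (rule index_mult_mat_sum[OF T S that that])
    finally show ?thesis using that by (simp add: Si complex_norm_square del: of_real_power)
  qed
  \<comment> \<open>The trace of both products, computed by summing the squared moduli of the
    entries of \<open>T\<close> by columns and by rows.\<close>
  have "of_nat d' * c = (\<Sum>k<d'. c)" by simp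
  also have "\<dots> = (\<Sum>k<d'. \<Sum>i<d. complex_of_real ((cmod (T $$ (i, k)))\<^sup>2))"
    by (rule sum.cong[OF refl]) (rule cS, simp)
  also have "\<dots> = (\<Sum>i<d. \<Sum>k<d'. complex_of_real ((cmod (T $$ (i, k)))\<^sup>2))" by (rule sum.swap)
  also have "\<dots> = (\<Sum>i<d. c')" by (rule sum.cong[OF refl]) (rule c'S[symmetric], simp)
  also have "\<dots> = of_nat d * c'" by simp
  finally have dd: "of_nat d' * c = of_nat d * c'" .
  have ik: "i < d" "k < d'" using ik by (auto simp: d_def d'_def)
  have "T * (S * T) = c \<cdot>\<^sub>m T" unfolding c using mult_smult_distrib[OF T one_carrier_mat] T by simp
  moreover have "(T * S) * T = c' \<cdot>\<^sub>m T" unfolding c' using mult_smult_assoc_mat[OF one_carrier_mat T] T by simp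
  ultimately have "c \<cdot>\<^sub>m T = c' \<cdot>\<^sub>m T" using assoc_mult_mat[OF T S T] by simp
  hence "(c \<cdot>\<^sub>m T) $$ (i, k) = (c' \<cdot>\<^sub>m T) $$ (i, k)" by simp
  hence cc: "c = c'" using ik T assms(7) by simp
  have c0: "c \<noteq> 0"
  proof
    assume "c = 0"
    hence "complex_of_real (\<Sum>i<d. (cmod (T $$ (i, k)))\<^sup>2) = 0" using cS[OF ik(2)] by simp
    hence "(\<Sum>i<d. (cmod (T $$ (i, k)))\<^sup>2) = 0" by (simp only: of_real_eq_0_iff)
    hence "(cmod (T $$ (i, k)))\<^sup>2 = 0" using ik by (subst (asm) sum_nonneg_eq_0_iff) auto
    thus False using assms(7) by simp
  qed
  have dd': "d = d'" using dd c0 cc by simp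
  have "inverts_mat T ((1 / c) \<cdot>\<^sub>m S)" "inverts_mat ((1 / c) \<cdot>\<^sub>m S) T"
    unfolding inverts_mat_def using S T c c' cc c0 dd'
    by (auto simp: mult_smult_distrib[OF T S] mult_smult_assoc_mat[OF S T] intro!: eq_matI)
  hence "invertible_mat T" unfolding invertible_mat_def square_mat.simps using T dd' by auto
  thus ?thesis unfolding equivalent_reps_def
    using dd' T inter by (auto simp: d_def d'_def intro!: bexI[of _ T])
qed

lemma dual_representatives_irr: "dual_representatives H R \<Longrightarrow> \<xi> \<in> R \<Longrightarrow> irreducible_rep H \<xi>"
  by (simp add: dual_representatives_def)

lemma equivalent_reps_refl: "irreducible_rep H \<xi> \<Longrightarrow> equivalent_reps H \<xi> \<xi>"
proof -
  assume irr: "irreducible_rep H \<xi>"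
  have "invertible_mat (1\<^sub>m (rep_dim H \<xi>) :: complex mat)"
    unfolding invertible_mat_def square_mat.simps inverts_mat_def
    by (intro conjI exI[of _ "1\<^sub>m (rep_dim H \<xi>)"]) auto
  thus ?thesis unfolding equivalent_reps_def
    using left_mult_one_mat[OF repD(2)[OF irr]] right_mult_one_mat[OF repD(2)[OF irr]]
    by (intro conjI bexI[of _ "1\<^sub>m (rep_dim H \<xi>)"]) auto
qed

text \<open>Averaging \<xi>(y) E \<eta>(y)^{-1} over the group, for a matrix unit E, yields an
  intertwiner \<open>T\<close> whose entries are the integrals in question. It vanishes for
  inequivalent representations; for equal ones it is scalar, and unitarity computes its
  trace.\<close>

lemma schur_orthogonality:
  assumes R: "dual_representatives H R" and \<xi>: "\<xi> \<in> R" and \<eta>: "\<eta> \<in> R"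
    and ij: "i < rep_dim H \<xi>" "j < rep_dim H \<xi>" and kl: "k < rep_dim H \<eta>" "l < rep_dim H \<eta>"
  shows "(\<integral>y. \<xi> y $$ (i, j) * cnj (\<eta> y $$ (k, l)) \<partial>M) =
    (if \<xi> = \<eta> \<and> i = k \<and> j = l then 1 / of_nat (rep_dim H \<xi>) else 0)"
proof -
  note irr = dual_representatives_irr[OF R \<xi>] dual_representatives_irr[OF R \<eta>]
  define d where "d = rep_dim H \<xi>"
  define d' where "d' = rep_dim H \<eta>"
  note r = repD[OF irr(1), folded d_def] and r' = repD[OF irr(2), folded d'_def]
  have ij: "i < d" "j < d" and kl: "k < d'" "l < d'" using ij kl by (auto simp: d_def d'_def)
  have cont: "continuous_on UNIV (\<lambda>y. \<xi> y $$ (p, q) * cnj (\<eta> y $$ (p', q')))" if "p < d" "q < d" "p' < d'" "q' < d'" for p q p' q'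
    by (intro continuous_intros r(5) r'(5) that)
  define T where "T = Matrix.mat d d' (\<lambda>(p, q). \<integral>y. \<xi> y $$ (p, j) * cnj (\<eta> y $$ (q, l)) \<partial>M)"
  have T: "T \<in> carrier_mat d d'" by (simp add: T_def)
  have Ti: "T $$ (p, q) = (\<integral>y. \<xi> y $$ (p, j) * cnj (\<eta> y $$ (q, l)) \<partial>M)" if "p < d" "q < d'" for p q
    using that by (simp add: T_def)
  have inter: "\<xi> x * T = T * \<eta> x" for x
  proof (rule eq_matI)
    fix p q assume "p < dim_row (T * \<eta> x)" "q < dim_col (T * \<eta> x)"
    hence pq: "p < d" "q < d'" using T r'(2)[of x] by auto
    have "(\<xi> x * T) $$ (p, q) = (\<Sum>m<d. \<xi> x $$ (p, m) * T $$ (m, q))" by (rule index_mult_mat_sum[OF r(2) T pq])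
    also have "\<dots> = (\<Sum>m<d. \<xi> x $$ (p, m) * (\<integral>y. \<xi> y $$ (m, j) * cnj (\<eta> y $$ (q, l)) \<partial>M))"
      using pq by (simp add: Ti)
    also have "\<dots> = (\<integral>y. (\<Sum>m<d. \<xi> x $$ (p, m) * (\<xi> y $$ (m, j) * cnj (\<eta> y $$ (q, l)))) \<partial>M)"
      using pq ij kl by (simp add: integrable_cont[OF cont])
    also have "\<dots> = (\<integral>y. \<xi> (x \<otimes> y) $$ (p, j) * cnj (\<eta> (inv x \<otimes> (x \<otimes> y)) $$ (q, l)) \<partial>M)"
      using pq ij by (simp add: rep_mult_index[OF irr(1), folded d_def] sum_distrib_right mult.assoc m_assoc[symmetric])
    also have "\<dots> = (\<integral>y. \<xi> y $$ (p, j) * cnj (\<eta> (inv x \<otimes> y) $$ (q, l)) \<partial>M)"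
      by (rule integral_left[where f = "\<lambda>y. \<xi> y $$ (p, j) * cnj (\<eta> (inv x \<otimes> y) $$ (q, l))"])
        (intro continuous_intros r(5)[OF pq(1) ij(2)] continuous_on_compose2[OF r'(5)[OF pq(2) kl(2)]] continuous_on_const continuous_on_id subset_UNIV)
    also have "\<dots> = (\<integral>y. (\<Sum>m<d'. (\<xi> y $$ (p, j) * cnj (\<eta> y $$ (m, l))) * \<eta> x $$ (m, q)) \<partial>M)"
      using pq kl by (simp add: rep_mult_index[OF irr(2), folded d'_def] rep_inv_index[OF irr(2), folded d'_def] sum_distrib_left mult_ac)
    also have "\<dots> = (\<Sum>m<d'. T $$ (p, m) * \<eta> x $$ (m, q))"
      using pq ij kl by (simp add: integrable_cont[OF cont] Ti)
    also have "\<dots> = (T * \<eta> x) $$ (p, q)" by (rule index_mult_mat_sum[OF T r'(2) pq, symmetric])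
    finally show "(\<xi> x * T) $$ (p, q) = (T * \<eta> x) $$ (p, q)" .
  qed (use T r(2)[of x] r'(2)[of x] in auto)
  show ?thesis
  proof (cases "\<xi> = \<eta>")
    case False
    \<comment> \<open>Distinct members of \<open>R\<close> are inequivalent, since every irreducible
      representation is equivalent to exactly one of them.\<close>
    have "\<not> equivalent_reps H \<eta> \<xi>"
      using R irr(2) \<xi> \<eta> False equivalent_reps_refl[OF irr(2)] unfolding dual_representatives_def by blast
    hence "T $$ (i, k) = 0"
      using schur_equivalent[OF irr, of T i k] T inter ij kl by (auto simp: d_def d'_def)
    thus ?thesis using False ij kl by (simp add: Ti)
  next
    case True
    have dd: "d' = d" using True by (simp add: d_def d'_def)
    have "T * \<xi> x = \<xi> x * T" for x using inter True by simp
    from schur_scalar[OF irr(1) _ this] T obtain c where c: "T = c \<cdot>\<^sub>m 1\<^sub>m d" by (auto simp: dd d_def)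
    have Tc: "T $$ (p, q) = (if p = q then c else 0)" if "p < d" "q < d" for p q using that by (simp add: c)
    have "of_nat d * c = (\<Sum>p<d. T $$ (p, p))" by (simp add: Tc)
    also have "\<dots> = (\<Sum>p<d. \<integral>y. \<xi> y $$ (p, j) * cnj (\<xi> y $$ (p, l)) \<partial>M)"
      using True dd by (simp add: Ti)
    also have "\<dots> = (\<integral>y. (\<Sum>p<d. \<xi> y $$ (p, j) * cnj (\<xi> y $$ (p, l))) \<partial>M)"
      using integrable_cont[OF cont] ij kl dd True by simp
    also have "\<dots> = (\<integral>y. (if l = j then 1 else 0) \<partial>M)"
      using rep_unitary_index[OF irr(1), of l j] ij kl dd by (simp add: d_def mult.commute)
    also have "\<dots> = (if l = j then 1 else 0)" using M.prob_space by simp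
    finally have "c = (if j = l then 1 / of_nat d else 0)" using r(1) by (auto simp: field_simps)
    thus ?thesis using Ti[OF ij(1) kl(1)] Tc[of i k] ij kl dd True by (auto simp: d_def)
  qed
qed

section \<open>Derivatives along one-parameter subgroups\<close>

lemma lie_algebraD:
  assumes "X \<in> lie_algebra H"
  shows "msmooth UNIV (atlas H) X" "X (s + t) = X s \<otimes> X t" "X 0 = \<one>" "continuous_on UNIV X"
proof -
  have sm: "smooth_map std_atlas (atlas H) X" and add: "\<And>s t. X (s + t) = X s \<otimes> X t"
    using assms by (auto simp: lie_algebra_def)
  show "msmooth UNIV (atlas H) X"
    using smooth_map_iff[OF manifold_std[OF fin_dim_real], of "atlas H" X] sm by (simp add: inv_id)
  thus "continuous_on UNIV X" by (rule msmooth_continuous)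
  show "X (s + t) = X s \<otimes> X t" by (rule add)
  have "X 0 \<otimes> X 0 = X 0" using add[of 0 0] by simp
  thus "X 0 = \<one>" by simp
qed

text \<open>The homomorphism property of \<open>X\<close> reduces the derivative at an arbitrary
  time to the one at time 0, based at the point reached.\<close>

lemma vfield_derivative:
  fixes f :: "'a \<Rightarrow> 'c::real_normed_vector"
  assumes X: "X \<in> lie_algebra H" and f: "(\<lambda>t. f (x \<otimes> X t)) differentiable (at t\<^sub>0)"
  shows "((\<lambda>t. f (x \<otimes> X t)) has_vector_derivative vfield H X f (x \<otimes> X t\<^sub>0)) (at t\<^sub>0)"
proof -
  obtain D where D: "((\<lambda>t. f (x \<otimes> X t)) has_vector_derivative D) (at t\<^sub>0)"
    using f vector_derivative_works by blast
  have "((\<lambda>h. t\<^sub>0 + h) has_vector_derivative 1) (at 0)" by (auto intro!: derivative_eq_intros)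
  from vector_diff_chain_at[OF this, of "\<lambda>t. f (x \<otimes> X t)" D] D
  have "((\<lambda>h. f (x \<otimes> X (t\<^sub>0 + h))) has_vector_derivative D) (at 0)" by (simp add: o_def)
  hence "((\<lambda>h. f ((x \<otimes> X t\<^sub>0) \<otimes> X h)) has_vector_derivative D) (at 0)"
    by (simp add: lie_algebraD(2)[OF X] m_assoc)
  hence "vfield H X f (x \<otimes> X t\<^sub>0) = D" unfolding vfield_def by (rule vector_derivative_at)
  thus ?thesis using D by simp
qed

lemma C_inf_differentiable_along:
  assumes X: "X \<in> lie_algebra H" and f: "f \<in> C_inf H"
  shows "(\<lambda>t. f (x \<otimes> X t)) differentiable (at t\<^sub>0)"
proof -
  have "smooth_on UNIV (\<lambda>t. f (x \<otimes> X t))"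
    by (intro C_inf_compose[OF mfd f] msmooth_mult msmooth_const lie_algebraD(1)[OF X] open_UNIV)
  thus ?thesis by (rule smooth_on_differentiable) simp
qed

text \<open>Since the symbol is diagonal, each entry of column \<open>r\<close> is an eigenfunction
  of the vector field with eigenvalue i times \<open>lam \<eta> r\<close>. Along the flow it solves
  a scalar linear differential equation, and the integrating factor turns it into a
  constant.\<close>

lemma rep_along:
  assumes X: "X \<in> lie_algebra H" and R: "dual_representatives H R" and sym: "diagonal_symbol H X R lam"
    and \<eta>: "\<eta> \<in> R" and s: "s < rep_dim H \<eta>" and r: "r < rep_dim H \<eta>"
  shows "\<eta> (y \<otimes> X t) $$ (s, r) = \<eta> y $$ (s, r) * exp (\<i> * complex_of_real (lam \<eta> r * t))"
proof -
  note irr = dual_representatives_irr[OF R \<eta>]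
  define d where "d = rep_dim H \<eta>"
  note rD = repD[OF irr, folded d_def]
  have sr: "s < d" "r < d" using s r by (auto simp: d_def)
  have vf: "vfield H X (\<lambda>y. \<eta> y $$ (s, r)) x = \<i> * complex_of_real (lam \<eta> r) * \<eta> x $$ (s, r)" for x
  proof -
    define V where "V = Matrix.mat d d (\<lambda>(m, n). vfield H X (\<lambda>y. \<eta> y $$ (m, n)) x)"
    define D where "D = mat_diag d (\<lambda>m. \<i> * complex_of_real (lam \<eta> m))"
    have V: "V \<in> carrier_mat d d" and D: "D \<in> carrier_mat d d" by (simp_all add: V_def D_def)
    have eq: "mat_adjoint (\<eta> x) * V = D"
      using sym \<eta> by (simp add: diagonal_symbol_def symbol_def V_def D_def d_def)
    have "\<eta> x * mat_adjoint (\<eta> x) = 1\<^sub>m d"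
      using rD(4)[of x "inv x"] rep_inv[OF irr] rep_one[OF irr] by (simp add: d_def)
    hence "V = \<eta> x * mat_adjoint (\<eta> x) * V" using V by simp
    also have "\<dots> = \<eta> x * D" using assoc_mult_mat[OF rD(2) mat_adjoint_carrier[OF rD(2)] V] eq by simp
    finally have "V $$ (s, r) = (\<Sum>k<d. \<eta> x $$ (s, k) * D $$ (k, r))"
      using index_mult_mat_sum[OF rD(2) D sr] by simp
    also have "\<dots> = (\<Sum>k<d. if k = r then \<eta> x $$ (s, k) * (\<i> * complex_of_real (lam \<eta> r)) else 0)"
      by (intro sum.cong refl) (use sr in \<open>auto simp: D_def mat_diag_def\<close>)
    also have "\<dots> = \<i> * complex_of_real (lam \<eta> r) * \<eta> x $$ (s, r)" using sr by simp
    finally show ?thesis using sr by (simp add: V_def)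
  qed
  define \<mu> where "\<mu> = \<i> * complex_of_real (lam \<eta> r)"
  define g where "g t = \<eta> (y \<otimes> X t) $$ (s, r) * exp (- \<mu> * complex_of_real t)" for t
  have "(g has_vector_derivative 0) (at t)" for t
  proof -
    have 1: "((\<lambda>t. \<eta> (y \<otimes> X t) $$ (s, r)) has_vector_derivative \<mu> * \<eta> (y \<otimes> X t) $$ (s, r)) (at t)"
      using vfield_derivative[OF X C_inf_differentiable_along[OF X rep_smooth[OF irr s r]], of y t]
      by (simp add: vf \<mu>_def)
    have "((\<lambda>t. - \<mu> * complex_of_real t) has_vector_derivative - \<mu>) (at t)"
      by (auto intro!: derivative_eq_intros)
    from field_vector_diff_chain_at[OF this DERIV_exp]
    have 2: "((\<lambda>t. exp (- \<mu> * complex_of_real t)) has_vector_derivative - \<mu> * exp (- \<mu> * complex_of_real t)) (at t)"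
      by (simp add: o_def)
    from has_vector_derivative_mult[OF 1 2] show ?thesis unfolding g_def by (simp add: algebra_simps)
  qed
  hence "g t = g 0" for t
    using has_vector_derivative_zero_constant[of UNIV g] by (metis UNIV_I convex_UNIV)
  hence "g t = \<eta> y $$ (s, r)" for t by (simp add: g_def lie_algebraD(3)[OF X])
  hence "\<eta> y $$ (s, r) * exp (\<mu> * complex_of_real t) = \<eta> (y \<otimes> X t) $$ (s, r) * (exp (- \<mu> * complex_of_real t) * exp (\<mu> * complex_of_real t))"
    by (metis g_def mult.assoc)
  also have "exp (- \<mu> * complex_of_real t) * exp (\<mu> * complex_of_real t) = 1" by (simp add: exp_add[symmetric])
  finally show ?thesis by (simp add: \<mu>_def mult.assoc)
qed

end

section \<open>Fourier projections\<close>

lemma borel_measurable_cnj [measurable (raw), simp]: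
  assumes "f \<in> borel_measurable M"
  shows "(\<lambda>x. cnj (f x)) \<in> borel_measurable M"
  by (rule measurable_compose[OF assms borel_measurable_continuous_onI]) (intro continuous_intros)

text \<open>The squared distance between \<open>w\<close> and its projection is nonnegative. Bounded
  measurable functions make all products integrable, and the squared norms \<open>1 / D i\<close> of
  the orthogonal family are the normalisation delivered by Schur orthogonality.\<close>

lemma (in prob_space) bessel_inequality:
  fixes e :: "'i \<Rightarrow> 'a \<Rightarrow> complex" and D :: "'i \<Rightarrow> real"
  assumes I: "finite I" and D: "\<And>i. i \<in> I \<Longrightarrow> D i > 0"
    and e: "\<And>i. i \<in> I \<Longrightarrow> e i \<in> borel_measurable M" "\<And>i. i \<in> I \<Longrightarrow> \<exists>C. \<forall>x\<in>space M. norm (e i x) \<le> C"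
    and orth: "\<And>i j. i \<in> I \<Longrightarrow> j \<in> I \<Longrightarrow> (\<integral>x. e i x * cnj (e j x) \<partial>M) = (if i = j then complex_of_real (1 / D i) else 0)"
    and w: "w \<in> borel_measurable M" "\<And>x. x \<in> space M \<Longrightarrow> norm (w x) \<le> 1"
  shows "(\<Sum>i\<in>I. D i * (cmod (\<integral>x. w x * cnj (e i x) \<partial>M))\<^sup>2) \<le> 1"
proof -
  have bd: "integrable M (\<lambda>x. f x * cnj (g x))"
    if fg: "f \<in> borel_measurable M" "g \<in> borel_measurable M" "\<exists>C. \<forall>x\<in>space M. norm (f x) \<le> C" "\<exists>C. \<forall>x\<in>space M. norm (g x) \<le> C"
    for f g :: "'a \<Rightarrow> complex"
  proof -
    obtain C C' where C: "\<And>x. x \<in> space M \<Longrightarrow> norm (f x) \<le> C" "\<And>x. x \<in> space M \<Longrightarrow> norm (g x) \<le> C'"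
      using fg by blast
    have "norm (f x * cnj (g x)) \<le> C * C'" if "x \<in> space M" for x
      unfolding norm_mult complex_mod_cnj using C[OF that] by (intro mult_mono) (auto intro: order_trans[OF norm_ge_zero])
    moreover have "(\<lambda>x. f x * cnj (g x)) \<in> borel_measurable M"
      by (intro borel_measurable_times borel_measurable_cnj fg)
    ultimately show ?thesis by (intro integrable_const_bound[of _ "C * C'"]) auto
  qed
  define c where "c i = (\<integral>x. w x * cnj (e i x) \<partial>M)" for i
  \<comment> \<open>The orthogonal projection of \<open>w\<close> onto the span of the family; the
    factor \<open>D i\<close> compensates for the norm of \<open>e i\<close>. Its inner products
    with \<open>w\<close> and with itself all equal \<open>s\<close>.\<close>
  define p where "p x = (\<Sum>i\<in>I. complex_of_real (D i) * c i * e i x)" for x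
  define s where "s = (\<Sum>i\<in>I. D i * (cmod (c i))\<^sup>2)"
  have w': "\<exists>C. \<forall>x\<in>space M. norm (w x) \<le> C" using w(2) by blast
  have pm: "p \<in> borel_measurable M" unfolding p_def using e(1) by (intro borel_measurable_sum) auto
  have pb: "\<exists>C. \<forall>x\<in>space M. norm (p x) \<le> C"
  proof -
    obtain C where C: "\<And>i x. i \<in> I \<Longrightarrow> x \<in> space M \<Longrightarrow> norm (e i x) \<le> C i" using e(2) by metis
    have "norm (p x) \<le> (\<Sum>i\<in>I. norm (complex_of_real (D i) * c i) * C i)" if "x \<in> space M" for x
      unfolding p_def using C that by (intro sum_norm_le) (auto simp: norm_mult intro!: mult_left_mono)
    thus ?thesis by blast
  qed
  have iw: "integrable M (\<lambda>x. w x * cnj (w x))" by (rule bd[OF w(1) w(1) w' w'])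
  have iwp: "integrable M (\<lambda>x. w x * cnj (p x))" by (rule bd[OF w(1) pm w' pb])
  have ipw: "integrable M (\<lambda>x. p x * cnj (w x))" by (rule bd[OF pm w(1) pb w'])
  have ipp: "integrable M (\<lambda>x. p x * cnj (p x))" by (rule bd[OF pm pm pb pb])
  have cc: "c i * cnj (c i) = complex_of_real ((cmod (c i))\<^sup>2)" for i by (simp add: complex_norm_square del: of_real_power)
  have WP: "(\<integral>x. w x * cnj (p x) \<partial>M) = complex_of_real s"
  proof -
    have "(\<integral>x. w x * cnj (p x) \<partial>M) = (\<integral>x. (\<Sum>i\<in>I. complex_of_real (D i) * cnj (c i) * (w x * cnj (e i x))) \<partial>M)"
      by (simp add: p_def sum_distrib_left mult_ac)
    also have "\<dots> = (\<Sum>i\<in>I. \<integral>x. complex_of_real (D i) * cnj (c i) * (w x * cnj (e i x)) \<partial>M)"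
      by (rule Bochner_Integration.integral_sum) (intro integrable_mult_right bd w(1) e w')
    also have "\<dots> = (\<Sum>i\<in>I. complex_of_real (D i * (cmod (c i))\<^sup>2))"
    proof (intro sum.cong refl)
      fix i
      have "(\<integral>x. complex_of_real (D i) * cnj (c i) * (w x * cnj (e i x)) \<partial>M) = complex_of_real (D i) * cnj (c i) * c i"
        unfolding c_def by (rule integral_mult_right_zero)
      also have "\<dots> = complex_of_real (D i) * (c i * cnj (c i))" by (simp add: mult_ac)
      finally show "(\<integral>x. complex_of_real (D i) * cnj (c i) * (w x * cnj (e i x)) \<partial>M) = complex_of_real (D i * (cmod (c i))\<^sup>2)"
        by (simp only: cc of_real_mult)
    qed
    finally show ?thesis by (simp add: s_def)
  qed
  have PP: "(\<integral>x. p x * cnj (p x) \<partial>M) = complex_of_real s"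
  proof -
    have "(\<integral>x. p x * cnj (p x) \<partial>M) = (\<integral>x. (\<Sum>i\<in>I. \<Sum>j\<in>I. complex_of_real (D i) * c i * (complex_of_real (D j) * cnj (c j)) * (e i x * cnj (e j x))) \<partial>M)"
      unfolding p_def cnj_sum sum_product by (simp add: mult_ac)
    also have "\<dots> = (\<Sum>i\<in>I. \<Sum>j\<in>I. \<integral>x. complex_of_real (D i) * c i * (complex_of_real (D j) * cnj (c j)) * (e i x * cnj (e j x)) \<partial>M)"
      by (subst Bochner_Integration.integral_sum, intro Bochner_Integration.integrable_sum integrable_mult_right bd e, assumption+,
          intro sum.cong refl Bochner_Integration.integral_sum integrable_mult_right bd e, assumption+)
    also have "\<dots> = (\<Sum>i\<in>I. \<Sum>j\<in>I. if i = j then complex_of_real (D i * (cmod (c i))\<^sup>2) else 0)"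
    proof (intro sum.cong refl)
      fix i j assume ij: "i \<in> I" "j \<in> I"
      have "(\<integral>x. complex_of_real (D i) * c i * (complex_of_real (D j) * cnj (c j)) * (e i x * cnj (e j x)) \<partial>M)
         = complex_of_real (D i) * c i * (complex_of_real (D j) * cnj (c j)) * (\<integral>x. e i x * cnj (e j x) \<partial>M)"
        by (rule integral_mult_right_zero)
      also have "\<dots> = (if i = j then complex_of_real (D i * (cmod (c i))\<^sup>2) else 0)"
        using D[OF ij(1)] cc[of i] by (auto simp: orth[OF ij] field_simps simp del: of_real_power)
      finally show "(\<integral>x. complex_of_real (D i) * c i * (complex_of_real (D j) * cnj (c j)) * (e i x * cnj (e j x)) \<partial>M) = (if i = j then complex_of_real (D i * (cmod (c i))\<^sup>2) else 0)" .
    qed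
    also have "\<dots> = complex_of_real s" using I by (simp add: s_def)
    finally show ?thesis .
  qed
  have PW: "(\<integral>x. p x * cnj (w x) \<partial>M) = complex_of_real s"
  proof -
    have "(\<integral>x. p x * cnj (w x) \<partial>M) = (\<integral>x. cnj (w x * cnj (p x)) \<partial>M)" by (simp add: mult.commute)
    also have "\<dots> = cnj (\<integral>x. w x * cnj (p x) \<partial>M)" by (rule integral_bounded_linear[OF bounded_linear_cnj iwp])
    finally show ?thesis by (simp add: WP)
  qed
  have nn: "0 \<le> (\<integral>x. (cmod (w x - p x))\<^sup>2 \<partial>M)" by simp
  have "complex_of_real (\<integral>x. (cmod (w x - p x))\<^sup>2 \<partial>M) = (\<integral>x. (w x - p x) * cnj (w x - p x) \<partial>M)"
    by (simp only: integral_complex_of_real[symmetric] complex_norm_square)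
  hence "complex_of_real (\<integral>x. (cmod (w x - p x))\<^sup>2 \<partial>M) =
      (\<integral>x. w x * cnj (w x) - w x * cnj (p x) - p x * cnj (w x) + p x * cnj (p x) \<partial>M)"
    by (simp add: algebra_simps)
  also have "\<dots> = (\<integral>x. w x * cnj (w x) \<partial>M) - complex_of_real s"
    using iw iwp ipw ipp by (simp add: WP PW PP)
  also have "(\<integral>x. w x * cnj (w x) \<partial>M) = complex_of_real (\<integral>x. (cmod (w x))\<^sup>2 \<partial>M)"
    by (simp only: integral_complex_of_real[symmetric] complex_norm_square)
  finally have "(\<integral>x. (cmod (w x - p x))\<^sup>2 \<partial>M) = (\<integral>x. (cmod (w x))\<^sup>2 \<partial>M) - s"
    by (simp only: of_real_diff[symmetric] of_real_eq_iff)
  moreover have "(\<integral>x. (cmod (w x))\<^sup>2 \<partial>M) \<le> (\<integral>x. 1 \<partial>M)"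
  proof (rule integral_mono)
    have "(\<lambda>x. (cmod (w x))\<^sup>2) \<in> borel_measurable M" using w(1) by simp
    moreover have "(cmod (w x))\<^sup>2 \<le> 1" if "x \<in> space M" for x using w(2)[OF that] by (simp add: power_le_one)
    ultimately show "integrable M (\<lambda>x. (cmod (w x))\<^sup>2)" by (intro integrable_const_bound[of _ 1]) auto
    show "(cmod (w x))\<^sup>2 \<le> 1" if "x \<in> space M" for x using w(2)[OF that] by (simp add: power_le_one)
  qed simp
  ultimately have "s \<le> 1" using prob_space nn by simp
  thus ?thesis by (simp add: s_def c_def)
qed

section \<open>Kernels of partial Fourier sums as bilinear forms\<close>

context compact_lie
begin

text \<open>Each summand is d times the trace of \<eta>(x)^{-1} \<eta>(y), that is, d times the
  character at x^{-1}y. Integration in \<open>y\<close> against this kernel projects onto the span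
  of the conjugated matrix coefficients of the members of \<open>F\<close>.\<close>

definition rep_kernel :: "('a \<Rightarrow> complex mat) set \<Rightarrow> 'a \<Rightarrow> 'a \<Rightarrow> complex" where
  "rep_kernel F x y = (\<Sum>\<eta>\<in>F. of_nat (rep_dim H \<eta>) * (\<Sum>r<rep_dim H \<eta>. \<Sum>s<rep_dim H \<eta>. cnj (\<eta> x $$ (s, r)) * \<eta> y $$ (s, r)))"

text \<open>The kernel is built from characters of x^{-1}y, and a common left factor cancels
  there.\<close>

lemma rep_kernel_translate:
  assumes R: "dual_representatives H R" and F: "F \<subseteq> R"
  shows "rep_kernel F (z \<otimes> x) (z \<otimes> y) = rep_kernel F x y"
proof -
  have *: "(\<Sum>r<rep_dim H \<eta>. \<Sum>s<rep_dim H \<eta>. cnj (\<eta> x $$ (s, r)) * \<eta> y $$ (s, r)) =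
     (\<Sum>r<rep_dim H \<eta>. \<eta> (inv x \<otimes> y) $$ (r, r))" if "\<eta> \<in> F" for \<eta> x y
    using dual_representatives_irr[OF R, of \<eta>] F that
    by (intro sum.cong refl) (simp add: rep_mult_index rep_inv_index subset_iff)
  have "inv (z \<otimes> x) \<otimes> (z \<otimes> y) = inv x \<otimes> (inv z \<otimes> (z \<otimes> y))" by (simp add: inv_mult_group m_assoc)
  also have "inv z \<otimes> (z \<otimes> y) = y" by (simp add: m_assoc[symmetric])
  finally show ?thesis unfolding rep_kernel_def by (simp add: *)
qed

lemma continuous_rep_kernel:
  assumes R: "dual_representatives H R" and F: "F \<subseteq> R"
    and f: "continuous_on S f" and g: "continuous_on S g"
  shows "continuous_on S (\<lambda>x. rep_kernel F (f x) (g x))"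
proof -
  have "continuous_on S (\<lambda>x. \<eta> (f x) $$ (i, j))" "continuous_on S (\<lambda>x. \<eta> (g x) $$ (i, j))"
    if "\<eta> \<in> F" "i < rep_dim H \<eta>" "j < rep_dim H \<eta>" for \<eta> i j
  proof -
    have "irreducible_rep H \<eta>" using R F that dual_representatives_irr by blast
    from repD(5)[OF this that(2,3)]
    show "continuous_on S (\<lambda>x. \<eta> (f x) $$ (i, j))" "continuous_on S (\<lambda>x. \<eta> (g x) $$ (i, j))"
      using continuous_on_compose2 f g by blast+
  qed
  thus ?thesis unfolding rep_kernel_def by (intro continuous_intros) auto
qed

text \<open>Matrix coefficients are orthogonal with squared norm 1/d, so Bessel applies with weights
  d. The decisive feature is a bound that is the same for all finite sets \<open>F\<close>.\<close>

lemma rep_coefficients_bessel: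
  assumes R: "dual_representatives H R" and F: "F \<subseteq> R" "finite F"
    and w: "w \<in> borel_measurable borel" "\<And>x. norm (w x) \<le> 1"
  shows "(\<Sum>\<eta>\<in>F. real (rep_dim H \<eta>) * (\<Sum>r<rep_dim H \<eta>. \<Sum>s<rep_dim H \<eta>.
      (cmod (\<integral>x. w x * cnj (\<eta> x $$ (s, r)) \<partial>M))\<^sup>2)) \<le> 1"
proof -
  define I where "I = (SIGMA \<eta>:F. {..<rep_dim H \<eta>} \<times> {..<rep_dim H \<eta>})"
  define e where "e = (\<lambda>(\<eta>, r, s) x. (\<eta> :: 'a \<Rightarrow> complex mat) x $$ (s, r))"
  define D where "D = (\<lambda>(\<eta>, r::nat, s::nat). real (rep_dim H \<eta>))"
  have irr: "irreducible_rep H \<eta>" if "\<eta> \<in> F" for \<eta> using R F that dual_representatives_irr by blast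
  have ec: "continuous_on UNIV (e i)" if "i \<in> I" for i
    using that repD(5)[OF irr] by (auto simp: I_def e_def)
  have "(\<Sum>i\<in>I. D i * (cmod (\<integral>x. w x * cnj (e i x) \<partial>M))\<^sup>2) \<le> 1"
  proof (rule M.bessel_inequality)
    show "finite I" using F unfolding I_def by auto
    show "D i > 0" if "i \<in> I" for i using that repD(1)[OF irr] by (auto simp: I_def D_def)
    show "e i \<in> borel_measurable M" if "i \<in> I" for i
      using borel_measurable_continuous_onI[OF ec[OF that]] by (simp add: measurable_cong_sets[OF sets_M refl])
    show "\<exists>C. \<forall>x\<in>space M. norm (e i x) \<le> C" if "i \<in> I" for i
      using compact_imp_bounded[OF compact_continuous_image[OF ec[OF that] compact_UNIV]] by (auto simp: bounded_iff)
    show "w \<in> borel_measurable M" using w(1) by (simp add: measurable_cong_sets[OF sets_M refl])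
    show "(\<integral>x. e i x * cnj (e j x) \<partial>M) = (if i = j then complex_of_real (1 / D i) else 0)" if ij: "i \<in> I" "j \<in> I" for i j
    proof -
      obtain \<eta> r s \<eta>' r' s' where i: "i = (\<eta>, r, s)" and j: "j = (\<eta>', r', s')" by (cases i, cases j) auto
      show ?thesis
        using ij F schur_orthogonality[OF R, of \<eta> \<eta>' s r s' r']
        by (auto simp: i j I_def e_def D_def subset_iff split: if_splits)
    qed
  qed (use w(2) in auto)
  also have "(\<Sum>i\<in>I. D i * (cmod (\<integral>x. w x * cnj (e i x) \<partial>M))\<^sup>2) =
     (\<Sum>(\<eta>, p)\<in>I. real (rep_dim H \<eta>) * (cmod (\<integral>x. w x * cnj (\<eta> x $$ (snd p, fst p)) \<partial>M))\<^sup>2)"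
    by (simp add: e_def D_def split_beta)
  also have "\<dots> = (\<Sum>\<eta>\<in>F. \<Sum>p\<in>{..<rep_dim H \<eta>} \<times> {..<rep_dim H \<eta>}. real (rep_dim H \<eta>) * (cmod (\<integral>x. w x * cnj (\<eta> x $$ (snd p, fst p)) \<partial>M))\<^sup>2)"
    unfolding I_def by (rule sum.Sigma[symmetric]) (use F in auto)
  also have "\<dots> = (\<Sum>\<eta>\<in>F. real (rep_dim H \<eta>) * (\<Sum>r<rep_dim H \<eta>. \<Sum>s<rep_dim H \<eta>.
      (cmod (\<integral>x. w x * cnj (\<eta> x $$ (s, r)) \<partial>M))\<^sup>2))"
    unfolding sum_distrib_left sum.cartesian_product by (simp add: split_beta)
  finally show ?thesis .
qed

lemma integrable_bounded_M:
  fixes f :: "'a \<Rightarrow> complex"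
  assumes "f \<in> borel_measurable borel" "\<And>x. norm (f x) \<le> C"
  shows "integrable M f"
  by (rule M.integrable_const_bound[of _ C]) (use assms in \<open>auto simp: measurable_cong_sets[OF sets_M refl]\<close>)

lemma integral_rep_sum:
  fixes g :: "('a \<Rightarrow> complex mat) \<Rightarrow> nat \<Rightarrow> nat \<Rightarrow> 'a \<Rightarrow> complex"
  assumes g: "\<And>\<eta> r s. \<eta> \<in> F \<Longrightarrow> r < rep_dim H \<eta> \<Longrightarrow> s < rep_dim H \<eta> \<Longrightarrow> integrable M (g \<eta> r s)"
  shows "(\<integral>x. (\<Sum>\<eta>\<in>F. of_nat (rep_dim H \<eta>) * (\<Sum>r<rep_dim H \<eta>. \<Sum>s<rep_dim H \<eta>. k \<eta> r s * g \<eta> r s x)) \<partial>M) =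
    (\<Sum>\<eta>\<in>F. of_nat (rep_dim H \<eta>) * (\<Sum>r<rep_dim H \<eta>. \<Sum>s<rep_dim H \<eta>. k \<eta> r s * (\<integral>x. g \<eta> r s x \<partial>M)))"
proof -
  have i1: "integrable M (\<lambda>x. \<Sum>s<rep_dim H \<eta>. k \<eta> r s * g \<eta> r s x)" if "\<eta> \<in> F" "r < rep_dim H \<eta>" for \<eta> r
    by (intro Bochner_Integration.integrable_sum integrable_mult_right g) (use that in auto)
  have i2: "integrable M (\<lambda>x. \<Sum>r<rep_dim H \<eta>. \<Sum>s<rep_dim H \<eta>. k \<eta> r s * g \<eta> r s x)" if "\<eta> \<in> F" for \<eta>
    by (intro Bochner_Integration.integrable_sum i1) (use that in auto)
  have e1: "(\<integral>x. (\<Sum>s<rep_dim H \<eta>. k \<eta> r s * g \<eta> r s x) \<partial>M) = (\<Sum>s<rep_dim H \<eta>. k \<eta> r s * (\<integral>x. g \<eta> r s x \<partial>M))"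
    if "\<eta> \<in> F" "r < rep_dim H \<eta>" for \<eta> r
    by (subst Bochner_Integration.integral_sum) (use that in \<open>auto intro!: integrable_mult_right g\<close>)
  have e2: "(\<integral>x. (\<Sum>r<rep_dim H \<eta>. \<Sum>s<rep_dim H \<eta>. k \<eta> r s * g \<eta> r s x) \<partial>M) =
     (\<Sum>r<rep_dim H \<eta>. \<Sum>s<rep_dim H \<eta>. k \<eta> r s * (\<integral>x. g \<eta> r s x \<partial>M))" if "\<eta> \<in> F" for \<eta>
  proof -
    have "(\<integral>x. (\<Sum>r<rep_dim H \<eta>. \<Sum>s<rep_dim H \<eta>. k \<eta> r s * g \<eta> r s x) \<partial>M) =
      (\<Sum>r<rep_dim H \<eta>. \<integral>x. (\<Sum>s<rep_dim H \<eta>. k \<eta> r s * g \<eta> r s x) \<partial>M)"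
      by (rule Bochner_Integration.integral_sum) (use i1 that in auto)
    thus ?thesis using e1[OF that] by simp
  qed
  have "(\<integral>x. (\<Sum>\<eta>\<in>F. of_nat (rep_dim H \<eta>) * (\<Sum>r<rep_dim H \<eta>. \<Sum>s<rep_dim H \<eta>. k \<eta> r s * g \<eta> r s x)) \<partial>M) =
    (\<Sum>\<eta>\<in>F. \<integral>x. of_nat (rep_dim H \<eta>) * (\<Sum>r<rep_dim H \<eta>. \<Sum>s<rep_dim H \<eta>. k \<eta> r s * g \<eta> r s x) \<partial>M)"
    by (rule Bochner_Integration.integral_sum) (intro integrable_mult_right i2)
  also have "\<dots> = (\<Sum>\<eta>\<in>F. of_nat (rep_dim H \<eta>) * (\<integral>x. (\<Sum>r<rep_dim H \<eta>. \<Sum>s<rep_dim H \<eta>. k \<eta> r s * g \<eta> r s x) \<partial>M))"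
    by simp
  finally show ?thesis using e2 by simp
qed

text \<open>For a product w(x) b(y) the double integral splits into the sum of d \<alpha> \<beta>
  over the Fourier coefficients of the two factors. The inequality between geometric and arithmetic
  mean, followed by Bessel for each factor, bounds it by 1 whatever \<open>F\<close> is.\<close>

lemma rep_kernel_bilinear_bound1:
  assumes R: "dual_representatives H R" and F: "F \<subseteq> R" "finite F"
    and w: "w \<in> borel_measurable borel" "\<And>x. norm (w x) \<le> 1"
    and b: "b \<in> borel_measurable borel" "\<And>x. norm (b x) \<le> 1"
  shows "norm (\<integral>x. (\<integral>y. w x * b y * rep_kernel F x y \<partial>M) \<partial>M) \<le> 1"
proof -
  have irr: "irreducible_rep H \<eta>" if "\<eta> \<in> F" for \<eta> using R F that dual_representatives_irr by blast
  define \<alpha> where "\<alpha> \<eta> r s = (\<integral>x. w x * cnj (\<eta> x $$ (s, r)) \<partial>M)" for \<eta> and r s :: nat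
  define \<beta> where "\<beta> \<eta> r s = (\<integral>x. b x * \<eta> x $$ (s, r) \<partial>M)" for \<eta> and r s :: nat
  \<comment> \<open>The coefficient of the conjugate of \<open>b\<close>, in the form that the
    Bessel estimate expects; its modulus is that of \<open>\<beta>\<close>.\<close>
  define \<gamma> where "\<gamma> \<eta> r s = (\<integral>x. cnj (b x) * cnj (\<eta> x $$ (s, r)) \<partial>M)" for \<eta> and r s :: nat
  have bb: "\<exists>C. \<forall>x. norm (\<eta> x $$ (s, r)) \<le> C" if "\<eta> \<in> F" "r < rep_dim H \<eta>" "s < rep_dim H \<eta>" for \<eta> r s
    using compact_imp_bounded[OF compact_continuous_image[OF repD(5)[OF irr[OF that(1)] that(3,2)] compact_UNIV]] by (auto simp: bounded_iff)
  have meas: "(\<lambda>x. \<eta> x $$ (s, r)) \<in> borel_measurable borel" if "\<eta> \<in> F" "r < rep_dim H \<eta>" "s < rep_dim H \<eta>" for \<eta> r s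
    by (rule borel_measurable_continuous_onI[OF repD(5)[OF irr[OF that(1)] that(3,2)]])
  have iw: "integrable M (\<lambda>x. w x * cnj (\<eta> x $$ (s, r)))" and ib: "integrable M (\<lambda>x. b x * \<eta> x $$ (s, r))"
    if \<eta>: "\<eta> \<in> F" "r < rep_dim H \<eta>" "s < rep_dim H \<eta>" for \<eta> r s
  proof -
    obtain C where C: "\<And>x. norm (\<eta> x $$ (s, r)) \<le> C" using bb[OF \<eta>] by blast
    have "norm (w x * cnj (\<eta> x $$ (s, r))) \<le> 1 * C" "norm (b x * \<eta> x $$ (s, r)) \<le> 1 * C" for x
      unfolding norm_mult complex_mod_cnj by (intro mult_mono w(2) b(2) C; simp)+
    thus "integrable M (\<lambda>x. w x * cnj (\<eta> x $$ (s, r)))" "integrable M (\<lambda>x. b x * \<eta> x $$ (s, r))"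
      using w(1) b(1) meas[OF \<eta>] by (auto intro!: integrable_bounded_M[of _ "1 * C"])
  qed
  have \<gamma>: "\<gamma> \<eta> r s = cnj (\<beta> \<eta> r s)" if "\<eta> \<in> F" "r < rep_dim H \<eta>" "s < rep_dim H \<eta>" for \<eta> r s
  proof -
    have "\<gamma> \<eta> r s = (\<integral>x. cnj (b x * \<eta> x $$ (s, r)) \<partial>M)" by (simp add: \<gamma>_def)
    also have "\<dots> = cnj (\<integral>x. b x * \<eta> x $$ (s, r) \<partial>M)"
      by (rule integral_bounded_linear[OF bounded_linear_cnj ib[OF that]])
    finally show ?thesis by (simp add: \<beta>_def)
  qed
  have inner: "(\<integral>y. w x * b y * rep_kernel F x y \<partial>M) =
     (\<Sum>\<eta>\<in>F. of_nat (rep_dim H \<eta>) * (\<Sum>r<rep_dim H \<eta>. \<Sum>s<rep_dim H \<eta>. w x * cnj (\<eta> x $$ (s, r)) * \<beta> \<eta> r s))" for x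
  proof -
    have "(\<integral>y. w x * b y * rep_kernel F x y \<partial>M) =
      (\<integral>y. (\<Sum>\<eta>\<in>F. of_nat (rep_dim H \<eta>) * (\<Sum>r<rep_dim H \<eta>. \<Sum>s<rep_dim H \<eta>. w x * cnj (\<eta> x $$ (s, r)) * (b y * \<eta> y $$ (s, r)))) \<partial>M)"
      unfolding rep_kernel_def by (simp add: sum_distrib_left mult_ac)
    also have "\<dots> = (\<Sum>\<eta>\<in>F. of_nat (rep_dim H \<eta>) * (\<Sum>r<rep_dim H \<eta>. \<Sum>s<rep_dim H \<eta>. w x * cnj (\<eta> x $$ (s, r)) * \<beta> \<eta> r s))"
      unfolding \<beta>_def by (rule integral_rep_sum) (rule ib)
    finally show ?thesis .
  qed
  have "(\<integral>x. (\<integral>y. w x * b y * rep_kernel F x y \<partial>M) \<partial>M) =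
     (\<Sum>\<eta>\<in>F. of_nat (rep_dim H \<eta>) * (\<Sum>r<rep_dim H \<eta>. \<Sum>s<rep_dim H \<eta>. \<alpha> \<eta> r s * \<beta> \<eta> r s))"
  proof -
    have "(\<integral>x. (\<integral>y. w x * b y * rep_kernel F x y \<partial>M) \<partial>M) =
     (\<integral>x. (\<Sum>\<eta>\<in>F. of_nat (rep_dim H \<eta>) * (\<Sum>r<rep_dim H \<eta>. \<Sum>s<rep_dim H \<eta>. \<beta> \<eta> r s * (w x * cnj (\<eta> x $$ (s, r))))) \<partial>M)"
      unfolding inner by (simp add: mult.commute)
    also have "\<dots> = (\<Sum>\<eta>\<in>F. of_nat (rep_dim H \<eta>) * (\<Sum>r<rep_dim H \<eta>. \<Sum>s<rep_dim H \<eta>. \<beta> \<eta> r s * (\<integral>x. w x * cnj (\<eta> x $$ (s, r)) \<partial>M)))"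
      by (rule integral_rep_sum) (rule iw)
    finally show ?thesis by (simp add: \<alpha>_def mult.commute)
  qed
  also have "norm \<dots> \<le> (\<Sum>\<eta>\<in>F. real (rep_dim H \<eta>) * (\<Sum>r<rep_dim H \<eta>. \<Sum>s<rep_dim H \<eta>. ((cmod (\<alpha> \<eta> r s))\<^sup>2 + (cmod (\<gamma> \<eta> r s))\<^sup>2) / 2))"
  proof (rule sum_norm_le)
    fix \<eta> assume "\<eta> \<in> F"
    have "norm (\<alpha> \<eta> r s * \<beta> \<eta> r s) \<le> ((cmod (\<alpha> \<eta> r s))\<^sup>2 + (cmod (\<gamma> \<eta> r s))\<^sup>2) / 2"
      if "r < rep_dim H \<eta>" "s < rep_dim H \<eta>" for r s
      using sum_squares_bound[of "cmod (\<alpha> \<eta> r s)" "cmod (\<beta> \<eta> r s)"] by (simp add: norm_mult \<gamma>[OF \<open>\<eta> \<in> F\<close> that])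
    hence "norm (\<Sum>r<rep_dim H \<eta>. \<Sum>s<rep_dim H \<eta>. \<alpha> \<eta> r s * \<beta> \<eta> r s) \<le>
       (\<Sum>r<rep_dim H \<eta>. \<Sum>s<rep_dim H \<eta>. ((cmod (\<alpha> \<eta> r s))\<^sup>2 + (cmod (\<gamma> \<eta> r s))\<^sup>2) / 2)"
      by (intro sum_norm_le) auto
    thus "norm (of_nat (rep_dim H \<eta>) * (\<Sum>r<rep_dim H \<eta>. \<Sum>s<rep_dim H \<eta>. \<alpha> \<eta> r s * \<beta> \<eta> r s)) \<le>
       real (rep_dim H \<eta>) * (\<Sum>r<rep_dim H \<eta>. \<Sum>s<rep_dim H \<eta>. ((cmod (\<alpha> \<eta> r s))\<^sup>2 + (cmod (\<gamma> \<eta> r s))\<^sup>2) / 2)"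
      by (simp add: norm_mult mult_left_mono)
  qed
  also have "\<dots> = ((\<Sum>\<eta>\<in>F. real (rep_dim H \<eta>) * (\<Sum>r<rep_dim H \<eta>. \<Sum>s<rep_dim H \<eta>. (cmod (\<alpha> \<eta> r s))\<^sup>2)) +
      (\<Sum>\<eta>\<in>F. real (rep_dim H \<eta>) * (\<Sum>r<rep_dim H \<eta>. \<Sum>s<rep_dim H \<eta>. (cmod (\<gamma> \<eta> r s))\<^sup>2))) / 2"
    by (simp add: sum.distrib sum_divide_distrib[symmetric] distrib_left add_divide_distrib)
  also have "\<dots> \<le> (1 + 1) / 2"
  proof (rule divide_right_mono, rule add_mono)
    show "(\<Sum>\<eta>\<in>F. real (rep_dim H \<eta>) * (\<Sum>r<rep_dim H \<eta>. \<Sum>s<rep_dim H \<eta>. (cmod (\<alpha> \<eta> r s))\<^sup>2)) \<le> 1"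
      unfolding \<alpha>_def by (rule rep_coefficients_bessel[OF R F w])
    show "(\<Sum>\<eta>\<in>F. real (rep_dim H \<eta>) * (\<Sum>r<rep_dim H \<eta>. \<Sum>s<rep_dim H \<eta>. (cmod (\<gamma> \<eta> r s))\<^sup>2)) \<le> 1"
      unfolding \<gamma>_def by (rule rep_coefficients_bessel[OF R F]) (use b in auto)
  qed simp
  finally show ?thesis by simp
qed

lemma rep_kernel_bilinear_bound:
  assumes R: "dual_representatives H R" and F: "F \<subseteq> R" "finite F"
    and w: "w \<in> borel_measurable borel" "\<And>x. norm (w x) \<le> 1"
    and b: "b \<in> borel_measurable borel" "\<And>x. norm (b x) \<le> C"
  shows "norm (\<integral>x. (\<integral>y. w x * b y * rep_kernel F x y \<partial>M) \<partial>M) \<le> C"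
proof (cases "C = 0")
  case True
  hence "b y = 0" for y using b(2)[of y] by simp
  thus ?thesis using True by simp
next
  case False
  have C: "C > 0" using False b(2)[of \<one>] norm_ge_zero[of "b \<one>"] by linarith
  define b' where "b' y = b y / complex_of_real C" for y
  have "norm (\<integral>x. (\<integral>y. w x * b' y * rep_kernel F x y \<partial>M) \<partial>M) \<le> 1"
    by (rule rep_kernel_bilinear_bound1[OF R F w]) (use b C in \<open>auto simp: b'_def norm_divide\<close>)
  moreover have "(\<integral>x. (\<integral>y. w x * b y * rep_kernel F x y \<partial>M) \<partial>M) =
     (\<integral>x. (\<integral>y. complex_of_real C * (w x * b' y * rep_kernel F x y) \<partial>M) \<partial>M)"
    using C by (simp add: b'_def)
  hence "(\<integral>x. (\<integral>y. w x * b y * rep_kernel F x y \<partial>M) \<partial>M) =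
     complex_of_real C * (\<integral>x. (\<integral>y. w x * b' y * rep_kernel F x y \<partial>M) \<partial>M)"
    by (simp only: integral_mult_right_zero)
  ultimately show ?thesis using C by (simp add: norm_mult)
qed

end

text \<open>Merges finitely many seminorm estimates into one. The sets \<open>Y a\<close> may be
  infinite: in the applications they are compact sets of points, or pairs of a finite set of
  representations and a point, and the estimate stays uniform over them.\<close>

lemma admissible_uniform:
  assumes "finite A"
    and "\<And>a. a \<in> A \<Longrightarrow> \<exists>I C. admissible \<A> I \<and> C \<ge> 0 \<and>
      (\<forall>f\<in>S. \<forall>B>0. seminorms_le I B f \<longrightarrow> (\<forall>y\<in>Y a. g a f y \<le> C * B))"
  shows "\<exists>I C. admissible \<A> I \<and> C \<ge> 0 \<and>
      (\<forall>f\<in>S. \<forall>B>(0::real). seminorms_le I B f \<longrightarrow> (\<forall>a\<in>A. \<forall>y\<in>Y a. g a f y \<le> C * B))"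
  using assms
proof (induction A rule: finite_induct)
  case empty
  show ?case using admissible_empty by (intro exI[of _ "{}"] exI[of _ 0]) auto
next
  case (insert a A)
  have "\<exists>I C. admissible \<A> I \<and> C \<ge> 0 \<and> (\<forall>f\<in>S. \<forall>B>0. seminorms_le I B f \<longrightarrow> (\<forall>y\<in>Y a. g a f y \<le> C * B))"
    by (rule insert.prems) simp
  then obtain I C where I: "admissible \<A> I" "C \<ge> 0"
    "\<And>f B y. f \<in> S \<Longrightarrow> B > 0 \<Longrightarrow> seminorms_le I B f \<Longrightarrow> y \<in> Y a \<Longrightarrow> g a f y \<le> C * B" by blast
  have "\<exists>I C. admissible \<A> I \<and> C \<ge> 0 \<and>
      (\<forall>f\<in>S. \<forall>B>(0::real). seminorms_le I B f \<longrightarrow> (\<forall>a\<in>A. \<forall>y\<in>Y a. g a f y \<le> C * B))"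
    by (rule insert.IH, rule insert.prems) simp
  then obtain J D where J: "admissible \<A> J" "D \<ge> 0"
    "\<And>f B a y. f \<in> S \<Longrightarrow> B > 0 \<Longrightarrow> seminorms_le J B f \<Longrightarrow> a \<in> A \<Longrightarrow> y \<in> Y a \<Longrightarrow> g a f y \<le> D * B" by blast
  show ?case
  proof (intro exI[of _ "I \<union> J"] exI[of _ "C + D"] conjI ballI allI impI)
    show "admissible \<A> (I \<union> J)" by (rule admissible_Un[OF I(1) J(1)])
    show "0 \<le> C + D" using I(2) J(2) by simp
    fix f B a' y assume f: "f \<in> S" and B: "(0::real) < B" and le: "seminorms_le (I \<union> J) B f" and a': "a' \<in> insert a A" and y: "y \<in> Y a'"
    have leI: "seminorms_le I B f" and leJ: "seminorms_le J B f"
      using seminorms_le_mono[OF le _ order.refl] by auto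
    have "C * B \<le> (C + D) * B" "D * B \<le> (C + D) * B" using I(2) J(2) B by (auto intro!: mult_right_mono)
    thus "g a' f y \<le> (C + D) * B"
      using I(3)[OF f B leI] J(3)[OF f B leJ] a' y by force
  qed
qed

lemma continuous_on_sum_list:
  fixes f :: "'i \<Rightarrow> 'a::topological_space \<Rightarrow> 'b::real_normed_vector"
  assumes "\<And>i. i \<in> set xs \<Longrightarrow> continuous_on S (f i)"
  shows "continuous_on S (\<lambda>x. \<Sum>i\<leftarrow>xs. f i x)"
  using assms by (induction xs) (auto intro!: continuous_on_add)

lemma param_smoothD:
  assumes "param_smooth S f"
  shows "x \<in> S \<Longrightarrow> iter_deriv vs (\<lambda>s. f s y) differentiable (at x)"
    and "continuous_on (S \<times> UNIV) (\<lambda>(x, y). iter_deriv vs (\<lambda>s. f s y) x)"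
  using assms[unfolded param_smooth_def, THEN spec, of vs] by auto

lemma param_smooth_deriv:
  assumes "param_smooth S f"
  shows "param_smooth S (\<lambda>s y. frechet_derivative (\<lambda>s. f s y) (at s) b)"
proof -
  have eq: "iter_deriv vs (\<lambda>s. frechet_derivative (\<lambda>s. f s y) (at s) b) = iter_deriv (vs @ [b]) (\<lambda>s. f s y)" for vs y
    by (simp add: iter_deriv_append)
  show ?thesis unfolding param_smooth_def eq
    by (intro allI conjI ballI param_smoothD[OF assms])
qed

lemma param_smooth_continuous: "param_smooth S f \<Longrightarrow> continuous_on (S \<times> UNIV) (\<lambda>(x, y). f x y)"
  using param_smoothD(2)[of S f "[]"] by simp

lemma param_smooth_has_derivative:
  assumes "param_smooth S f" "x \<in> S"
  shows "((\<lambda>s. f s y) has_derivative frechet_derivative (\<lambda>s. f s y) (at x)) (at x)"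
  using param_smoothD(1)[OF assms, of "[]" y] by (simp add: has_frechet_derivative)

section \<open>From the bilinear bound to evaluation at the identity\<close>

context compact_lie
begin

sublocale MM: pair_prob_space M M ..

lemma sets_MM: "sets (M \<Otimes>\<^sub>M M) = sets (borel :: ('a \<times> 'a) measure)"
  unfolding borel_prod[symmetric] by (rule sets_pair_measure_cong[OF sets_M sets_M])

lemma integral_MM:
  fixes h :: "'a \<times> 'a \<Rightarrow> complex"
  assumes h: "h \<in> borel_measurable borel" "\<And>z. norm (h z) \<le> C"
  shows "integrable (M \<Otimes>\<^sub>M M) h" "(\<integral>x. (\<integral>y. h (x, y) \<partial>M) \<partial>M) = (\<integral>z. h z \<partial>(M \<Otimes>\<^sub>M M))"
proof -
  show *: "integrable (M \<Otimes>\<^sub>M M) h"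
    by (rule MM.P.integrable_const_bound[of _ C]) (use h in \<open>auto simp: measurable_cong_sets[OF sets_MM refl]\<close>)
  show "(\<integral>x. (\<integral>y. h (x, y) \<partial>M) \<partial>M) = (\<integral>z. h z \<partial>(M \<Otimes>\<^sub>M M))"
    using MM.integral_fst'[OF *] .
qed

lemma compact_UNIV2: "compact (UNIV :: ('a \<times> 'a) set)"
  using compact_Times[OF compact_UNIV compact_UNIV] by simp

lemma rep_kernel_bounded:
  assumes R: "dual_representatives H R" and F: "F \<subseteq> R"
  obtains c where "c \<ge> 0" "\<And>x y. norm (rep_kernel F x y) \<le> c"
proof -
  have "continuous_on UNIV (\<lambda>z :: 'a \<times> 'a. rep_kernel F (fst z) (snd z))"
    by (intro continuous_rep_kernel[OF R F] continuous_on_fst continuous_on_snd continuous_on_id)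
  from compact_imp_bounded[OF compact_continuous_image[OF this compact_UNIV2]]
  obtain c where "\<And>x y. norm (rep_kernel F x y) \<le> c" by (force simp: bounded_iff)
  with that[of "max c 0"] show thesis by (meson max.cobounded1 max.cobounded2 order_trans)
qed

lemma measurable_rep_kernel:
  assumes R: "dual_representatives H R" and F: "F \<subseteq> R"
  shows "(\<lambda>z. rep_kernel F (fst z) (snd z)) \<in> borel_measurable borel"
  by (intro borel_measurable_continuous_onI continuous_rep_kernel[OF R F] continuous_on_fst continuous_on_snd continuous_on_id)

lemma measurable_fst_borel:
  "w \<in> borel_measurable borel \<Longrightarrow> (\<lambda>z :: 'a \<times> 'b::second_countable_topology. w (fst z)) \<in> borel_measurable borel"
  by (rule measurable_compose[of fst borel borel])
    (intro borel_measurable_continuous_onI continuous_on_fst continuous_on_id)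

text \<open>Writing a function on a box through its iterated one-dimensional integrals turns the kernel
  into a superposition of products of a bounded weight in the first variable and a mixed derivative
  in the second, to which the bilinear bound applies.\<close>

lemma rep_kernel_box_bound:
  fixes Fn :: "'v::real_normed_vector \<Rightarrow> 'a \<Rightarrow> complex" and \<tau> :: "'v \<Rightarrow> 'a \<Rightarrow> real"
  assumes R: "dual_representatives H R" and F: "F \<subseteq> R" "finite F"
    and S: "open S" and Fn: "param_smooth S Fn" and U: "open U" and r: "r \<ge> 0"
    and \<tau>: "\<And>b. b \<in> set bs \<Longrightarrow> continuous_on U (\<tau> b)" "\<And>b x. b \<in> set bs \<Longrightarrow> x \<in> U \<Longrightarrow> \<bar>\<tau> b x\<bar> \<le> r"
    and dist: "distinct bs"
    and w: "w \<in> borel_measurable borel" "\<And>x. norm (w x) \<le> 1" "\<And>x. x \<notin> U \<Longrightarrow> w x = 0"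
    and box: "\<And>t. (\<And>b. b \<in> set bs \<Longrightarrow> \<bar>t b\<bar> \<le> r) \<Longrightarrow> p + (\<Sum>b\<leftarrow>bs. t b *\<^sub>R b) \<in> Q" and QS: "Q \<subseteq> S"
    and bound: "\<And>vs v y. set vs \<subseteq> set bs \<Longrightarrow> length vs \<le> length bs \<Longrightarrow> v \<in> Q \<Longrightarrow> norm (iter_deriv vs (\<lambda>v. Fn v y) v) \<le> C"
  shows "norm (\<integral>z. w (fst z) * Fn (p + (\<Sum>b\<leftarrow>bs. \<tau> b (fst z) *\<^sub>R b)) (snd z) * rep_kernel F (fst z) (snd z) \<partial>(M \<Otimes>\<^sub>M M)) \<le> (1 + 2 * r) ^ length bs * C"
  using Fn \<tau> dist w box bound
proof (induction bs arbitrary: p w Fn)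
  case Nil
  have p: "p \<in> Q" using Nil.prems(8)[of "\<lambda>_. 0"] by simp
  \<comment> \<open>With no direction left, the first argument of \<open>Fn\<close> is the constant
    \<open>p\<close>, so the integrand is a weight in one variable times a function of the other,
    times the kernel.\<close>
  have b: "(\<lambda>y. Fn p y) \<in> borel_measurable borel" "\<And>y. norm (Fn p y) \<le> C"
  proof -
    have "continuous_on UNIV (\<lambda>y :: 'a. (p, y))" by (intro continuous_on_Pair continuous_on_const continuous_on_id)
    from continuous_on_compose2[OF param_smooth_continuous[OF Nil.prems(1)] this] p QS
    show "(\<lambda>y. Fn p y) \<in> borel_measurable borel" by (intro borel_measurable_continuous_onI) auto
    show "\<And>y. norm (Fn p y) \<le> C" using Nil.prems(9)[of "[]" p] p by simp
  qed
  obtain c where c: "c \<ge> 0" "\<And>x y. norm (rep_kernel F x y) \<le> c" using rep_kernel_bounded[OF R F(1)] by blast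
  have C: "C \<ge> 0" using b(2)[of \<one>] norm_ge_zero order_trans by blast
  have sndm: "(\<lambda>z :: 'a \<times> 'a. Fn p (snd z)) \<in> borel_measurable borel"
    by (rule measurable_compose[OF _ b(1)]) (intro borel_measurable_continuous_onI continuous_on_snd continuous_on_id)
  have "(\<integral>z. w (fst z) * Fn p (snd z) * rep_kernel F (fst z) (snd z) \<partial>(M \<Otimes>\<^sub>M M)) =
     (\<integral>x. (\<integral>y. w x * Fn p y * rep_kernel F x y \<partial>M) \<partial>M)"
  proof (subst integral_MM(2)[where C = "1 * C * c", symmetric])
    show "(\<lambda>z. w (fst z) * Fn p (snd z) * rep_kernel F (fst z) (snd z)) \<in> borel_measurable borel"
      by (intro borel_measurable_times measurable_fst_borel Nil.prems sndm measurable_rep_kernel[OF R F(1)])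
    show "norm (w (fst z) * Fn p (snd z) * rep_kernel F (fst z) (snd z)) \<le> 1 * C * c" for z
      unfolding norm_mult by (intro mult_mono Nil.prems b(2) c mult_nonneg_nonneg norm_ge_zero C) auto
  qed simp
  also have "norm \<dots> \<le> C" by (rule rep_kernel_bilinear_bound[OF R F Nil.prems(5,6) b])
  finally show ?case by simp
next
  case (Cons b bs)
  note Fn = Cons.prems(1) and w = Cons.prems(5-7) and box = Cons.prems(8) and bound = Cons.prems(9)
  have \<tau>c: "continuous_on U (\<tau> b')" if "b' \<in> insert b (set bs)" for b' using Cons.prems(2) that by simp
  have \<tau>r: "\<bar>\<tau> b' x\<bar> \<le> r" if "b' \<in> insert b (set bs)" "x \<in> U" for b' x using Cons.prems(3) that by simp
  have bbs: "b \<notin> set bs" "distinct bs" using Cons.prems(4) by auto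
  define \<sigma> where "\<sigma> x = (\<Sum>b\<leftarrow>bs. \<tau> b x *\<^sub>R b)" for x
  define Fn' where "Fn' v y = frechet_derivative (\<lambda>v. Fn v y) (at v) b" for v y
  have Fn': "param_smooth S Fn'" unfolding Fn'_def by (rule param_smooth_deriv[OF Fn])
  have box': "p + s *\<^sub>R b + (\<Sum>b\<leftarrow>bs. t b *\<^sub>R b) \<in> Q" if "\<bar>s\<bar> \<le> r" "\<And>b. b \<in> set bs \<Longrightarrow> \<bar>t b\<bar> \<le> r" for s t
  proof -
    \<comment> \<open>The update sets the coordinate along \<open>b\<close>; by distinctness
      \<open>b\<close> does not occur in \<open>bs\<close>, so the other coordinates are
      unaffected.\<close>
    have "p + (\<Sum>b'\<leftarrow>b # bs. (t(b := s)) b' *\<^sub>R b') \<in> Q" by (rule box) (use that in auto)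
    moreover have "(\<Sum>b'\<leftarrow>bs. (t(b := s)) b' *\<^sub>R b') = (\<Sum>b'\<leftarrow>bs. t b' *\<^sub>R b')"
      by (rule arg_cong[where f = sum_list], rule map_cong) (use bbs in auto)
    ultimately show ?thesis by (simp add: add.assoc)
  qed
  have inQ: "p + s *\<^sub>R b + \<sigma> x \<in> Q" if "\<bar>s\<bar> \<le> r" "x \<in> U" for s x
    unfolding \<sigma>_def by (rule box'[OF that(1)]) (use \<tau>r that in auto)
  have bnd: "norm (Fn v y) \<le> C" "norm (Fn' v y) \<le> C" if "v \<in> Q" for v y
    using bound[of "[]" v y] bound[of "[b]" v y] that by (auto simp: Fn'_def)
  have "p \<in> Q" using box[of "\<lambda>_. 0"] r by simp
  hence C: "C \<ge> 0" using bnd(1)[of p \<one>] norm_ge_zero order_trans by blast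
  obtain c where c: "c \<ge> 0" "\<And>x y. norm (rep_kernel F x y) \<le> c" using rep_kernel_bounded[OF R F(1)] by blast
  have \<sigma>c: "continuous_on U \<sigma>" unfolding \<sigma>_def
    by (rule continuous_on_sum_list, rule continuous_on_scaleR) (auto intro: \<tau>c continuous_on_const)
  \<comment> \<open>The coordinate \<open>\<tau> b\<close> is known to be continuous only on
    \<open>U\<close>; extended by zero it is Borel on the whole group.\<close>
  define \<tau>' where "\<tau>' x = indicator U x *\<^sub>R \<tau> b x" for x
  have \<tau>'m: "\<tau>' \<in> borel_measurable borel" unfolding \<tau>'_def
    by (rule borel_measurable_continuous_on_indicator) (use U \<tau>c in auto)
  \<comment> \<open>The derivative along \<open>b\<close> where the box parametrisation makes sense,
    and zero elsewhere, so that it is measurable and bounded by \<open>C\<close> everywhere.\<close>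
  define g where "g z = indicator (U \<times> UNIV \<times> {-r..r}) (fst (fst z), snd (fst z), snd z) *\<^sub>R Fn' (p + snd z *\<^sub>R b + \<sigma> (fst (fst z))) (snd (fst z))" for z :: "('a \<times> 'a) \<times> real"
  have gm: "g \<in> borel_measurable borel"
  proof -
    let ?S = "(U \<times> UNIV) \<times> {-r..r} :: (('a \<times> 'a) \<times> real) set"
    have "?S \<in> sets borel" unfolding borel_prod[symmetric] using U by (intro pair_measureI) auto
    moreover have "continuous_on ?S (\<lambda>z. (p + snd z *\<^sub>R b + \<sigma> (fst (fst z)), snd (fst z)))"
      by (intro continuous_intros continuous_on_compose2[OF \<sigma>c]) auto
    from continuous_on_compose2[OF param_smooth_continuous[OF Fn'] this]
    have "continuous_on ?S (\<lambda>z. Fn' (p + snd z *\<^sub>R b + \<sigma> (fst (fst z))) (snd (fst z)))"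
      using inQ QS by fastforce
    ultimately have "(\<lambda>z. indicator ?S z *\<^sub>R Fn' (p + snd z *\<^sub>R b + \<sigma> (fst (fst z))) (snd (fst z))) \<in> borel_measurable borel"
      by (rule borel_measurable_continuous_on_indicator)
    moreover have "indicator ?S z = (indicator (U \<times> UNIV \<times> {-r..r}) (fst (fst z), snd (fst z), snd z) :: real)" for z
      by (cases z) (auto simp: indicator_def)
    ultimately show ?thesis by (simp add: g_def[abs_def])
  qed
  have gb: "norm (g z) \<le> C" for z
    using bnd(2)[OF inQ] C by (auto simp: g_def indicator_def)
  \<comment> \<open>The condition \<open>s \<le> \<tau>' (fst z)\<close> encodes the upper limit of
    integration. It involves the first group variable and \<open>s\<close>, but not the second group
    variable.\<close>
  define h where "h z s = w (fst z) * (if s \<le> \<tau>' (fst z) then 1 else 0) * g (z, s) * rep_kernel F (fst z) (snd z)" for z and s :: real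
  have hb: "norm (h z s) \<le> 1 * 1 * C * c" for z s
    unfolding h_def norm_mult by (intro mult_mono w gb c mult_nonneg_nonneg norm_ge_zero C) auto
  have hm: "(\<lambda>z. h (fst z) (snd z)) \<in> borel_measurable borel"
  proof -
    have f1: "(\<lambda>z :: ('a \<times> 'a) \<times> real. u (fst (fst z))) \<in> borel_measurable borel" if "u \<in> borel_measurable borel" for u :: "'a \<Rightarrow> 'c::topological_space"
      by (rule measurable_compose[OF _ that]) (intro borel_measurable_continuous_onI continuous_on_fst continuous_on_id)
    have s1: "(\<lambda>z :: ('a \<times> 'a) \<times> real. snd z) \<in> borel_measurable borel"
      by (intro borel_measurable_continuous_onI continuous_on_snd continuous_on_id)
    have k1: "(\<lambda>z :: ('a \<times> 'a) \<times> real. rep_kernel F (fst (fst z)) (snd (fst z))) \<in> borel_measurable borel"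
      by (rule measurable_compose[OF _ measurable_rep_kernel[OF R F(1)]]) (intro borel_measurable_continuous_onI continuous_on_fst continuous_on_id)
    have "{z :: ('a \<times> 'a) \<times> real. snd z \<le> \<tau>' (fst (fst z))} \<in> sets borel"
      using borel_measurable_le[OF s1 f1[OF \<tau>'m]] by simp
    hence i1: "(\<lambda>z :: ('a \<times> 'a) \<times> real. if snd z \<le> \<tau>' (fst (fst z)) then 1 else 0 :: complex) \<in> borel_measurable borel"
      by (intro measurable_If) auto
    show ?thesis unfolding h_def prod.collapse
      by (intro borel_measurable_times f1 w i1 gm k1)
  qed
  \<comment> \<open>Lebesgue measure on the interval as a finite measure of mass
    \<open>2 * r\<close>, so that Fubini applies to the bounded integrand \<open>h\<close>.\<close>
  define N where "N = restrict_space lborel {-r..r}"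
  have spN: "space N = {-r..r}" by (simp add: N_def space_restrict_space)
  have emN: "emeasure N (space N) = ennreal (2 * r)"
    unfolding spN N_def using r by (subst emeasure_restrict_space) auto
  interpret N: finite_measure N by (rule finite_measureI) (simp add: emN)
  have mN: "measure N (space N) = 2 * r" using emN r by (simp add: measure_def)
  interpret PN: pair_sigma_finite "M \<Otimes>\<^sub>M M" N ..
  have idm: "(\<lambda>z. z) \<in> (M \<Otimes>\<^sub>M M) \<Otimes>\<^sub>M N \<rightarrow>\<^sub>M borel"
  proof -
    have "(\<lambda>s. s) \<in> N \<rightarrow>\<^sub>M borel" unfolding N_def by (rule measurable_restrict_space1) simp
    moreover have "(\<lambda>z. z) \<in> (M \<Otimes>\<^sub>M M) \<rightarrow>\<^sub>M borel" by (simp add: measurable_cong_sets[OF sets_MM refl])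
    ultimately have "(\<lambda>z. (fst z, snd z)) \<in> (M \<Otimes>\<^sub>M M) \<Otimes>\<^sub>M N \<rightarrow>\<^sub>M borel \<Otimes>\<^sub>M borel"
      by (intro measurable_Pair measurable_compose[OF measurable_fst] measurable_compose[OF measurable_snd]) auto
    thus ?thesis by (simp add: borel_prod)
  qed
  have finP: "finite_measure ((M \<Otimes>\<^sub>M M) \<Otimes>\<^sub>M N)"
    by (rule finite_measure_pair_measure) (unfold_locales)
  have hint: "integrable ((M \<Otimes>\<^sub>M M) \<Otimes>\<^sub>M N) (case_prod h)"
  proof (rule finite_measure.integrable_const_bound[OF finP, of _ "1 * 1 * C * c"])
    show "case_prod h \<in> borel_measurable ((M \<Otimes>\<^sub>M M) \<Otimes>\<^sub>M N)"
      using measurable_compose[OF idm hm] by (simp add: split_beta')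
  qed (use hb in auto)
  have fub: "(\<integral>z. (\<integral>s. h z s \<partial>N) \<partial>(M \<Otimes>\<^sub>M M)) = (\<integral>s. (\<integral>z. h z s \<partial>(M \<Otimes>\<^sub>M M)) \<partial>N)"
    by (rule PN.Fubini_integral[OF hint, symmetric])
  have hiz: "integrable (M \<Otimes>\<^sub>M M) (\<lambda>z. \<integral>s. h z s \<partial>N)"
    using PN.integrable_fst'[OF hint] by simp
  \<comment> \<open>The fundamental theorem of calculus along \<open>b\<close>, from the face at
    \<open>- r\<close> up to the actual coordinate \<open>\<tau> b x\<close>.\<close>
  have ftc: "Fn (p + \<tau> b x *\<^sub>R b + \<sigma> x) y = Fn (p + (- r) *\<^sub>R b + \<sigma> x) y +
      (\<integral>s. (if s \<le> \<tau>' x then 1 else 0) * g ((x, y), s) \<partial>N)" if x: "x \<in> U" for x y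
  proof -
    have \<tau>x: "- r \<le> \<tau> b x" "\<tau> b x \<le> r" "\<tau>' x = \<tau> b x" using \<tau>r[of b x] x by (auto simp: \<tau>'_def)
    have "((\<lambda>s. Fn (p + s *\<^sub>R b + \<sigma> x) y) has_vector_derivative Fn' (p + s *\<^sub>R b + \<sigma> x) y) (at s within {- r..\<tau> b x})"
      if "- r \<le> s" "s \<le> \<tau> b x" for s
    proof -
      have "\<bar>s\<bar> \<le> r" using that \<tau>x by auto
      hence inS: "p + s *\<^sub>R b + \<sigma> x \<in> S" using inQ x QS by blast
      from param_smooth_has_derivative[OF Fn this, of y]
      have D: "((\<lambda>v. Fn v y) has_derivative frechet_derivative (\<lambda>v. Fn v y) (at (p + s *\<^sub>R b + \<sigma> x))) (at (p + s *\<^sub>R b + \<sigma> x))" .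
      have line: "((\<lambda>s. p + s *\<^sub>R b + \<sigma> x) has_derivative (\<lambda>t. t *\<^sub>R b)) (at s)"
        by (auto intro!: derivative_eq_intros)
      have "((\<lambda>s. Fn (p + s *\<^sub>R b + \<sigma> x) y) has_derivative
        (\<lambda>t. frechet_derivative (\<lambda>v. Fn v y) (at (p + s *\<^sub>R b + \<sigma> x)) (t *\<^sub>R b))) (at s)"
        by (rule has_derivative_compose[where f = "\<lambda>s. p + s *\<^sub>R b + \<sigma> x" and g = "\<lambda>v. Fn v y", OF line D])
      moreover have "frechet_derivative (\<lambda>v. Fn v y) (at (p + s *\<^sub>R b + \<sigma> x)) (t *\<^sub>R b) = t *\<^sub>R Fn' (p + s *\<^sub>R b + \<sigma> x) y" for t
        unfolding Fn'_def using D
        by (simp add: linear_simps(5) has_derivative_bounded_linear)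
      ultimately show ?thesis by (simp add: has_vector_derivative_def has_derivative_at_withinI)
    qed
    moreover have "continuous_on {- r..\<tau> b x} (\<lambda>s. Fn' (p + s *\<^sub>R b + \<sigma> x) y)"
    proof -
      have "continuous_on {- r..\<tau> b x} (\<lambda>s. (p + s *\<^sub>R b + \<sigma> x, y))" by (intro continuous_intros)
      from continuous_on_compose2[OF param_smooth_continuous[OF Fn'] this]
      show ?thesis using inQ[OF _ x] QS \<tau>x by force
    qed
    ultimately have "(\<integral>s. indicator {- r..\<tau> b x} s *\<^sub>R Fn' (p + s *\<^sub>R b + \<sigma> x) y \<partial>lborel) =
       Fn (p + \<tau> b x *\<^sub>R b + \<sigma> x) y - Fn (p + (- r) *\<^sub>R b + \<sigma> x) y"
      by (rule integral_FTC_Icc[OF \<tau>x(1)])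
    moreover have "(\<integral>s. (if s \<le> \<tau>' x then 1 else 0) * g ((x, y), s) \<partial>N) =
        (\<integral>s. indicator {-r..r} s *\<^sub>R ((if s \<le> \<tau>' x then 1 else 0) * g ((x, y), s)) \<partial>lborel)"
      unfolding N_def by (rule integral_restrict_space) simp
    moreover have "indicator {-r..r} s *\<^sub>R ((if s \<le> \<tau>' x then 1 else 0) * g ((x, y), s)) =
        indicator {- r..\<tau> b x} s *\<^sub>R Fn' (p + s *\<^sub>R b + \<sigma> x) y" for s
      using \<tau>x x by (auto simp: g_def indicator_def)
    ultimately show ?thesis by simp
  qed
  have meas0: "(\<lambda>z. indicator (U \<times> UNIV) z *\<^sub>R Fn (p + (- r) *\<^sub>R b + \<sigma> (fst z)) (snd z)) \<in> borel_measurable borel"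
  proof (rule borel_measurable_continuous_on_indicator)
    show "U \<times> UNIV \<in> sets (borel :: ('a \<times> 'a) measure)" unfolding borel_prod[symmetric] using U by (intro pair_measureI) auto
    have "continuous_on (U \<times> UNIV) (\<lambda>z :: 'a \<times> 'a. (p + (- r) *\<^sub>R b + \<sigma> (fst z), snd z))"
      by (intro continuous_intros continuous_on_compose2[OF \<sigma>c]) auto
    from continuous_on_compose2[OF param_smooth_continuous[OF Fn] this]
    show "continuous_on (U \<times> UNIV) (\<lambda>z :: 'a \<times> 'a. Fn (p + (- r) *\<^sub>R b + \<sigma> (fst z)) (snd z))"
      using inQ[of "- r"] r QS by fastforce
  qed
  define h0 where "h0 z = w (fst z) * Fn (p + (- r) *\<^sub>R b + \<sigma> (fst z)) (snd z) * rep_kernel F (fst z) (snd z)" for z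
  have h0int: "integrable (M \<Otimes>\<^sub>M M) h0"
  proof (rule integral_MM(1)[where C = "1 * C * c"])
    have eq: "h0 = (\<lambda>z. w (fst z) * (indicator (U \<times> UNIV) z *\<^sub>R Fn (p + (- r) *\<^sub>R b + \<sigma> (fst z)) (snd z)) * rep_kernel F (fst z) (snd z))"
      using w(3) by (auto simp: h0_def indicator_def mem_Times_iff)
    show "h0 \<in> borel_measurable borel" unfolding eq
      by (intro borel_measurable_times measurable_fst_borel w meas0 measurable_rep_kernel[OF R F(1)])
    have "norm (indicator (U \<times> UNIV) z *\<^sub>R Fn (p + (- r) *\<^sub>R b + \<sigma> (fst z)) (snd z)) \<le> C" for z
      using bnd(1)[OF inQ[of "- r" "fst z"]] r C by (auto simp: indicator_def mem_Times_iff)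
    thus "norm (h0 z) \<le> 1 * C * c" for z unfolding eq norm_mult
      by (intro mult_mono w c mult_nonneg_nonneg norm_ge_zero C) auto
  qed
  have split: "w (fst z) * Fn (p + (\<Sum>b\<leftarrow>b # bs. \<tau> b (fst z) *\<^sub>R b)) (snd z) * rep_kernel F (fst z) (snd z) =
      h0 z + (\<integral>s. h z s \<partial>N)" for z
  proof (cases "fst z \<in> U")
    case True
    have "(\<integral>s. h z s \<partial>N) = (\<integral>s. (w (fst z) * rep_kernel F (fst z) (snd z)) * ((if s \<le> \<tau>' (fst z) then 1 else 0) * g (z, s)) \<partial>N)"
      unfolding h_def by (simp add: mult_ac)
    also have "\<dots> = (w (fst z) * rep_kernel F (fst z) (snd z)) * (\<integral>s. (if s \<le> \<tau>' (fst z) then 1 else 0) * g (z, s) \<partial>N)"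
      by (rule integral_mult_right_zero)
    finally have hN: "(\<integral>s. h z s \<partial>N) = (w (fst z) * rep_kernel F (fst z) (snd z)) * (\<integral>s. (if s \<le> \<tau>' (fst z) then 1 else 0) * g (z, s) \<partial>N)" .
    have e: "p + (\<Sum>b\<leftarrow>b # bs. \<tau> b (fst z) *\<^sub>R b) = p + \<tau> b (fst z) *\<^sub>R b + \<sigma> (fst z)"
      by (simp add: \<sigma>_def add.assoc)
    show ?thesis
      unfolding e ftc[OF True, of "snd z", unfolded prod.collapse] hN h0_def
      by (simp only: distrib_left distrib_right mult_ac)
  next
    case False
    thus ?thesis using w(3) by (simp add: h0_def h_def)
  qed
  \<comment> \<open>The term on the face: the base point has moved by \<open>- r\<close> along
    \<open>b\<close>, and one direction has disappeared.\<close>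
  have IH0: "norm (\<integral>z. h0 z \<partial>(M \<Otimes>\<^sub>M M)) \<le> (1 + 2 * r) ^ length bs * C"
    unfolding h0_def \<sigma>_def
  proof (rule Cons.IH[OF Fn])
    show "p + (- r) *\<^sub>R b + (\<Sum>b\<leftarrow>bs. t b *\<^sub>R b) \<in> Q" if "\<And>b. b \<in> set bs \<Longrightarrow> \<bar>t b\<bar> \<le> r" for t
      by (rule box') (use that r in auto)
    show "norm (iter_deriv vs (\<lambda>v. Fn v y) v) \<le> C" if "set vs \<subseteq> set bs" "length vs \<le> length bs" "v \<in> Q" for vs v y
      by (rule bound) (use that in auto)
  qed (use \<tau>c \<tau>r bbs w in auto)
  have IH1: "norm (\<integral>z. h z s \<partial>(M \<Otimes>\<^sub>M M)) \<le> (1 + 2 * r) ^ length bs * C" if s: "s \<in> space N" for s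
  proof -
    have sr: "\<bar>s\<bar> \<le> r" using s by (auto simp: spN)
    \<comment> \<open>For fixed \<open>s\<close> the cut-off is absorbed into the weight, which
      stays measurable, bounded by 1 and zero off \<open>U\<close>. This is why the induction admits
      discontinuous weights.\<close>
    define w' where "w' x = w x * (if s \<le> \<tau>' x then 1 else 0)" for x
    have "h z s = w' (fst z) * Fn' (p + s *\<^sub>R b + (\<Sum>b\<leftarrow>bs. \<tau> b (fst z) *\<^sub>R b)) (snd z) * rep_kernel F (fst z) (snd z)" for z
    proof (cases "fst z \<in> U")
      case True
      hence "(fst z, snd z, s) \<in> U \<times> UNIV \<times> {- r..r}" using sr by auto
      hence "g (z, s) = Fn' (p + s *\<^sub>R b + \<sigma> (fst z)) (snd z)" by (simp add: g_def)
      thus ?thesis by (simp add: h_def w'_def \<sigma>_def)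
    next
      case False
      thus ?thesis using w(3) by (simp add: h_def w'_def)
    qed
    moreover have "norm (\<integral>z. w' (fst z) * Fn' (p + s *\<^sub>R b + (\<Sum>b\<leftarrow>bs. \<tau> b (fst z) *\<^sub>R b)) (snd z) * rep_kernel F (fst z) (snd z) \<partial>(M \<Otimes>\<^sub>M M)) \<le> (1 + 2 * r) ^ length bs * C"
    proof (rule Cons.IH[OF Fn'])
      have "{x. s \<le> \<tau>' x} \<in> sets borel" using borel_measurable_le[OF measurable_const[of s borel borel] \<tau>'m] by simp
      hence "(\<lambda>x. if s \<le> \<tau>' x then 1 else 0 :: complex) \<in> borel_measurable borel" by (intro measurable_If) auto
      thus "w' \<in> borel_measurable borel" unfolding w'_def by (intro borel_measurable_times w)
      show "norm (w' x) \<le> 1" for x using w(2)[of x] by (auto simp: w'_def)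
      show "p + s *\<^sub>R b + (\<Sum>b\<leftarrow>bs. t b *\<^sub>R b) \<in> Q" if "\<And>b. b \<in> set bs \<Longrightarrow> \<bar>t b\<bar> \<le> r" for t
        by (rule box'[OF sr]) (use that in auto)
      \<comment> \<open>At most \<open>length bs\<close> further derivatives of \<open>Fn'\<close>
        are at most \<open>length bs + 1\<close> derivatives of \<open>Fn\<close>, which is what the
        bound for \<open>b # bs\<close> allows.\<close>
      show "norm (iter_deriv vs (\<lambda>v. Fn' v y) v) \<le> C" if "set vs \<subseteq> set bs" "length vs \<le> length bs" "v \<in> Q" for vs v y
        using bound[of "vs @ [b]" v y] that by (auto simp: Fn'_def iter_deriv_append)
    qed (use \<tau>c \<tau>r bbs w in \<open>auto simp: w'_def\<close>)
    ultimately show ?thesis by simp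
  qed
  have "(\<integral>z. w (fst z) * Fn (p + (\<Sum>b\<leftarrow>b # bs. \<tau> b (fst z) *\<^sub>R b)) (snd z) * rep_kernel F (fst z) (snd z) \<partial>(M \<Otimes>\<^sub>M M)) =
     (\<integral>z. h0 z \<partial>(M \<Otimes>\<^sub>M M)) + (\<integral>s. (\<integral>z. h z s \<partial>(M \<Otimes>\<^sub>M M)) \<partial>N)"
    unfolding split using h0int hiz fub by simp
  \<comment> \<open>Each direction multiplies the constant by \<open>1 + 2 * r\<close>: 1 comes from
    the face and \<open>2 * r\<close> from the length of the interval of integration.\<close>
  also have "norm \<dots> \<le> (1 + 2 * r) ^ length bs * C + (1 + 2 * r) ^ length bs * C * (2 * r)"
  proof (rule norm_triangle_mono[OF IH0])
    have "norm (\<integral>s. (\<integral>z. h z s \<partial>(M \<Otimes>\<^sub>M M)) \<partial>N) \<le> (\<integral>s. norm (\<integral>z. h z s \<partial>(M \<Otimes>\<^sub>M M)) \<partial>N)"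
      by (rule integral_norm_bound)
    also have "\<dots> \<le> (\<integral>s. (1 + 2 * r) ^ length bs * C \<partial>N)"
      using PN.integrable_snd[OF hint] IH1 by (intro integral_mono integrable_norm) auto
    also have "\<dots> = (1 + 2 * r) ^ length bs * C * (2 * r)" by (simp add: mN)
    finally show "norm (\<integral>s. (\<integral>z. h z s \<partial>(M \<Otimes>\<^sub>M M)) \<partial>N) \<le> (1 + 2 * r) ^ length bs * C * (2 * r)" .
  qed
  also have "\<dots> = (1 + 2 * r) ^ length (b # bs) * C" by (simp add: algebra_simps)
  finally show ?case .
qed

end

text \<open>The closed cubes stay inside the chart images, where derivatives can be bounded, while
  the open cubes already cover the space; compactness leaves finitely many.\<close>

lemma chart_cube_cover:
  fixes \<A> :: "('a::topological_space, 'e::real_normed_vector) chart set"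
  assumes A: "manifold \<A>" and cpt: "compact (UNIV :: 'a set)"
    and B: "finite B" "independent B" "span B = (UNIV :: 'e set)"
  obtains X :: "'a set" and U \<phi> c r where "finite X"
    "\<And>x. x \<in> X \<Longrightarrow> (U x, \<phi> x) \<in> \<A>" "\<And>x. x \<in> X \<Longrightarrow> r x \<ge> (0::real)"
    "\<And>x. x \<in> X \<Longrightarrow> {v. \<forall>b\<in>B. \<bar>representation B (v - c x) b\<bar> \<le> r x} \<subseteq> \<phi> x ` U x"
    "\<And>x. x \<in> X \<Longrightarrow> open {y \<in> U x. \<forall>b\<in>B. \<bar>representation B (\<phi> x y - c x) b\<bar> < r x}"
    "\<And>y. \<exists>x\<in>X. y \<in> U x \<and> (\<forall>b\<in>B. \<bar>representation B (\<phi> x y - c x) b\<bar> < r x)"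
proof -
  have "\<exists>p. (fst p, fst (snd p)) \<in> \<A> \<and> x \<in> fst p \<and> snd (snd p) > 0 \<and>
     {v. \<forall>b\<in>B. \<bar>representation B (v - fst (snd p) x) b\<bar> \<le> snd (snd p)} \<subseteq> fst (snd p) ` fst p" for x
  proof -
    obtain U \<phi> where U: "(U, \<phi>) \<in> \<A>" "x \<in> U" using chart_ex[OF A] by blast
    obtain r where "r > 0" "{v. \<forall>b\<in>B. \<bar>representation B (v - \<phi> x) b\<bar> \<le> r} \<subseteq> \<phi> ` U"
      using cube_subset_open[OF B chartD(2)[OF A U(1)] imageI[OF U(2)]] .
    thus ?thesis using U by (intro exI[of _ "(U, \<phi>, r)"]) simp
  qed
  hence "\<forall>x. \<exists>p. (fst p, fst (snd p)) \<in> \<A> \<and> x \<in> fst p \<and> snd (snd p) > 0 \<and>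
     {v. \<forall>b\<in>B. \<bar>representation B (v - fst (snd p) x) b\<bar> \<le> snd (snd p)} \<subseteq> fst (snd p) ` fst p" ..
  from choice[OF this] obtain p where p: "\<And>x. (fst (p x), fst (snd (p x))) \<in> \<A>" "\<And>x. x \<in> fst (p x)" "\<And>x. snd (snd (p x)) > 0"
     "\<And>x. {v. \<forall>b\<in>B. \<bar>representation B (v - fst (snd (p x)) x) b\<bar> \<le> snd (snd (p x))} \<subseteq> fst (snd (p x)) ` fst (p x)" by blast
  define U where "U x = fst (p x)" for x
  define \<phi> where "\<phi> x = fst (snd (p x))" for x
  define r where "r x = snd (snd (p x))" for x
  define W where "W x = {y \<in> U x. \<forall>b\<in>B. \<bar>representation B (\<phi> x y - \<phi> x x) b\<bar> < r x}" for x
  have U: "(U x, \<phi> x) \<in> \<A>" "x \<in> U x" "r x > 0" "{v. \<forall>b\<in>B. \<bar>representation B (v - \<phi> x x) b\<bar> \<le> r x} \<subseteq> \<phi> x ` U x" for x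
    using p[of x] by (simp_all add: U_def \<phi>_def r_def)
  have W: "open (W x)" for x
  proof -
    have "continuous_on (U x) (\<lambda>y. \<bar>representation B (\<phi> x y - \<phi> x x) b\<bar>)" if "b \<in> B" for b
      by (intro continuous_on_rabs bounded_linear.continuous_on[OF bounded_linear_representation[OF B that]]
          continuous_on_diff continuous_on_const chartD(4)[OF A U(1)])
    from continuous_open_preimage[OF this chartD(1)[OF A U(1)] open_lessThan]
    have "open (U x \<inter> (\<lambda>y. \<bar>representation B (\<phi> x y - \<phi> x x) b\<bar>) -` {..<r x})" if "b \<in> B" for b using that .
    hence "open (U x \<inter> (\<Inter>b\<in>B. U x \<inter> (\<lambda>y. \<bar>representation B (\<phi> x y - \<phi> x x) b\<bar>) -` {..<r x}))"
      using B(1) chartD(1)[OF A U(1)] by (intro open_Int open_INT) auto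
    moreover have "W x = U x \<inter> (\<Inter>b\<in>B. U x \<inter> (\<lambda>y. \<bar>representation B (\<phi> x y - \<phi> x x) b\<bar>) -` {..<r x})"
      by (auto simp: W_def)
    ultimately show ?thesis by simp
  qed
  have "x \<in> W x" for x using U(2,3)[of x] B by (simp add: W_def real_vector.representation_zero)
  hence "UNIV \<subseteq> (\<Union>x\<in>UNIV. W x)" by blast
  then obtain X where X: "finite X" "UNIV \<subseteq> (\<Union>x\<in>X. W x)"
    using compactE_image[OF cpt, of UNIV W] W by metis
  show thesis
  proof (rule that[of X U \<phi> r "\<lambda>x. \<phi> x x"])
    show "\<exists>x\<in>X. y \<in> U x \<and> (\<forall>b\<in>B. \<bar>representation B (\<phi> x y - \<phi> x x) b\<bar> < r x)" for y
      using X(2) unfolding W_def by blast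
    show "open {y \<in> U x. \<forall>b\<in>B. \<bar>representation B (\<phi> x y - \<phi> x x) b\<bar> < r x}" for x
      using W[of x] by (simp add: W_def)
    show "0 \<le> r x" for x using U(3)[of x] by simp
  qed (rule X(1) U(1) U(4))+
qed

context compact_lie
begin

text \<open>Uniformity in \<open>y\<close> holds because \<open>y\<close> itself lies in one of the
  finitely many compact cubes. The derivatives in \<open>v\<close> are then partial derivatives of a
  smooth function of two chart variables on a compact product, and \<open>pullback_bound\<close>
  applies.\<close>

lemma translated_derivatives_bound:
  assumes X: "finite X" and VS: "finite VS"
    and U: "\<And>x. x \<in> X \<Longrightarrow> (U x, \<phi> x) \<in> atlas H"
    and Q: "\<And>x. x \<in> X \<Longrightarrow> compact (Q x)" "\<And>x. x \<in> X \<Longrightarrow> Q x \<subseteq> \<phi> x ` U x"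
    and cover: "\<And>y. \<exists>x\<in>X. y \<in> U x \<and> \<phi> x y \<in> Q x"
  shows "\<exists>J C. admissible (atlas H) J \<and> C \<ge> 0 \<and> (\<forall>\<Theta>\<in>C_inf H. \<forall>B>0. seminorms_le J B \<Theta> \<longrightarrow>
    (\<forall>x\<in>X. \<forall>vs\<in>VS. \<forall>v\<in>Q x. \<forall>y. norm (iter_deriv vs (\<lambda>v. \<Theta> (inv (inv_into (U x) (\<phi> x) v) \<otimes> y)) v) \<le> C * B))"
proof -
  define \<Omega> where "\<Omega> x x' z = inv (inv_into (U x) (\<phi> x) (fst z)) \<otimes> inv_into (U x') (\<phi> x') (snd z)" for x x' z
  define A where "A = X \<times> X \<times> VS"
  have op: "open (\<phi> x ` U x \<times> \<phi> x' ` U x')" if "x \<in> X" "x' \<in> X" for x x'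
    by (intro open_Times chartD(2)[OF mfd U] that)
  have \<Omega>: "msmooth (\<phi> x ` U x \<times> \<phi> x' ` U x') (atlas H) (\<Omega> x x')" if "x \<in> X" "x' \<in> X" for x x'
    unfolding \<Omega>_def
    by (intro msmooth_mult[OF op[OF that]] msmooth_inv[OF op[OF that]] smooth_on_imp_msmooth[OF mfd op[OF that] U[OF that(1)]]
        smooth_on_imp_msmooth[OF mfd op[OF that] U[OF that(2)]] smooth_on_fst[OF op[OF that]] smooth_on_snd[OF op[OF that]] smooth_on_id) auto
  \<comment> \<open>The factor 1 fits the composition to the weighted form of
    \<open>pullback_bound\<close>.\<close>
  have ex: "\<exists>I C. admissible (atlas H) I \<and> C \<ge> 0 \<and> (\<forall>\<Theta>\<in>C_inf H. \<forall>B>0. seminorms_le I B \<Theta> \<longrightarrow>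
     (\<forall>z\<in>Q (fst a) \<times> Q (fst (snd a)). norm (iter_deriv (map (\<lambda>v. (v, 0)) (snd (snd a))) (\<lambda>z. 1 * \<Theta> (\<Omega> (fst a) (fst (snd a)) z)) z) \<le> C * B))"
    if "a \<in> A" for a
  proof -
    have a: "fst a \<in> X" "fst (snd a) \<in> X" using that by (auto simp: A_def)
    show ?thesis
      by (rule pullback_bound[OF mfd op[OF a] smooth_on_const \<Omega>[OF a] compact_Times[OF Q(1)[OF a(1)] Q(1)[OF a(2)]]])
        (use Q(2)[OF a(1)] Q(2)[OF a(2)] in auto)
  qed
  obtain J C where J: "admissible (atlas H) J" "C \<ge> 0"
    and le: "\<And>\<Theta> B a z. \<Theta> \<in> C_inf H \<Longrightarrow> B > 0 \<Longrightarrow> seminorms_le J B \<Theta> \<Longrightarrow> a \<in> A \<Longrightarrow> z \<in> Q (fst a) \<times> Q (fst (snd a)) \<Longrightarrow>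
      norm (iter_deriv (map (\<lambda>v. (v, 0)) (snd (snd a))) (\<lambda>z. 1 * \<Theta> (\<Omega> (fst a) (fst (snd a)) z)) z) \<le> C * B"
  proof -
    assume *: "\<And>J C. admissible (atlas H) J \<Longrightarrow> 0 \<le> C \<Longrightarrow> (\<And>\<Theta> B a z. \<Theta> \<in> C_inf H \<Longrightarrow> B > 0 \<Longrightarrow> seminorms_le J B \<Theta> \<Longrightarrow> a \<in> A \<Longrightarrow> z \<in> Q (fst a) \<times> Q (fst (snd a)) \<Longrightarrow>
      norm (iter_deriv (map (\<lambda>v. (v, 0)) (snd (snd a))) (\<lambda>z. 1 * \<Theta> (\<Omega> (fst a) (fst (snd a)) z)) z) \<le> C * B) \<Longrightarrow> thesis"
    have "finite A" using X VS by (simp add: A_def)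
    from admissible_uniform[where S = "C_inf H" and Y = "\<lambda>a. Q (fst a) \<times> Q (fst (snd a))" and \<A> = "atlas H"
        and g = "\<lambda>a \<Theta> z. norm (iter_deriv (map (\<lambda>v. (v, 0)) (snd (snd a))) (\<lambda>z. 1 * \<Theta> (\<Omega> (fst a) (fst (snd a)) z)) z)", OF this ex]
    obtain J C where "admissible (atlas H) J \<and> C \<ge> 0 \<and> (\<forall>\<Theta>\<in>C_inf H. \<forall>B>0. seminorms_le J B \<Theta> \<longrightarrow>
     (\<forall>a\<in>A. \<forall>z\<in>Q (fst a) \<times> Q (fst (snd a)). norm (iter_deriv (map (\<lambda>v. (v, 0)) (snd (snd a))) (\<lambda>z. 1 * \<Theta> (\<Omega> (fst a) (fst (snd a)) z)) z) \<le> C * B))"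
      by blast
    thus thesis by (intro *[of J C]) blast+
  qed
  show ?thesis
  proof (intro exI[of _ J] exI[of _ C] conjI J ballI allI impI)
    fix \<Theta> B x vs v y
    assume \<Theta>: "\<Theta> \<in> C_inf H" and B: "(0::real) < B" and sl: "seminorms_le J B \<Theta>" and x: "x \<in> X" and vs: "vs \<in> VS" and v: "v \<in> Q x"
    obtain x' where x': "x' \<in> X" "y \<in> U x'" "\<phi> x' y \<in> Q x'" using cover by blast
    have z: "(v, \<phi> x' y) \<in> \<phi> x ` U x \<times> \<phi> x' ` U x'" using v x' Q(2)[OF x] by auto
    have sm: "smooth_on (\<phi> x ` U x \<times> \<phi> x' ` U x') (\<lambda>z. \<Theta> (\<Omega> x x' z))"
      by (rule C_inf_compose[OF mfd \<Theta> op[OF x x'(1)] \<Omega>[OF x x'(1)]])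
    have "iter_deriv vs (\<lambda>v. \<Theta> (inv (inv_into (U x) (\<phi> x) v) \<otimes> y)) v = iter_deriv vs (\<lambda>v. \<Theta> (\<Omega> x x' (v, \<phi> x' y))) v"
      using chartD(6)[OF mfd U[OF x'(1)] x'(2)] by (simp add: \<Omega>_def)
    also have "\<dots> = iter_deriv (map (\<lambda>v. (v, 0)) vs) (\<lambda>z. \<Theta> (\<Omega> x x' z)) (v, \<phi> x' y)"
      by (rule iter_deriv_slice1(1)[OF op[OF x x'(1)] sm z])
    finally show "norm (iter_deriv vs (\<lambda>v. \<Theta> (inv (inv_into (U x) (\<phi> x) v) \<otimes> y)) v) \<le> C * B"
      using le[OF \<Theta> B sl, of "(x, x', vs)" "(v, \<phi> x' y)"] x x' vs v by (simp add: A_def)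
  qed
qed

text \<open>By translation invariance the integral at the identity equals, for each
  \<open>x\<close>, the integral of \<Theta>(x^{-1}y) against the kernel at (x, y). Averaging over
  \<open>x\<close> gives a double integral, which is cut into chart cubes and estimated by
  \<open>rep_kernel_box_bound\<close>. Neither the seminorms nor the constant depend on the finite
  set \<open>F\<close>.\<close>

lemma fourier_projection_bound:
  assumes R: "dual_representatives H R"
  shows "\<exists>J C. admissible (atlas H) J \<and> C \<ge> 0 \<and> (\<forall>F\<subseteq>R. finite F \<longrightarrow> (\<forall>\<Theta>\<in>C_inf H. \<forall>B>0. seminorms_le J B \<Theta> \<longrightarrow>
    norm (\<integral>y. rep_kernel F \<one> y * \<Theta> y \<partial>M) \<le> C * B))"
proof -
  obtain Bs :: "'e set" where Bs: "finite Bs" "independent Bs" "span Bs = UNIV"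
    using fin_dim_basis[OF manifold_fin_dim[OF mfd]] by blast
  obtain bl where bl: "set bl = Bs" "distinct bl" using finite_distinct_list[OF Bs(1)] by blast
  obtain X :: "'a set" and U \<phi> c r where X: "finite X"
    and U: "\<And>x. x \<in> X \<Longrightarrow> (U x, \<phi> x) \<in> atlas H" and r: "\<And>x. x \<in> X \<Longrightarrow> r x \<ge> (0::real)"
    and Q0: "\<And>x. x \<in> X \<Longrightarrow> {v. \<forall>b\<in>Bs. \<bar>representation Bs (v - c x) b\<bar> \<le> r x} \<subseteq> \<phi> x ` U x"
    and W0: "\<And>x. x \<in> X \<Longrightarrow> open {y \<in> U x. \<forall>b\<in>Bs. \<bar>representation Bs (\<phi> x y - c x) b\<bar> < r x}"
    and cov0: "\<And>y. \<exists>x\<in>X. y \<in> U x \<and> (\<forall>b\<in>Bs. \<bar>representation Bs (\<phi> x y - c x) b\<bar> < r x)"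
  proof (rule chart_cube_cover[OF mfd compact_UNIV Bs], goal_cases)
    case (1 X U \<phi> r c)
    from 1(2-7) show ?case by (rule 1(1))
  qed
  define Q where "Q x = {v. \<forall>b\<in>Bs. \<bar>representation Bs (v - c x) b\<bar> \<le> r x}" for x
  define W where "W x = {y \<in> U x. \<forall>b\<in>Bs. \<bar>representation Bs (\<phi> x y - c x) b\<bar> < r x}" for x
  \<comment> \<open>All words of basis directions up to the dimension, which is the order of
    differentiation that the box bound calls for.\<close>
  define VS where "VS = {vs. set vs \<subseteq> Bs \<and> length vs \<le> length bl}"
  have VS: "finite VS" unfolding VS_def by (rule finite_lists_length_le[OF Bs(1)])
  have W: "open (W x)" if "x \<in> X" for x unfolding W_def by (rule W0[OF that])
  have cov: "\<exists>x\<in>X. y \<in> W x" for y using cov0[of y] by (auto simp: W_def)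
  have Q: "compact (Q x)" "x \<in> X \<Longrightarrow> Q x \<subseteq> \<phi> x ` U x" for x
    unfolding Q_def using compact_cube[OF Bs] Q0 by auto
  have covQ: "\<exists>x\<in>X. y \<in> U x \<and> \<phi> x y \<in> Q x" for y
    using cov[of y] by (auto simp: W_def Q_def less_imp_le)
  obtain J C where J: "admissible (atlas H) J" "C \<ge> 0"
    and le: "\<And>\<Theta> B x vs v y. \<Theta> \<in> C_inf H \<Longrightarrow> B > 0 \<Longrightarrow> seminorms_le J B \<Theta> \<Longrightarrow> x \<in> X \<Longrightarrow> vs \<in> VS \<Longrightarrow> v \<in> Q x \<Longrightarrow>
      norm (iter_deriv vs (\<lambda>v. \<Theta> (inv (inv_into (U x) (\<phi> x) v) \<otimes> y)) v) \<le> C * B"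
    using translated_derivatives_bound[OF X VS U Q(1) Q(2) covQ] by blast
  define D where "D = (\<Sum>x\<in>X. (1 + 2 * r x) ^ length bl * C)"
  show ?thesis
  proof (intro exI[of _ J] exI[of _ D] conjI J allI impI ballI)
    show "0 \<le> D" unfolding D_def using r J(2) by (intro sum_nonneg mult_nonneg_nonneg zero_le_power) auto
    fix F \<Theta> B assume F: "F \<subseteq> R" "finite F" and \<Theta>: "\<Theta> \<in> C_inf H" and B: "(0::real) < B" and sl: "seminorms_le J B \<Theta>"
    note \<Theta>c = C_inf_continuous[OF \<Theta>]
    define n where "n y = (\<Sum>x\<in>X. indicator (W x) y :: real)" for y
    define w where "w x y = complex_of_real (indicator (W x) y / n y)" for x y
    have n1: "n y \<ge> 1" for y
    proof -
      obtain x where x: "x \<in> X" "y \<in> W x" using cov by blast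
      have "indicator (W x) y \<le> (\<Sum>x\<in>X. indicator (W x) y :: real)" using x X by (intro member_le_sum) auto
      thus ?thesis using x by (simp add: n_def)
    qed
    have wsum: "(\<Sum>x\<in>X. w x y) = 1" for y
    proof -
      have "(\<Sum>x\<in>X. w x y) = complex_of_real ((\<Sum>x\<in>X. indicator (W x) y) / n y)"
        unfolding w_def sum_divide_distrib by simp
      thus ?thesis using n1[of y] by (simp add: n_def[symmetric])
    qed
    have nm: "n \<in> borel_measurable borel" unfolding n_def
      by (intro borel_measurable_sum borel_measurable_indicator) (use W in auto)
    have wm: "w x \<in> borel_measurable borel" if "x \<in> X" for x
    proof -
      have meas: "(\<lambda>y. indicator (W x) y / n y) \<in> borel_measurable borel"
        by (intro borel_measurable_divide borel_measurable_indicator nm) (use W[OF that] in auto)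
      show ?thesis unfolding w_def
        by (rule measurable_compose[OF meas borel_measurable_continuous_onI]) (intro continuous_intros)
    qed
    have w1: "norm (w x y) \<le> 1" for x y
      using n1[of y] by (auto simp: w_def indicator_def norm_divide)
    have w0: "w x y = 0" if "y \<notin> W x" for x y using that by (simp add: w_def)
    define Fn where "Fn x v y = \<Theta> (inv (inv_into (U x) (\<phi> x) v) \<otimes> y)" for x v y
    define \<tau> where "\<tau> x b y = representation Bs (\<phi> x y - c x) b" for x b y
    define h where "h z = \<Theta> (inv (fst z) \<otimes> snd z) * rep_kernel F (fst z) (snd z)" for z
    have hc: "continuous_on UNIV h" unfolding h_def
      by (intro continuous_on_mult continuous_on_compose2[OF \<Theta>c] continuous_on_mult_grp continuous_on_inv_grp
          continuous_rep_kernel[OF R F(1)] continuous_on_fst continuous_on_snd continuous_on_id) auto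
    obtain hC where hC: "\<And>z. norm (h z) \<le> hC"
      using compact_imp_bounded[OF compact_continuous_image[OF hc compact_UNIV2]] by (force simp: bounded_iff)
    have hm: "h \<in> borel_measurable borel" by (rule borel_measurable_continuous_onI[OF hc])
    have ker: "rep_kernel F x y = rep_kernel F \<one> (inv x \<otimes> y)" for x y
      using rep_kernel_translate[OF R F(1), of x \<one> "inv x \<otimes> y"] by (simp add: m_assoc[symmetric])
    have "(\<integral>y. h (x, y) \<partial>M) = (\<integral>y. rep_kernel F \<one> y * \<Theta> y \<partial>M)" for x
    proof -
      have "(\<integral>y. h (x, y) \<partial>M) = (\<integral>y. rep_kernel F \<one> (inv x \<otimes> y) * \<Theta> (inv x \<otimes> y) \<partial>M)"
        by (simp add: h_def ker[of x] mult.commute)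
      also have "\<dots> = (\<integral>y. rep_kernel F \<one> y * \<Theta> y \<partial>M)"
        by (rule integral_left[where f = "\<lambda>y. rep_kernel F \<one> y * \<Theta> y"])
          (intro continuous_on_mult continuous_rep_kernel[OF R F(1)] continuous_on_const continuous_on_id \<Theta>c)
      finally show ?thesis .
    qed
    hence "(\<integral>y. rep_kernel F \<one> y * \<Theta> y \<partial>M) = (\<integral>x. (\<integral>y. h (x, y) \<partial>M) \<partial>M)"
      using M.prob_space by simp
    also have "\<dots> = (\<integral>z. h z \<partial>(M \<Otimes>\<^sub>M M))" by (rule integral_MM(2)[OF hm hC])
    also have "\<dots> = (\<integral>z. (\<Sum>x\<in>X. w x (fst z) * h z) \<partial>(M \<Otimes>\<^sub>M M))"
      by (simp add: sum_distrib_right[symmetric] wsum)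
    also have "\<dots> = (\<Sum>x\<in>X. \<integral>z. w x (fst z) * h z \<partial>(M \<Otimes>\<^sub>M M))"
    proof (rule Bochner_Integration.integral_sum, rule integral_MM(1)[where C = "1 * hC"])
      fix x assume x: "x \<in> X"
      show "(\<lambda>z. w x (fst z) * h z) \<in> borel_measurable borel"
        by (intro borel_measurable_times measurable_fst_borel wm[OF x] hm)
      show "norm (w x (fst z) * h z) \<le> 1 * hC" for z
        unfolding norm_mult by (intro mult_mono w1 hC) auto
    qed
    also have "norm \<dots> \<le> (\<Sum>x\<in>X. (1 + 2 * r x) ^ length bl * (C * B))"
    proof (rule sum_norm_le)
      fix x assume x: "x \<in> X"
      \<comment> \<open>On the cube the coordinates \<open>\<tau> x\<close> reconstruct the chart
        value, so \<open>Fn x\<close> is the translated test function; off the cube the weight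
        vanishes.\<close>
      have "w x (fst z) * h z = w x (fst z) * Fn x (c x + (\<Sum>b\<leftarrow>bl. \<tau> x b (fst z) *\<^sub>R b)) (snd z) * rep_kernel F (fst z) (snd z)" for z
      proof (cases "fst z \<in> W x")
        case True
        have "(\<Sum>b\<leftarrow>bl. \<tau> x b (fst z) *\<^sub>R b) = (\<Sum>b\<in>Bs. \<tau> x b (fst z) *\<^sub>R b)"
          using bl by (simp flip: sum.distinct_set_conv_list)
        also have "\<dots> = \<phi> x (fst z) - c x" unfolding \<tau>_def by (rule basis_expansion[OF Bs])
        finally have "Fn x (c x + (\<Sum>b\<leftarrow>bl. \<tau> x b (fst z) *\<^sub>R b)) (snd z) = \<Theta> (inv (fst z) \<otimes> snd z)"
          using True chartD(6)[OF mfd U[OF x]] by (simp add: Fn_def W_def)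
        thus ?thesis by (simp add: h_def)
      qed (simp add: w0)
      moreover have "norm (\<integral>z. w x (fst z) * Fn x (c x + (\<Sum>b\<leftarrow>bl. \<tau> x b (fst z) *\<^sub>R b)) (snd z) * rep_kernel F (fst z) (snd z) \<partial>(M \<Otimes>\<^sub>M M))
          \<le> (1 + 2 * r x) ^ length bl * (C * B)"
      proof (rule rep_kernel_box_bound[OF R F chartD(2)[OF mfd U[OF x]] _ W[OF x] r[OF x] _ _ bl(2) wm[OF x] w1 w0 _ Q(2)[OF x]])
        show "param_smooth (\<phi> x ` U x) (Fn x)"
          unfolding Fn_def
        proof (rule param_smooth_C_inf[OF mfd mfd chartD(2)[OF mfd U[OF x]] \<Theta>, where \<Omega> = "\<lambda>v y. inv (inv_into (U x) (\<phi> x) v) \<otimes> y"])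
          fix V \<psi> assume V: "(V, \<psi>) \<in> atlas H"
          have op2: "open (\<phi> x ` U x \<times> \<psi> ` V)" by (intro open_Times chartD(2)[OF mfd U[OF x]] chartD(2)[OF mfd V])
          show "msmooth (\<phi> x ` U x \<times> \<psi> ` V) (atlas H) (\<lambda>z. inv (inv_into (U x) (\<phi> x) (fst z)) \<otimes> inv_into V \<psi> (snd z))"
            by (intro msmooth_mult[OF op2] msmooth_inv[OF op2] smooth_on_imp_msmooth[OF mfd op2 U[OF x]] smooth_on_imp_msmooth[OF mfd op2 V]
                smooth_on_fst[OF op2] smooth_on_snd[OF op2] smooth_on_id) auto
        qed
        show "continuous_on (W x) (\<tau> x b)" if "b \<in> set bl" for b
        proof -
          have "b \<in> Bs" using that bl by simp
          have "continuous_on (W x) (\<phi> x)" using chartD(4)[OF mfd U[OF x]] by (rule continuous_on_subset) (auto simp: W_def)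
          thus ?thesis unfolding \<tau>_def
            by (intro bounded_linear.continuous_on[OF bounded_linear_representation[OF Bs \<open>b \<in> Bs\<close>]] continuous_on_diff continuous_on_const)
        qed
        show "\<bar>\<tau> x b y\<bar> \<le> r x" if "b \<in> set bl" "y \<in> W x" for b y
          using that bl by (auto simp: W_def \<tau>_def less_imp_le)
        show "c x + (\<Sum>b\<leftarrow>bl. t b *\<^sub>R b) \<in> Q x" if t: "\<And>b. b \<in> set bl \<Longrightarrow> \<bar>t b\<bar> \<le> r x" for t
        proof -
          have "representation Bs (\<Sum>b\<in>Bs. t b *\<^sub>R b) b = t b" if b: "b \<in> Bs" for b
          proof -
            have "representation Bs (\<Sum>b\<in>Bs. t b *\<^sub>R b) b = (\<Sum>b'\<in>Bs. t b' * representation Bs b' b)"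
              using Bs by (simp add: real_vector.representation_sum real_vector.representation_scale)
            also have "\<dots> = (\<Sum>b'\<in>Bs. if b' = b then t b' else 0)"
              by (intro sum.cong refl) (auto simp: real_vector.representation_basis[OF Bs(2)])
            also have "\<dots> = t b" using b Bs(1) by simp
            finally show ?thesis .
          qed
          thus ?thesis using t bl by (simp add: Q_def flip: sum.distinct_set_conv_list)
        qed
        show "norm (iter_deriv vs (\<lambda>v. Fn x v y) v) \<le> C * B" if "set vs \<subseteq> set bl" "length vs \<le> length bl" "v \<in> Q x" for vs v y
          unfolding Fn_def by (rule le[OF \<Theta> B sl x]) (use that bl in \<open>auto simp: VS_def\<close>)
      qed
      ultimately show "norm (\<integral>z. w x (fst z) * h z \<partial>(M \<Otimes>\<^sub>M M)) \<le> (1 + 2 * r x) ^ length bl * (C * B)" by (simp only:)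
    qed
    also have "\<dots> = D * B" by (simp add: D_def sum_distrib_right mult.assoc)
    finally show "norm (\<integral>y. rep_kernel F \<one> y * \<Theta> y \<partial>M) \<le> D * B" .
  qed
qed

end

section \<open>Distributions on a product\<close>

lemma distribution_sum:
  assumes H: "manifold (atlas H)" and u: "u \<in> distributions H" and f: "\<And>i. i \<in> I \<Longrightarrow> f i \<in> C_inf H"
  shows "u (\<lambda>x. \<Sum>i\<in>I. f i x) = (\<Sum>i\<in>I. u (f i))"
proof -
  have "u (\<lambda>_. 0) = 0" using distributionD(3)[OF u C_inf_const[OF H], of 0 0] by simp
  thus ?thesis using f
  proof (induction I rule: infinite_finite_induct)
    case (insert i I)
    have "u (\<lambda>x. f i x + (\<Sum>i\<in>I. f i x)) = u (f i) + u (\<lambda>x. \<Sum>i\<in>I. f i x)"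
      using insert.prems by (intro distributionD(2)[OF u] C_inf_sum[OF H]) auto
    thus ?case using insert by simp
  qed auto
qed

text \<open>Supplies the scale at which a uniform estimate is read off for one given test
  function.\<close>

lemma seminorms_le_ex:
  assumes H: "manifold (atlas H)" and I: "admissible (atlas H) I" and f: "f \<in> C_inf H"
  shows "\<exists>B>0. seminorms_le I B f"
proof -
  have "\<exists>B\<ge>0. \<forall>y\<in>fst (snd i). norm (iter_deriv (snd (snd i)) (f \<circ> inv_into (fst (fst i)) (snd (fst i))) y) \<le> B" if "i \<in> I" for i
  proof -
    obtain U \<phi> K vs where i: "i = ((U, \<phi>), K, vs)" by (metis prod.collapse)
    note U = admissibleD[OF I that[unfolded i]]
    have "continuous_on K (iter_deriv vs (\<lambda>x. f (inv_into U \<phi> x)))"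
      by (rule continuous_on_subset[OF smooth_on_continuous_on[OF smooth_on_iter_deriv[OF C_inf_chart[OF H f U(1)]]] U(3)])
    from compact_imp_bounded[OF compact_continuous_image[OF this U(2)]]
    obtain B where "\<And>y. y \<in> K \<Longrightarrow> norm (iter_deriv vs (\<lambda>x. f (inv_into U \<phi> x)) y) \<le> B" by (auto simp: bounded_iff)
    thus ?thesis by (intro exI[of _ "max B 0"]) (force simp: i o_def)
  qed
  hence "\<forall>i\<in>I. \<exists>B\<ge>0. \<forall>y\<in>fst (snd i). norm (iter_deriv (snd (snd i)) (f \<circ> inv_into (fst (fst i)) (snd (fst i))) y) \<le> B" by blast
  from bchoice[OF this] obtain B where B: "\<And>i. i \<in> I \<Longrightarrow> B i \<ge> 0"
    "\<And>i y. i \<in> I \<Longrightarrow> y \<in> fst (snd i) \<Longrightarrow> norm (iter_deriv (snd (snd i)) (f \<circ> inv_into (fst (fst i)) (snd (fst i))) y) \<le> B i" by blast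
  have fin: "finite I" using I by (simp add: admissible_def)
  have "B i \<le> (\<Sum>i\<in>I. B i) + 1" if "i \<in> I" for i
    using member_le_sum[OF that, of B] B(1) fin by fastforce
  hence "seminorms_le I ((\<Sum>i\<in>I. B i) + 1) f"
    unfolding seminorms_le_def using B(2) by (fastforce intro: order_trans)
  moreover have "(\<Sum>i\<in>I. B i) + 1 > 0" using B(1) by (intro add_nonneg_pos sum_nonneg) auto
  ultimately show ?thesis by blast
qed

text \<open>For a real family the nonnegative and the negative terms of a finite set each form a
  partial sum, so the absolute values add up to at most \<open>2 * C\<close>. Real and imaginary
  parts together give \<open>4 * C\<close>, and absolute summability follows.\<close>

lemma bounded_sums_summable:
  fixes f :: "'i \<Rightarrow> complex"
  assumes "\<And>F. finite F \<Longrightarrow> F \<subseteq> R \<Longrightarrow> norm (\<Sum>i\<in>F. f i) \<le> C"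
  shows "f summable_on R" "norm (\<Sum>\<^sub>\<infinity>i\<in>R. f i) \<le> C"
proof -
  have real: "(\<Sum>i\<in>F. \<bar>g i\<bar>) \<le> 2 * C" if g: "\<And>F. finite F \<Longrightarrow> F \<subseteq> R \<Longrightarrow> \<bar>\<Sum>i\<in>F. g i\<bar> \<le> C" and F: "finite F" "F \<subseteq> R" for F and g :: "'i \<Rightarrow> real"
  proof -
    let ?P = "{i \<in> F. g i \<ge> 0}" and ?N = "{i \<in> F. \<not> g i \<ge> 0}"
    have "F = ?P \<union> ?N" by auto
    hence "(\<Sum>i\<in>F. \<bar>g i\<bar>) = (\<Sum>i\<in>?P \<union> ?N. \<bar>g i\<bar>)" by simp
    also have "\<dots> = (\<Sum>i\<in>?P. \<bar>g i\<bar>) + (\<Sum>i\<in>?N. \<bar>g i\<bar>)"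
      by (rule sum.union_disjoint) (use F in auto)
    also have "\<dots> = (\<Sum>i\<in>?P. g i) - (\<Sum>i\<in>?N. g i)"
      unfolding diff_conv_add_uminus sum_negf[symmetric] by (intro arg_cong2[where f = "(+)"] sum.cong) auto
    also have "\<dots> \<le> C + C"
      using g[of ?P] g[of ?N] F by (simp add: subset_iff abs_le_iff)
    finally show ?thesis by simp
  qed
  have "(\<Sum>i\<in>F. norm (f i)) \<le> 4 * C" if F: "finite F" "F \<subseteq> R" for F
  proof -
    have "(\<Sum>i\<in>F. norm (f i)) \<le> (\<Sum>i\<in>F. \<bar>Re (f i)\<bar> + \<bar>Im (f i)\<bar>)" by (intro sum_mono cmod_le)
    also have "\<dots> = (\<Sum>i\<in>F. \<bar>Re (f i)\<bar>) + (\<Sum>i\<in>F. \<bar>Im (f i)\<bar>)" by (rule sum.distrib)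
    also have "\<dots> \<le> 2 * C + 2 * C"
    proof (intro add_mono real F)
      show "\<bar>\<Sum>i\<in>F. Re (f i)\<bar> \<le> C" "\<bar>\<Sum>i\<in>F. Im (f i)\<bar> \<le> C" if "finite F" "F \<subseteq> R" for F
        using assms[OF that] abs_Re_le_cmod[of "\<Sum>i\<in>F. f i"] abs_Im_le_cmod[of "\<Sum>i\<in>F. f i"] by auto
    qed
    finally show ?thesis by simp
  qed
  hence "(\<lambda>i. norm (f i)) summable_on R"
    by (intro nonneg_bdd_above_summable_on bdd_aboveI[of _ "4 * C"]) auto
  thus sm: "f summable_on R" by (rule abs_summable_summable)
  have "(sum f \<longlongrightarrow> (\<Sum>\<^sub>\<infinity>i\<in>R. f i)) (finite_subsets_at_top R)"
    using has_sum_infsum[OF sm] by (simp add: has_sum_def)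
  moreover have "eventually (\<lambda>F. norm (sum f F) \<le> C) (finite_subsets_at_top R)"
    by (rule eventually_finite_subsets_at_top_weakI) (use assms in auto)
  ultimately show "norm (\<Sum>\<^sub>\<infinity>i\<in>R. f i) \<le> C"
    by (rule Lim_norm_ubound[OF finite_subsets_at_top_neq_bot])
qed

section \<open>Smooth functions on a product of two groups\<close>

locale lie_pair = G1: compact_lie G\<^sub>1 M\<^sub>1 + G2: compact_lie G\<^sub>2 M\<^sub>2
  for G\<^sub>1 :: "('a::{t2_space, second_countable_topology}, 'e::real_normed_vector) lie_group" and M\<^sub>1
    and G\<^sub>2 :: "('b::{t2_space, second_countable_topology}, 'f::real_normed_vector) lie_group" and M\<^sub>2
begin

abbreviation "G \<equiv> lie_prod G\<^sub>1 G\<^sub>2"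

lemma mfdG: "manifold (atlas G)"
  by (simp add: manifold_prod[OF G1.mfd G2.mfd])

lemma smooth_map_fst: "smooth_map (atlas G) (atlas G\<^sub>1) fst" and smooth_map_snd: "smooth_map (atlas G) (atlas G\<^sub>2) snd"
proof -
  have "msmooth (\<phi> ` U) (atlas G\<^sub>1) (\<lambda>x. fst (inv_into U \<phi> x)) \<and> msmooth (\<phi> ` U) (atlas G\<^sub>2) (\<lambda>x. snd (inv_into U \<phi> x))"
    if U: "(U, \<phi>) \<in> atlas G" for U \<phi>
    using msmooth_fst_snd[OF G1.mfd G2.mfd chartD(2)[OF mfdG U], of "inv_into U \<phi>"] msmooth_chart_inv[OF mfdG U] by simp
  thus "smooth_map (atlas G) (atlas G\<^sub>1) fst" "smooth_map (atlas G) (atlas G\<^sub>2) snd"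
    unfolding smooth_map_iff[OF mfdG] by (auto intro: continuous_on_fst continuous_on_snd continuous_on_id)
qed

lemma C_inf_fst: "f \<in> C_inf G\<^sub>1 \<Longrightarrow> (\<lambda>x. f (fst x)) \<in> C_inf G"
  by (rule C_inf_smooth_map[OF mfdG G1.mfd _ smooth_map_fst])

lemma C_inf_snd: "f \<in> C_inf G\<^sub>2 \<Longrightarrow> (\<lambda>x. f (snd x)) \<in> C_inf G"
  by (rule C_inf_smooth_map[OF mfdG G2.mfd _ smooth_map_snd])

lemma C_inf_fun_tensor: "f \<in> C_inf G\<^sub>1 \<Longrightarrow> g \<in> C_inf G\<^sub>2 \<Longrightarrow> fun_tensor f g \<in> C_inf G"
  using C_inf_mult[OF mfdG C_inf_fst C_inf_snd] by (simp add: fun_tensor_def split_beta')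

lemma C_inf_compose_pair:
  assumes \<phi>: "\<phi> \<in> C_inf G" and S: "open S" and F: "msmooth S (atlas G\<^sub>1) F" "msmooth S (atlas G\<^sub>2) F'"
  shows "smooth_on S (\<lambda>x. \<phi> (F x, F' x))"
  by (rule C_inf_compose[OF mfdG \<phi> S]) (simp add: msmooth_Pair[OF G1.mfd G2.mfd S F])

lemma partial_integral_C_inf:
  assumes \<phi>: "\<phi> \<in> C_inf G" and k: "continuous_on UNIV k"
  shows "(\<lambda>x. \<integral>y. k y * \<phi> (x, y) \<partial>M\<^sub>2) \<in> C_inf G\<^sub>1"
  unfolding C_inf_iff[OF G1.mfd]
proof clarify
  fix U \<alpha> assume U: "(U, \<alpha>) \<in> atlas G\<^sub>1"
  note op = chartD(2)[OF G1.mfd U]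
  have "param_smooth (\<alpha> ` U) (\<lambda>s y. \<phi> (inv_into U \<alpha> s, y))"
  proof (rule param_smooth_C_inf[OF mfdG G2.mfd op \<phi>, where \<Omega> = "\<lambda>s y. (inv_into U \<alpha> s, y)"])
    fix V \<psi> assume V: "(V, \<psi>) \<in> atlas G\<^sub>2"
    show "msmooth (\<alpha> ` U \<times> \<psi> ` V) (atlas G) (\<lambda>z. (inv_into U \<alpha> (fst z), inv_into V \<psi> (snd z)))"
      using msmooth_prod_chart_inv[OF G1.mfd G2.mfd U V] by simp
  qed
  from integral_param_smooth(1)[OF manifold_fin_dim[OF G1.mfd] op G2.compact_UNIV G2.finite_M G2.sets_M param_smooth_cmult(1)[OF op k this]]
  show "smooth_on (\<alpha> ` U) (\<lambda>x. \<integral>y. k y * \<phi> (inv_into U \<alpha> x, y) \<partial>M\<^sub>2)" .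
qed

lemma C_inf_slice_continuous:
  "\<phi> \<in> C_inf G \<Longrightarrow> continuous_on S f \<Longrightarrow> continuous_on S g \<Longrightarrow> continuous_on S (\<lambda>y. \<phi> (f y, g y))"
  using continuous_on_compose2[OF C_inf_continuous continuous_on_Pair[of S f g]] by blast

subsection \<open>Fourier projections in the second variable\<close>

text \<open>The transpose of the partial Fourier sum in the second variable:
  \<open>u (proj F \<psi>)\<close> collects the terms of the Fourier series of \<open>u\<close> with
  index in \<open>F\<close>, paired with \<open>\<psi>\<close>.\<close>

definition proj :: "('b \<Rightarrow> complex mat) set \<Rightarrow> ('a \<times> 'b \<Rightarrow> complex) \<Rightarrow> 'a \<times> 'b \<Rightarrow> complex" where
  "proj F \<psi> = (\<lambda>x. \<integral>y. G2.rep_kernel F (snd x) y * \<psi> (fst x, y) \<partial>M\<^sub>2)"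

lemma proj_expand:
  assumes R: "dual_representatives G\<^sub>2 R" and F: "F \<subseteq> R" and \<psi>: "\<psi> \<in> C_inf G"
  shows "proj F \<psi> x = (\<Sum>\<eta>\<in>F. of_nat (rep_dim G\<^sub>2 \<eta>) * (\<Sum>r<rep_dim G\<^sub>2 \<eta>. \<Sum>s<rep_dim G\<^sub>2 \<eta>.
      (\<integral>y. \<eta> y $$ (s, r) * \<psi> (fst x, y) \<partial>M\<^sub>2) * cnj (\<eta> (snd x) $$ (s, r))))"
proof -
  have int: "integrable M\<^sub>2 (\<lambda>y. \<eta> y $$ (s, r) * \<psi> (fst x, y))" if "\<eta> \<in> F" "r < rep_dim G\<^sub>2 \<eta>" "s < rep_dim G\<^sub>2 \<eta>" for \<eta> r s
    using that F G2.dual_representatives_irr[OF R]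
    by (intro G2.integrable_cont continuous_on_mult G2.repD(5) C_inf_slice_continuous[OF \<psi>] continuous_on_const continuous_on_id) auto
  have "proj F \<psi> x = (\<integral>y. (\<Sum>\<eta>\<in>F. of_nat (rep_dim G\<^sub>2 \<eta>) * (\<Sum>r<rep_dim G\<^sub>2 \<eta>. \<Sum>s<rep_dim G\<^sub>2 \<eta>.
      cnj (\<eta> (snd x) $$ (s, r)) * (\<eta> y $$ (s, r) * \<psi> (fst x, y)))) \<partial>M\<^sub>2)"
    unfolding proj_def G2.rep_kernel_def by (simp add: sum_distrib_right mult.assoc)
  also have "\<dots> = (\<Sum>\<eta>\<in>F. of_nat (rep_dim G\<^sub>2 \<eta>) * (\<Sum>r<rep_dim G\<^sub>2 \<eta>. \<Sum>s<rep_dim G\<^sub>2 \<eta>.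
      cnj (\<eta> (snd x) $$ (s, r)) * (\<integral>y. \<eta> y $$ (s, r) * \<psi> (fst x, y) \<partial>M\<^sub>2)))"
    by (rule G2.integral_rep_sum) (rule int)
  finally show ?thesis by (simp add: mult.commute)
qed

lemma proj_term_C_inf:
  assumes irr: "irreducible_rep G\<^sub>2 \<eta>" and \<psi>: "\<psi> \<in> C_inf G" and s: "s < rep_dim G\<^sub>2 \<eta>" and r: "r < rep_dim G\<^sub>2 \<eta>"
  shows "fun_tensor (\<lambda>x. \<integral>y. \<eta> y $$ (s, r) * \<psi> (x, y) \<partial>M\<^sub>2) (\<lambda>y. cnj (\<eta> y $$ (s, r))) \<in> C_inf G"
  by (intro C_inf_fun_tensor partial_integral_C_inf[OF \<psi>] G2.repD(5)[OF irr s r] C_inf_cnj[OF G2.mfd] G2.rep_smooth[OF irr s r])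

lemma proj_expand_fun:
  assumes R: "dual_representatives G\<^sub>2 R" and F: "F \<subseteq> R" and \<psi>: "\<psi> \<in> C_inf G"
  shows "proj F \<psi> = (\<lambda>x. \<Sum>\<eta>\<in>F. of_nat (rep_dim G\<^sub>2 \<eta>) * (\<Sum>r<rep_dim G\<^sub>2 \<eta>. \<Sum>s<rep_dim G\<^sub>2 \<eta>.
      fun_tensor (\<lambda>x. \<integral>y. \<eta> y $$ (s, r) * \<psi> (x, y) \<partial>M\<^sub>2) (\<lambda>y. cnj (\<eta> y $$ (s, r))) x))"
  using proj_expand[OF assms] by (simp add: fun_tensor_def split_beta fun_eq_iff)

lemma proj_C_inf:
  assumes R: "dual_representatives G\<^sub>2 R" and F: "F \<subseteq> R" and \<psi>: "\<psi> \<in> C_inf G"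
  shows "proj F \<psi> \<in> C_inf G"
  unfolding proj_expand_fun[OF assms]
  using F G2.dual_representatives_irr[OF R]
  by (intro C_inf_sum[OF mfdG] C_inf_cmult[OF mfdG] proj_term_C_inf \<psi>) auto

text \<open>The projection is a finite sum of tensors, so \<open>u\<close> passes through it by
  linearity. The terms are those in the definition of \<open>Psi_op\<close>, without the exponential
  factor.\<close>

lemma distribution_proj:
  assumes R: "dual_representatives G\<^sub>2 R" and F: "F \<subseteq> R" and \<psi>: "\<psi> \<in> C_inf G" and u: "u \<in> distributions G"
  shows "u (proj F \<psi>) = (\<Sum>\<eta>\<in>F. of_nat (rep_dim G\<^sub>2 \<eta>) * (\<Sum>r<rep_dim G\<^sub>2 \<eta>. \<Sum>s<rep_dim G\<^sub>2 \<eta>.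
      u (fun_tensor (\<lambda>x. \<integral>y. \<eta> y $$ (s, r) * \<psi> (x, y) \<partial>M\<^sub>2) (\<lambda>y. cnj (\<eta> y $$ (s, r))))))"
proof -
  define t where "t \<eta> r s = fun_tensor (\<lambda>x. \<integral>y. \<eta> y $$ (s, r) * \<psi> (x, y) \<partial>M\<^sub>2) (\<lambda>y. cnj (\<eta> y $$ (s, r)))" for \<eta> :: "'b \<Rightarrow> complex mat" and r s
  have t: "t \<eta> r s \<in> C_inf G" if "\<eta> \<in> F" "r < rep_dim G\<^sub>2 \<eta>" "s < rep_dim G\<^sub>2 \<eta>" for \<eta> r s
    unfolding t_def using that F G2.dual_representatives_irr[OF R] by (intro proj_term_C_inf \<psi>) auto
  have t1: "(\<lambda>x. \<Sum>s<rep_dim G\<^sub>2 \<eta>. t \<eta> r s x) \<in> C_inf G" if "\<eta> \<in> F" "r < rep_dim G\<^sub>2 \<eta>" for \<eta> r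
    by (rule C_inf_sum[OF mfdG]) (use t that in auto)
  have t2: "(\<lambda>x. \<Sum>r<rep_dim G\<^sub>2 \<eta>. \<Sum>s<rep_dim G\<^sub>2 \<eta>. t \<eta> r s x) \<in> C_inf G" if "\<eta> \<in> F" for \<eta>
    by (rule C_inf_sum[OF mfdG]) (use t1 that in auto)
  have "u (proj F \<psi>) = (\<Sum>\<eta>\<in>F. u (\<lambda>x. of_nat (rep_dim G\<^sub>2 \<eta>) * (\<Sum>r<rep_dim G\<^sub>2 \<eta>. \<Sum>s<rep_dim G\<^sub>2 \<eta>. t \<eta> r s x)))"
    unfolding proj_expand_fun[OF R F \<psi>] t_def[symmetric]
    by (rule distribution_sum[OF mfdG u]) (intro C_inf_cmult[OF mfdG] t2)
  also have "\<dots> = (\<Sum>\<eta>\<in>F. of_nat (rep_dim G\<^sub>2 \<eta>) * (\<Sum>r<rep_dim G\<^sub>2 \<eta>. \<Sum>s<rep_dim G\<^sub>2 \<eta>. u (t \<eta> r s)))"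
  proof (rule sum.cong[OF refl])
    fix \<eta> assume \<eta>: "\<eta> \<in> F"
    have "u (\<lambda>x. \<Sum>r<rep_dim G\<^sub>2 \<eta>. \<Sum>s<rep_dim G\<^sub>2 \<eta>. t \<eta> r s x) = (\<Sum>r<rep_dim G\<^sub>2 \<eta>. u (\<lambda>x. \<Sum>s<rep_dim G\<^sub>2 \<eta>. t \<eta> r s x))"
      by (rule distribution_sum[OF mfdG u]) (use t1 \<eta> in auto)
    also have "\<dots> = (\<Sum>r<rep_dim G\<^sub>2 \<eta>. \<Sum>s<rep_dim G\<^sub>2 \<eta>. u (t \<eta> r s))"
      by (rule sum.cong[OF refl], rule distribution_sum[OF mfdG u]) (use t \<eta> in auto)
    finally show "u (\<lambda>x. of_nat (rep_dim G\<^sub>2 \<eta>) * (\<Sum>r<rep_dim G\<^sub>2 \<eta>. \<Sum>s<rep_dim G\<^sub>2 \<eta>. t \<eta> r s x)) =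
       of_nat (rep_dim G\<^sub>2 \<eta>) * (\<Sum>r<rep_dim G\<^sub>2 \<eta>. \<Sum>s<rep_dim G\<^sub>2 \<eta>. u (t \<eta> r s))"
      using distributionD(3)[OF u t2[OF \<eta>]] by simp
  qed
  finally show ?thesis by (simp add: t_def)
qed

text \<open>Shifts the dependence on \<open>x\<close> from the kernel to the argument of
  \<open>\<psi>\<close>: derivatives in \<open>x\<close> then fall on \<open>\<psi>\<close>, and the
  kernel is always based at the identity.\<close>

lemma proj_translate:
  assumes R: "dual_representatives G\<^sub>2 R" and F: "F \<subseteq> R" and \<psi>: "\<psi> \<in> C_inf G"
  shows "proj F \<psi> x = (\<integral>y. G2.rep_kernel F \<one>\<^bsub>G\<^sub>2\<^esub> y * \<psi> (fst x, snd x \<otimes>\<^bsub>G\<^sub>2\<^esub> y) \<partial>M\<^sub>2)"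
proof -
  have "proj F \<psi> x = (\<integral>y. G2.rep_kernel F (snd x) (snd x \<otimes>\<^bsub>G\<^sub>2\<^esub> y) * \<psi> (fst x, snd x \<otimes>\<^bsub>G\<^sub>2\<^esub> y) \<partial>M\<^sub>2)"
    unfolding proj_def
    by (rule G2.integral_left[where f = "\<lambda>y. G2.rep_kernel F (snd x) y * \<psi> (fst x, y)", symmetric])
      (intro continuous_on_mult G2.continuous_rep_kernel[OF R F] C_inf_slice_continuous[OF \<psi>] continuous_on_const continuous_on_id)
  thus ?thesis using G2.rep_kernel_translate[OF R F, of "snd x" "\<one>\<^bsub>G\<^sub>2\<^esub>"] by simp
qed

end

section \<open>Uniform seminorm bounds for partial sums\<close>

context lie_pair
begin

text \<open>A derivative of the projection at \<open>z\<close> is the integral of the kernel at the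
  identity against a function \<open>\<Theta>\<close> of \<open>y\<close>, obtained by
  differentiating the translate of \<open>\<psi>\<close> by \<open>y\<close> in \<open>z\<close>.
  The estimate on the second group bounds it by seminorms of \<open>\<Theta>\<close>, and these are
  mixed derivatives of \<open>\<psi>\<close> along compact products.\<close>

lemma proj_seminorm_bound:
  assumes R: "dual_representatives G\<^sub>2 R" and W: "(W, \<kappa>) \<in> atlas G" and K: "compact K" "K \<subseteq> \<kappa> ` W"
  shows "\<exists>I C. admissible (atlas G) I \<and> C \<ge> 0 \<and> (\<forall>\<psi>\<in>C_inf G. \<forall>B>0. seminorms_le I B \<psi> \<longrightarrow>
    (\<forall>p\<in>{F. F \<subseteq> R \<and> finite F} \<times> K. norm (iter_deriv vs (\<lambda>z. proj (fst p) \<psi> (inv_into W \<kappa> z)) (snd p)) \<le> C * B))"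
proof -
  define S where "S = \<kappa> ` W"
  have S: "open S" unfolding S_def by (rule chartD(2)[OF mfdG W])
  define \<Omega> where "\<Omega> z y = (fst (inv_into W \<kappa> z), snd (inv_into W \<kappa> z) \<otimes>\<^bsub>G\<^sub>2\<^esub> y)" for z y
  have op: "open (S \<times> \<upsilon> ` V)" if "(V, \<upsilon>) \<in> atlas G\<^sub>2" for V \<upsilon>
    by (intro open_Times S chartD(2)[OF G2.mfd that])
  have \<Omega>: "msmooth (S \<times> \<upsilon> ` V) (atlas G) (\<lambda>p. \<Omega> (fst p) (inv_into V \<upsilon> (snd p)))" if V: "(V, \<upsilon>) \<in> atlas G\<^sub>2" for V \<upsilon>
  proof -
    have i: "msmooth (S \<times> \<upsilon> ` V) (atlas G) (\<lambda>p. inv_into W \<kappa> (fst p))"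
      by (rule smooth_on_imp_msmooth[OF mfdG op[OF V] W smooth_on_fst[OF op[OF V] smooth_on_id]]) (auto simp: S_def)
    have j: "msmooth (S \<times> \<upsilon> ` V) (atlas G\<^sub>2) (\<lambda>p. inv_into V \<upsilon> (snd p))"
      by (rule smooth_on_imp_msmooth[OF G2.mfd op[OF V] V smooth_on_snd[OF op[OF V] smooth_on_id]]) auto
    note i' = msmooth_fst_snd[OF G1.mfd G2.mfd op[OF V] i[unfolded lie_prod_simps]]
    show ?thesis unfolding \<Omega>_def lie_prod_simps
      by (rule msmooth_Pair[OF G1.mfd G2.mfd op[OF V] i'(1) G2.msmooth_mult[OF op[OF V] i'(2) j]])
  qed
  have sm: "smooth_on (S \<times> \<upsilon> ` V) (\<lambda>p. \<psi> (\<Omega> (fst p) (inv_into V \<upsilon> (snd p))))"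
    if V: "(V, \<upsilon>) \<in> atlas G\<^sub>2" and \<psi>: "\<psi> \<in> C_inf G" for V \<upsilon> \<psi>
    by (rule C_inf_compose[OF mfdG \<psi> op[OF V] \<Omega>[OF V]])
  obtain J C1 where J: "admissible (atlas G\<^sub>2) J" "C1 \<ge> 0" and leJ': "\<forall>F\<subseteq>R. finite F \<longrightarrow> (\<forall>\<Theta>\<in>C_inf G\<^sub>2. \<forall>B>0. seminorms_le J B \<Theta> \<longrightarrow>
     norm (\<integral>y. G2.rep_kernel F \<one>\<^bsub>G\<^sub>2\<^esub> y * \<Theta> y \<partial>M\<^sub>2) \<le> C1 * B)"
    using G2.fourier_projection_bound[OF R] by (elim exE conjE)
  note leJ = leJ'[rule_format]
  \<comment> \<open>Directions of the mixed derivative: those in the chart variable of the product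
    are applied innermost, those in the chart variable of the second group outermost.\<close>
  define dir where "dir ws = map (\<lambda>v. (0::'e \<times> 'f, v)) ws @ map (\<lambda>v. (v, 0::'f)) vs" for ws
  have "\<exists>I C. admissible (atlas G) I \<and> C \<ge> 0 \<and> (\<forall>\<psi>\<in>C_inf G. \<forall>B>0. seminorms_le I B \<psi> \<longrightarrow>
     (\<forall>p\<in>K \<times> fst (snd i). norm (iter_deriv (dir (snd (snd i))) (\<lambda>p. 1 * \<psi> (\<Omega> (fst p) (inv_into (fst (fst i)) (snd (fst i)) (snd p)))) p) \<le> C * B))"
    if "i \<in> J" for i
  proof -
    obtain V \<upsilon> K' ws where i: "i = ((V, \<upsilon>), K', ws)" by (metis prod.collapse)
    note V = admissibleD[OF J(1) that[unfolded i]]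
    show ?thesis unfolding i fst_conv snd_conv
      by (rule pullback_bound[OF mfdG op[OF V(1)] smooth_on_const \<Omega>[OF V(1)] compact_Times[OF K(1) V(2)]])
        (use K(2) V(3) in \<open>auto simp: S_def\<close>)
  qed
  moreover have "finite J" using J(1) by (simp add: admissible_def)
  ultimately have "\<exists>I C. admissible (atlas G) I \<and> C \<ge> 0 \<and> (\<forall>\<psi>\<in>C_inf G. \<forall>B>0. seminorms_le I B \<psi> \<longrightarrow> (\<forall>i\<in>J.
     \<forall>p\<in>K \<times> fst (snd i). norm (iter_deriv (dir (snd (snd i))) (\<lambda>p. 1 * \<psi> (\<Omega> (fst p) (inv_into (fst (fst i)) (snd (fst i)) (snd p)))) p) \<le> C * B))"
    by (rule_tac admissible_uniform[where S = "C_inf G" and Y = "\<lambda>i. K \<times> fst (snd i)" and \<A> = "atlas G"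
        and g = "\<lambda>i \<psi> p. norm (iter_deriv (dir (snd (snd i))) (\<lambda>p. 1 * \<psi> (\<Omega> (fst p) (inv_into (fst (fst i)) (snd (fst i)) (snd p)))) p)"])
  then obtain I C where I: "admissible (atlas G) I" "C \<ge> 0" and leI': "\<forall>\<psi>\<in>C_inf G. \<forall>B>0. seminorms_le I B \<psi> \<longrightarrow> (\<forall>i\<in>J.
     \<forall>p\<in>K \<times> fst (snd i). norm (iter_deriv (dir (snd (snd i))) (\<lambda>p. 1 * \<psi> (\<Omega> (fst p) (inv_into (fst (fst i)) (snd (fst i)) (snd p)))) p) \<le> C * B)"
    by (elim exE conjE)
  note leI = leI'[rule_format]
  \<comment> \<open>\<open>C + 1\<close> takes the place of \<open>C\<close> because the estimate on
    the second group is stated for strictly positive bounds and \<open>C\<close> may be 0.\<close>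
  show ?thesis
  proof (intro exI[of _ I] exI[of _ "C1 * (C + 1)"] conjI I(1) ballI allI impI)
    show "0 \<le> C1 * (C + 1)" using J I by simp
    fix \<psi> B p assume \<psi>: "\<psi> \<in> C_inf G" and B: "(0::real) < B" and sl: "seminorms_le I B \<psi>" and p: "p \<in> {F. F \<subseteq> R \<and> finite F} \<times> K"
    obtain F z where pF: "p = (F, z)" and F: "F \<subseteq> R" "finite F" and z: "z \<in> K" using p by (cases p) auto
    have zS: "z \<in> S" using z K by (auto simp: S_def)
    define \<Theta> where "\<Theta> y = iter_deriv vs (\<lambda>z. \<psi> (\<Omega> z y)) z" for y
    have ps: "param_smooth S (\<lambda>z y. \<psi> (\<Omega> z y))"
      by (rule param_smooth_C_inf[OF mfdG G2.mfd S \<psi> \<Omega>])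
    have kc: "continuous_on UNIV (\<lambda>y. G2.rep_kernel F \<one>\<^bsub>G\<^sub>2\<^esub> y)"
      by (intro G2.continuous_rep_kernel[OF R F(1)] continuous_on_const continuous_on_id)
    have "iter_deriv vs (\<lambda>z. proj F \<psi> (inv_into W \<kappa> z)) z =
        iter_deriv vs (\<lambda>z. \<integral>y. G2.rep_kernel F \<one>\<^bsub>G\<^sub>2\<^esub> y * \<psi> (\<Omega> z y) \<partial>M\<^sub>2) z"
      by (simp add: proj_translate[OF R F(1) \<psi>] \<Omega>_def)
    also have "\<dots> = (\<integral>y. iter_deriv vs (\<lambda>z. G2.rep_kernel F \<one>\<^bsub>G\<^sub>2\<^esub> y * \<psi> (\<Omega> z y)) z \<partial>M\<^sub>2)"
      by (rule integral_param_smooth(2)[OF manifold_fin_dim[OF mfdG] S G2.compact_UNIV G2.finite_M G2.sets_M param_smooth_cmult(1)[OF S kc ps] zS])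
    also have "\<dots> = (\<integral>y. G2.rep_kernel F \<one>\<^bsub>G\<^sub>2\<^esub> y * \<Theta> y \<partial>M\<^sub>2)"
      by (simp add: param_smooth_cmult(2)[OF S kc ps zS] \<Theta>_def)
    finally have eq: "iter_deriv vs (\<lambda>z. proj F \<psi> (inv_into W \<kappa> z)) z = (\<integral>y. G2.rep_kernel F \<one>\<^bsub>G\<^sub>2\<^esub> y * \<Theta> y \<partial>M\<^sub>2)" .
    have \<Theta>chart: "\<Theta> (inv_into V \<upsilon> y') = iter_deriv (map (\<lambda>v. (v, 0)) vs) (\<lambda>p. \<psi> (\<Omega> (fst p) (inv_into V \<upsilon> (snd p)))) (z, y')"
      if V: "(V, \<upsilon>) \<in> atlas G\<^sub>2" and y': "y' \<in> \<upsilon> ` V" for V \<upsilon> y'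
    proof -
      have "(z, y') \<in> S \<times> \<upsilon> ` V" using zS y' by simp
      from iter_deriv_slice1(1)[OF op[OF V] sm[OF V \<psi>] this, of vs] show ?thesis by (simp add: \<Theta>_def)
    qed
    have smg: "smooth_on (S \<times> \<upsilon> ` V) (iter_deriv (map (\<lambda>v. (v, 0)) vs) (\<lambda>p. \<psi> (\<Omega> (fst p) (inv_into V \<upsilon> (snd p)))))"
      if V: "(V, \<upsilon>) \<in> atlas G\<^sub>2" for V \<upsilon>
      by (rule smooth_on_iter_deriv[OF sm[OF V \<psi>]])
    have "\<Theta> \<in> C_inf G\<^sub>2" unfolding C_inf_iff[OF G2.mfd]
    proof clarify
      fix V \<upsilon> assume V: "(V, \<upsilon>) \<in> atlas G\<^sub>2"
      have "smooth_on (\<upsilon> ` V) (\<lambda>y'. iter_deriv (map (\<lambda>v. (v, 0)) vs) (\<lambda>p. \<psi> (\<Omega> (fst p) (inv_into V \<upsilon> (snd p)))) (z, y'))"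
        unfolding smooth_on_iff
      proof (intro allI ballI)
        fix us y' assume "y' \<in> \<upsilon> ` V"
        hence "(z, y') \<in> S \<times> \<upsilon> ` V" using zS by simp
        from iter_deriv_slice2(2)[OF op[OF V] smg[OF V] this]
        show "iter_deriv us (\<lambda>y'. iter_deriv (map (\<lambda>v. (v, 0)) vs) (\<lambda>p. \<psi> (\<Omega> (fst p) (inv_into V \<upsilon> (snd p)))) (z, y')) differentiable at y'" .
      qed
      thus "smooth_on (\<upsilon> ` V) (\<lambda>y'. \<Theta> (inv_into V \<upsilon> y'))"
        by (subst smooth_on_cong[OF chartD(2)[OF G2.mfd V] \<Theta>chart[OF V]])
    qed
    moreover have "seminorms_le J ((C + 1) * B) \<Theta>" unfolding seminorms_le_iff
    proof (intro allI impI)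
      fix V \<upsilon> K' ws y' assume i: "((V, \<upsilon>), K', ws) \<in> J" and y': "y' \<in> K'"
      note V = admissibleD[OF J(1) i]
      have zy: "(z, y') \<in> S \<times> \<upsilon> ` V" using zS V(4)[OF y'] by simp
      have "iter_deriv ws (\<lambda>y'. \<Theta> (inv_into V \<upsilon> y')) y' =
          iter_deriv ws (\<lambda>y'. iter_deriv (map (\<lambda>v. (v, 0)) vs) (\<lambda>p. \<psi> (\<Omega> (fst p) (inv_into V \<upsilon> (snd p)))) (z, y')) y'"
        by (rule iter_deriv_cong[OF chartD(2)[OF G2.mfd V(1)] \<Theta>chart[OF V(1)] V(4)[OF y']])
      also have "\<dots> = iter_deriv (dir ws) (\<lambda>p. \<psi> (\<Omega> (fst p) (inv_into V \<upsilon> (snd p)))) (z, y')"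
        by (simp only: iter_deriv_slice2(1)[OF op[OF V(1)] smg[OF V(1)] zy] dir_def iter_deriv_append)
      finally have "norm (iter_deriv ws (\<lambda>y'. \<Theta> (inv_into V \<upsilon> y')) y') \<le> C * B"
        using leI[OF \<psi> B sl i, of "(z, y')"] z y' by simp
      thus "norm (iter_deriv ws (\<lambda>y'. \<Theta> (inv_into V \<upsilon> y')) y') \<le> (C + 1) * B" using B by (simp add: distrib_right)
    qed
    ultimately have "norm (\<integral>y. G2.rep_kernel F \<one>\<^bsub>G\<^sub>2\<^esub> y * \<Theta> y \<partial>M\<^sub>2) \<le> C1 * ((C + 1) * B)"
      using I(2) B by (intro leJ F) auto
    thus "norm (iter_deriv vs (\<lambda>z. proj (fst p) \<psi> (inv_into W \<kappa> z)) (snd p)) \<le> C1 * (C + 1) * B"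
      by (simp add: pF eq mult.assoc)
  qed
qed

lemma distribution_proj_bound:
  assumes R: "dual_representatives G\<^sub>2 R" and u: "u \<in> distributions G"
  shows "\<exists>I C. admissible (atlas G) I \<and> C \<ge> 0 \<and> (\<forall>\<psi>\<in>C_inf G. \<forall>B>0. seminorms_le I B \<psi> \<longrightarrow>
    (\<forall>F. F \<subseteq> R \<longrightarrow> finite F \<longrightarrow> norm (u (proj F \<psi>)) \<le> C * B))"
proof -
  obtain I0 C0 where I0: "admissible (atlas G) I0" and C0: "C0 \<ge> 0"
    and le0: "\<And>f B. f \<in> C_inf G \<Longrightarrow> B > 0 \<Longrightarrow> seminorms_le I0 B f \<Longrightarrow> norm (u f) \<le> C0 * B"
    using u[unfolded distributions_iff[OF mfdG]] by blast
  have "\<exists>I C. admissible (atlas G) I \<and> C \<ge> 0 \<and> (\<forall>\<psi>\<in>C_inf G. \<forall>B>0. seminorms_le I B \<psi> \<longrightarrow>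
    (\<forall>p\<in>{F. F \<subseteq> R \<and> finite F} \<times> fst (snd i). norm (iter_deriv (snd (snd i)) (\<lambda>z. proj (fst p) \<psi> (inv_into (fst (fst i)) (snd (fst i)) z)) (snd p)) \<le> C * B))"
    if "i \<in> I0" for i
  proof -
    obtain W \<kappa> K vs where i: "i = ((W, \<kappa>), K, vs)" by (metis prod.collapse)
    note W = admissibleD[OF I0 that[unfolded i]]
    show ?thesis unfolding i fst_conv snd_conv by (rule proj_seminorm_bound[OF R W(1,2,3)])
  qed
  moreover have "finite I0" using I0 by (simp add: admissible_def)
  ultimately have "\<exists>I C. admissible (atlas G) I \<and> C \<ge> 0 \<and> (\<forall>\<psi>\<in>C_inf G. \<forall>B>0. seminorms_le I B \<psi> \<longrightarrow> (\<forall>i\<in>I0.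
    \<forall>p\<in>{F. F \<subseteq> R \<and> finite F} \<times> fst (snd i). norm (iter_deriv (snd (snd i)) (\<lambda>z. proj (fst p) \<psi> (inv_into (fst (fst i)) (snd (fst i)) z)) (snd p)) \<le> C * B))"
    by (rule_tac admissible_uniform[where S = "C_inf G" and Y = "\<lambda>i. {F. F \<subseteq> R \<and> finite F} \<times> fst (snd i)" and \<A> = "atlas G"
        and g = "\<lambda>i \<psi> p. norm (iter_deriv (snd (snd i)) (\<lambda>z. proj (fst p) \<psi> (inv_into (fst (fst i)) (snd (fst i)) z)) (snd p))"])
  then obtain I C where I: "admissible (atlas G) I" "C \<ge> 0" and leI': "\<forall>\<psi>\<in>C_inf G. \<forall>B>0. seminorms_le I B \<psi> \<longrightarrow> (\<forall>i\<in>I0.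
    \<forall>p\<in>{F. F \<subseteq> R \<and> finite F} \<times> fst (snd i). norm (iter_deriv (snd (snd i)) (\<lambda>z. proj (fst p) \<psi> (inv_into (fst (fst i)) (snd (fst i)) z)) (snd p)) \<le> C * B)"
    by (elim exE conjE)
  note leI = leI'[rule_format]
  show ?thesis
  proof (intro exI[of _ I] exI[of _ "C0 * (C + 1)"] conjI I(1) ballI allI impI)
    show "0 \<le> C0 * (C + 1)" using C0 I by simp
    fix \<psi> B F assume \<psi>: "\<psi> \<in> C_inf G" and B: "(0::real) < B" and sl: "seminorms_le I B \<psi>" and F: "F \<subseteq> R" "finite F"
    have "seminorms_le I0 ((C + 1) * B) (proj F \<psi>)" unfolding seminorms_le_iff
    proof (intro allI impI)
      fix W \<kappa> K vs z assume i: "((W, \<kappa>), K, vs) \<in> I0" and z: "z \<in> K"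
      have "norm (iter_deriv vs (\<lambda>z. proj F \<psi> (inv_into W \<kappa> z)) z) \<le> C * B"
        using leI[OF \<psi> B sl i, of "(F, z)"] z F by simp
      thus "norm (iter_deriv vs (\<lambda>z. proj F \<psi> (inv_into W \<kappa> z)) z) \<le> (C + 1) * B" using B by (simp add: distrib_right)
    qed
    from le0[OF proj_C_inf[OF R F(1) \<psi>] _ this] show "norm (u (proj F \<psi>)) \<le> C0 * (C + 1) * B"
      using I(2) B by (simp add: mult.assoc)
  qed
qed

text \<open>The Fourier series of \<open>u\<close> in the second variable, treated as a distribution
  in its own right and never identified with \<open>u\<close>.\<close>

definition fourier_sum :: "('b \<Rightarrow> complex mat) set \<Rightarrow> (('a \<times> 'b \<Rightarrow> complex) \<Rightarrow> complex) \<Rightarrow> ('a \<times> 'b \<Rightarrow> complex) \<Rightarrow> complex" where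
  "fourier_sum R u = (\<lambda>\<psi>\<in>C_inf G. \<Sum>\<^sub>\<infinity>\<eta>\<in>R. u (proj {\<eta>} \<psi>))"

lemma integrable_kernel_slice:
  assumes R: "dual_representatives G\<^sub>2 R" and F: "F \<subseteq> R" and \<psi>: "\<psi> \<in> C_inf G"
  shows "integrable M\<^sub>2 (\<lambda>y. G2.rep_kernel F x\<^sub>2 y * \<psi> (x\<^sub>1, y))"
  by (intro G2.integrable_cont continuous_on_mult G2.continuous_rep_kernel[OF R F] C_inf_slice_continuous[OF \<psi>] continuous_on_const continuous_on_id)

lemma distribution_proj_sum:
  assumes R: "dual_representatives G\<^sub>2 R" and F: "F \<subseteq> R" and \<psi>: "\<psi> \<in> C_inf G" and u: "u \<in> distributions G"
  shows "u (proj F \<psi>) = (\<Sum>\<eta>\<in>F. u (proj {\<eta>} \<psi>))"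
proof -
  have t: "u (proj {\<eta>} \<psi>) = of_nat (rep_dim G\<^sub>2 \<eta>) * (\<Sum>r<rep_dim G\<^sub>2 \<eta>. \<Sum>s<rep_dim G\<^sub>2 \<eta>.
      u (fun_tensor (\<lambda>x. \<integral>y. \<eta> y $$ (s, r) * \<psi> (x, y) \<partial>M\<^sub>2) (\<lambda>y. cnj (\<eta> y $$ (s, r)))))" if "\<eta> \<in> F" for \<eta>
  proof -
    have "{\<eta>} \<subseteq> R" using that F by blast
    from distribution_proj[OF R this \<psi> u] show ?thesis by (simp only: sum.insert[OF finite.emptyI] sum.empty add_0_right empty_iff not_False_eq_True)
  qed
  show ?thesis unfolding distribution_proj[OF R F \<psi> u] by (rule sum.cong[OF refl]) (rule t[symmetric])
qed

text \<open>The bound on \<open>u (proj F \<psi>)\<close>, uniform in finite \<open>F\<close>, gives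
  summability for each test function and survives the limit as the continuity estimate, with the
  same seminorms and constant.\<close>

lemma fourier_sum_distribution:
  assumes R: "dual_representatives G\<^sub>2 R" and u: "u \<in> distributions G"
  shows "fourier_sum R u \<in> distributions G"
proof -
  obtain I C where I: "admissible (atlas G) I" "C \<ge> 0"
    and le0: "\<forall>\<psi>\<in>C_inf G. \<forall>B>0. seminorms_le I B \<psi> \<longrightarrow> (\<forall>F. F \<subseteq> R \<longrightarrow> finite F \<longrightarrow> norm (u (proj F \<psi>)) \<le> C * B)"
    using distribution_proj_bound[OF R u] by (elim exE conjE)
  note le = le0[rule_format]
  have le': "norm (\<Sum>\<eta>\<in>F. u (proj {\<eta>} \<psi>)) \<le> C * B"
    if "\<psi> \<in> C_inf G" "B > 0" "seminorms_le I B \<psi>" "finite F" "F \<subseteq> R" for \<psi> B F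
    using le[OF that(1-3,5,4)] distribution_proj_sum[OF R that(5,1) u] by simp
  have sm: "(\<lambda>\<eta>. u (proj {\<eta>} \<psi>)) summable_on R" if \<psi>: "\<psi> \<in> C_inf G" for \<psi>
  proof -
    obtain B where "B > 0" "seminorms_le I B \<psi>" using seminorms_le_ex[OF mfdG I(1) \<psi>] by blast
    from bounded_sums_summable(1)[OF le'[OF \<psi> this]] show ?thesis .
  qed
  show ?thesis unfolding distributions_iff[OF mfdG]
  proof (intro conjI ballI allI impI exI[of _ I] exI[of _ C] I)
    show "fourier_sum R u \<in> extensional (C_inf G)" by (simp add: fourier_sum_def)
    fix f assume f: "f \<in> C_inf G"
    show "fourier_sum R u (\<lambda>x. f x + g x) = fourier_sum R u f + fourier_sum R u g" if g: "g \<in> C_inf G" for g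
    proof -
      have "u (proj {\<eta>} (\<lambda>x. f x + g x)) = u (proj {\<eta>} f) + u (proj {\<eta>} g)" if "\<eta> \<in> R" for \<eta>
      proof -
        have \<eta>: "{\<eta>} \<subseteq> R" using that by simp
        have "proj {\<eta>} (\<lambda>x. f x + g x) = (\<lambda>x. proj {\<eta>} f x + proj {\<eta>} g x)"
          by (simp add: proj_def distrib_left integrable_kernel_slice[OF R \<eta> f] integrable_kernel_slice[OF R \<eta> g])
        thus ?thesis using distributionD(2)[OF u proj_C_inf[OF R \<eta> f] proj_C_inf[OF R \<eta> g]] by simp
      qed
      hence "(\<Sum>\<^sub>\<infinity>\<eta>\<in>R. u (proj {\<eta>} (\<lambda>x. f x + g x))) = (\<Sum>\<^sub>\<infinity>\<eta>\<in>R. u (proj {\<eta>} f) + u (proj {\<eta>} g))"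
        by (rule infsum_cong)
      also have "\<dots> = (\<Sum>\<^sub>\<infinity>\<eta>\<in>R. u (proj {\<eta>} f)) + (\<Sum>\<^sub>\<infinity>\<eta>\<in>R. u (proj {\<eta>} g))"
        by (rule infsum_add[OF sm[OF f] sm[OF g]])
      finally show ?thesis using f g C_inf_add[OF mfdG f g] by (simp add: fourier_sum_def)
    qed
    show "fourier_sum R u (\<lambda>x. c * f x) = c * fourier_sum R u f" for c
    proof -
      have "u (proj {\<eta>} (\<lambda>x. c * f x)) = c * u (proj {\<eta>} f)" if "\<eta> \<in> R" for \<eta>
      proof -
        have \<eta>: "{\<eta>} \<subseteq> R" using that by simp
        have "proj {\<eta>} (\<lambda>x. c * f x) = (\<lambda>x. c * proj {\<eta>} f x)"
          by (simp add: proj_def mult.left_commute)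
        thus ?thesis using distributionD(3)[OF u proj_C_inf[OF R \<eta> f]] by simp
      qed
      hence "(\<Sum>\<^sub>\<infinity>\<eta>\<in>R. u (proj {\<eta>} (\<lambda>x. c * f x))) = (\<Sum>\<^sub>\<infinity>\<eta>\<in>R. c * u (proj {\<eta>} f))"
        by (rule infsum_cong)
      also have "\<dots> = c * (\<Sum>\<^sub>\<infinity>\<eta>\<in>R. u (proj {\<eta>} f))"
        by (rule infsum_cmult_right) (rule sm[OF f])
      finally show ?thesis using f C_inf_cmult[OF mfdG f] by (simp add: fourier_sum_def)
    qed
    fix B :: real assume B: "0 < B" "seminorms_le I B f"
    from bounded_sums_summable(2)[OF le'[OF f B]] show "norm (fourier_sum R u f) \<le> C * B"
      using f by (simp add: fourier_sum_def)
  qed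
qed

subsection \<open>The conjugating operator as a pullback\<close>

definition shear :: "(real \<Rightarrow> 'b) \<Rightarrow> ('a \<Rightarrow> real) \<Rightarrow> 'a \<times> 'b \<Rightarrow> 'a \<times> 'b" where
  "shear X t = (\<lambda>x. (fst x, snd x \<otimes>\<^bsub>G\<^sub>2\<^esub> X (t (fst x))))"

lemma smooth_map_shear:
  assumes X: "X \<in> lie_algebra G\<^sub>2" and t: "(\<lambda>x. complex_of_real (t x)) \<in> C_inf G\<^sub>1"
  shows "smooth_map (atlas G) (atlas G) (shear X t)"
  unfolding lie_prod_simps
proof (rule smooth_mapI_prod[OF G1.mfd G2.mfd manifold_prod[OF G1.mfd G2.mfd]])
  fix U \<phi> V \<psi> assume U: "(U, \<phi>) \<in> atlas G\<^sub>1" and V: "(V, \<psi>) \<in> atlas G\<^sub>2"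
  have op: "open (\<phi> ` U \<times> \<psi> ` V)" by (intro open_Times chartD(2)[OF G1.mfd U] chartD(2)[OF G2.mfd V])
  have i: "msmooth (\<phi> ` U \<times> \<psi> ` V) (atlas G\<^sub>1) (\<lambda>z. inv_into U \<phi> (fst z))"
    by (rule smooth_on_imp_msmooth[OF G1.mfd op U smooth_on_fst[OF op smooth_on_id]]) auto
  have j: "msmooth (\<phi> ` U \<times> \<psi> ` V) (atlas G\<^sub>2) (\<lambda>z. inv_into V \<psi> (snd z))"
    by (rule smooth_on_imp_msmooth[OF G2.mfd op V smooth_on_snd[OF op smooth_on_id]]) auto
  have "smooth_on (\<phi> ` U \<times> \<psi> ` V) (\<lambda>z. Re (complex_of_real (t (inv_into U \<phi> (fst z)))))"
    by (rule smooth_on_bounded_linear[OF bounded_linear_Re op C_inf_compose[OF G1.mfd t op i]])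
  hence tz: "smooth_on (\<phi> ` U \<times> \<psi> ` V) (\<lambda>z. t (inv_into U \<phi> (fst z)))" by simp
  have Xt: "msmooth (\<phi> ` U \<times> \<psi> ` V) (atlas G\<^sub>2) (\<lambda>z. X (t (inv_into U \<phi> (fst z))))"
    by (rule msmooth_comp_smooth[OF fin_dim_real G2.mfd open_UNIV op _ tz G2.lie_algebraD(1)[OF X]]) simp
  show "msmooth (\<phi> ` U \<times> \<psi> ` V) (prod_atlas (atlas G\<^sub>1) (atlas G\<^sub>2)) (\<lambda>z. shear X t (inv_into U \<phi> (fst z), inv_into V \<psi> (snd z)))"
    unfolding shear_def fst_conv snd_conv
    by (rule msmooth_Pair[OF G1.mfd G2.mfd op i G2.msmooth_mult[OF op j Xt]])
qed

lemma flow_inverse: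
  assumes "X \<in> lie_algebra G\<^sub>2"
  shows "X s \<otimes>\<^bsub>G\<^sub>2\<^esub> X (- s) = \<one>\<^bsub>G\<^sub>2\<^esub>" "X (- s) \<otimes>\<^bsub>G\<^sub>2\<^esub> X s = \<one>\<^bsub>G\<^sub>2\<^esub>"
  by (simp_all only: G2.lie_algebraD(2)[OF assms, symmetric] G2.lie_algebraD(3)[OF assms, symmetric] add.right_inverse add.left_inverse)

lemma shear_inverse:
  assumes X: "X \<in> lie_algebra G\<^sub>2"
  shows "shear X t (shear X (\<lambda>x. - t x) x) = x" "shear X (\<lambda>x. - t x) (shear X t x) = x"
  by (simp_all add: shear_def G2.m_assoc flow_inverse[OF X])

lemma C_inf_uminus_real:
  assumes "(\<lambda>x. complex_of_real (t x)) \<in> C_inf G\<^sub>1"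
  shows "(\<lambda>x. complex_of_real (- t x)) \<in> C_inf G\<^sub>1"
  using C_inf_cmult[OF G1.mfd assms, of "-1"] by simp

text \<open>The factor exp(i \<mu> A) turns the matrix coefficient at y into the one at y exp(A X).
  Right invariance of Haar measure in y moves this translation, with opposite sign, onto the test
  function. The shear obtained is the same for all indices and all representations.\<close>

lemma Psi_op_eq:
  assumes R: "dual_representatives G\<^sub>2 R" and X: "X \<in> lie_algebra G\<^sub>2" and sym: "diagonal_symbol G\<^sub>2 X R mu"
    and A: "(\<lambda>x. complex_of_real (A x)) \<in> C_inf G\<^sub>1" and u: "u \<in> distributions G"
  shows "Psi_op G\<^sub>1 G\<^sub>2 M\<^sub>2 R mu A u = transfer_dist G (\<lambda>_. 1) (shear X (\<lambda>x. - A x)) (fourier_sum R u)"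
  unfolding Psi_op_def transfer_dist_def
proof (rule restrict_ext)
  fix \<phi> assume \<phi>: "\<phi> \<in> C_inf G"
  define \<psi> where "\<psi> x = \<phi> (shear X (\<lambda>x. - A x) x)" for x
  have \<psi>: "\<psi> \<in> C_inf G" unfolding \<psi>_def
    by (rule C_inf_smooth_map[OF mfdG mfdG \<phi> smooth_map_shear[OF X C_inf_uminus_real[OF A]]])
  have term_eq: "of_nat (rep_dim G\<^sub>2 \<eta>) * (\<Sum>r<rep_dim G\<^sub>2 \<eta>. \<Sum>s<rep_dim G\<^sub>2 \<eta>.
             dist_tensor G\<^sub>1 G\<^sub>2 M\<^sub>2
               (dist_times G\<^sub>1 (\<lambda>x\<^sub>1. exp (\<i> * complex_of_real (mu \<eta> r * A x\<^sub>1)))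
                  (partial_fourier_coeff G\<^sub>1 u \<eta> r s))
               (\<lambda>x\<^sub>2. \<eta> x\<^sub>2 $$ (s, r)) \<phi>) = u (proj {\<eta>} \<psi>)" if \<eta>: "\<eta> \<in> R" for \<eta>
  proof -
    note irr = G2.dual_representatives_irr[OF R \<eta>]
    have "dist_tensor G\<^sub>1 G\<^sub>2 M\<^sub>2
               (dist_times G\<^sub>1 (\<lambda>x\<^sub>1. exp (\<i> * complex_of_real (mu \<eta> r * A x\<^sub>1)))
                  (partial_fourier_coeff G\<^sub>1 u \<eta> r s))
               (\<lambda>x\<^sub>2. \<eta> x\<^sub>2 $$ (s, r)) \<phi> =
        u (fun_tensor (\<lambda>x. \<integral>y. \<eta> y $$ (s, r) * \<psi> (x, y) \<partial>M\<^sub>2) (\<lambda>y. cnj (\<eta> y $$ (s, r))))"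
      if sr: "s < rep_dim G\<^sub>2 \<eta>" "r < rep_dim G\<^sub>2 \<eta>" for r s
    proof -
      define p where "p x = (\<integral>y. \<eta> y $$ (s, r) * \<phi> (x, y) \<partial>M\<^sub>2)" for x
      define e where "e x = exp (\<i> * complex_of_real (mu \<eta> r * A x))" for x
      have p: "p \<in> C_inf G\<^sub>1" unfolding p_def
        by (rule partial_integral_C_inf[OF \<phi> G2.repD(5)[OF irr sr]])
      have "(\<lambda>x. exp (\<i> * complex_of_real (mu \<eta> r) * complex_of_real (A x))) \<in> C_inf G\<^sub>1"
        by (rule C_inf_exp[OF G1.mfd C_inf_cmult[OF G1.mfd A]])
      hence e: "e \<in> C_inf G\<^sub>1" by (simp add: e_def[abs_def] mult.assoc)
      have ep: "(\<lambda>x. e x * p x) \<in> C_inf G\<^sub>1" by (rule C_inf_mult[OF G1.mfd e p])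
      have "e x * p x = (\<integral>y. \<eta> y $$ (s, r) * \<psi> (x, y) \<partial>M\<^sub>2)" for x
      proof -
        have "e x * p x = (\<integral>y. e x * (\<eta> y $$ (s, r) * \<phi> (x, y)) \<partial>M\<^sub>2)" by (simp add: p_def)
        also have "\<dots> = (\<integral>y. \<eta> (y \<otimes>\<^bsub>G\<^sub>2\<^esub> X (A x)) $$ (s, r) * \<phi> (x, y) \<partial>M\<^sub>2)"
          by (simp add: G2.rep_along[OF X R sym \<eta> sr] e_def mult_ac)
        \<comment> \<open>Substitution of \<open>y\<close> by its right translate under
          \<open>X (- A x)\<close>: it undoes the translation in the matrix coefficient and shears
          the test function.\<close>
        also have "\<dots> = (\<integral>y. \<eta> ((y \<otimes>\<^bsub>G\<^sub>2\<^esub> X (- A x)) \<otimes>\<^bsub>G\<^sub>2\<^esub> X (A x)) $$ (s, r) * \<phi> (x, y \<otimes>\<^bsub>G\<^sub>2\<^esub> X (- A x)) \<partial>M\<^sub>2)"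
          by (rule G2.integral_right[where f = "\<lambda>y. \<eta> (y \<otimes>\<^bsub>G\<^sub>2\<^esub> X (A x)) $$ (s, r) * \<phi> (x, y)", symmetric])
            (intro continuous_on_mult C_inf_slice_continuous[OF \<phi>] continuous_on_const continuous_on_id
              continuous_on_compose2[OF G2.repD(5)[OF irr sr]] G2.continuous_on_mult_grp subset_UNIV)
        also have "\<dots> = (\<integral>y. \<eta> y $$ (s, r) * \<psi> (x, y) \<partial>M\<^sub>2)"
          by (simp add: \<psi>_def shear_def G2.m_assoc flow_inverse[OF X])
        finally show ?thesis .
      qed
      hence epe: "(\<lambda>x. e x * p x) = (\<lambda>x. \<integral>y. \<eta> y $$ (s, r) * \<psi> (x, y) \<partial>M\<^sub>2)" by blast
      have "dist_tensor G\<^sub>1 G\<^sub>2 M\<^sub>2 (dist_times G\<^sub>1 e (partial_fourier_coeff G\<^sub>1 u \<eta> r s)) (\<lambda>x\<^sub>2. \<eta> x\<^sub>2 $$ (s, r)) \<phi> =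
         u (fun_tensor (\<lambda>x. e x * p x) (\<lambda>y. cnj (\<eta> y $$ (s, r))))"
        using \<phi> p ep by (simp add: dist_tensor_def dist_times_def partial_fourier_coeff_def p_def[symmetric, abs_def])
      thus ?thesis unfolding epe by (simp only: e_def[abs_def])
    qed
    thus ?thesis using distribution_proj[OF R _ \<psi> u, of "{\<eta>}"] \<eta> by simp
  qed
  have "fourier_sum R u (\<lambda>x. 1 * \<phi> (shear X (\<lambda>x. - A x) x)) = (\<Sum>\<^sub>\<infinity>\<eta>\<in>R. u (proj {\<eta>} \<psi>))"
    using \<psi> by (simp add: fourier_sum_def \<psi>_def[abs_def])
  also have "\<dots> = (\<Sum>\<^sub>\<infinity>\<eta>\<in>R. of_nat (rep_dim G\<^sub>2 \<eta>) * (\<Sum>r<rep_dim G\<^sub>2 \<eta>. \<Sum>s<rep_dim G\<^sub>2 \<eta>.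
             dist_tensor G\<^sub>1 G\<^sub>2 M\<^sub>2
               (dist_times G\<^sub>1 (\<lambda>x\<^sub>1. exp (\<i> * complex_of_real (mu \<eta> r * A x\<^sub>1)))
                  (partial_fourier_coeff G\<^sub>1 u \<eta> r s))
               (\<lambda>x\<^sub>2. \<eta> x\<^sub>2 $$ (s, r)) \<phi>))"
    by (rule infsum_cong[symmetric]) (rule term_eq)
  finally show "(\<Sum>\<^sub>\<infinity>\<eta>\<in>R. of_nat (rep_dim G\<^sub>2 \<eta>) * (\<Sum>r<rep_dim G\<^sub>2 \<eta>. \<Sum>s<rep_dim G\<^sub>2 \<eta>.
             dist_tensor G\<^sub>1 G\<^sub>2 M\<^sub>2
               (dist_times G\<^sub>1 (\<lambda>x\<^sub>1. exp (\<i> * complex_of_real (mu \<eta> r * A x\<^sub>1)))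
                  (partial_fourier_coeff G\<^sub>1 u \<eta> r s))
               (\<lambda>x\<^sub>2. \<eta> x\<^sub>2 $$ (s, r)) \<phi>)) = fourier_sum R u (\<lambda>x. 1 * \<phi> (shear X (\<lambda>x. - A x) x))" by (rule HOL.sym)
qed

lemma Psi_op_distribution:
  assumes R: "dual_representatives G\<^sub>2 R" and X: "X \<in> lie_algebra G\<^sub>2" and sym: "diagonal_symbol G\<^sub>2 X R mu"
    and A: "(\<lambda>x. complex_of_real (A x)) \<in> C_inf G\<^sub>1" and u: "u \<in> distributions G"
  shows "Psi_op G\<^sub>1 G\<^sub>2 M\<^sub>2 R mu A u \<in> distributions G"
  unfolding Psi_op_eq[OF assms]
  by (rule transfer_dist[OF mfdG mfdG C_inf_const[OF mfdG] smooth_map_shear[OF X C_inf_uminus_real[OF A]] fourier_sum_distribution[OF R u]])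

text \<open>The sheared tensor is a function of the first variable times the same conjugated matrix
  coefficient. By Schur orthogonality the projection belonging to \<open>\<eta>\<close> fixes it and
  the others annihilate it, so the infinite sum has one term, and that term is \<open>u\<close>
  itself on the sheared tensor.\<close>

lemma Psi_op_tensor:
  assumes R: "dual_representatives G\<^sub>2 R" and X: "X \<in> lie_algebra G\<^sub>2" and sym: "diagonal_symbol G\<^sub>2 X R mu"
    and A: "(\<lambda>x. complex_of_real (A x)) \<in> C_inf G\<^sub>1" and u: "u \<in> distributions G"
    and f: "f \<in> C_inf G\<^sub>1" and \<eta>: "\<eta> \<in> R" and sr: "s < rep_dim G\<^sub>2 \<eta>" "r < rep_dim G\<^sub>2 \<eta>"
  defines "\<phi> \<equiv> fun_tensor f (\<lambda>y. cnj (\<eta> y $$ (s, r)))"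
  shows "Psi_op G\<^sub>1 G\<^sub>2 M\<^sub>2 R mu A u \<phi> = u (\<lambda>x. \<phi> (shear X (\<lambda>x. - A x) x))"
proof -
  note irr = G2.dual_representatives_irr[OF R]
  define \<psi> where "\<psi> x = \<phi> (shear X (\<lambda>x. - A x) x)" for x
  have \<phi>: "\<phi> \<in> C_inf G" unfolding \<phi>_def
    by (rule C_inf_fun_tensor[OF f C_inf_cnj[OF G2.mfd G2.rep_smooth[OF irr[OF \<eta>] sr]]])
  have \<psi>: "\<psi> \<in> C_inf G" unfolding \<psi>_def
    by (rule C_inf_smooth_map[OF mfdG mfdG \<phi> smooth_map_shear[OF X C_inf_uminus_real[OF A]]])
  \<comment> \<open>The shear by \<open>- A\<close> multiplies the matrix coefficient by a scalar
    exponential in the first variable; after conjugation this scalar is joined to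
    \<open>f\<close>.\<close>
  define k where "k x = f x * cnj (exp (\<i> * complex_of_real (mu \<eta> r * - A x)))" for x
  have \<psi>k: "\<psi> (x, y) = k x * cnj (\<eta> y $$ (s, r))" for x y
    unfolding \<psi>_def \<phi>_def k_def shear_def fun_tensor_def fst_conv snd_conv prod.case
    by (simp only: G2.rep_along[OF X R sym \<eta> sr] complex_cnj_mult mult_ac)
  have pr: "proj {\<zeta>} \<psi> = (if \<zeta> = \<eta> then \<psi> else (\<lambda>_. 0))" if \<zeta>: "\<zeta> \<in> R" for \<zeta>
  proof
    fix x :: "'a \<times> 'b"
    have i: "(\<integral>y. \<zeta> y $$ (s', r') * \<psi> (fst x, y) \<partial>M\<^sub>2) = (if \<zeta> = \<eta> \<and> s' = s \<and> r' = r then k (fst x) / of_nat (rep_dim G\<^sub>2 \<zeta>) else 0)"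
      if "s' < rep_dim G\<^sub>2 \<zeta>" "r' < rep_dim G\<^sub>2 \<zeta>" for s' r'
    proof -
      have "(\<integral>y. \<zeta> y $$ (s', r') * \<psi> (fst x, y) \<partial>M\<^sub>2) = (\<integral>y. k (fst x) * (\<zeta> y $$ (s', r') * cnj (\<eta> y $$ (s, r))) \<partial>M\<^sub>2)"
        by (simp add: \<psi>k mult.left_commute)
      also have "\<dots> = k (fst x) * (\<integral>y. \<zeta> y $$ (s', r') * cnj (\<eta> y $$ (s, r)) \<partial>M\<^sub>2)"
        by (rule integral_mult_right_zero)
      finally show ?thesis by (simp add: G2.schur_orthogonality[OF R \<zeta> \<eta> that sr])
    qed
    have "proj {\<zeta>} \<psi> x = of_nat (rep_dim G\<^sub>2 \<zeta>) * (\<Sum>r'<rep_dim G\<^sub>2 \<zeta>. \<Sum>s'<rep_dim G\<^sub>2 \<zeta>.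
      (\<integral>y. \<zeta> y $$ (s', r') * \<psi> (fst x, y) \<partial>M\<^sub>2) * cnj (\<zeta> (snd x) $$ (s', r')))"
      using proj_expand[OF R _ \<psi>, of "{\<zeta>}" x] \<zeta> by simp
    also have "\<dots> = of_nat (rep_dim G\<^sub>2 \<zeta>) * (\<Sum>r'<rep_dim G\<^sub>2 \<zeta>. \<Sum>s'<rep_dim G\<^sub>2 \<zeta>.
      (if r' = r then (if s' = s then (if \<zeta> = \<eta> then k (fst x) / of_nat (rep_dim G\<^sub>2 \<zeta>) * cnj (\<zeta> (snd x) $$ (s, r)) else 0) else 0) else 0))"
      by (intro arg_cong2[where f = "(*)"] refl sum.cong) (auto simp: i)
    also have "\<dots> = (if \<zeta> = \<eta> then \<psi> x else 0)"
    proof (cases "\<zeta> = \<eta>")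
      case True
      have "(\<Sum>r'<rep_dim G\<^sub>2 \<eta>. \<Sum>s'<rep_dim G\<^sub>2 \<eta>. (if r' = r then (if s' = s then c else 0) else 0)) = c" for c :: complex
      proof -
        have "(\<Sum>s'<rep_dim G\<^sub>2 \<eta>. (if r' = r then (if s' = s then c else 0) else 0)) = (if r' = r then c else 0)" for r'
          using sr by (cases "r' = r") simp_all
        thus ?thesis using sr by simp
      qed
      thus ?thesis using True G2.repD(1)[OF irr[OF \<eta>]] \<psi>k[of "fst x" "snd x"] by simp
    next
      case False thus ?thesis by (auto intro!: sum.neutral)
    qed
    finally show "proj {\<zeta>} \<psi> x = (if \<zeta> = \<eta> then \<psi> else (\<lambda>_. 0)) x" by simp
  qed
  have u0: "u (\<lambda>_. 0) = 0" using distributionD(3)[OF u C_inf_const[OF mfdG], of 0 0] by simp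
  have "Psi_op G\<^sub>1 G\<^sub>2 M\<^sub>2 R mu A u \<phi> = (\<Sum>\<^sub>\<infinity>\<zeta>\<in>R. u (proj {\<zeta>} \<psi>))"
    unfolding Psi_op_eq[OF R X sym A u] using \<phi> \<psi> by (simp add: transfer_dist_def fourier_sum_def \<psi>_def[abs_def])
  also have "\<dots> = (\<Sum>\<^sub>\<infinity>\<zeta>\<in>{\<eta>}. u \<psi>)"
    by (rule infsum_cong_neutral) (use pr u0 \<eta> in auto)
  finally show ?thesis by (simp add: \<psi>_def[abs_def])
qed

end

subsection \<open>Conjugation of operators on distributions\<close>

text \<open>The weights satisfy c'(F x) = 1 / c(x), so the primed pair has the same properties with
  the roles exchanged, and through \<open>flip\<close> every statement is available in both
  directions. Invariance of the integral is what carries smooth densities to smooth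
  densities.\<close>

locale dist_conjugation =
  fixes H :: "('a::topological_space, 'e::real_normed_vector) lie_group" and M :: "'a measure" and c F c' F'
  assumes mfd: "manifold (atlas H)" and cH: "c \<in> C_inf H" "c' \<in> C_inf H"
    and smooth_F: "smooth_map (atlas H) (atlas H) F" "smooth_map (atlas H) (atlas H) F'"
    and F_inv: "\<And>x. F (F' x) = x" "\<And>x. F' (F x) = x"
    and c_inv: "\<And>x. c x * c' (F x) = 1" "\<And>x. c' x * c (F' x) = 1"
    and integral_F: "\<And>h. h \<in> C_inf H \<Longrightarrow> (\<integral>x. h (F x) \<partial>M) = (\<integral>x. h x \<partial>M)"
      "\<And>h. h \<in> C_inf H \<Longrightarrow> (\<integral>x. h (F' x) \<partial>M) = (\<integral>x. h x \<partial>M)"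
begin

lemma flip: "dist_conjugation H M c' F' c F"
  using mfd cH smooth_F F_inv c_inv integral_F by unfold_locales auto

abbreviation "T \<equiv> transfer_dist H c F"
abbreviation "T' \<equiv> transfer_dist H c' F'"

lemma pull_C_inf: "\<phi> \<in> C_inf H \<Longrightarrow> (\<lambda>x. c x * \<phi> (F x)) \<in> C_inf H"
  by (rule C_inf_mult[OF mfd cH(1) C_inf_smooth_map[OF mfd mfd _ smooth_F(1)]])

lemma T_distribution: "u \<in> distributions H \<Longrightarrow> T u \<in> distributions H"
  by (rule transfer_dist[OF mfd mfd cH(1) smooth_F(1)])

lemma T_inverse:
  assumes u: "u \<in> extensional (C_inf H)"
  shows "T (T' u) = u"
proof (rule extensionalityI[OF _ u])
  show "T (T' u) \<in> extensional (C_inf H)" by (simp add: transfer_dist_def)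
  fix \<phi> assume \<phi>: "\<phi> \<in> C_inf H"
  have "(\<lambda>x. c' x * (c (F' x) * \<phi> (F (F' x)))) = \<phi>"
    using c_inv(2) F_inv(1) by (simp add: mult.assoc[symmetric])
  thus "T (T' u) \<phi> = u \<phi>" using \<phi> pull_C_inf[OF \<phi>] by (simp add: transfer_dist_def)
qed

text \<open>The invariant integral allows the substitution by \<open>F'\<close>, which moves the map
  from the test function to the density.\<close>

lemma T_dist_of:
  assumes f: "f \<in> C_inf H"
  shows "T (dist_of H M f) \<in> smooth_distributions H M"
proof -
  have g: "(\<lambda>x. f (F' x) * c (F' x)) \<in> C_inf H"
    by (intro C_inf_mult[OF mfd] C_inf_smooth_map[OF mfd mfd _ smooth_F(2)] f cH)
  have "T (dist_of H M f) = dist_of H M (\<lambda>x. f (F' x) * c (F' x))"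
    unfolding dist_of_def transfer_dist_def
  proof (rule restrict_ext)
    fix \<phi> assume \<phi>: "\<phi> \<in> C_inf H"
    have "(\<integral>x. f x * (c x * \<phi> (F x)) \<partial>M) = (\<integral>x. f (F' x) * (c (F' x) * \<phi> (F (F' x))) \<partial>M)"
      by (rule integral_F(2)[symmetric]) (rule C_inf_mult[OF mfd f pull_C_inf[OF \<phi>]])
    thus "(\<lambda>\<phi>\<in>C_inf H. \<integral>x. f x * \<phi> x \<partial>M) (\<lambda>x. c x * \<phi> (F x)) = (\<integral>x. f (F' x) * c (F' x) * \<phi> x \<partial>M)"
      using pull_C_inf[OF \<phi>] by (simp add: F_inv mult.assoc)
  qed
  thus ?thesis using g by (auto simp: smooth_distributions_def)
qed

lemma T_smooth: "w \<in> smooth_distributions H M \<Longrightarrow> T w \<in> smooth_distributions H M"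
  using T_dist_of by (auto simp: smooth_distributions_def)

lemma T_dist_diff: "T (dist_diff H u v) = dist_diff H (T u) (T v)"
  unfolding transfer_dist_def dist_diff_def by (rule restrict_ext) (simp add: pull_C_inf)

lemma T_zero: "T (\<lambda>\<phi>\<in>C_inf H. 0) = (\<lambda>\<phi>\<in>C_inf H. 0)"
  unfolding transfer_dist_def by (rule restrict_ext) (simp add: pull_C_inf)

text \<open>One implication is enough, since \<open>flip\<close> and \<open>commute_flip\<close>
  exchange the two operators.\<close>

lemma hypoelliptic_transfer:
  assumes comm: "\<And>u. u \<in> distributions H \<Longrightarrow> T (P u) = P' (T u)"
    and gh: "globally_hypoelliptic H M P'"
  shows "globally_hypoelliptic H M P"
  unfolding globally_hypoelliptic_def
proof (intro ballI impI)
  interpret flip: dist_conjugation H M c' F' c F by (rule flip)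
  fix u assume u: "u \<in> distributions H" and "P u \<in> smooth_distributions H M"
  hence "P' (T u) \<in> smooth_distributions H M" using T_smooth[of "P u"] comm[OF u] by simp
  hence "T u \<in> smooth_distributions H M" using gh T_distribution[OF u] by (auto simp: globally_hypoelliptic_def)
  from flip.T_smooth[OF this] show "u \<in> smooth_distributions H M"
    by (simp only: flip.T_inverse[OF distributionD(1)[OF u]])
qed

lemma hypoelliptic_mod_kernel_transfer:
  assumes comm: "\<And>u. u \<in> distributions H \<Longrightarrow> T (P u) = P' (T u)"
    and ext: "\<And>u. P u \<in> extensional (C_inf H)"
    and gh: "globally_hypoelliptic_mod_kernel H M P'"
  shows "globally_hypoelliptic_mod_kernel H M P"
  unfolding globally_hypoelliptic_mod_kernel_def
proof (intro ballI impI)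
  interpret flip: dist_conjugation H M c' F' c F by (rule flip)
  fix u assume u: "u \<in> distributions H" and "P u \<in> smooth_distributions H M"
  hence "P' (T u) \<in> smooth_distributions H M" using T_smooth[of "P u"] comm[OF u] by simp
  then obtain v where v: "v \<in> smooth_distributions H M" and k: "dist_diff H (T u) v \<in> dist_kernel H P'"
    using gh T_distribution[OF u] by (auto simp: globally_hypoelliptic_mod_kernel_def)
  define w where "w = dist_diff H (T u) v"
  have w: "w \<in> distributions H" "P' w = (\<lambda>\<phi>\<in>C_inf H. 0)" using k by (auto simp: w_def dist_kernel_def)
  \<comment> \<open>The kernel condition on \<open>w\<close> is transported back to
    \<open>P\<close>: the intertwining relation at \<open>T' w\<close> gives zero, and
    \<open>T'\<close> removes the outer \<open>T\<close>.\<close>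
  have "T (P (T' w)) = (\<lambda>\<phi>\<in>C_inf H. 0)"
    by (simp only: comm[OF flip.T_distribution[OF w(1)]] T_inverse[OF distributionD(1)[OF w(1)]] w(2))
  hence "P (T' w) = (\<lambda>\<phi>\<in>C_inf H. 0)" using flip.T_inverse[OF ext, of "T' w"] flip.T_zero by simp
  hence "T' w \<in> dist_kernel H P" using flip.T_distribution[OF w(1)] by (simp add: dist_kernel_def)
  moreover have "T' w = dist_diff H u (T' v)"
    by (simp only: w_def flip.T_dist_diff flip.T_inverse[OF distributionD(1)[OF u]])
  ultimately show "\<exists>v\<in>smooth_distributions H M. dist_diff H u v \<in> dist_kernel H P"
    using flip.T_smooth[OF v] by auto
qed

lemma commute_flip:
  assumes comm: "\<And>u. u \<in> distributions H \<Longrightarrow> T (P u) = P' (T u)"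
    and ext: "\<And>u. P u \<in> extensional (C_inf H)" and u: "u \<in> distributions H"
  shows "T' (P' u) = P (T' u)"
proof -
  interpret flip: dist_conjugation H M c' F' c F by (rule flip)
  have "T' (P' (T (T' u))) = T' (T (P (T' u)))" by (simp only: comm[OF flip.T_distribution[OF u]])
  thus ?thesis by (simp only: T_inverse[OF distributionD(1)[OF u]] flip.T_inverse[OF ext])
qed

text \<open>\<open>T\<close> is a bijection of the distributions that carries the range of
  \<open>P\<close> to that of \<open>P'\<close> and, by the choice of \<open>J\<close>, the set
  \<open>J\<close> to \<open>K\<close>. Injectivity on extensional functionals turns equality of the
  images into equality of the sets.\<close>

lemma image_transfer:
  assumes comm: "\<And>u. u \<in> distributions H \<Longrightarrow> T (P u) = P' (T u)"
    and ext: "\<And>u. P u \<in> extensional (C_inf H)"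
    and K: "K \<subseteq> distributions H" and J: "J = {v \<in> distributions H. T v \<in> K}"
  shows "P ` distributions H = J \<longleftrightarrow> P' ` distributions H = K"
proof -
  interpret flip: dist_conjugation H M c' F' c F by (rule flip)
  have TT': "T (T' u) = u" if "u \<in> distributions H" for u by (rule T_inverse[OF distributionD(1)[OF that]])
  have D: "T ` distributions H = distributions H"
  proof
    show "distributions H \<subseteq> T ` distributions H"
      using TT' flip.T_distribution by (metis imageI subsetI)
  qed (use T_distribution in auto)
  have KJ: "T ` J = K"
  proof
    show "K \<subseteq> T ` J"
    proof
      fix w assume w: "w \<in> K"
      hence "T' w \<in> J" using K TT' flip.T_distribution unfolding J by auto
      thus "w \<in> T ` J" using TT' w K by (metis imageI subsetD)
    qed
  qed (auto simp: J)
  have PD: "T ` P ` distributions H = P' ` distributions H"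
  proof -
    have "T ` P ` distributions H = P' ` T ` distributions H" unfolding image_image by (rule image_cong[OF refl comm])
    thus ?thesis by (simp only: D)
  qed
  have inv: "T' ` T ` S = S" if "S \<subseteq> extensional (C_inf H)" for S
  proof -
    have "T' (T s) = s" if "s \<in> S" for s using flip.T_inverse \<open>S \<subseteq> _\<close> that by blast
    thus ?thesis by (simp add: image_image)
  qed
  have "J \<subseteq> extensional (C_inf H)" using distributionD(1) unfolding J by blast
  moreover have "P ` distributions H \<subseteq> extensional (C_inf H)" using ext by blast
  ultimately show ?thesis using inv KJ PD by metis
qed

end

subsection \<open>Derivatives along flows\<close>

text \<open>In a chart the derivative at time 0 is the joint derivative in direction (0, 1) of a
  function smooth in position and time, restricted to time 0; a slice of a smooth function is
  smooth.\<close>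

lemma flow_derivative_C_inf:
  fixes \<Phi> :: "'a::topological_space \<Rightarrow> real \<Rightarrow> 'b::topological_space"
    and H :: "('a, 'e::real_normed_vector) lie_group" and H' :: "('b, 'f::real_normed_vector) lie_group"
  assumes H: "manifold (atlas H)" and H': "manifold (atlas H')" and \<phi>: "\<phi> \<in> C_inf H'"
    and \<Phi>: "\<And>U \<kappa>. (U, \<kappa>) \<in> atlas H \<Longrightarrow> msmooth (\<kappa> ` U \<times> UNIV) (atlas H') (\<lambda>p. \<Phi> (inv_into U \<kappa> (fst p)) (snd p))"
  shows "(\<lambda>x. vector_derivative (\<lambda>t. \<phi> (\<Phi> x t)) (at 0)) \<in> C_inf H"
  unfolding C_inf_iff[OF H]
proof clarify
  fix U \<kappa> assume U: "(U, \<kappa>) \<in> atlas H"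
  have op: "open (\<kappa> ` U \<times> (UNIV :: real set))" by (intro open_Times chartD(2)[OF H U] open_UNIV)
  define g where "g p = \<phi> (\<Phi> (inv_into U \<kappa> (fst p)) (snd p))" for p :: "'e \<times> real"
  have g: "smooth_on (\<kappa> ` U \<times> UNIV) g" unfolding g_def[abs_def] by (rule C_inf_compose[OF H' \<phi> op \<Phi>[OF U]])
  have eq: "vector_derivative (\<lambda>t. \<phi> (\<Phi> (inv_into U \<kappa> z) t)) (at 0) = iter_deriv [(0, 1)] g (z, 0)" if z: "z \<in> \<kappa> ` U" for z
  proof -
    have z': "(z, 0) \<in> \<kappa> ` U \<times> (UNIV :: real set)" using z by simp
    have "(\<lambda>t. g (z, t)) differentiable at 0" using iter_deriv_slice2(2)[OF op g z', of "[]"] by simp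
    hence "((\<lambda>t. g (z, t)) has_vector_derivative frechet_derivative (\<lambda>t. g (z, t)) (at 0) 1) (at 0)"
      by (simp add: vector_derivative_works frechet_derivative_eq_vector_derivative)
    hence "vector_derivative (\<lambda>t. g (z, t)) (at 0) = frechet_derivative (\<lambda>t. g (z, t)) (at 0) 1"
      by (rule vector_derivative_at)
    thus ?thesis using iter_deriv_slice2(1)[OF op g z', of "[1]"] by (simp add: g_def)
  qed
  have "smooth_on (\<kappa> ` U) (\<lambda>z. iter_deriv [(0, 1)] g (z, 0))"
    unfolding smooth_on_iff
  proof (intro allI ballI)
    fix vs z assume "z \<in> \<kappa> ` U"
    hence "(z, 0) \<in> \<kappa> ` U \<times> (UNIV :: real set)" by simp
    from iter_deriv_slice1(2)[OF op smooth_on_iter_deriv[OF g] this]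
    show "iter_deriv vs (\<lambda>z. iter_deriv [(0, 1)] g (z, 0)) differentiable at z" .
  qed
  thus "smooth_on (\<kappa> ` U) (\<lambda>z. vector_derivative (\<lambda>t. \<phi> (\<Phi> (inv_into U \<kappa> z) t)) (at 0))"
    by (subst smooth_on_cong[OF chartD(2)[OF H U] eq])
qed

context compact_lie
begin

lemma vfield_derivative_0:
  assumes X: "X \<in> lie_algebra H" and f: "f \<in> C_inf H"
  shows "((\<lambda>t. f (x \<otimes> X t)) has_vector_derivative vfield H X f x) (at 0)"
  using vfield_derivative[OF X C_inf_differentiable_along[OF X f], of x 0] by (simp add: lie_algebraD(3)[OF X])

text \<open>A real coefficient is declared smooth through its complexification, so differentiability
  along the flow is recovered by taking real parts.\<close>

lemma vfield_derivative_real: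
  assumes X: "X \<in> lie_algebra H" and t: "(\<lambda>x. complex_of_real (t x)) \<in> C_inf H"
  shows "((\<lambda>s. t (x \<otimes> X s)) has_vector_derivative vfield H X t x) (at 0)"
proof -
  obtain D where "((\<lambda>s. complex_of_real (t (x \<otimes> X s))) has_derivative D) (at 0)"
    using C_inf_differentiable_along[OF X t] unfolding differentiable_def by blast
  from has_derivative_Re[OF this] have "(\<lambda>s. t (x \<otimes> X s)) differentiable (at 0)"
    unfolding differentiable_def by auto
  from vfield_derivative[OF X this] show ?thesis by (simp add: lie_algebraD(3)[OF X])
qed

lemma vfield_uminus:
  assumes X: "X \<in> lie_algebra H" and t: "(\<lambda>x. complex_of_real (t x)) \<in> C_inf H"
  shows "vfield H X (\<lambda>x. - t x) x = - vfield H X t x"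
  unfolding vfield_def[of H X "\<lambda>x. - t x"]
  by (rule vector_derivative_at[OF has_vector_derivative_minus[OF vfield_derivative_real[OF X t]]])

lemma vfield_mult:
  assumes X: "X \<in> lie_algebra H" and f: "f \<in> C_inf H" and g: "g \<in> C_inf H"
  shows "vfield H X (\<lambda>x. f x * g x) x = f x * vfield H X g x + vfield H X f x * g x"
  unfolding vfield_def[of H X "\<lambda>x. f x * g x"]
  using vector_derivative_at[OF has_vector_derivative_mult[OF vfield_derivative_0[OF X f, of x] vfield_derivative_0[OF X g, of x]]]
  by (simp add: lie_algebraD(3)[OF X])

lemma vfield_exp:
  assumes X: "X \<in> lie_algebra H" and f: "f \<in> C_inf H"
  shows "vfield H X (\<lambda>x. exp (f x)) x = exp (f x) * vfield H X f x"
  unfolding vfield_def[of H X "\<lambda>x. exp (f x)"]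
  using vector_derivative_at[OF field_vector_diff_chain_at[OF vfield_derivative_0[OF X f, of x] DERIV_exp]]
  by (simp add: lie_algebraD(3)[OF X] o_def mult.commute)

end

section \<open>Conjugation of the differential operators\<close>

context lie_pair
begin

lemma C_inf_slice1: "\<phi> \<in> C_inf G \<Longrightarrow> (\<lambda>y. \<phi> (y, x\<^sub>2)) \<in> C_inf G\<^sub>1"
  unfolding C_inf_iff[OF G1.mfd]
proof clarify
  fix U \<kappa> assume \<phi>: "\<phi> \<in> C_inf G" and U: "(U, \<kappa>) \<in> atlas G\<^sub>1"
  show "smooth_on (\<kappa> ` U) (\<lambda>x. \<phi> (inv_into U \<kappa> x, x\<^sub>2))"
    by (intro C_inf_compose_pair[OF \<phi> chartD(2)[OF G1.mfd U]] msmooth_chart_inv[OF G1.mfd U]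
        msmooth_const)
qed

lemma C_inf_slice2: "\<phi> \<in> C_inf G \<Longrightarrow> (\<lambda>y. \<phi> (x\<^sub>1, y)) \<in> C_inf G\<^sub>2"
  unfolding C_inf_iff[OF G2.mfd]
proof clarify
  fix U \<kappa> assume \<phi>: "\<phi> \<in> C_inf G" and U: "(U, \<kappa>) \<in> atlas G\<^sub>2"
  show "smooth_on (\<kappa> ` U) (\<lambda>x. \<phi> (x\<^sub>1, inv_into U \<kappa> x))"
    by (intro C_inf_compose_pair[OF \<phi> chartD(2)[OF G2.mfd U]] msmooth_chart_inv[OF G2.mfd U]
        msmooth_const)
qed

lemma vfield_C_inf:
  assumes \<phi>: "\<phi> \<in> C_inf G"
  shows "X \<in> lie_algebra G\<^sub>1 \<Longrightarrow> (\<lambda>x. vfield G\<^sub>1 X (\<lambda>y. \<phi> (y, snd x)) (fst x)) \<in> C_inf G"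
    and "Y \<in> lie_algebra G\<^sub>2 \<Longrightarrow> (\<lambda>x. vfield G\<^sub>2 Y (\<lambda>y. \<phi> (fst x, y)) (snd x)) \<in> C_inf G"
proof -
  have op: "open (\<kappa> ` U \<times> (UNIV :: real set))" if "(U, \<kappa>) \<in> atlas G" for U \<kappa>
    by (intro open_Times chartD(2)[OF mfdG that] open_UNIV)
  have i: "msmooth (\<kappa> ` U \<times> (UNIV :: real set)) (atlas G) (\<lambda>p. inv_into U \<kappa> (fst p))" if U: "(U, \<kappa>) \<in> atlas G" for U \<kappa>
    by (rule smooth_on_imp_msmooth[OF mfdG op[OF U] U smooth_on_fst[OF op[OF U] smooth_on_id]]) auto
  have i': "msmooth (\<kappa> ` U \<times> (UNIV :: real set)) (atlas G\<^sub>1) (\<lambda>p. fst (inv_into U \<kappa> (fst p)))"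
      "msmooth (\<kappa> ` U \<times> (UNIV :: real set)) (atlas G\<^sub>2) (\<lambda>p. snd (inv_into U \<kappa> (fst p)))" if U: "(U, \<kappa>) \<in> atlas G" for U \<kappa>
    using msmooth_fst_snd[OF G1.mfd G2.mfd op[OF U] i[OF U, unfolded lie_prod_simps]] by auto
  { assume X: "X \<in> lie_algebra G\<^sub>1"
    have "msmooth (\<kappa> ` U \<times> UNIV) (atlas G) (\<lambda>p. (fst (inv_into U \<kappa> (fst p)) \<otimes>\<^bsub>G\<^sub>1\<^esub> X (snd p), snd (inv_into U \<kappa> (fst p))))"
      if U: "(U, \<kappa>) \<in> atlas G" for U \<kappa>
    proof -
      have "msmooth (\<kappa> ` U \<times> UNIV) (atlas G\<^sub>1) (\<lambda>p. X (snd p))"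
        by (rule msmooth_comp_smooth[OF fin_dim_real G1.mfd open_UNIV op[OF U] _ smooth_on_snd[OF op[OF U] smooth_on_id] G1.lie_algebraD(1)[OF X]]) simp
      from G1.msmooth_mult[OF op[OF U] i'(1)[OF U] this] show ?thesis
        unfolding lie_prod_simps by (rule msmooth_Pair[OF G1.mfd G2.mfd op[OF U] _ i'(2)[OF U]])
    qed
    from flow_derivative_C_inf[OF mfdG mfdG \<phi> this]
    show "(\<lambda>x. vfield G\<^sub>1 X (\<lambda>y. \<phi> (y, snd x)) (fst x)) \<in> C_inf G" by (simp only: vfield_def) }
  { assume Y: "Y \<in> lie_algebra G\<^sub>2"
    have "msmooth (\<kappa> ` U \<times> UNIV) (atlas G) (\<lambda>p. (fst (inv_into U \<kappa> (fst p)), snd (inv_into U \<kappa> (fst p)) \<otimes>\<^bsub>G\<^sub>2\<^esub> Y (snd p)))"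
      if U: "(U, \<kappa>) \<in> atlas G" for U \<kappa>
    proof -
      have "msmooth (\<kappa> ` U \<times> UNIV) (atlas G\<^sub>2) (\<lambda>p. Y (snd p))"
        by (rule msmooth_comp_smooth[OF fin_dim_real G2.mfd open_UNIV op[OF U] _ smooth_on_snd[OF op[OF U] smooth_on_id] G2.lie_algebraD(1)[OF Y]]) simp
      from G2.msmooth_mult[OF op[OF U] i'(2)[OF U] this] show ?thesis
        unfolding lie_prod_simps by (rule msmooth_Pair[OF G1.mfd G2.mfd op[OF U] i'(1)[OF U]])
    qed
    from flow_derivative_C_inf[OF mfdG mfdG \<phi> this]
    show "(\<lambda>x. vfield G\<^sub>2 Y (\<lambda>y. \<phi> (fst x, y)) (snd x)) \<in> C_inf G" by (simp only: vfield_def) }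
qed

lemma principal_part_C_inf:
  assumes "X \<in> lie_algebra G\<^sub>1" "Y \<in> lie_algebra G\<^sub>2" "(\<lambda>x. complex_of_real (a x)) \<in> C_inf G\<^sub>1" "\<phi> \<in> C_inf G"
  shows "principal_part G\<^sub>1 G\<^sub>2 X Y a \<phi> \<in> C_inf G"
proof -
  have "principal_part G\<^sub>1 G\<^sub>2 X Y a \<phi> = (\<lambda>x. vfield G\<^sub>1 X (\<lambda>y. \<phi> (y, snd x)) (fst x) +
      complex_of_real (a (fst x)) * vfield G\<^sub>2 Y (\<lambda>y. \<phi> (fst x, y)) (snd x))"
    by (simp add: principal_part_def split_beta')
  thus ?thesis using C_inf_add[OF mfdG vfield_C_inf(1) C_inf_mult[OF mfdG C_inf_fst vfield_C_inf(2)]] assms by simp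
qed

lemma principal_part_mult:
  assumes X: "X \<in> lie_algebra G\<^sub>1" and Y: "Y \<in> lie_algebra G\<^sub>2" and f: "f \<in> C_inf G" and g: "g \<in> C_inf G"
  shows "principal_part G\<^sub>1 G\<^sub>2 X Y a (\<lambda>x. f x * g x) x =
    f x * principal_part G\<^sub>1 G\<^sub>2 X Y a g x + principal_part G\<^sub>1 G\<^sub>2 X Y a f x * g x"
  by (cases x) (simp add: principal_part_def G1.vfield_mult[OF X C_inf_slice1[OF f] C_inf_slice1[OF g]]
    G2.vfield_mult[OF Y C_inf_slice2[OF f] C_inf_slice2[OF g]] algebra_simps)

lemma principal_part_exp:
  assumes X: "X \<in> lie_algebra G\<^sub>1" and Y: "Y \<in> lie_algebra G\<^sub>2" and f: "f \<in> C_inf G"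
  shows "principal_part G\<^sub>1 G\<^sub>2 X Y a (\<lambda>x. exp (f x)) x = exp (f x) * principal_part G\<^sub>1 G\<^sub>2 X Y a f x"
  by (cases x) (simp add: principal_part_def G1.vfield_exp[OF X C_inf_slice1[OF f]]
    G2.vfield_exp[OF Y C_inf_slice2[OF f]] algebra_simps)

text \<open>Chain rule for the function \<open>h\<close> of two flow times, at the point whose
  second time is the amount of shear. Moving the first variable changes the shear as well and
  follows a curve with velocity (1, t'); moving the second variable commutes with the flow of
  \<open>Y\<close> and gives the direction (0, 1).\<close>

lemma vfield_shear:
  assumes X: "X \<in> lie_algebra G\<^sub>1" and Y: "Y \<in> lie_algebra G\<^sub>2" and t: "(\<lambda>x. complex_of_real (t x)) \<in> C_inf G\<^sub>1"
    and \<phi>: "\<phi> \<in> C_inf G"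
  shows "vfield G\<^sub>1 X (\<lambda>y. \<phi> (shear Y t (y, x\<^sub>2))) x\<^sub>1 =
      vfield G\<^sub>1 X (\<lambda>y. \<phi> (y, x\<^sub>2 \<otimes>\<^bsub>G\<^sub>2\<^esub> Y (t x\<^sub>1))) x\<^sub>1 +
      complex_of_real (vfield G\<^sub>1 X t x\<^sub>1) * vfield G\<^sub>2 Y (\<lambda>y. \<phi> (x\<^sub>1, y)) (x\<^sub>2 \<otimes>\<^bsub>G\<^sub>2\<^esub> Y (t x\<^sub>1))"
    and "vfield G\<^sub>2 Y (\<lambda>y. \<phi> (shear Y t (x\<^sub>1, y))) x\<^sub>2 = vfield G\<^sub>2 Y (\<lambda>y. \<phi> (x\<^sub>1, y)) (x\<^sub>2 \<otimes>\<^bsub>G\<^sub>2\<^esub> Y (t x\<^sub>1))"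
proof -
  define h where "h p = \<phi> (x\<^sub>1 \<otimes>\<^bsub>G\<^sub>1\<^esub> X (fst p), x\<^sub>2 \<otimes>\<^bsub>G\<^sub>2\<^esub> Y (snd p))" for p
  have s: "msmooth UNIV (atlas G\<^sub>1) (\<lambda>p. X (fst p))" "msmooth UNIV (atlas G\<^sub>2) (\<lambda>p. Y (snd p))"
    by (rule msmooth_comp_smooth[OF fin_dim_real G1.mfd open_UNIV open_UNIV _ smooth_on_fst[OF open_UNIV smooth_on_id] G1.lie_algebraD(1)[OF X]]
        msmooth_comp_smooth[OF fin_dim_real G2.mfd open_UNIV open_UNIV _ smooth_on_snd[OF open_UNIV smooth_on_id] G2.lie_algebraD(1)[OF Y]]; simp)+
  have "smooth_on UNIV h" unfolding h_def[abs_def]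
    by (intro C_inf_compose_pair[OF \<phi> open_UNIV] G1.msmooth_mult[OF open_UNIV] G2.msmooth_mult[OF open_UNIV]
        msmooth_const msmooth_const s)
  hence "h differentiable (at (0, t x\<^sub>1))" using smooth_on_differentiable[of UNIV h] by simp
  then obtain D where D: "(h has_derivative D) (at (0, t x\<^sub>1))" unfolding differentiable_def by blast
  then interpret D: bounded_linear D by (rule has_derivative_bounded_linear)
  have chain: "((\<lambda>s. h (\<gamma> s)) has_vector_derivative D v) (at s\<^sub>0)"
    if "(\<gamma> has_vector_derivative v) (at s\<^sub>0)" "\<gamma> s\<^sub>0 = (0, t x\<^sub>1)" for \<gamma> v s\<^sub>0
    using vector_derivative_diff_chain_within[OF that(1), of h D] has_derivative_at_withinI[OF D] that(2) by (simp add: o_def)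
  have X0: "X 0 = \<one>\<^bsub>G\<^sub>1\<^esub>" "Y 0 = \<one>\<^bsub>G\<^sub>2\<^esub>" using G1.lie_algebraD(3)[OF X] G2.lie_algebraD(3)[OF Y] by auto
  have "((\<lambda>s. h (s, t x\<^sub>1)) has_vector_derivative D (1, 0)) (at 0)"
    by (rule chain) (auto intro!: has_vector_derivative_Pair derivative_eq_intros)
  hence D1: "vfield G\<^sub>1 X (\<lambda>y. \<phi> (y, x\<^sub>2 \<otimes>\<^bsub>G\<^sub>2\<^esub> Y (t x\<^sub>1))) x\<^sub>1 = D (1, 0)"
    unfolding vfield_def h_def fst_conv snd_conv by (rule vector_derivative_at)
  have "((\<lambda>s. h (0, t x\<^sub>1 + s)) has_vector_derivative D (0, 1)) (at 0)"
    by (rule chain) (auto intro!: has_vector_derivative_Pair derivative_eq_intros)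
  hence D2: "((\<lambda>s. \<phi> (x\<^sub>1, (x\<^sub>2 \<otimes>\<^bsub>G\<^sub>2\<^esub> Y (t x\<^sub>1)) \<otimes>\<^bsub>G\<^sub>2\<^esub> Y s)) has_vector_derivative D (0, 1)) (at 0)"
    by (simp add: h_def X0 G2.lie_algebraD(2)[OF Y] G2.m_assoc)
  hence D2': "vfield G\<^sub>2 Y (\<lambda>y. \<phi> (x\<^sub>1, y)) (x\<^sub>2 \<otimes>\<^bsub>G\<^sub>2\<^esub> Y (t x\<^sub>1)) = D (0, 1)"
    unfolding vfield_def by (rule vector_derivative_at)
  define t' where "t' = vfield G\<^sub>1 X t x\<^sub>1"
  have t': "((\<lambda>s. t (x\<^sub>1 \<otimes>\<^bsub>G\<^sub>1\<^esub> X s)) has_vector_derivative t') (at 0)"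
    unfolding t'_def by (rule G1.vfield_derivative_real[OF X t])
  have "((\<lambda>s. h (s, t (x\<^sub>1 \<otimes>\<^bsub>G\<^sub>1\<^esub> X s))) has_vector_derivative D (1, t')) (at 0)"
    by (rule chain) (auto intro!: has_vector_derivative_Pair t' simp: X0)
  hence "vfield G\<^sub>1 X (\<lambda>y. \<phi> (shear Y t (y, x\<^sub>2))) x\<^sub>1 = D (1, t')"
    unfolding vfield_def h_def shear_def fst_conv snd_conv by (rule vector_derivative_at)
  also have "D (1, t') = D (1, 0) + complex_of_real t' * D (0, 1)"
    using D.add[of "(1, 0)" "(0, t')"] D.scaleR[of t' "(0, 1)"] by (simp add: scaleR_conv_of_real)
  finally show "vfield G\<^sub>1 X (\<lambda>y. \<phi> (shear Y t (y, x\<^sub>2))) x\<^sub>1 =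
      vfield G\<^sub>1 X (\<lambda>y. \<phi> (y, x\<^sub>2 \<otimes>\<^bsub>G\<^sub>2\<^esub> Y (t x\<^sub>1))) x\<^sub>1 +
      complex_of_real (vfield G\<^sub>1 X t x\<^sub>1) * vfield G\<^sub>2 Y (\<lambda>y. \<phi> (x\<^sub>1, y)) (x\<^sub>2 \<otimes>\<^bsub>G\<^sub>2\<^esub> Y (t x\<^sub>1))"
    by (simp only: D1 D2' t'_def)
  have comm: "(x\<^sub>2 \<otimes>\<^bsub>G\<^sub>2\<^esub> Y (t x\<^sub>1)) \<otimes>\<^bsub>G\<^sub>2\<^esub> Y s = (x\<^sub>2 \<otimes>\<^bsub>G\<^sub>2\<^esub> Y s) \<otimes>\<^bsub>G\<^sub>2\<^esub> Y (t x\<^sub>1)" for s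
    using G2.lie_algebraD(2)[OF Y, of s "t x\<^sub>1"] G2.lie_algebraD(2)[OF Y, of "t x\<^sub>1" s]
    by (simp add: G2.m_assoc add.commute)
  show "vfield G\<^sub>2 Y (\<lambda>y. \<phi> (shear Y t (x\<^sub>1, y))) x\<^sub>2 = vfield G\<^sub>2 Y (\<lambda>y. \<phi> (x\<^sub>1, y)) (x\<^sub>2 \<otimes>\<^bsub>G\<^sub>2\<^esub> Y (t x\<^sub>1))"
    using vector_derivative_at[OF D2] unfolding D2' comm unfolding vfield_def shear_def fst_conv snd_conv .
qed

text \<open>Differentiating the shear by \<open>- A\<close> in the first variable produces -(a -
  a_0) times the derivative along \<open>Y\<close>, which reduces the variable coefficient to the
  constant one.\<close>

lemma principal_part_shear:
  assumes X: "X \<in> lie_algebra G\<^sub>1" and Y: "Y \<in> lie_algebra G\<^sub>2" and A: "(\<lambda>x. complex_of_real (A x)) \<in> C_inf G\<^sub>1"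
    and XA: "\<And>x. vfield G\<^sub>1 X A x = a x - a\<^sub>0" and \<phi>: "\<phi> \<in> C_inf G"
  shows "principal_part G\<^sub>1 G\<^sub>2 X Y a (\<lambda>x. \<phi> (shear Y (\<lambda>x. - A x) x)) x =
    principal_part G\<^sub>1 G\<^sub>2 X Y (\<lambda>_. a\<^sub>0) \<phi> (shear Y (\<lambda>x. - A x) x)"
proof (cases x)
  case (Pair x\<^sub>1 x\<^sub>2)
  note v = vfield_shear[OF X Y C_inf_uminus_real[OF A] \<phi>, unfolded G1.vfield_uminus[OF X A] XA]
  have sh: "shear Y (\<lambda>x. - A x) x = (x\<^sub>1, x\<^sub>2 \<otimes>\<^bsub>G\<^sub>2\<^esub> Y (- A x\<^sub>1))" by (simp add: shear_def Pair)
  show ?thesis unfolding sh unfolding Pair principal_part_def prod.case v by (simp add: algebra_simps)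
qed

text \<open>By the product rule the principal part of the transported test function is the
  transported constant-coefficient principal part plus (q - q_0) times the function itself. The
  derivatives carry a minus sign in the transposed operator, so this extra term reduces
  \<open>q\<close> to \<open>q\<^sub>0\<close>.\<close>

lemma L_op_conjugation:
  assumes X: "X \<in> lie_algebra G\<^sub>1" and Y: "Y \<in> lie_algebra G\<^sub>2" and A: "(\<lambda>x. complex_of_real (A x)) \<in> C_inf G\<^sub>1"
    and XA: "\<And>x. vfield G\<^sub>1 X A x = a x - a\<^sub>0" and q: "q \<in> C_inf G" and Q: "Q \<in> C_inf G"
    and PQ: "\<And>x. principal_part G\<^sub>1 G\<^sub>2 X Y a Q x = q x - q\<^sub>0" and u: "u \<in> distributions G"
  defines "F \<equiv> shear Y (\<lambda>x. - A x)"
  shows "transfer_dist G (\<lambda>x. exp (Q x)) F (L_op G\<^sub>1 G\<^sub>2 X Y a q u) =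
    L_op G\<^sub>1 G\<^sub>2 X Y (\<lambda>_. a\<^sub>0) (\<lambda>_. q\<^sub>0) (transfer_dist G (\<lambda>x. exp (Q x)) F u)"
  unfolding L_op_def transfer_dist_def
proof (rule restrict_ext)
  fix \<phi> assume \<phi>: "\<phi> \<in> C_inf G"
  have F: "smooth_map (atlas G) (atlas G) F" unfolding F_def by (rule smooth_map_shear[OF Y C_inf_uminus_real[OF A]])
  have e: "(\<lambda>x. exp (Q x)) \<in> C_inf G" by (rule C_inf_exp[OF mfdG Q])
  define P\<^sub>0 where "P\<^sub>0 = principal_part G\<^sub>1 G\<^sub>2 X Y (\<lambda>_. a\<^sub>0) \<phi>"
  have P\<^sub>0: "P\<^sub>0 \<in> C_inf G" unfolding P\<^sub>0_def by (rule principal_part_C_inf[OF X Y C_inf_const[OF G1.mfd] \<phi>])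
  note pull = C_inf_smooth_map[OF mfdG mfdG _ F]
  define \<psi> where "\<psi> x = exp (Q x) * \<phi> (F x)" for x
  define \<chi>\<^sub>0 where "\<chi>\<^sub>0 x = exp (Q x) * P\<^sub>0 (F x)" for x
  have \<psi>: "\<psi> \<in> C_inf G" unfolding \<psi>_def[abs_def] by (rule C_inf_mult[OF mfdG e pull[OF \<phi>]])
  have \<chi>\<^sub>0: "\<chi>\<^sub>0 \<in> C_inf G" unfolding \<chi>\<^sub>0_def[abs_def] by (rule C_inf_mult[OF mfdG e pull[OF P\<^sub>0]])
  have q\<psi>: "(\<lambda>x. q x * \<psi> x) \<in> C_inf G" by (rule C_inf_mult[OF mfdG q \<psi>])
  have "principal_part G\<^sub>1 G\<^sub>2 X Y a \<psi> x = (q x * \<psi> x + - q\<^sub>0 * \<psi> x) + \<chi>\<^sub>0 x" for x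
  proof -
    have "principal_part G\<^sub>1 G\<^sub>2 X Y a \<psi> x = exp (Q x) * principal_part G\<^sub>1 G\<^sub>2 X Y a (\<lambda>x. \<phi> (F x)) x +
        principal_part G\<^sub>1 G\<^sub>2 X Y a (\<lambda>x. exp (Q x)) x * \<phi> (F x)"
      unfolding \<psi>_def[abs_def] by (rule principal_part_mult[OF X Y e pull[OF \<phi>]])
    moreover have "principal_part G\<^sub>1 G\<^sub>2 X Y a (\<lambda>x. \<phi> (F x)) x = P\<^sub>0 (F x)"
      unfolding P\<^sub>0_def F_def by (rule principal_part_shear[OF X Y A XA \<phi>])
    ultimately show ?thesis
      by (simp add: principal_part_exp[OF X Y Q] PQ \<psi>_def \<chi>\<^sub>0_def algebra_simps)
  qed
  hence "u (principal_part G\<^sub>1 G\<^sub>2 X Y a \<psi>) = u (\<lambda>x. (q x * \<psi> x + - q\<^sub>0 * \<psi> x) + \<chi>\<^sub>0 x)"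
    by (intro arg_cong[where f = u] ext)
  also have "\<dots> = u (\<lambda>x. q x * \<psi> x + - q\<^sub>0 * \<psi> x) + u \<chi>\<^sub>0"
    by (rule distributionD(2)[OF u C_inf_add[OF mfdG q\<psi> C_inf_cmult[OF mfdG \<psi>]] \<chi>\<^sub>0])
  also have "u (\<lambda>x. q x * \<psi> x + - q\<^sub>0 * \<psi> x) = u (\<lambda>x. q x * \<psi> x) + u (\<lambda>x. - q\<^sub>0 * \<psi> x)"
    by (rule distributionD(2)[OF u q\<psi> C_inf_cmult[OF mfdG \<psi>]])
  also have "u (\<lambda>x. - q\<^sub>0 * \<psi> x) = - q\<^sub>0 * u \<psi>" by (rule distributionD(3)[OF u \<psi>])
  finally have main: "- u (principal_part G\<^sub>1 G\<^sub>2 X Y a \<psi>) + u (\<lambda>x. q x * \<psi> x) = - u \<chi>\<^sub>0 + q\<^sub>0 * u \<psi>" by simp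
  have q0: "u (\<lambda>x. exp (Q x) * (q\<^sub>0 * \<phi> (F x))) = q\<^sub>0 * u \<psi>"
    using distributionD(3)[OF u \<psi>, of q\<^sub>0] by (simp add: \<psi>_def mult.left_commute)
  show "(\<lambda>\<phi>\<in>C_inf G. - u (principal_part G\<^sub>1 G\<^sub>2 X Y a \<phi>) + u (\<lambda>x. q x * \<phi> x)) (\<lambda>x. exp (Q x) * \<phi> (F x)) =
      - (\<lambda>f\<in>C_inf G. u (\<lambda>x. exp (Q x) * f (F x))) (principal_part G\<^sub>1 G\<^sub>2 X Y (\<lambda>_. a\<^sub>0) \<phi>) +
      (\<lambda>f\<in>C_inf G. u (\<lambda>x. exp (Q x) * f (F x))) (\<lambda>x. q\<^sub>0 * \<phi> x)"
    unfolding P\<^sub>0_def[symmetric] \<psi>_def[symmetric]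
    using \<psi> P\<^sub>0 C_inf_cmult[OF mfdG \<phi>] main q0 by (simp add: \<chi>\<^sub>0_def[symmetric])
qed

lemma haar_prod_unique:
  assumes "normalized_haar G M"
  shows "M = M\<^sub>1 \<Otimes>\<^sub>M M\<^sub>2"
proof -
  note ax = G1.compact_topological_group_axioms G2.compact_topological_group_axioms
  show ?thesis
    by (rule compact_topological_group.haar_unique[OF compact_topological_group_prod[OF ax] assms normalized_haar_prod[OF ax G1.haar G2.haar]])
qed

text \<open>On each fibre over the first factor the shear is a right translation, so Fubini and
  right invariance suffice once the given Haar measure is recognised as the product measure.\<close>

lemma integral_shear:
  fixes h :: "'a \<times> 'b \<Rightarrow> complex"
  assumes M: "normalized_haar G M" and Y: "Y \<in> lie_algebra G\<^sub>2" and t: "(\<lambda>x. complex_of_real (t x)) \<in> C_inf G\<^sub>1"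
    and h: "h \<in> C_inf G"
  shows "(\<integral>x. h (shear Y t x) \<partial>M) = (\<integral>x. h x \<partial>M)"
proof -
  note ax = G1.compact_topological_group_axioms G2.compact_topological_group_axioms
  interpret P1: prob_space M\<^sub>1 using G1.haar by (simp add: normalized_haar_def)
  interpret P2: prob_space M\<^sub>2 using G2.haar by (simp add: normalized_haar_def)
  interpret P: pair_prob_space M\<^sub>1 M\<^sub>2 ..
  have int: "integrable (M\<^sub>1 \<Otimes>\<^sub>M M\<^sub>2) f" if "f \<in> C_inf G" for f
    using M C_inf_continuous[OF that]
    by (intro integrable_continuous_compact compact_topological_group.compact_UNIV[OF compact_topological_group_prod[OF ax]])
      (auto simp: haar_prod_unique[OF M] normalized_haar_def P.finite_measure_axioms)
  have "(\<integral>x. h (shear Y t x) \<partial>(M\<^sub>1 \<Otimes>\<^sub>M M\<^sub>2)) = (\<integral>x. \<integral>y. h (shear Y t (x, y)) \<partial>M\<^sub>2 \<partial>M\<^sub>1)"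
    by (rule P.integral_fst'[symmetric]) (rule int[OF C_inf_smooth_map[OF mfdG mfdG h smooth_map_shear[OF Y t]]])
  also have "\<dots> = (\<integral>x. \<integral>y. h (x, y) \<partial>M\<^sub>2 \<partial>M\<^sub>1)"
    unfolding shear_def fst_conv snd_conv
    by (rule Bochner_Integration.integral_cong[OF refl], rule G2.integral_right[where f = "\<lambda>y. h (_, y)"])
      (intro C_inf_slice_continuous[OF h] continuous_on_const continuous_on_id)
  also have "\<dots> = (\<integral>x. h x \<partial>(M\<^sub>1 \<Otimes>\<^sub>M M\<^sub>2))" by (rule P.integral_fst'[OF int[OF h]])
  finally show ?thesis by (simp only: haar_prod_unique[OF M])
qed

text \<open>The inverse weight has to equal exp(-Q(x)) at the sheared image of x, hence the
  composition of \<open>Q\<close> with the inverse shear \<open>shear Y A\<close>.\<close>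

lemma dist_conjugation_shear:
  assumes M: "normalized_haar G M" and Y: "Y \<in> lie_algebra G\<^sub>2" and A: "(\<lambda>x. complex_of_real (A x)) \<in> C_inf G\<^sub>1"
    and Q: "Q \<in> C_inf G"
  shows "dist_conjugation G M (\<lambda>x. exp (Q x)) (shear Y (\<lambda>x. - A x)) (\<lambda>x. exp (- Q (shear Y A x))) (shear Y A)"
proof -
  have "(\<lambda>x. - Q (shear Y A x)) \<in> C_inf G"
    using C_inf_cmult[OF mfdG C_inf_smooth_map[OF mfdG mfdG Q smooth_map_shear[OF Y A]], of "-1"] by simp
  thus ?thesis
    by unfold_locales (simp_all del: lie_prod_simps add: mfdG C_inf_exp[OF mfdG] Q smooth_map_shear[OF Y] A C_inf_uminus_real[OF A, simplified] shear_inverse[OF Y]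
      integral_shear[OF M Y] exp_add[symmetric])
qed

lemma smooth_map_ident: "smooth_map (atlas G) (atlas G) (\<lambda>x. x)"
  unfolding smooth_map_iff[OF mfdG] using msmooth_chart_inv[OF mfdG] by (auto intro: continuous_on_id)

text \<open>Apart from being a distribution, membership is decided by double Fourier coefficients.
  These test only tensors of conjugated matrix coefficients, on which \<open>Psi_op\<close> and the
  pullback agree. That \<open>Psi_op\<close> gives a distribution at all is where convergence of the
  Fourier series enters.\<close>

lemma Psi_op_K_space:
  assumes R: "dual_representatives G\<^sub>1 R\<^sub>1" "dual_representatives G\<^sub>2 R\<^sub>2" and Y: "Y \<in> lie_algebra G\<^sub>2" and sym: "diagonal_symbol G\<^sub>2 Y R\<^sub>2 mu"
    and A: "(\<lambda>x. complex_of_real (A x)) \<in> C_inf G\<^sub>1" and e: "e \<in> C_inf G" and v: "v \<in> distributions G"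
  shows "Psi_op G\<^sub>1 G\<^sub>2 M\<^sub>2 R\<^sub>2 mu A (dist_times G e v) \<in> K_space G\<^sub>1 G\<^sub>2 R\<^sub>1 R\<^sub>2 lam mu a\<^sub>0 q\<^sub>0 \<longleftrightarrow>
    transfer_dist G e (shear Y (\<lambda>x. - A x)) v \<in> K_space G\<^sub>1 G\<^sub>2 R\<^sub>1 R\<^sub>2 lam mu a\<^sub>0 q\<^sub>0"
proof -
  have ev: "dist_times G e v \<in> distributions G"
    using transfer_dist[OF mfdG mfdG e smooth_map_ident v] by (simp add: transfer_dist_def dist_times_def)
  have sh: "smooth_map (atlas G) (atlas G) (shear Y (\<lambda>x. - A x))" by (rule smooth_map_shear[OF Y C_inf_uminus_real[OF A]])
  have D: "Psi_op G\<^sub>1 G\<^sub>2 M\<^sub>2 R\<^sub>2 mu A (dist_times G e v) \<in> distributions G" "transfer_dist G e (shear Y (\<lambda>x. - A x)) v \<in> distributions G"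
    by (rule Psi_op_distribution[OF R(2) Y sym A ev], rule transfer_dist[OF mfdG mfdG e sh v])
  have "fourier_coeff (Psi_op G\<^sub>1 G\<^sub>2 M\<^sub>2 R\<^sub>2 mu A (dist_times G e v)) \<xi> \<eta> m n r s =
      fourier_coeff (transfer_dist G e (shear Y (\<lambda>x. - A x)) v) \<xi> \<eta> m n r s"
    if \<xi>: "\<xi> \<in> R\<^sub>1" "m < rep_dim G\<^sub>1 \<xi>" "n < rep_dim G\<^sub>1 \<xi>" and \<eta>: "\<eta> \<in> R\<^sub>2" "r < rep_dim G\<^sub>2 \<eta>" "s < rep_dim G\<^sub>2 \<eta>" for \<xi> \<eta> m n r s
  proof -
    define f where "f = (\<lambda>x. cnj (\<xi> x $$ (n, m)))"
    define \<phi> where "\<phi> = fun_tensor f (\<lambda>y. cnj (\<eta> y $$ (s, r)))"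
    have f: "f \<in> C_inf G\<^sub>1" unfolding f_def
      by (rule C_inf_cnj[OF G1.mfd G1.rep_smooth[OF G1.dual_representatives_irr[OF R(1) \<xi>(1)] \<xi>(3,2)]])
    have \<phi>: "\<phi> \<in> C_inf G" unfolding \<phi>_def
      by (rule C_inf_fun_tensor[OF f C_inf_cnj[OF G2.mfd G2.rep_smooth[OF G2.dual_representatives_irr[OF R(2) \<eta>(1)] \<eta>(3,2)]]])
    have "Psi_op G\<^sub>1 G\<^sub>2 M\<^sub>2 R\<^sub>2 mu A (dist_times G e v) \<phi> = dist_times G e v (\<lambda>x. \<phi> (shear Y (\<lambda>x. - A x) x))"
      unfolding \<phi>_def by (rule Psi_op_tensor[OF R(2) Y sym A ev f \<eta>(1,3,2)])
    also have "\<dots> = transfer_dist G e (shear Y (\<lambda>x. - A x)) v \<phi>"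
      using \<phi> C_inf_smooth_map[OF mfdG mfdG \<phi> sh] by (simp add: dist_times_def transfer_dist_def)
    finally show ?thesis by (simp add: fourier_coeff_def \<phi>_def f_def)
  qed
  thus ?thesis using D by (auto simp: K_space_def)
qed

end

theorem proposition6p11:
  fixes G\<^sub>1 :: "('a::{t2_space, second_countable_topology}, 'e::real_normed_vector) lie_group"
    and G\<^sub>2 :: "('b::{t2_space, second_countable_topology}, 'f::real_normed_vector) lie_group"
    and G :: "('a \<times> 'b, 'e \<times> 'f) lie_group"
    and M\<^sub>1 :: "'a measure" and M\<^sub>2 :: "'b measure" and M :: "('a \<times> 'b) measure"
    and X\<^sub>1 :: "real \<Rightarrow> 'a" and X\<^sub>2 :: "real \<Rightarrow> 'b"
    and R\<^sub>1 :: "('a \<Rightarrow> complex mat) set" and R\<^sub>2 :: "('b \<Rightarrow> complex mat) set"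
    and lam :: "('a \<Rightarrow> complex mat) \<Rightarrow> nat \<Rightarrow> real"
    and mu :: "('b \<Rightarrow> complex mat) \<Rightarrow> nat \<Rightarrow> real"
    and a A :: "'a \<Rightarrow> real" and q Q :: "'a \<times> 'b \<Rightarrow> complex"
    and a\<^sub>0 :: real and q\<^sub>0 :: complex
  assumes "compact_lie_group G\<^sub>1" and "compact_lie_group G\<^sub>2"
    and "G = lie_prod G\<^sub>1 G\<^sub>2"
    and "normalized_haar G\<^sub>1 M\<^sub>1" and "normalized_haar G\<^sub>2 M\<^sub>2" and "normalized_haar G M"
    and "X\<^sub>1 \<in> lie_algebra G\<^sub>1" and "X\<^sub>2 \<in> lie_algebra G\<^sub>2"
    and "dual_representatives G\<^sub>1 R\<^sub>1" and "diagonal_symbol G\<^sub>1 X\<^sub>1 R\<^sub>1 lam"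
    and "dual_representatives G\<^sub>2 R\<^sub>2" and "diagonal_symbol G\<^sub>2 X\<^sub>2 R\<^sub>2 mu"
    and "(\<lambda>x. complex_of_real (a x)) \<in> C_inf G\<^sub>1" and "q \<in> C_inf G"
    and "a\<^sub>0 = (\<integral>x. a x \<partial>M\<^sub>1)" and "q\<^sub>0 = (\<integral>x. q x \<partial>M)"
    and "(\<lambda>x. complex_of_real (A x)) \<in> C_inf G\<^sub>1"
    and "\<And>x. vfield G\<^sub>1 X\<^sub>1 A x = a x - a\<^sub>0"
    and "Q \<in> C_inf G"
    and "\<And>x. principal_part G\<^sub>1 G\<^sub>2 X\<^sub>1 X\<^sub>2 a Q x = q x - q\<^sub>0"
  shows "(globally_hypoelliptic G M (L_op G\<^sub>1 G\<^sub>2 X\<^sub>1 X\<^sub>2 a q) \<longleftrightarrow>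
          globally_hypoelliptic G M (L_op G\<^sub>1 G\<^sub>2 X\<^sub>1 X\<^sub>2 (\<lambda>_. a\<^sub>0) (\<lambda>_. q\<^sub>0)))
       \<and> (globally_hypoelliptic_mod_kernel G M (L_op G\<^sub>1 G\<^sub>2 X\<^sub>1 X\<^sub>2 a q) \<longleftrightarrow>
          globally_hypoelliptic_mod_kernel G M (L_op G\<^sub>1 G\<^sub>2 X\<^sub>1 X\<^sub>2 (\<lambda>_. a\<^sub>0) (\<lambda>_. q\<^sub>0)))
       \<and> (globally_solvable_var G\<^sub>1 G\<^sub>2 M\<^sub>2 X\<^sub>1 X\<^sub>2 R\<^sub>1 R\<^sub>2 lam mu a q A Q a\<^sub>0 q\<^sub>0 \<longleftrightarrow>
          globally_solvable_const G\<^sub>1 G\<^sub>2 X\<^sub>1 X\<^sub>2 R\<^sub>1 R\<^sub>2 lam mu a\<^sub>0 q\<^sub>0)"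
proof -
  note G = assms(3)
  have "compact_lie G\<^sub>1 M\<^sub>1" "compact_lie G\<^sub>2 M\<^sub>2"
    using assms(1,2,4,5) compact_lie_group_topological by (auto intro!: compact_lie.intro compact_lie_axioms.intro)
  then interpret lie_pair G\<^sub>1 M\<^sub>1 G\<^sub>2 M\<^sub>2 by (rule lie_pair.intro)
  note M = assms(6)[unfolded G] and q = assms(14)[unfolded G] and Q = assms(19)[unfolded G]
  define F where "F = shear X\<^sub>2 (\<lambda>x. - A x)"
  interpret C: dist_conjugation "lie_prod G\<^sub>1 G\<^sub>2" M "\<lambda>x. exp (Q x)" F "\<lambda>x. exp (- Q (shear X\<^sub>2 A x))" "shear X\<^sub>2 A"
    unfolding F_def by (rule dist_conjugation_shear[OF M assms(8,17) Q])
  interpret C': dist_conjugation "lie_prod G\<^sub>1 G\<^sub>2" M "\<lambda>x. exp (- Q (shear X\<^sub>2 A x))" "shear X\<^sub>2 A" "\<lambda>x. exp (Q x)" F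
    by (rule C.flip)
  let ?L = "L_op G\<^sub>1 G\<^sub>2 X\<^sub>1 X\<^sub>2 a q" and ?L\<^sub>0 = "L_op G\<^sub>1 G\<^sub>2 X\<^sub>1 X\<^sub>2 (\<lambda>_. a\<^sub>0) (\<lambda>_. q\<^sub>0)"
  have ext: "L_op G\<^sub>1 G\<^sub>2 X\<^sub>1 X\<^sub>2 b p u \<in> extensional (C_inf (lie_prod G\<^sub>1 G\<^sub>2))" for b p u by (simp add: L_op_def)
  have comm: "C.T (?L u) = ?L\<^sub>0 (C.T u)" if "u \<in> distributions (lie_prod G\<^sub>1 G\<^sub>2)" for u
    unfolding F_def by (rule L_op_conjugation[OF assms(7,8,17,18) q Q assms(20) that])
  have comm': "C'.T (?L\<^sub>0 u) = ?L (C'.T u)" if "u \<in> distributions (lie_prod G\<^sub>1 G\<^sub>2)" for u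
    using C.commute_flip[of ?L ?L\<^sub>0, OF comm ext that] .
  \<comment> \<open>Replaces \<open>Psi_op\<close> by the conjugation, so that
    \<open>image_transfer\<close> applies with the same transpose that serves the two
    hypoellipticity statements.\<close>
  have J: "J_space G\<^sub>1 G\<^sub>2 M\<^sub>2 R\<^sub>1 R\<^sub>2 lam mu A Q a\<^sub>0 q\<^sub>0 =
      {v \<in> distributions (lie_prod G\<^sub>1 G\<^sub>2). C.T v \<in> K_space G\<^sub>1 G\<^sub>2 R\<^sub>1 R\<^sub>2 lam mu a\<^sub>0 q\<^sub>0}"
    unfolding J_space_def F_def
    using Psi_op_K_space[OF assms(9,11,8,12,17) C_inf_exp[OF mfdG Q]] by blast
  have K: "K_space G\<^sub>1 G\<^sub>2 R\<^sub>1 R\<^sub>2 lam mu a\<^sub>0 q\<^sub>0 \<subseteq> distributions (lie_prod G\<^sub>1 G\<^sub>2)" by (auto simp: K_space_def)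
  show ?thesis unfolding G globally_solvable_var_def globally_solvable_const_def
    using C.hypoelliptic_transfer[of ?L ?L\<^sub>0, OF comm] C'.hypoelliptic_transfer[of ?L\<^sub>0 ?L, OF comm']
      C.hypoelliptic_mod_kernel_transfer[of ?L ?L\<^sub>0, OF comm ext] C'.hypoelliptic_mod_kernel_transfer[of ?L\<^sub>0 ?L, OF comm' ext]
      C.image_transfer[of ?L ?L\<^sub>0, OF comm ext K J] by blast
qed

end
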